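(* Let $(\varphi_0,\psi_0)$ be an admissible pair and let $J_h$, $K_h$ be the associated embedding and discretization operators. Let $V\colon\mathbf R^d\to\mathbf R$ be bounded and Hölder continuous with exponent $\theta\in(0,1]$, and let $V_h$ be the operator of multiplication by $V_h(k)=V(hk)$, $k\in\mathbf Z^d$, on $\mathcal H_h$. If $V\not\equiv 0$, assume in addition that there exist $\tau>d$ and $C'>0$ with $|\psi_0(x)|\le C'(1+|x|)^{-\tau}$ for all $x\in\mathbf R^d$, and define $\theta'$ by $\frac1{\theta'}=\frac1\theta+\frac1{\tau-d}$. Let $G_0\colon\mathbf R^d\to\mathbf R$ satisfy one of the following three options: (i) $G_0$ is of class I with parameters $\alpha,\beta$; (ii) $G_0$ is of class II with parameters $\alpha,\tilde\beta$; (iii) $G_0(\xi)=|\xi|^\alpha$ for all $\xi\in\mathbf R^d$, with $0<\alpha\le 1$. Let $$\gamma=\begin{cases}\min\{2\alpha-1,\,2\alpha-\beta-1,\,\theta'\} & \text{in case (i)},\\ \min\{2\alpha-\tilde\beta-1,\,\theta'\} & \text{in case (ii)},\\ \min\{\alpha,\,\theta'\} & \text{in case (iii)},\end{cases}$$ where $\theta'$ is omitted from the minimum if $V\equiv 0$. Let $H=H_0+V$ on $\mathcal H$ and $H_h=H_{0,h}+V_h$ on $\mathcal H_h$. Then for each compact set $K\subset\mathbf C\setminus\mathbf R$ there exist $C>0$ and $h_0>0$ such that $$\|J_h(H_h-zI_h)^{-1}K_h-(H-zI)^{-1}\|_{\mathcal B(\mathcal H)}\le C h^\gamma$$ for all $z\in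 K$ and all $0<h\le h_0$.
   Context: Spaces and Fourier transforms. Fix $d\ge1$. $\mathcal H=L^2(\mathbf R^d)$, with inner product $\langle\cdot,\cdot\rangle$ linear in the second argument and identity $I$. For $h>0$, $\mathcal H_h=\ell^2(h\mathbf Z^d)$ is the space of $u_h\colon\mathbf Z^d\to\mathbf C$ with norm $\|u_h\|=(h^d\sum_{n\in\mathbf Z^d}|u_h(n)|^2)^{1/2}<\infty$, with identity $I_h$. $\mathcal B(\cdot)$ denotes bounded operators with operator norm. $\hat f(\xi)=(\mathcal F f)(\xi)=(2\pi)^{-d/2}\int_{\mathbf R^d} e^{-ix\cdot\xi}f(x)\,dx$ is the unitary Fourier transform on $L^2(\mathbf R^d)$. With $\mathbf T_h^d=[-\pi/h,\pi/h]^d$, the unitary discrete Fourier transform $\mathsf F_h\colon\mathcal H_h\to L^2(\mathbf T_h^d)$ is $(\mathsf F_hu_h)(\xi)=\frac{h^d}{(2\pi)^{d/2}}\sum_{n\in\mathbf Z^d}u_h(n)e^{-ihn\cdot\xi}$. Riesz sequences. Sequences $\{u_k\},\{v_k\}$ indexed by $\mathbf Z^d$ in a Hilbert space are biorthogonal if $\langle u_k,v_n\rangle=\delta_{k,n}$. $\{u_k\}$ is a Riesz sequence if there are $A,B>0$ with $A\sum|c_k|^2\le\|\sum c_ku_k\|^2\le B\sum|c_k|^2$ for all $\{c_k\}\in\ell^2(\mathbf Z^d)$. Embedding and discretization. For $\varphi_0,\psi_0\in\mathcal H$ put $\varphi_{h,k}(x)=\varphi_0((x-hk)/h)$, $\psi_{h,k}(x)=\psi_0((x-hk)/h)$,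 $h>0$, $k\in\mathbf Z^d$. The pair $(\varphi_0,\psi_0)$ is called admissible if $\{\varphi_{1,k}\}_{k\in\mathbf Z^d}$ and $\{\psi_{1,k}\}_{k\in\mathbf Z^d}$ are biorthogonal Riesz sequences in $\mathcal H$, $\hat\varphi_0,\hat\psi_0$ are essentially bounded and supported in $[-3\pi/2,3\pi/2]^d$, and there is a constant $c_0>0$ with $|\hat\varphi_0(\xi)|\ge c_0$ and $|\hat\psi_0(\xi)|\ge c_0$ for $\xi\in[-\pi/2,\pi/2]^d$. Define $J_h\colon\mathcal H_h\to\mathcal H$, $J_hu_h=\sum_{k}u_h(k)\varphi_{h,k}$, and $K_h\colon\mathcal H\to\mathcal H_h$, $(K_hf)(k)=h^{-d}\langle\psi_{h,k},f\rangle$ (both are bounded). Multiplier classes. $G_0$ is of class I with parameters $\alpha,\beta$ if $\alpha>\frac12$, $\beta>-\frac12$, $\alpha\le1+\beta<2\alpha\le3+\beta$, and $G_0\in C^1(\mathbf R^d)$ is real-valued, non-negative, with (1) $G_0(0)=0$; (2) there are $c>0$, $c_0>0$ with $G_0(\xi)\ge c|\xi|^\alpha$ for $|\xi|\ge c_0$; (3) for some constant $c'>0$, $|\nabla G_0(\xi)|\le c'|\xi|^\beta$ for all $\xi\in\mathbf R^d$; (4) $G_0(\xi_1,\dots,\xi_d)=G_0(|\xi_1|,\dots,|\xi_d|)$ for all $\xi$. $G_0$ is of class II with parameters $\alpha,\tilde\beta$ if $\frac12<\alpha\le1$, $\tilde\beta\ge0$, $1+\tilde\beta<2\alpha$, and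 $G_0(\xi)=|\xi|^\alpha+\widetilde G_0(\xi)$, where $\widetilde G_0\in C^1(\mathbf R^d)$ is real-valued, non-negative, with (1) $\widetilde G_0(0)=0$; (2) there are $c>0$, $c_0>0$ with $|\nabla\widetilde G_0(\xi)|\le c|\xi|^{\tilde\beta}$ for $|\xi|\ge c_0$; (3) $\widetilde G_0(\xi_1,\dots,\xi_d)=\widetilde G_0(|\xi_1|,\dots,|\xi_d|)$ for all $\xi$. Operators. $G_{0,h}(\xi)=G_0(\frac2h\sin(\frac h2\xi_1),\dots,\frac2h\sin(\frac h2\xi_d))$. $H_0=\mathcal F^*G_0(\cdot)\mathcal F$ on $\mathcal H$ with domain $\{f\in\mathcal H:G_0\hat f\in L^2(\mathbf R^d)\}$ (self-adjoint), and $H_{0,h}=\mathsf F_h^*G_{0,h}(\cdot)\mathsf F_h$ on $\mathcal H_h$ (bounded, self-adjoint), where $G(\cdot)$ denotes multiplication by $G$. $V$ also denotes multiplication by $V$; $H$ has the domain of $H_0$. *)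

theory Defs
  imports "HOL-Analysis.Analysis"
begin

section \<open>The Hilbert space $L^2(\mathbf R^d)$\<close>

text \<open>
  The dimension is \<open>CARD('d)\<close>, and elements of the index lattice are vectors of type
  \<open>int ^ 'd\<close>. Elements of \<open>'d L2\<close> are classes of square-integrable Borel functions modulo
  equality almost everywhere; every Lebesgue measurable function has a Borel representative,
  so nothing is lost by using \<open>lborel\<close>. Below, \<open>rep_L2 f\<close> is an arbitrarily chosen
  representative of the class \<open>f\<close>; it is only used where the choice does not matter.
\<close>

definition square_integrable :: "(real ^ 'd \<Rightarrow> complex) \<Rightarrow> bool" where
  "square_integrable f \<longleftrightarrow>
     f \<in> borel_measurable lborel \<and> integrable lborel (\<lambda>x. (cmod (f x))\<^sup>2)"

definition L2_eq :: "(real ^ 'd \<Rightarrow> complex) \<Rightarrow> (real ^ 'd \<Rightarrow> complex) \<Rightarrow> bool" where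
  "L2_eq f g \<longleftrightarrow> square_integrable f \<and> square_integrable g \<and> (AE x in lborel. f x = g x)"

lemma square_integrable_zero [simp]: "square_integrable (\<lambda>x. 0)"
  by (simp add: square_integrable_def)

lemma square_integrable_scale:
  "square_integrable f \<Longrightarrow> square_integrable (\<lambda>x. c * f x)"
  by (auto simp: square_integrable_def norm_mult power_mult_distrib)

lemma square_integrable_add:
  assumes "square_integrable f" "square_integrable g"
  shows "square_integrable (\<lambda>x. f x + g x)"
proof -
  have [measurable]: "f \<in> borel_measurable lborel" "g \<in> borel_measurable lborel"
    using assms by (auto simp: square_integrable_def)
  have "integrable lborel (\<lambda>x. 2 * (cmod (f x))\<^sup>2 + 2 * (cmod (g x))\<^sup>2)"
    using assms by (auto simp: square_integrable_def)
  then have "integrable lborel (\<lambda>x. (cmod (f x + g x))\<^sup>2)"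
  proof (rule Bochner_Integration.integrable_bound)
    have "(cmod (a + b))\<^sup>2 \<le> 2 * (cmod a)\<^sup>2 + 2 * (cmod b)\<^sup>2" for a b
    proof -
      have "(cmod (a + b))\<^sup>2 \<le> (cmod a + cmod b)\<^sup>2"
        by (intro power_mono norm_triangle_ineq) simp
      also have "\<dots> \<le> 2 * (cmod a)\<^sup>2 + 2 * (cmod b)\<^sup>2"
        using sum_squares_bound[of "cmod a" "cmod b"] by (simp add: power2_sum)
      finally show ?thesis .
    qed
    then show "AE x in lborel. norm ((cmod (f x + g x))\<^sup>2)
        \<le> norm (2 * (cmod (f x))\<^sup>2 + 2 * (cmod (g x))\<^sup>2)"
      by simp
  qed simp
  then show ?thesis
    by (simp add: square_integrable_def)
qed

lemma integrable_cnj_mult: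
  assumes "square_integrable f" "square_integrable g"
  shows "integrable lborel (\<lambda>x. cnj (f x) * g x)"
proof -
  have [measurable]: "f \<in> borel_measurable lborel" "g \<in> borel_measurable lborel"
    using assms by (auto simp: square_integrable_def)
  have "integrable lborel (\<lambda>x. (cmod (f x))\<^sup>2 + (cmod (g x))\<^sup>2)"
    using assms by (auto simp: square_integrable_def)
  then show ?thesis
  proof (rule Bochner_Integration.integrable_bound)
    have "cmod (cnj a * b) \<le> (cmod a)\<^sup>2 + (cmod b)\<^sup>2" for a b
    proof -
      have "2 * (cmod a * cmod b) \<le> (cmod a)\<^sup>2 + (cmod b)\<^sup>2"
        using sum_squares_bound[of "cmod a" "cmod b"] by (simp add: mult.assoc)
      moreover have "0 \<le> cmod a * cmod b" by simp
      ultimately show ?thesis unfolding norm_mult complex_mod_cnj by linarith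
    qed
    then show "AE x in lborel. norm (cnj (f x) * g x)
        \<le> norm ((cmod (f x))\<^sup>2 + (cmod (g x))\<^sup>2)"
      by simp
  next
    show "(\<lambda>x. cnj (f x) * g x) \<in> borel_measurable lborel"
      by (intro borel_measurable_times borel_measurable_continuous_on[where f = cnj])
        (auto intro!: continuous_intros)
  qed
qed

quotient_type (overloaded) 'd L2 = "(real, 'd::finite) vec \<Rightarrow> complex" / partial: L2_eq
proof (rule part_equivpI)
  show "\<exists>f. L2_eq f f"
    by (rule exI[of _ "\<lambda>x. 0"]) (simp add: L2_eq_def)
  show "symp L2_eq"
    by (rule sympI) (auto simp: L2_eq_def)
  show "transp L2_eq"
    by (rule transpI) (auto simp: L2_eq_def)
qed

text \<open>The class of a function; \<open>0\<close> if the function is not square-integrable.\<close>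

lift_definition L2_of :: "(real ^ 'd \<Rightarrow> complex) \<Rightarrow> ('d::finite) L2"
  is "\<lambda>f. if square_integrable f then f else (\<lambda>x. 0)"
  by (simp add: L2_eq_def)

lift_definition cinner :: "('d::finite) L2 \<Rightarrow> 'd L2 \<Rightarrow> complex"
  is "\<lambda>f g. LINT x|lborel. cnj (f x) * g x"
proof -
  fix f f' g g' :: "real ^ 'd \<Rightarrow> complex"
  assume *: "L2_eq f f'" "L2_eq g g'"
  then have "AE x in lborel. cnj (f x) * g x = cnj (f' x) * g' x"
    by (auto simp: L2_eq_def)
  moreover have "integrable lborel (\<lambda>x. cnj (f x) * g x)"
    "integrable lborel (\<lambda>x. cnj (f' x) * g' x)"
    using * by (auto simp: L2_eq_def intro: integrable_cnj_mult)
  ultimately show "(LINT x|lborel. cnj (f x) * g x) = (LINT x|lborel. cnj (f' x) * g' x)"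
    by (intro integral_cong_AE) auto
qed

lift_definition scaleC :: "complex \<Rightarrow> ('d::finite) L2 \<Rightarrow> 'd L2" (infixr \<open>*\<^sub>C\<close> 75)
  is "\<lambda>c f x. c * f x"
  by (auto simp: L2_eq_def square_integrable_scale)

text \<open>
  The real inner product is the real part of the complex one; both induce the $L^2$ norm.
\<close>

instantiation L2 :: (finite) real_inner
begin

lift_definition zero_L2 :: "'a L2" is "\<lambda>x. 0"
  by (simp add: L2_eq_def)

lift_definition plus_L2 :: "'a L2 \<Rightarrow> 'a L2 \<Rightarrow> 'a L2" is "\<lambda>f g x. f x + g x"
  by (auto simp: L2_eq_def square_integrable_add)

definition uminus_L2 :: "'a L2 \<Rightarrow> 'a L2" where "uminus_L2 f = (- 1) *\<^sub>C f"

definition minus_L2 :: "'a L2 \<Rightarrow> 'a L2 \<Rightarrow> 'a L2" where "minus_L2 f g = f + (- 1) *\<^sub>C g"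

definition scaleR_L2 :: "real \<Rightarrow> 'a L2 \<Rightarrow> 'a L2" where
  "scaleR_L2 r f = complex_of_real r *\<^sub>C f"

definition inner_L2 :: "'a L2 \<Rightarrow> 'a L2 \<Rightarrow> real" where "inner_L2 f g = Re (cinner f g)"

definition norm_L2 :: "'a L2 \<Rightarrow> real" where "norm_L2 f = sqrt (inner f f)"

definition sgn_L2 :: "'a L2 \<Rightarrow> 'a L2" where "sgn_L2 f = inverse (norm f) *\<^sub>R f"

definition dist_L2 :: "'a L2 \<Rightarrow> 'a L2 \<Rightarrow> real" where "dist_L2 f g = norm (f - g)"

definition uniformity_L2 :: "('a L2 \<times> 'a L2) filter" where
  "uniformity_L2 = (INF e\<in>{0<..}. principal {(f, g). dist f g < e})"

definition open_L2 :: "'a L2 set \<Rightarrow> bool" where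
  "open_L2 U \<longleftrightarrow> (\<forall>f\<in>U. \<forall>\<^sub>F (f', g) in uniformity. f' = f \<longrightarrow> g \<in> U)"

instance
proof
  fix f g k :: "'a L2" and r s :: real
  show "f + g + k = f + (g + k)"
    by transfer (auto simp: L2_eq_def square_integrable_add add.assoc)
  show "f + g = g + f"
    by transfer (auto simp: L2_eq_def square_integrable_add add.commute)
  show "0 + f = f"
    by transfer (auto simp: L2_eq_def)
  show "- f + f = 0"
    unfolding uminus_L2_def
    by transfer (auto simp: L2_eq_def intro!: square_integrable_add dest: square_integrable_scale[of _ "-1"])
  show "f - g = f + - g"
    by (simp add: minus_L2_def uminus_L2_def)
  show "r *\<^sub>R (f + g) = r *\<^sub>R f + r *\<^sub>R g"
    unfolding scaleR_L2_def
    by transfer (auto simp: L2_eq_def distrib_left distrib_right intro!: square_integrable_add square_integrable_scale)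
  show "(r + s) *\<^sub>R f = r *\<^sub>R f + s *\<^sub>R f"
    unfolding scaleR_L2_def
    by transfer (auto simp: L2_eq_def distrib_left distrib_right intro!: square_integrable_add square_integrable_scale)
  show "r *\<^sub>R s *\<^sub>R f = (r * s) *\<^sub>R f"
    unfolding scaleR_L2_def
    by transfer (auto simp: L2_eq_def mult.assoc intro!: square_integrable_scale)
  show "1 *\<^sub>R f = f"
    unfolding scaleR_L2_def by transfer (auto simp: L2_eq_def)
  show "dist f g = norm (f - g)"
    by (simp add: dist_L2_def)
  show "sgn f = inverse (norm f) *\<^sub>R f"
    by (simp add: sgn_L2_def)
  show "(uniformity :: ('a L2 \<times> 'a L2) filter) = (INF e\<in>{0<..}. principal {(f, g). dist f g < e})"
    by (simp add: uniformity_L2_def)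
  show "open U \<longleftrightarrow> (\<forall>f\<in>U. \<forall>\<^sub>F (f', g) in uniformity. f' = f \<longrightarrow> g \<in> U)" for U :: "'a L2 set"
    by (simp add: open_L2_def)
  show "inner f g = inner g f"
    unfolding inner_L2_def
  proof transfer
    fix f g :: "real ^ 'a \<Rightarrow> complex"
    assume "L2_eq f f" "L2_eq g g"
    then have "integrable lborel (\<lambda>x. cnj (f x) * g x)" "integrable lborel (\<lambda>x. cnj (g x) * f x)"
      by (auto simp: L2_eq_def intro: integrable_cnj_mult)
    then show "Re (LINT x|lborel. cnj (f x) * g x) = Re (LINT x|lborel. cnj (g x) * f x)"
      by (simp flip: integral_Re add: mult.commute)
  qed
  show "inner (f + g) k = inner f k + inner g k"
    unfolding inner_L2_def
  proof transfer
    fix f g k :: "real ^ 'a \<Rightarrow> complex"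
    assume "L2_eq f f" "L2_eq g g" "L2_eq k k"
    then have "integrable lborel (\<lambda>x. cnj (f x) * k x)" "integrable lborel (\<lambda>x. cnj (g x) * k x)"
      by (auto simp: L2_eq_def intro: integrable_cnj_mult)
    then show "Re (LINT x|lborel. cnj (f x + g x) * k x) =
        Re (LINT x|lborel. cnj (f x) * k x) + Re (LINT x|lborel. cnj (g x) * k x)"
      by (simp add: distrib_right)
  qed
  show "inner (r *\<^sub>R f) g = r * inner f g"
    unfolding inner_L2_def scaleR_L2_def
    by transfer (simp add: mult.assoc)
  have inner_self: "inner (abs_L2 f) (abs_L2 f) = (LINT x|lborel. (cmod (f x))\<^sup>2)"
    if "square_integrable f" for f :: "real ^ 'a \<Rightarrow> complex"
  proof -
    have "cnj (f x) * f x = complex_of_real ((cmod (f x))\<^sup>2)" for x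
      by (metis complex_norm_square mult.commute)
    then show ?thesis
      using that
      by (simp add: inner_L2_def cinner.abs_eq L2_eq_def del: of_real_power)
  qed
  obtain f0 where f0: "square_integrable f0" "f = abs_L2 f0"
    by (metis L2_eq_def Quotient_L2 Quotient_def)
  show "0 \<le> inner f f"
    using f0 by (simp add: inner_self)
  have "inner f f = 0 \<longleftrightarrow> (AE x in lborel. (cmod (f0 x))\<^sup>2 = 0)"
    unfolding f0(2) inner_self[OF f0(1)] using f0(1)
    by (intro integral_nonneg_eq_0_iff_AE) (auto simp: square_integrable_def)
  also have "\<dots> \<longleftrightarrow> L2_eq f0 (\<lambda>x. 0)"
    using f0(1) by (simp add: L2_eq_def)
  also have "\<dots> \<longleftrightarrow> f = 0"
    unfolding f0(2) zero_L2_def using f0(1)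
    by (subst Lifting.Quotient_rel[OF Quotient_L2, symmetric]) (auto simp: L2_eq_def)
  finally show "inner f f = 0 \<longleftrightarrow> f = 0" .
  show "norm f = sqrt (inner f f)"
    by (simp add: norm_L2_def)
qed

end

section \<open>The Hilbert space $\ell^2(h\mathbf Z^d)$\<close>

text \<open>
  The underlying set does not depend on the mesh size \<open>h\<close>; only the inner product does.
\<close>

definition ell2 :: "(int ^ 'd \<Rightarrow> complex) set" where
  "ell2 = {u. (\<lambda>n. (cmod (u n))\<^sup>2) summable_on UNIV}"

definition ell2_inner :: "real \<Rightarrow> (int ^ 'd \<Rightarrow> complex) \<Rightarrow> (int ^ 'd \<Rightarrow> complex) \<Rightarrow> complex" where
  "ell2_inner h u v = complex_of_real (h ^ CARD('d)) * (\<Sum>\<^sub>\<infinity>n. cnj (u n) * v n)"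

section \<open>Operators\<close>

text \<open>
  The Hilbert space adjoint of \<open>T\<close>, from the space \<open>X\<close> with inner product \<open>ipX\<close> to a space
  with inner product \<open>ipY\<close>.
\<close>

definition adjoint_op ::
  "('x \<Rightarrow> 'x \<Rightarrow> complex) \<Rightarrow> 'x set \<Rightarrow> ('y \<Rightarrow> 'y \<Rightarrow> complex) \<Rightarrow> ('x \<Rightarrow> 'y) \<Rightarrow> 'y \<Rightarrow> 'x" where
  "adjoint_op ipX X ipY T y = (THE x. x \<in> X \<and> (\<forall>x'\<in>X. ipX x x' = ipY y (T x')))"

definition bounded_clinear :: "(('d::finite) L2 \<Rightarrow> 'd L2) \<Rightarrow> bool" where
  "bounded_clinear T \<longleftrightarrow> bounded_linear T \<and> (\<forall>c f. T (c *\<^sub>C f) = c *\<^sub>C T f)"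

text \<open>Multiplication by a real function; meaningful on \<open>mult_domain\<close> only.\<close>

definition mult_domain :: "(real ^ 'd \<Rightarrow> real) \<Rightarrow> ('d::finite) L2 set" where
  "mult_domain G = {f. square_integrable (\<lambda>x. complex_of_real (G x) * rep_L2 f x)}"

definition mult_op :: "(real ^ 'd \<Rightarrow> real) \<Rightarrow> ('d::finite) L2 \<Rightarrow> 'd L2" where
  "mult_op G f = L2_of (\<lambda>x. complex_of_real (G x) * rep_L2 f x)"

section \<open>Fourier transforms\<close>

definition fourier_integral :: "(real ^ 'd \<Rightarrow> complex) \<Rightarrow> real ^ 'd \<Rightarrow> complex" where
  "fourier_integral f \<xi> = complex_of_real ((2 * pi) powr (- real CARD('d) / 2)) *
     (LINT x|lborel. exp (- \<i> * complex_of_real (x \<bullet> \<xi>)) * f x)"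

text \<open>
  The integral converges for $f \in L^1 \cap L^2$. The extension to $L^2$ by continuity is
  obtained by truncating \<open>f\<close> to balls and passing to the limit in the $L^2$ norm.
\<close>

definition fourier :: "('d::finite) L2 \<Rightarrow> 'd L2" where
  "fourier f = lim (\<lambda>N::nat. L2_of (fourier_integral
     (\<lambda>x. indicator (cball 0 (real N)) x * rep_L2 f x)))"

abbreviation fourier_adj :: "('d::finite) L2 \<Rightarrow> 'd L2" where
  "fourier_adj \<equiv> adjoint_op cinner UNIV cinner fourier"

definition lattice_point :: "real \<Rightarrow> int ^ 'd \<Rightarrow> real ^ 'd" where
  "lattice_point h k = (\<chi> i. h * real_of_int (k $ i))"

definition cube :: "real \<Rightarrow> (real ^ 'd) set" where
  "cube r = cbox (\<chi> i. - r) (\<chi> i. r)"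

text \<open>
  $L^2(\mathbf T_h^d)$ is regarded as the subspace of $L^2(\mathbf R^d)$ of functions vanishing
  outside $\mathbf T_h^d$, and the Fourier series is summed in the norm of that space.
\<close>

definition dfourier :: "real \<Rightarrow> (int ^ 'd \<Rightarrow> complex) \<Rightarrow> ('d::finite) L2" where
  "dfourier h u = (\<Sum>\<^sub>\<infinity>n.
     (complex_of_real (h ^ CARD('d) / (2 * pi) powr (real CARD('d) / 2)) * u n) *\<^sub>C
     L2_of (\<lambda>\<xi>. indicator (cube (pi / h)) \<xi> *
       exp (- \<i> * complex_of_real (lattice_point h n \<bullet> \<xi>))))"

abbreviation dfourier_adj :: "real \<Rightarrow> ('d::finite) L2 \<Rightarrow> int ^ 'd \<Rightarrow> complex" where
  "dfourier_adj h \<equiv> adjoint_op (ell2_inner h) ell2 cinner (dfourier h)"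

section \<open>Embedding and discretization\<close>

definition shifted :: "(real ^ 'd \<Rightarrow> complex) \<Rightarrow> real \<Rightarrow> int ^ 'd \<Rightarrow> ('d::finite) L2" where
  "shifted \<phi>0 h k = L2_of (\<lambda>x. \<phi>0 ((1 / h) *\<^sub>R (x - lattice_point h k)))"

definition biorthogonal :: "(int ^ 'd \<Rightarrow> ('d::finite) L2) \<Rightarrow> (int ^ 'd \<Rightarrow> 'd L2) \<Rightarrow> bool" where
  "biorthogonal u v \<longleftrightarrow> (\<forall>k n. cinner (u k) (v n) = (if k = n then 1 else 0))"

definition Riesz_sequence :: "(int ^ 'd \<Rightarrow> ('d::finite) L2) \<Rightarrow> bool" where
  "Riesz_sequence u \<longleftrightarrow> (\<exists>A>0. \<exists>B>0. \<forall>c\<in>ell2.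
     (\<lambda>k. c k *\<^sub>C u k) summable_on UNIV \<and>
     A * (\<Sum>\<^sub>\<infinity>k. (cmod (c k))\<^sup>2) \<le> (norm (\<Sum>\<^sub>\<infinity>k. c k *\<^sub>C u k))\<^sup>2 \<and>
     (norm (\<Sum>\<^sub>\<infinity>k. c k *\<^sub>C u k))\<^sup>2 \<le> B * (\<Sum>\<^sub>\<infinity>k. (cmod (c k))\<^sup>2))"

text \<open>The conditions on the (classes of the) Fourier transforms hold almost everywhere.\<close>

definition admissible :: "(real ^ 'd \<Rightarrow> complex) \<Rightarrow> (real ^ 'd \<Rightarrow> complex) \<Rightarrow> bool" where
  "admissible \<phi>0 \<psi>0 \<longleftrightarrow>
     square_integrable \<phi>0 \<and> square_integrable \<psi>0 \<and>
     Riesz_sequence (shifted \<phi>0 1) \<and> Riesz_sequence (shifted \<psi>0 1) \<and>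
     biorthogonal (shifted \<phi>0 1) (shifted \<psi>0 1) \<and>
     (\<forall>f\<in>{\<phi>0, \<psi>0}.
        (\<exists>M. AE \<xi> in lborel. cmod (rep_L2 (fourier (L2_of f)) \<xi>) \<le> M) \<and>
        (AE \<xi> in lborel. \<xi> \<notin> cube (3 * pi / 2) \<longrightarrow> rep_L2 (fourier (L2_of f)) \<xi> = 0)) \<and>
     (\<exists>c0>0. \<forall>f\<in>{\<phi>0, \<psi>0}.
        AE \<xi> in lborel. \<xi> \<in> cube (pi / 2) \<longrightarrow> c0 \<le> cmod (rep_L2 (fourier (L2_of f)) \<xi>))"

definition embedding :: "(real ^ 'd \<Rightarrow> complex) \<Rightarrow> real \<Rightarrow> (int ^ 'd \<Rightarrow> complex) \<Rightarrow> ('d::finite) L2" where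
  "embedding \<phi>0 h u = (\<Sum>\<^sub>\<infinity>k. u k *\<^sub>C shifted \<phi>0 h k)"

definition discretization :: "(real ^ 'd \<Rightarrow> complex) \<Rightarrow> real \<Rightarrow> ('d::finite) L2 \<Rightarrow> int ^ 'd \<Rightarrow> complex" where
  "discretization \<psi>0 h f = (\<lambda>k. cinner (shifted \<psi>0 h k) f / complex_of_real (h ^ CARD('d)))"

section \<open>Multiplier classes\<close>

definition C1_gradient :: "(real ^ 'd \<Rightarrow> real) \<Rightarrow> (real ^ 'd \<Rightarrow> real ^ 'd) \<Rightarrow> bool" where
  "C1_gradient G D \<longleftrightarrow> continuous_on UNIV D \<and> (\<forall>\<xi>. GDERIV G \<xi> :> D \<xi>)"

definition even_in_coordinates :: "(real ^ 'd \<Rightarrow> real) \<Rightarrow> bool" where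
  "even_in_coordinates G \<longleftrightarrow> (\<forall>\<xi>. G \<xi> = G (\<chi> i. \<bar>\<xi> $ i\<bar>))"

text \<open>
  In \<open>class_I\<close> the exponent \<open>\<beta>\<close> may be negative or zero, while \<open>0 powr \<beta> = 0\<close> for every \<open>\<beta>\<close>;
  hence the gradient bound is only stated off the origin. At the origin \<open>G\<close> has a minimum, so
  its gradient vanishes there anyway.
\<close>

definition class_I :: "real \<Rightarrow> real \<Rightarrow> (real ^ 'd \<Rightarrow> real) \<Rightarrow> bool" where
  "class_I \<alpha> \<beta> G \<longleftrightarrow>
     \<alpha> > 1 / 2 \<and> \<beta> > - 1 / 2 \<and> \<alpha> \<le> 1 + \<beta> \<and> 1 + \<beta> < 2 * \<alpha> \<and> 2 * \<alpha> \<le> 3 + \<beta> \<and>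
     (\<forall>\<xi>. 0 \<le> G \<xi>) \<and> G 0 = 0 \<and>
     (\<exists>c>0. \<exists>c0>0. \<forall>\<xi>. c0 \<le> norm \<xi> \<longrightarrow> c * norm \<xi> powr \<alpha> \<le> G \<xi>) \<and>
     (\<exists>D. C1_gradient G D \<and>
        (\<exists>c'>0. \<forall>\<xi>. \<xi> \<noteq> 0 \<longrightarrow> norm (D \<xi>) \<le> c' * norm \<xi> powr \<beta>)) \<and>
     even_in_coordinates G"

definition class_II :: "real \<Rightarrow> real \<Rightarrow> (real ^ 'd \<Rightarrow> real) \<Rightarrow> bool" where
  "class_II \<alpha> \<beta>' G \<longleftrightarrow>
     1 / 2 < \<alpha> \<and> \<alpha> \<le> 1 \<and> 0 \<le> \<beta>' \<and> 1 + \<beta>' < 2 * \<alpha> \<and>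
     (\<exists>G'. (\<forall>\<xi>. G \<xi> = norm \<xi> powr \<alpha> + G' \<xi>) \<and>
        (\<forall>\<xi>. 0 \<le> G' \<xi>) \<and> G' 0 = 0 \<and>
        (\<exists>D. C1_gradient G' D \<and>
           (\<exists>c>0. \<exists>c0>0. \<forall>\<xi>. c0 \<le> norm \<xi> \<longrightarrow> norm (D \<xi>) \<le> c * norm \<xi> powr \<beta>')) \<and>
        even_in_coordinates G')"

section \<open>Hamiltonians and resolvents\<close>

definition H0_domain :: "(real ^ 'd \<Rightarrow> real) \<Rightarrow> ('d::finite) L2 set" where
  "H0_domain G = {f. fourier f \<in> mult_domain G}"

definition H0 :: "(real ^ 'd \<Rightarrow> real) \<Rightarrow> ('d::finite) L2 \<Rightarrow> 'd L2" where
  "H0 G f = fourier_adj (mult_op G (fourier f))"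

definition H_op :: "(real ^ 'd \<Rightarrow> real) \<Rightarrow> (real ^ 'd \<Rightarrow> real) \<Rightarrow> ('d::finite) L2 \<Rightarrow> 'd L2" where
  "H_op G V f = H0 G f + mult_op V f"

definition discrete_symbol :: "(real ^ 'd \<Rightarrow> real) \<Rightarrow> real \<Rightarrow> real ^ 'd \<Rightarrow> real" where
  "discrete_symbol G h \<xi> = G (\<chi> i. 2 / h * sin (h / 2 * \<xi> $ i))"

definition H0_discrete ::
  "(real ^ 'd \<Rightarrow> real) \<Rightarrow> real \<Rightarrow> (int ^ 'd \<Rightarrow> complex) \<Rightarrow> int ^ ('d::finite) \<Rightarrow> complex" where
  "H0_discrete G h u = dfourier_adj h (mult_op (discrete_symbol G h) (dfourier h u))"

definition H_discrete :: "(real ^ 'd \<Rightarrow> real) \<Rightarrow> (real ^ 'd \<Rightarrow> real) \<Rightarrow> real \<Rightarrow>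
    (int ^ 'd \<Rightarrow> complex) \<Rightarrow> int ^ ('d::finite) \<Rightarrow> complex" where
  "H_discrete G V h u =
     (\<lambda>k. H0_discrete G h u k + complex_of_real (V (lattice_point h k)) * u k)"

text \<open>
  For \<open>z\<close> in the resolvent set the following are the inverses of
  $H - zI \colon \mathrm{dom}(H_0) \to \mathcal H$ and of $H_h - zI_h$ on $\ell^2(h\mathbf Z^d)$.
\<close>

definition resolvent :: "(real ^ 'd \<Rightarrow> real) \<Rightarrow> (real ^ 'd \<Rightarrow> real) \<Rightarrow> complex \<Rightarrow>
    ('d::finite) L2 \<Rightarrow> 'd L2" where
  "resolvent G V z = the_inv_into (H0_domain G) (\<lambda>f. H_op G V f - z *\<^sub>C f)"

definition resolvent_discrete :: "(real ^ 'd \<Rightarrow> real) \<Rightarrow> (real ^ 'd \<Rightarrow> real) \<Rightarrow> real \<Rightarrow> complex \<Rightarrow>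
    (int ^ 'd \<Rightarrow> complex) \<Rightarrow> int ^ ('d::finite) \<Rightarrow> complex" where
  "resolvent_discrete G V h z =
     the_inv_into ell2 (\<lambda>u k. H_discrete G V h u k - z * u k)"

end

theory Submission
  imports Defs
begin

text \<open>
  After conjugation with the Fourier transform both operators become operators on functions of
  \<open>\<xi>\<close>. For \<open>V = 0\<close> the composition of embedding, discrete resolvent and discretization is a finite
  sum, over pairs of translations by the dual lattice, of multiplications by
  \<open>1 / (G\<^sub>0\<^sub>h - z)\<close> times a product of the two rescaled symbols. By biorthogonality the diagonal part
  is exactly \<open>1 / (G\<^sub>0\<^sub>h - z)\<close> on the cube \<open>|\<xi>\<^sub>i| < pi / (2 h)\<close>, where it is compared with
  \<open>1 / (G\<^sub>0 - z)\<close> through \<open>|G\<^sub>0\<^sub>h - G\<^sub>0| \<le> C h\<^sup>\<gamma> (1 + |\<xi>|)\<^sup>2\<^sup>\<alpha>\<close> and the growth of both symbols; everything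
  else lives outside that cube, where both resolvents are already small.

  With a potential, \<open>p = J\<^sub>h (H\<^sub>h - z)\<^sup>-\<^sup>1 K\<^sub>h g\<close> solves the resolvent equation of \<open>H\<close> up to the free error
  and the commutator \<open>V\<^sub>h K\<^sub>h - K\<^sub>h V\<close>. A Schur test bounds the commutator by \<open>h\<^sup>\<theta>\<^sup>'\<close>, using the Hoelder
  condition near the diagonal and the decay of \<open>\<psi>\<^sub>0\<close> away from it, and the resolvent equation is
  stable.
\<close>

section \<open>Square-integrable functions and weighted composition\<close>

text \<open>On the Fourier side the operators are finite sums of weighted compositions
  \<open>wco\<close>, so products, adjoints and norm bounds reduce to pointwise statements about
  weights. Three facts fix the rates. Evenness in each coordinate makes the discrete symbol periodic
  under the dual lattice, as a shift by a period only changes signs of sines; so the discrete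
  resolvent passes through every translation. The support cube of half-side 3 pi / 2 lets two points
  that differ by a nonzero dual vector be active together only where some |h \<xi>_i| lies between
  pi / 2 and 3 pi / 2; there the sine is bounded below and the discrete resolvent has size
  h^\<alpha>. The free rate is at most \<alpha> by the parameter conditions, so these terms are
  harmless. The discrete problem is posed on all of \<open>'d L2\<close>, where its operators
  commute with the projection to the cube, so one perturbation argument serves both resolvents. As
  discretization after embedding is the identity, the two potentials are compared only through their
  commutator with the discretization, which is where the decay of \<psi>_0 enters.\<close>

lemma square_integrable_rep_L2 [simp]: "square_integrable (rep_L2 f)"
  using Quotient_rep_reflp[OF Quotient_L2, of f] by (simp add: L2_eq_def)

lemma L2_of_rep_L2 [simp]: "L2_of (rep_L2 f) = f"
  by (simp add: L2_of_def Quotient_abs_rep[OF Quotient_L2])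

lemma L2_of_abs: "square_integrable f \<Longrightarrow> L2_of f = abs_L2 f"
  by (simp add: L2_of_def)

lemma L2_of_eq_iff:
  "square_integrable f \<Longrightarrow> square_integrable g \<Longrightarrow> L2_of f = L2_of g \<longleftrightarrow> (AE x in lborel. f x = g x)"
  using Quotient_rel[OF Quotient_L2, of f g] by (auto simp: L2_of_abs L2_eq_def)

lemma L2_of_eqI:
  "square_integrable f \<Longrightarrow> square_integrable g \<Longrightarrow> (AE x in lborel. f x = g x) \<Longrightarrow> L2_of f = L2_of g"
  by (simp add: L2_of_eq_iff)

lemma rep_L2_of: "square_integrable f \<Longrightarrow> AE x in lborel. rep_L2 (L2_of f) x = f x"
  using L2_of_eq_iff[of "rep_L2 (L2_of f)" f] by simp

lemma L2_cases [case_names L2_of, cases type: L2]: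
  obtains f0 where "square_integrable f0" "f = L2_of f0"
  using that[of "rep_L2 f"] by simp

lemma borel_measurable_square_integrable:
  "square_integrable f \<Longrightarrow> f \<in> borel_measurable borel"
  by (simp add: square_integrable_def)

lemma borel_measurable_rep_L2 [measurable, simp]: "rep_L2 f \<in> borel_measurable borel"
  by (simp add: borel_measurable_square_integrable)

lemma L2_of_add:
  "square_integrable f \<Longrightarrow> square_integrable g \<Longrightarrow> L2_of f + L2_of g = L2_of (\<lambda>x. f x + g x)"
  by (simp add: L2_of_abs square_integrable_add plus_L2.abs_eq L2_eq_def)

lemma scaleC_L2_of: "square_integrable f \<Longrightarrow> c *\<^sub>C L2_of f = L2_of (\<lambda>x. c * f x)"
  by (simp add: L2_of_abs square_integrable_scale scaleC.abs_eq L2_eq_def)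

lemma L2_of_zero [simp]: "L2_of (\<lambda>x. 0) = 0"
  by (simp add: L2_of_abs zero_L2.abs_eq)

lemma square_integrable_diff:
  "square_integrable f \<Longrightarrow> square_integrable g \<Longrightarrow> square_integrable (\<lambda>x. f x - g x)"
  using square_integrable_add[of f "\<lambda>x. - 1 * g x"] square_integrable_scale[of g "- 1"] by simp

lemma L2_of_diff:
  "square_integrable f \<Longrightarrow> square_integrable g \<Longrightarrow> L2_of f - L2_of g = L2_of (\<lambda>x. f x - g x)"
  using L2_of_add[of f "\<lambda>x. - 1 * g x"] square_integrable_scale[of g "- 1"]
  by (simp add: minus_L2_def scaleC_L2_of)

section \<open>The complex inner product\<close>

lemma cinner_L2_of:
  "square_integrable f \<Longrightarrow> square_integrable g \<Longrightarrow>
    cinner (L2_of f) (L2_of g) = (LINT x|lborel. cnj (f x) * g x)"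
  by (simp add: L2_of_abs cinner.abs_eq L2_eq_def)

lemma cinner_add_left: "cinner (f + g) k = cinner f k + cinner g k"
  by (cases f; cases g; cases k)
    (simp add: L2_of_add cinner_L2_of square_integrable_add distrib_right
      Bochner_Integration.integral_add integrable_cnj_mult)

lemma cinner_add_right: "cinner k (f + g) = cinner k f + cinner k g"
  by (cases f; cases g; cases k)
    (simp add: L2_of_add cinner_L2_of square_integrable_add distrib_left
      Bochner_Integration.integral_add integrable_cnj_mult)

lemma cinner_scaleC_left [simp]: "cinner (c *\<^sub>C f) g = cnj c * cinner f g"
  by (cases f; cases g) (simp add: scaleC_L2_of cinner_L2_of square_integrable_scale mult.assoc)

lemma cinner_scaleC_right [simp]: "cinner f (c *\<^sub>C g) = c * cinner f g"
  by (cases f; cases g)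
    (simp add: scaleC_L2_of cinner_L2_of square_integrable_scale mult.left_commute[of _ c])

lemma cinner_commute: "cinner f g = cnj (cinner g f)"
proof (cases f; cases g)
  fix f0 g0 assume "square_integrable f0" "f = L2_of f0" "square_integrable g0" "g = L2_of g0"
  moreover have "cnj (LINT x|lborel. cnj (g0 x) * f0 x) = (LINT x|lborel. cnj (cnj (g0 x) * f0 x))"
    by (rule Bochner_Integration.integral_cnj[symmetric])
  ultimately show ?thesis
    by (simp add: cinner_L2_of mult.commute del: integral_cnj)
qed

lemma cinner_zero [simp]: "cinner 0 f = 0" "cinner f 0 = 0"
  using cinner_add_left[of 0 0 f] cinner_add_right[of f 0 0] by auto

lemma uminus_L2_scaleC: "- f = (- 1) *\<^sub>C f" for f :: "'d::finite L2"
  by (simp add: uminus_L2_def)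

lemma cinner_uminus [simp]: "cinner (- f) g = - cinner f g" "cinner f (- g) = - cinner f g"
  by (simp_all add: uminus_L2_scaleC)

lemma cinner_diff_left: "cinner (f - g) k = cinner f k - cinner g k"
  and cinner_diff_right: "cinner k (f - g) = cinner k f - cinner k g"
  by (simp_all only: diff_conv_add_uminus cinner_add_left cinner_add_right cinner_uminus)

lemma Re_cinner: "Re (cinner f g) = inner f g"
  by (simp add: inner_L2_def)

lemma cinner_self: "cinner f f = complex_of_real ((norm f)\<^sup>2)"
proof -
  have "Im (cinner f f) = 0"
    using arg_cong[OF cinner_commute[of f f], of Im] by simp
  then show ?thesis by (simp add: complex_eq_iff Re_cinner dot_square_norm del: of_real_power)
qed

lemma norm_scaleC [simp]: "norm (c *\<^sub>C f) = cmod c * norm f"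
proof -
  have "(norm (c *\<^sub>C f))\<^sup>2 = Re ((c * cnj c) * cinner f f)"
    by (simp add: power2_norm_eq_inner mult_ac flip: Re_cinner)
  also have "\<dots> = (cmod c * norm f)\<^sup>2"
    by (simp add: cinner_self complex_norm_square[symmetric] power_mult_distrib flip: of_real_power of_real_mult)
  finally show ?thesis by (simp add: power2_eq_iff_nonneg)
qed

text \<open>A unimodular factor \<open>u\<close> on \<open>g\<close> turns the inner product into
  its modulus, and the real Cauchy-Schwarz inequality then applies.\<close>

lemma cmod_cinner_le: "cmod (cinner f g) \<le> norm f * norm g"
proof (cases "cinner f g = 0")
  case False
  define u where "u = cnj (sgn (cinner f g))"
  have u: "cmod u = 1" using False by (simp add: u_def norm_sgn)
  have "cinner f (u *\<^sub>C g) = complex_of_real (cmod (cinner f g))"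
    using False complex_norm_square[of "cinner f g"]
    by (simp add: u_def sgn_eq field_simps power2_eq_square)
  then have "cmod (cinner f g) = inner f (u *\<^sub>C g)" by (simp flip: Re_cinner)
  also have "\<dots> \<le> norm f * norm (u *\<^sub>C g)" by (rule norm_cauchy_schwarz)
  finally show ?thesis by (simp add: u)
qed simp

lemma norm_L2_of: "square_integrable f \<Longrightarrow> (norm (L2_of f))\<^sup>2 = (LINT x|lborel. (cmod (f x))\<^sup>2)"
proof -
  assume f: "square_integrable f"
  have "complex_of_real ((norm (L2_of f))\<^sup>2) = (LINT x|lborel. cnj (f x) * f x)"
    using f by (simp add: cinner_self[symmetric] cinner_L2_of del: of_real_power)
  also have "\<dots> = (LINT x|lborel. complex_of_real ((cmod (f x))\<^sup>2))"
    by (rule Bochner_Integration.integral_cong) (simp_all add: complex_norm_square mult.commute del: of_real_power)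
  also have "\<dots> = complex_of_real (LINT x|lborel. (cmod (f x))\<^sup>2)" by (rule integral_complex_of_real)
  finally show ?thesis by (simp only: of_real_eq_iff)
qed

lemma nn_integral_norm_L2_of:
  "square_integrable f \<Longrightarrow> (\<integral>\<^sup>+x. ennreal ((cmod (f x))\<^sup>2) \<partial>lborel) = ennreal ((norm (L2_of f))\<^sup>2)"
  by (simp add: norm_L2_of square_integrable_def nn_integral_eq_integral)

lemma nn_integral_norm_rep:
  "(\<integral>\<^sup>+x. ennreal ((cmod (rep_L2 f x))\<^sup>2) \<partial>lborel) = ennreal ((norm f)\<^sup>2)"
  using nn_integral_norm_L2_of[of "rep_L2 f"] by simp

lemma square_integrable_iff_nn:
  "square_integrable f \<longleftrightarrow> f \<in> borel_measurable borel \<and> (\<integral>\<^sup>+x. ennreal ((cmod (f x))\<^sup>2) \<partial>lborel) < \<infinity>"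
  by (auto simp: square_integrable_def integrable_iff_bounded)

lemma scaleC_scaleC [simp]: "a *\<^sub>C b *\<^sub>C f = (a * b) *\<^sub>C f"
  by (cases f) (simp add: scaleC_L2_of square_integrable_scale mult.assoc)

lemma scaleC_add_right: "a *\<^sub>C (f + g) = a *\<^sub>C f + a *\<^sub>C g"
  by (cases f; cases g) (simp add: scaleC_L2_of L2_of_add square_integrable_add square_integrable_scale distrib_left)

lemma scaleC_add_left: "(a + b) *\<^sub>C f = a *\<^sub>C f + b *\<^sub>C f"
  by (cases f) (simp add: scaleC_L2_of L2_of_add square_integrable_scale distrib_right)

lemma scaleC_zero [simp]: "0 *\<^sub>C f = 0" "c *\<^sub>C 0 = 0" "1 *\<^sub>C f = f"
  by (simp_all flip: norm_eq_zero) (cases f, simp add: scaleC_L2_of)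

lemma scaleC_diff_right: "a *\<^sub>C (f - g) = a *\<^sub>C f - a *\<^sub>C g"
  by (simp add: diff_conv_add_uminus scaleC_add_right uminus_L2_scaleC mult.commute del: add_uminus_conv_diff)

lemma scaleR_scaleC: "r *\<^sub>R f = complex_of_real r *\<^sub>C f" for f :: "'d::finite L2"
  by (rule scaleR_L2_def)

section \<open>Bounded complex-linear operators\<close>

lemma bounded_clinearI:
  assumes "\<And>f g. T (f + g) = T f + T g" "\<And>c f. T (c *\<^sub>C f) = c *\<^sub>C T f"
    "\<And>f. norm (T f) \<le> M * norm f"
  shows "bounded_clinear T"
  unfolding bounded_clinear_def
proof
  show "bounded_linear T"
    by (rule bounded_linear_intro[where K = M]) (use assms in \<open>auto simp: scaleR_scaleC mult.commute\<close>)
qed (use assms in auto)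

lemma bounded_clinear_imp_linear: "bounded_clinear T \<Longrightarrow> bounded_linear T"
  by (simp add: bounded_clinear_def)

lemma bounded_clinear_scaleC: "bounded_clinear T \<Longrightarrow> T (c *\<^sub>C f) = c *\<^sub>C T f"
  by (simp add: bounded_clinear_def)

lemma bounded_clinear_simps:
  assumes "bounded_clinear T"
  shows "T (f + g) = T f + T g" "T (f - g) = T f - T g" "T 0 = 0" "T (- f) = - T f"
  using bounded_clinear_imp_linear[OF assms]
  by (simp_all add: linear_simps)

lemma bounded_clinear_compose:
  "bounded_clinear S \<Longrightarrow> bounded_clinear T \<Longrightarrow> bounded_clinear (\<lambda>f. S (T f))"
  by (simp add: bounded_clinear_def bounded_linear_compose)

lemma bounded_clinear_add:
  "bounded_clinear S \<Longrightarrow> bounded_clinear T \<Longrightarrow> bounded_clinear (\<lambda>f. S f + T f)"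
  by (simp add: bounded_clinear_def bounded_linear_add scaleC_add_right)

lemma bounded_clinear_diff:
  "bounded_clinear S \<Longrightarrow> bounded_clinear T \<Longrightarrow> bounded_clinear (\<lambda>f. S f - T f)"
  by (simp add: bounded_clinear_def bounded_linear_sub scaleC_diff_right)

lemma bounded_clinear_zero: "bounded_clinear (\<lambda>f. 0)"
  by (simp add: bounded_clinear_def)

lemma bounded_clinear_ident: "bounded_clinear (\<lambda>f. f)"
  by (simp add: bounded_clinear_def bounded_linear_ident)

lemma bounded_clinear_cmult:
  "bounded_clinear T \<Longrightarrow> bounded_clinear (\<lambda>f. c *\<^sub>C T f)"
  by (rule bounded_clinear_compose[of "\<lambda>f. c *\<^sub>C f" T])
    (auto intro: bounded_clinearI[where M = "cmod c"] simp: scaleC_add_right mult.commute)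

lemma bounded_clinear_sum:
  assumes "\<And>i. i \<in> I \<Longrightarrow> bounded_clinear (T i)"
  shows "bounded_clinear (\<lambda>f. \<Sum>i\<in>I. T i f)"
proof (cases "finite I")
  case True
  then show ?thesis using assms
    by (induction I) (auto intro: bounded_clinear_zero bounded_clinear_add)
qed (simp add: bounded_clinear_zero)

lemma cinner_sum_left: "cinner (\<Sum>i\<in>I. f i) g = (\<Sum>i\<in>I. cinner (f i) g)"
  and cinner_sum_right: "cinner g (\<Sum>i\<in>I. f i) = (\<Sum>i\<in>I. cinner g (f i))"
  by (induction I rule: infinite_finite_induct; simp add: cinner_add_left cinner_add_right)+

lemma bounded_linear_cinner_right: "bounded_linear (cinner f)"
  by (rule bounded_linear_intro[where K = "norm f"])
    (auto simp: cinner_add_right scaleR_scaleC scaleR_conv_of_real mult.commute intro: order_trans[OF cmod_cinner_le])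

lemma bounded_linear_cinner_left: "bounded_linear (\<lambda>f. cinner f g)"
  by (rule bounded_linear_intro[where K = "norm g"])
    (auto simp: cinner_add_left scaleR_scaleC scaleR_conv_of_real intro: order_trans[OF cmod_cinner_le])

lemma cinner_eqI: "(\<And>g. cinner f g = cinner f' g) \<Longrightarrow> f = f'"
proof -
  assume "\<And>g. cinner f g = cinner f' g"
  then have "cinner (f - f') (f - f') = 0" by (simp add: cinner_diff_left)
  then show ?thesis by (simp add: cinner_self)
qed

lemma cinner_eqI': "(\<And>g. cinner g f = cinner g f') \<Longrightarrow> f = f'"
  by (rule cinner_eqI) (metis cinner_commute)

section \<open>Affine changes of variables\<close>

lemma measurable_affine_borel [measurable]:
  "(\<lambda>x::real^'d. c *\<^sub>R x + v) \<in> borel_measurable borel"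
  by measurable

lemma nn_integral_lborel_affine:
  fixes g :: "real ^ 'd::finite \<Rightarrow> ennreal"
  assumes [measurable]: "g \<in> borel_measurable borel" and c: "c \<noteq> 0"
  shows "(\<integral>\<^sup>+x. g x \<partial>lborel) = ennreal (\<bar>c\<bar> ^ CARD('d::finite)) * (\<integral>\<^sup>+x. g (c *\<^sub>R x + v) \<partial>lborel)"
proof -
  have "(\<integral>\<^sup>+x. g x \<partial>lborel) =
      (\<integral>\<^sup>+x. g x \<partial>density (distr lborel borel (\<lambda>x. v + c *\<^sub>R x)) (\<lambda>_. ennreal (\<bar>c\<bar> ^ DIM(real ^ 'd))))"
    using lborel_affine[OF c, of v] by simp
  also have "\<dots> = ennreal (\<bar>c\<bar> ^ CARD('d)) * (\<integral>\<^sup>+x. g (c *\<^sub>R x + v) \<partial>lborel)"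
    by (simp add: nn_integral_density nn_integral_distr nn_integral_cmult add.commute)
  finally show ?thesis .
qed

lemma lborel_integral_affine:
  fixes g :: "real ^ 'd::finite \<Rightarrow> 'b::{banach, second_countable_topology}"
  assumes [measurable]: "g \<in> borel_measurable borel" and c: "c \<noteq> 0"
  shows "(LINT x|lborel. g x) = \<bar>c\<bar> ^ CARD('d) *\<^sub>R (LINT x|lborel. g (c *\<^sub>R x + v))"
proof -
  have "(LINT x|lborel. g x) =
      (LINT x|density (distr lborel borel (\<lambda>x. v + c *\<^sub>R x)) (\<lambda>_. ennreal (\<bar>c\<bar> ^ DIM(real ^ 'd))). g x)"
    using lborel_affine[OF c, of v] by simp
  also have "\<dots> = \<bar>c\<bar> ^ CARD('d) *\<^sub>R (LINT x|lborel. g (c *\<^sub>R x + v))"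
    by (simp add: integral_density integral_distr add.commute)
  finally show ?thesis .
qed

text \<open>The change of variables, applied to the indicator of a Borel null set that contains the
  exceptional points, shows that its preimage is null. This makes compositions of classes with
  affine maps well defined.\<close>

lemma AE_lborel_affine:
  fixes P :: "real ^ 'd::finite \<Rightarrow> bool"
  assumes "AE x in lborel. P x" and c: "c \<noteq> 0"
  shows "AE x in lborel. P (c *\<^sub>R x + v)"
proof -
  obtain N where N: "{x. \<not> P x} \<subseteq> N" "emeasure lborel N = 0" "N \<in> sets borel"
    using assms(1) by (auto elim!: AE_E)
  have [measurable]: "N \<in> sets borel" by fact
  have "ennreal (\<bar>c\<bar> ^ CARD('d)) * (\<integral>\<^sup>+x. indicator N (c *\<^sub>R x + v) \<partial>lborel)
    = (\<integral>\<^sup>+x. indicator N x \<partial>(lborel :: (real ^ 'd) measure))"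
    by (rule nn_integral_lborel_affine[symmetric]) (use c in auto)
  also have "\<dots> = 0" using N by simp
  finally have "(\<integral>\<^sup>+x. indicator N (c *\<^sub>R x + v) \<partial>(lborel :: (real ^ 'd) measure)) = 0"
    using c by simp
  then have "AE x in lborel. (indicator N (c *\<^sub>R x + v) :: ennreal) = 0"
    by (subst (asm) nn_integral_0_iff_AE) auto
  then show ?thesis
    by eventually_elim (use N in \<open>auto simp: indicator_def split: if_splits\<close>)
qed

section \<open>Weighted composition operators\<close>

definition bounded_measurable :: "(real ^ 'd::finite \<Rightarrow> complex) \<Rightarrow> bool" where
  "bounded_measurable a \<longleftrightarrow> a \<in> borel_measurable borel \<and> (\<exists>M. \<forall>x. cmod (a x) \<le> M)"

text \<open>A common form for translations, dilations, multiplications and modulations. For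
  \<open>c \<noteq> 0\<close> the arbitrary representative is harmless, since affine maps pull null
  sets back to null sets. The weights are bounded everywhere, not just almost everywhere, so that
  they can be composed freely.\<close>

definition wco :: "(real ^ 'd::finite \<Rightarrow> complex) \<Rightarrow> real \<Rightarrow> real ^ 'd::finite \<Rightarrow> ('d::finite) L2 \<Rightarrow> 'd L2" where
  "wco a c v f = L2_of (\<lambda>x. a x * rep_L2 f (c *\<^sub>R x + v))"

lemma bounded_measurableI:
  "a \<in> borel_measurable borel \<Longrightarrow> (\<And>x. cmod (a x) \<le> M) \<Longrightarrow> bounded_measurable a"
  by (auto simp: bounded_measurable_def)

lemma bounded_measurable_borel: "bounded_measurable a \<Longrightarrow> a \<in> borel_measurable borel"
  by (simp add: bounded_measurable_def)

lemma bounded_measurable_mult: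
  assumes "bounded_measurable a" "bounded_measurable b"
  shows "bounded_measurable (\<lambda>x. a x * b x)"
proof -
  obtain A B where AB: "\<And>x. cmod (a x) \<le> A" "\<And>x. cmod (b x) \<le> B"
    using assms by (auto simp: bounded_measurable_def)
  have "cmod (a x * b x) \<le> A * B" for x
    unfolding norm_mult by (rule mult_mono[OF AB]) (use AB norm_ge_zero order_trans in blast)+
  then show ?thesis
    using assms by (auto simp: bounded_measurable_def)
qed

lemma bounded_measurable_cnj:
  "bounded_measurable a \<Longrightarrow> bounded_measurable (\<lambda>x. cnj (a x))"
  by (auto simp: bounded_measurable_def intro: borel_measurable_continuous_on[where f = cnj] continuous_intros)

lemma bounded_measurable_affine:
  "bounded_measurable a \<Longrightarrow> bounded_measurable (\<lambda>x. a (c *\<^sub>R x + v))"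
  unfolding bounded_measurable_def by (auto intro: measurable_compose[OF measurable_affine_borel])

lemma bounded_measurable_const [simp]: "bounded_measurable (\<lambda>x. c)"
  by (auto simp: bounded_measurable_def)

lemma bounded_measurable_add:
  assumes "bounded_measurable a" "bounded_measurable b"
  shows "bounded_measurable (\<lambda>x. a x + b x)"
proof -
  obtain A B where AB: "\<And>x. cmod (a x) \<le> A" "\<And>x. cmod (b x) \<le> B"
    using assms by (auto simp: bounded_measurable_def)
  have "cmod (a x + b x) \<le> A + B" for x
    using AB[of x] norm_triangle_ineq[of "a x" "b x"] by linarith
  then show ?thesis
    using assms by (auto simp: bounded_measurable_def)
qed

lemma bounded_measurable_sum:
  "(\<And>i. i \<in> I \<Longrightarrow> bounded_measurable (a i)) \<Longrightarrow> bounded_measurable (\<lambda>x. \<Sum>i\<in>I. a i x)"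
  by (induction I rule: infinite_finite_induct) (auto intro: bounded_measurable_add)

text \<open>The Jacobian stays on the left, which avoids a division of extended reals.\<close>

lemma wco_nn_integral:
  fixes f :: "real ^ 'd::finite \<Rightarrow> complex"
  assumes [measurable]: "a \<in> borel_measurable borel" and a: "\<And>x. cmod (a x) \<le> M"
    and c: "c \<noteq> 0" and [measurable]: "f \<in> borel_measurable borel"
  shows "ennreal (\<bar>c\<bar> ^ CARD('d)) * (\<integral>\<^sup>+x. ennreal ((cmod (a x * f (c *\<^sub>R x + v)))\<^sup>2) \<partial>lborel) \<le>
    ennreal (M\<^sup>2) * (\<integral>\<^sup>+x. ennreal ((cmod (f x))\<^sup>2) \<partial>lborel)"
proof -
  have "(\<integral>\<^sup>+x. ennreal ((cmod (a x * f (c *\<^sub>R x + v)))\<^sup>2) \<partial>lborel) \<le>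
      (\<integral>\<^sup>+x. ennreal (M\<^sup>2) * ennreal ((cmod (f (c *\<^sub>R x + v)))\<^sup>2) \<partial>lborel)"
    by (intro nn_integral_mono)
      (auto simp: norm_mult power_mult_distrib a ennreal_mult'[symmetric] intro!: ennreal_leI mult_right_mono
        power_mono)
  also have "\<dots> = ennreal (M\<^sup>2) * (\<integral>\<^sup>+x. ennreal ((cmod (f (c *\<^sub>R x + v)))\<^sup>2) \<partial>lborel)"
    by (rule nn_integral_cmult) measurable
  finally show ?thesis
    using nn_integral_lborel_affine[of "\<lambda>x. ennreal ((cmod (f x))\<^sup>2)" c v] c
    by (simp add: mult_left_mono mult.left_commute[of "ennreal (M\<^sup>2)"])
qed

lemma square_integrable_wco:
  fixes f :: "real ^ 'd::finite \<Rightarrow> complex"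
  assumes "bounded_measurable a" "c \<noteq> 0" "square_integrable f"
  shows "square_integrable (\<lambda>x. a x * f (c *\<^sub>R x + v))"
proof -
  have [measurable]: "a \<in> borel_measurable borel" "f \<in> borel_measurable borel"
    using assms by (auto simp: bounded_measurable_def square_integrable_def)
  obtain M where M: "\<And>x. cmod (a x) \<le> M" using assms by (auto simp: bounded_measurable_def)
  have "ennreal (M\<^sup>2) * (\<integral>\<^sup>+x. ennreal ((cmod (f x))\<^sup>2) \<partial>lborel) < \<infinity>"
    using assms by (auto simp: square_integrable_iff_nn ennreal_mult_less_top)
  then have "ennreal (\<bar>c\<bar> ^ CARD('d)) * (\<integral>\<^sup>+x. ennreal ((cmod (a x * f (c *\<^sub>R x + v)))\<^sup>2) \<partial>lborel) < \<infinity>"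
    using wco_nn_integral[where a = a and M = M and c = c and f = f and v = v, OF _ M assms(2)]
    by (auto intro: order.strict_trans1)
  then have "(\<integral>\<^sup>+x. ennreal ((cmod (a x * f (c *\<^sub>R x + v)))\<^sup>2) \<partial>lborel) < \<infinity>"
    using assms(2) by (auto simp: ennreal_mult_less_top)
  then show ?thesis by (simp add: square_integrable_iff_nn)
qed

lemma square_integrable_mult:
  "bounded_measurable a \<Longrightarrow> square_integrable f \<Longrightarrow> square_integrable (\<lambda>x. a x * f x)"
  using square_integrable_wco[of a 1 f 0] by simp

lemma square_integrable_affine:
  "c \<noteq> 0 \<Longrightarrow> square_integrable f \<Longrightarrow> square_integrable (\<lambda>x. f (c *\<^sub>R x + v))"
  using square_integrable_wco[of "\<lambda>x. 1" c f v] by simp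

lemma wco_L2_of:
  assumes "bounded_measurable a" "c \<noteq> 0" "square_integrable f"
  shows "wco a c v (L2_of f) = L2_of (\<lambda>x. a x * f (c *\<^sub>R x + v))"
  unfolding wco_def
  by (rule L2_of_eqI)
    (use assms AE_lborel_affine[OF rep_L2_of[OF assms(3)] assms(2), of v]
      in \<open>auto intro: square_integrable_wco\<close>)

lemma bounded_clinear_wco:
  fixes a :: "real ^ 'd::finite \<Rightarrow> complex"
  assumes "bounded_measurable a" "c \<noteq> 0"
  shows "bounded_clinear (wco a c v)"
proof -
  obtain M where M: "\<And>x. cmod (a x) \<le> M" using assms by (auto simp: bounded_measurable_def)
  have M0: "0 \<le> M" using M norm_ge_zero order_trans by blast
  show ?thesis
  proof (rule bounded_clinearI)
    show "wco a c v (f + g) = wco a c v f + wco a c v g" for f g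
      by (cases f; cases g)
        (simp add: L2_of_add wco_L2_of assms square_integrable_wco square_integrable_add distrib_left)
    show "wco a c v (k *\<^sub>C f) = k *\<^sub>C wco a c v f" for k f
      by (cases f)
        (simp add: scaleC_L2_of wco_L2_of assms square_integrable_wco square_integrable_scale mult.left_commute[of k])
    show "norm (wco a c v f) \<le> sqrt (M\<^sup>2 / \<bar>c\<bar> ^ CARD('d)) * norm f" for f
    proof (cases f)
      case (L2_of f0)
      have [measurable]: "a \<in> borel_measurable borel" "f0 \<in> borel_measurable borel"
        using assms L2_of by (auto simp: bounded_measurable_def square_integrable_def)
      have "\<bar>c\<bar> ^ CARD('d) * (norm (wco a c v f))\<^sup>2 \<le> M\<^sup>2 * (norm f)\<^sup>2"
        using wco_nn_integral[where a = a and M = M and f = f0 and v = v, OF _ M assms(2)] L2_of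
        by (simp add: wco_L2_of assms nn_integral_norm_L2_of square_integrable_wco ennreal_mult'[symmetric])
      then have "(norm (wco a c v f))\<^sup>2 \<le> M\<^sup>2 / \<bar>c\<bar> ^ CARD('d) * (norm f)\<^sup>2"
        using assms by (simp add: field_simps)
      also have "\<dots> = (sqrt (M\<^sup>2 / \<bar>c\<bar> ^ CARD('d)) * norm f)\<^sup>2"
        by (simp add: power_mult_distrib)
      finally show ?thesis by (rule power2_le_imp_le) simp
    qed
  qed
qed

lemma norm_wco_le:
  fixes a :: "real ^ 'd::finite \<Rightarrow> complex"
  assumes [measurable]: "a \<in> borel_measurable borel" and M: "\<And>x. cmod (a x) \<le> M"
  shows "norm (wco a 1 v f) \<le> M * norm f"
proof (cases f)
  case (L2_of f0)
  have M0: "0 \<le> M" using M norm_ge_zero order_trans by blast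
  have a: "bounded_measurable a" using assms by (auto simp: bounded_measurable_def)
  have [measurable]: "f0 \<in> borel_measurable borel"
    using L2_of by (auto simp: square_integrable_def)
  have "(norm (wco a 1 v f))\<^sup>2 \<le> M\<^sup>2 * (norm f)\<^sup>2"
    using wco_nn_integral[where a = a and M = M and c = 1 and f = f0
      and v = v, OF _ M] L2_of square_integrable_wco[OF a, of 1 f0 v] wco_L2_of[OF a, of 1 f0 v]
    by (simp add: nn_integral_norm_L2_of ennreal_mult'[symmetric])
  then have "(norm (wco a 1 v f))\<^sup>2 \<le> (M * norm f)\<^sup>2" by (simp add: power_mult_distrib)
  then show ?thesis by (rule power2_le_imp_le) (simp add: M0)
qed

lemma wco_wco:
  assumes "bounded_measurable a" "bounded_measurable b" "c \<noteq> 0" "c' \<noteq> 0"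
  shows "wco a c v (wco b c' v' f) = wco (\<lambda>x. a x * b (c *\<^sub>R x + v)) (c' * c) (c' *\<^sub>R v + v') f"
  by (cases f)
    (simp add: wco_L2_of assms square_integrable_wco bounded_measurable_mult bounded_measurable_affine
      scaleR_add_right add.assoc mult.assoc)

text \<open>Translation invariance of Lebesgue measure moves the shift from \<open>f\<close> to
  \<open>g\<close>.\<close>

lemma cinner_wco:
  fixes a :: "real ^ 'd::finite \<Rightarrow> complex"
  assumes a: "bounded_measurable a"
  shows "cinner g (wco a 1 v f) = cinner (wco (\<lambda>x. cnj (a (x - v))) 1 (- v) g) f"
proof (cases f; cases g)
  fix f0 g0 assume fg: "square_integrable f0" "f = L2_of f0" "square_integrable g0" "g = L2_of g0"
  have [measurable]: "a \<in> borel_measurable borel" "f0 \<in> borel_measurable borel" "g0 \<in> borel_measurable borel"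
    using fg a by (auto simp: square_integrable_def bounded_measurable_def)
  have a': "bounded_measurable (\<lambda>x. cnj (a (x - v)))"
    using bounded_measurable_cnj[OF bounded_measurable_affine[OF a, of 1 "- v"]] by simp
  have "cinner g (wco a 1 v f) = (LINT x|lborel. cnj (g0 x) * (a x * f0 (x + v)))"
    using fg wco_L2_of[OF a, of 1 f0 v] square_integrable_wco[OF a, of 1 f0 v] by (simp add: cinner_L2_of)
  also have "\<dots> = (LINT x|lborel. cnj (g0 (x - v)) * (a (x - v) * f0 x))"
  proof -
    have [measurable]: "(\<lambda>x. cnj (g0 x)) \<in> borel_measurable borel"
      by (rule borel_measurable_continuous_on[where f = cnj]) (auto intro: continuous_intros)
    show ?thesis
      using lborel_integral_affine[of "\<lambda>x. cnj (g0 x) * (a x * f0 (x + v))" 1 "- v"] by simp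
  qed
  also have "\<dots> = cinner (wco (\<lambda>x. cnj (a (x - v))) 1 (- v) g) f"
    using fg wco_L2_of[OF a', of 1 g0 "- v"] square_integrable_wco[OF a', of 1 g0 "- v"]
    by (simp add: cinner_L2_of mult_ac)
  finally show ?thesis .
qed

lemma wco_add:
  assumes "bounded_measurable a" "bounded_measurable b" "c \<noteq> 0"
  shows "wco a c v f + wco b c v f = wco (\<lambda>x. a x + b x) c v f"
  by (cases f) (simp add: wco_L2_of assms square_integrable_wco bounded_measurable_add L2_of_add distrib_right)

lemma wco_sum:
  assumes "\<And>i. i \<in> I \<Longrightarrow> bounded_measurable (a i)" "c \<noteq> 0"
  shows "(\<Sum>i\<in>I. wco (a i) c v f) = wco (\<lambda>x. \<Sum>i\<in>I. a i x) c v f"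
  using assms
proof (induction I rule: infinite_finite_induct)
  case (insert i I)
  then show ?case by (simp add: wco_add bounded_measurable_sum)
qed (simp_all add: wco_def)

section \<open>Completeness of the space of square-integrable functions\<close>

lemma power_square_commute: "(x ^ k)\<^sup>2 = (x\<^sup>2) ^ k" for x :: "'a::comm_monoid_mult"
  by (simp only: power_mult[symmetric] mult.commute)

text \<open>Riesz-Fischer. A subsequence with distances below \<open>(1 / 4) ^ k\<close> converges
  almost everywhere, and Fatou's lemma bounds the distance from its pointwise limit. A Cauchy
  sequence with a convergent subsequence converges.\<close>

lemma L2_Cauchy_convergent:
  fixes X :: "nat \<Rightarrow> ('d::finite) L2"
  assumes "Cauchy X"
  shows "convergent X"
proof -
  have "\<forall>k. \<exists>M. \<forall>m\<ge>M. \<forall>n\<ge>M. dist (X m) (X n) < (1 / 4) ^ k"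
    using assms by (auto simp: Cauchy_def)
  then obtain N where N: "\<And>k m n. m \<ge> N k \<Longrightarrow> n \<ge> N k \<Longrightarrow> dist (X m) (X n) < (1 / 4) ^ k"
    by metis
  \<comment> \<open>Summing the thresholds makes the chosen indices increasing while keeping each of
    them above its own \<open>N k\<close>.\<close>
  define r where "r k = (\<Sum>j\<le>k. N j)" for k
  have r: "N k \<le> r l" if "k \<le> l" for k l
    unfolding r_def using that by (intro member_le_sum) auto
  define f where "f k = rep_L2 (X (r k))" for k
  have f [measurable, simp]: "f k \<in> borel_measurable borel" for k
    by (simp add: f_def)
  have sq: "square_integrable (f k)" for k by (simp add: f_def)
  have int_diff: "(\<integral>\<^sup>+x. ennreal ((cmod (f m x - f k x))\<^sup>2) \<partial>lborel) \<le> ennreal ((1 / 16) ^ k)" if "k \<le> m" for k m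
  proof -
    have "(\<integral>\<^sup>+x. ennreal ((cmod (f m x - f k x))\<^sup>2) \<partial>lborel) = ennreal ((norm (L2_of (\<lambda>x. f m x - f k x)))\<^sup>2)"
      by (intro nn_integral_norm_L2_of square_integrable_diff sq)
    also have "L2_of (\<lambda>x. f m x - f k x) = X (r m) - X (r k)"
      by (simp add: L2_of_diff[symmetric] sq) (simp add: f_def)
    also have "(norm (X (r m) - X (r k)))\<^sup>2 \<le> ((1 / 4) ^ k)\<^sup>2"
      using N[OF r[OF that] r[OF order_refl]] by (intro power_mono) (auto simp: dist_norm)
    also have "((1 / 4) ^ k)\<^sup>2 = ((1 / 16) ^ k :: real)"
      unfolding power_square_commute by (simp add: power2_eq_square)
    finally show ?thesis by (simp add: ennreal_leI)
  qed
  \<comment> \<open>The factor \<open>4 ^ k\<close> leaves \<open>(1 / 4) ^ k\<close> of the bound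
    \<open>(1 / 16) ^ k\<close>, so the integral stays finite; pointwise, a finite sum forces
    increments of order \<open>(1 / 2) ^ k\<close>, which are summable.\<close>
  have "(\<integral>\<^sup>+x. (\<Sum>k. ennreal (4 ^ k * (cmod (f (Suc k) x - f k x))\<^sup>2)) \<partial>lborel) =
      (\<Sum>k. ennreal (4 ^ k) * (\<integral>\<^sup>+x. ennreal ((cmod (f (Suc k) x - f k x))\<^sup>2) \<partial>lborel))"
    by (subst nn_integral_suminf) (simp_all add: ennreal_mult nn_integral_cmult)
  also have "\<dots> \<le> (\<Sum>k. ennreal ((1 / 4) ^ k))"
  proof (intro suminf_le allI)
    fix k
    have "ennreal (4 ^ k) * (\<integral>\<^sup>+x. ennreal ((cmod (f (Suc k) x - f k x))\<^sup>2) \<partial>lborel) \<le>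
        ennreal (4 ^ k) * ennreal ((1 / 16) ^ k)"
      by (intro mult_left_mono int_diff) auto
    also have "\<dots> = ennreal ((4 * (1 / 16)) ^ k)"
      by (subst ennreal_mult[symmetric]) (simp_all only: power_mult_distrib, auto)
    also have "\<dots> = ennreal ((1 / 4) ^ k)"
      by simp
    finally show "ennreal (4 ^ k) * (\<integral>\<^sup>+x. ennreal ((cmod (f (Suc k) x - f k x))\<^sup>2) \<partial>lborel)
      \<le> ennreal ((1 / 4) ^ k)" .
  qed auto
  also have "\<dots> < \<infinity>"
  proof -
    have "(\<Sum>k. ennreal ((1 / 4) ^ k)) = ennreal (\<Sum>k. (1 / 4) ^ k)"
      by (intro suminf_ennreal2) (auto intro: summable_geometric)
    then show ?thesis by simp
  qed
  finally have "AE x in lborel. (\<Sum>k. ennreal (4 ^ k * (cmod (f (Suc k) x - f k x))\<^sup>2)) \<noteq> \<infinity>"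
    by (intro nn_integral_PInf_AE) auto
  then have conv: "AE x in lborel. convergent (\<lambda>k. f k x)"
  proof eventually_elim
    fix x assume fin: "(\<Sum>k. ennreal (4 ^ k * (cmod (f (Suc k) x - f k x))\<^sup>2)) \<noteq> \<infinity>"
    have "\<exists>S\<ge>0. y = ennreal S" if "y \<noteq> \<infinity>" for y
      using that by (cases y) auto
    from this[OF fin] obtain S where S: "0 \<le> S" "(\<Sum>k. ennreal (4 ^ k * (cmod (f (Suc k) x - f k x))\<^sup>2)) = ennreal S"
      by blast
    have four: "(2 ^ k)\<^sup>2 = (4 :: real) ^ k" for k
      unfolding power_square_commute by simp
    have bd: "norm (f (Suc k) x - f k x) \<le> sqrt S * (1 / 2) ^ k" for k
    proof -
      have "ennreal (4 ^ k * (cmod (f (Suc k) x - f k x))\<^sup>2) \<le> ennreal S"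
        using sum_le_suminf[of "\<lambda>k. ennreal (4 ^ k * (cmod (f (Suc k) x - f k x))\<^sup>2)" "{k}"]
        by (simp add: S)
      then have "(2 ^ k * cmod (f (Suc k) x - f k x))\<^sup>2 \<le> S"
        using S(1) by (simp add: power_mult_distrib four)
      then have "2 ^ k * cmod (f (Suc k) x - f k x) \<le> sqrt S"
        by (rule real_le_rsqrt)
      then show ?thesis by (simp add: power_divide pos_le_divide_eq mult.commute)
    qed
    have "summable (\<lambda>k. f (Suc k) x - f k x)"
      by (rule summable_comparison_test'[where g = "\<lambda>k. sqrt S * (1 / 2) ^ k" and N = 0, OF _ bd])
        (intro summable_mult summable_geometric, simp)
    then have "convergent (\<lambda>n. \<Sum>k<n. f (Suc k) x - f k x)"
      by (simp add: summable_iff_convergent)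
    then have "convergent (\<lambda>n. f n x - f 0 x)"
      by (simp only: sum_lessThan_telescope[of "\<lambda>k. f k x"])
    then show "convergent (\<lambda>k. f k x)"
      using convergent_add[OF _ convergent_const[of "f 0 x"]] by fastforce
  qed
  define g where "g x = lim (\<lambda>k. f k x)" for x
  have [measurable]: "g \<in> borel_measurable borel"
    unfolding g_def by (rule borel_measurable_lim_metric) simp
  \<comment> \<open>Fatou's lemma in \<open>m\<close> turns the Cauchy bounds into a bound for the
    pointwise limit.\<close>
  have g_diff: "(\<integral>\<^sup>+x. ennreal ((cmod (g x - f k x))\<^sup>2) \<partial>lborel) \<le> ennreal ((1 / 16) ^ k)" for k
  proof -
    have "(\<integral>\<^sup>+x. ennreal ((cmod (g x - f k x))\<^sup>2) \<partial>lborel) =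
        (\<integral>\<^sup>+x. liminf (\<lambda>m. ennreal ((cmod (f m x - f k x))\<^sup>2)) \<partial>lborel)"
    proof (rule nn_integral_cong_AE)
      show "AE x in lborel. ennreal ((cmod (g x - f k x))\<^sup>2) = liminf (\<lambda>m. ennreal ((cmod (f m x - f k x))\<^sup>2))"
        using conv
      proof eventually_elim
        fix x assume "convergent (\<lambda>k. f k x)"
        then have "(\<lambda>m. f m x) \<longlonglongrightarrow> g x" by (simp add: g_def convergent_LIMSEQ_iff)
        then have "(\<lambda>m. ennreal ((cmod (f m x - f k x))\<^sup>2)) \<longlonglongrightarrow> ennreal ((cmod (g x - f k x))\<^sup>2)"
          by (intro tendsto_intros)
        then show "ennreal ((cmod (g x - f k x))\<^sup>2) = liminf (\<lambda>m. ennreal ((cmod (f m x - f k x))\<^sup>2))"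
          by (rule lim_imp_Liminf[symmetric, rotated]) simp
      qed
    qed
    also have "\<dots> \<le> liminf (\<lambda>m. \<integral>\<^sup>+x. ennreal ((cmod (f m x - f k x))\<^sup>2) \<partial>lborel)"
      by (rule nn_integral_liminf) measurable
    also have "\<dots> \<le> ennreal ((1 / 16) ^ k)"
      by (rule Liminf_le) (auto intro!: eventually_sequentiallyI[of k] int_diff)
    finally show ?thesis .
  qed
  have sqd: "square_integrable (\<lambda>x. g x - f k x)" for k
    using g_diff[of k] by (auto simp: square_integrable_iff_nn order.strict_trans1)
  then have sqg: "square_integrable g"
    using square_integrable_add[OF sqd[of 0] sq[of 0]] by simp
  have near: "norm (L2_of g - X (r k)) \<le> (1 / 4) ^ k" for k
  proof -
    have "L2_of (\<lambda>x. g x - f k x) = L2_of g - X (r k)"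
      by (simp add: L2_of_diff[symmetric] sqg sq) (simp add: f_def)
    then have "ennreal ((norm (L2_of g - X (r k)))\<^sup>2) \<le> ennreal ((1 / 16) ^ k)"
      using g_diff[of k] nn_integral_norm_L2_of[OF sqd[of k]] by simp
    then have "(norm (L2_of g - X (r k)))\<^sup>2 \<le> ((1 / 4) ^ k)\<^sup>2"
      unfolding power_square_commute by (simp add: power2_eq_square)
    then show ?thesis by (rule power2_le_imp_le) simp
  qed
  have "X \<longlonglongrightarrow> L2_of g"
  proof (rule metric_LIMSEQ_I)
    fix e :: real assume "0 < e"
    then obtain k where k: "(1 / 4 :: real) ^ k < e / 2"
      using real_arch_pow_inv[of "e / 2" "1 / 4"] by auto
    have "dist (X n) (L2_of g) < e" if "n \<ge> N k" for n
      using N[OF that r[OF order_refl]] near[of k] k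
        dist_triangle[of "X n" "L2_of g" "X (r k)"] by (simp add: dist_norm norm_minus_commute)
    then show "\<exists>no. \<forall>n\<ge>no. dist (X n) (L2_of g) < e" by blast
  qed
  then show ?thesis by (rule convergentI)
qed

instance L2 :: (finite) banach
  by standard (rule L2_Cauchy_convergent)

section \<open>Fourier series on a cube\<close>

definition wave :: "real \<Rightarrow> int ^ 'd \<Rightarrow> real ^ 'd \<Rightarrow> complex" where
  "wave h n \<xi> = exp (- \<i> * complex_of_real (lattice_point h n \<bullet> \<xi>))"

text \<open>Not normalised: the common squared norm is (2 pi / h)^d. The waves are extended by zero,
  so that functions on the cube remain elements of \<open>'d L2\<close>.\<close>

definition ebasis :: "real \<Rightarrow> int ^ 'd \<Rightarrow> ('d::finite) L2" where
  "ebasis h n = L2_of (\<lambda>\<xi>. indicator (cube (pi / h)) \<xi> * wave h n \<xi>)"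

lemma lattice_point_add: "lattice_point h (m + n) = lattice_point h m + lattice_point h n"
  by (simp add: lattice_point_def vec_eq_iff distrib_left)

lemma lattice_point_minus: "lattice_point h (- n) = - lattice_point h n"
  by (simp add: lattice_point_def vec_eq_iff)

lemma lattice_point_zero [simp]: "lattice_point h 0 = 0"
  by (simp add: lattice_point_def vec_eq_iff)

lemma wave_zero [simp]: "wave h 0 x = 1"
  by (simp add: wave_def)

lemma wave_add: "wave h (m + n) x = wave h m x * wave h n x"
  by (simp add: wave_def lattice_point_add inner_add_left exp_add[symmetric] distrib_left)

lemma cnj_wave: "cnj (wave h n x) = wave h (- n) x"
  by (simp add: wave_def lattice_point_minus exp_cnj)

lemma cmod_wave [simp]: "cmod (wave h n x) = 1"
  by (simp add: wave_def)

lemma continuous_on_wave: "continuous_on A (wave h n)"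
  unfolding wave_def by (intro continuous_intros)

lemma borel_measurable_wave [measurable, simp]: "wave h n \<in> borel_measurable borel"
  by (intro borel_measurable_continuous_onI continuous_on_wave)

lemma bounded_measurable_wave [simp]: "bounded_measurable (wave h n)"
  by (rule bounded_measurableI[where M = 1]) auto

lemma mem_cube: "x \<in> cube r \<longleftrightarrow> (\<forall>i. - r \<le> x $ i \<and> x $ i \<le> r)"
  by (simp add: cube_def mem_box_cart)

lemma cube_borel [measurable, simp]: "cube r \<in> sets borel"
  by (simp add: cube_def)

lemma bounded_measurable_indicator [simp]: "A \<in> sets borel \<Longrightarrow> bounded_measurable (indicator A)"
  by (rule bounded_measurableI[where M = 1]) (auto simp: indicator_def)

lemma square_integrable_indicator:
  "bounded A \<Longrightarrow> A \<in> sets borel \<Longrightarrow> square_integrable (indicator A :: real ^ 'd::finite \<Rightarrow> complex)"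
proof -
  assume A: "bounded A" "A \<in> sets borel"
  have "ennreal ((cmod (indicator A x))\<^sup>2) = indicator A x" for x :: "real ^ 'd"
    by (simp add: indicator_def)
  then have "(\<integral>\<^sup>+x. ennreal ((cmod (indicator A x))\<^sup>2) \<partial>(lborel :: (real ^ 'd) measure)) = emeasure lborel A"
    using A(2) by simp
  then show ?thesis
    using A emeasure_bounded_finite[OF A(1)] by (simp add: square_integrable_iff_nn)
qed

lemma bounded_cube: "bounded (cube r)"
  by (simp add: cube_def)

lemma square_integrable_cube_wave: "square_integrable (\<lambda>\<xi>. indicator (cube r) \<xi> * wave h n \<xi>)"
  using square_integrable_mult[OF bounded_measurable_wave square_integrable_indicator[OF bounded_cube]]
  by (simp add: mult.commute)

text \<open>Lebesgue measure on the vectors is a product measure indexed by the basis vectors,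
  whereas the factors here are indexed by coordinates; the bijection between the two reduces the
  claim to Fubini for finite products.\<close>

lemma lborel_integral_vec_prod:
  fixes f :: "'d::finite \<Rightarrow> real \<Rightarrow> complex"
  assumes int: "\<And>i. integrable lborel (f i)"
  shows "(LINT x|(lborel :: (real ^ 'd) measure). (\<Prod>i\<in>UNIV. f i (x $ i))) = (\<Prod>i\<in>UNIV. LINT t|lborel. f i t)"
proof -
  interpret product_sigma_finite "\<lambda>b :: real ^ 'd. lborel :: real measure"
    by (rule product_sigma_finite.intro) (rule lborel.sigma_finite_measure_axioms)
  define g where "g b = f (inv (\<lambda>i. axis i 1) b)" for b :: "real ^ 'd"
  have inj: "inj (\<lambda>i::'d. axis i (1::real))"
    by (auto simp: inj_on_def axis_eq_axis)
  have g: "g (axis i 1) = f i" for i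
    by (simp add: g_def inv_f_f[OF inj])
  have Basis: "(Basis :: (real ^ 'd) set) = (\<lambda>i. axis i 1) ` UNIV"
    by (auto simp: Basis_vec_def)
  have prod: "(\<Prod>i\<in>UNIV. F (axis i 1)) = (\<Prod>b\<in>Basis. F b)" for F :: "real ^ 'd \<Rightarrow> complex"
    unfolding Basis by (simp add: prod.reindex[OF inj] o_def)
  have int': "integrable lborel (g b)" for b
    unfolding g_def by (rule int)
  have meas [measurable]: "g b \<in> borel_measurable borel" for b
    using borel_measurable_integrable[OF int'] by simp
  have "(LINT x|(lborel :: (real ^ 'd) measure). (\<Prod>i\<in>UNIV. f i (x $ i))) =
      (LINT x|(lborel :: (real ^ 'd) measure). (\<Prod>b\<in>Basis. g b (x \<bullet> b)))"
    by (simp add: prod[symmetric] g inner_axis)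
  also have "\<dots> = (LINT \<phi>|(\<Pi>\<^sub>M b\<in>(Basis :: (real ^ 'd) set). lborel). (\<Prod>b\<in>Basis. g b ((\<Sum>b'\<in>Basis. \<phi> b' *\<^sub>R b') \<bullet> b)))"
    by (subst lborel_eq, subst integral_distr) auto
  also have "\<dots> = (LINT \<phi>|(\<Pi>\<^sub>M b\<in>(Basis :: (real ^ 'd) set). lborel). (\<Prod>b\<in>Basis. g b (\<phi> b)))"
    by (intro Bochner_Integration.integral_cong prod.cong refl)
      (simp add: inner_sum_left_Basis)
  also have "\<dots> = (\<Prod>b\<in>(Basis :: (real ^ 'd) set). integral\<^sup>L lborel (g b))"
    by (rule product_integral_prod) (auto intro: int')
  also have "\<dots> = (\<Prod>i\<in>UNIV. LINT t|lborel. f i t)"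
    by (simp add: prod[symmetric] g)
  finally show ?thesis .
qed

lemma integral_exp_period:
  fixes k :: int
  assumes h: "h > 0"
  shows "has_bochner_integral lborel (\<lambda>t. indicator {- (pi / h)..pi / h} t *\<^sub>R exp (- \<i> * complex_of_real (h * k
    * t)))
    (if k = 0 then complex_of_real (2 * pi / h) else 0)"
proof (cases "k = 0")
  case True
  have "has_bochner_integral lborel (\<lambda>t. indicator {- (pi / h)..pi / h} t *\<^sub>R (1 :: complex))
      (complex_of_real (pi / h) - complex_of_real (- (pi / h)))"
    using h by (intro has_bochner_integral_FTC_Icc[where F = complex_of_real])
      (auto intro!: derivative_eq_intros continuous_intros has_vector_derivative_of_real)
  then show ?thesis using True by simp
next
  case False
  define c where "c = - \<i> * complex_of_real (h * k)"
  have c: "c \<noteq> 0" using h False by (simp add: c_def)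
  define F where "F t = exp (c * complex_of_real t) / c" for t :: real
  have deriv: "(F has_vector_derivative exp (c * complex_of_real t)) (at t within A)" for t A
  proof -
    have "((\<lambda>z. exp (c * z) / c) has_field_derivative exp (c * complex_of_real t)) (at (complex_of_real t))"
      using c by (auto intro!: derivative_eq_intros)
    from has_vector_derivative_real_field[OF this, of A] show ?thesis by (simp add: F_def[abs_def])
  qed
  have "has_bochner_integral lborel (\<lambda>t. indicator {- (pi / h)..pi / h} t *\<^sub>R exp (c * complex_of_real t))
      (F (pi / h) - F (- (pi / h)))"
    using h by (intro has_bochner_integral_FTC_Icc deriv) (auto intro!: continuous_intros)
  moreover have "F (pi / h) = F (- (pi / h))"
  proof -
    \<comment> \<open>The exponents at the two endpoints differ by an integer multiple of 2 pi i, so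
      the antiderivative takes equal values there.\<close>
    have "c * complex_of_real (pi / h) = c * complex_of_real (- (pi / h)) + \<i> * (of_int (- k) * (of_real pi * 2))"
      using h by (simp add: c_def field_simps)
    then have "exp (c * complex_of_real (pi / h)) = exp (c * complex_of_real (- (pi / h)))"
      by (auto simp: exp_eq intro!: exI[of _ "- k"])
    then show ?thesis by (simp add: F_def)
  qed
  ultimately show ?thesis using False by (simp add: c_def mult.assoc)
qed

lemma wave_prod: "wave h n x = (\<Prod>i\<in>UNIV. exp (- \<i> * complex_of_real (h * (n $ i) * (x $ i))))"
  by (simp add: wave_def inner_vec_def lattice_point_def sum_distrib_left flip: exp_sum sum_negf)

lemma cinner_ebasis:
  fixes m n :: "int ^ 'd::finite"
  assumes h: "h > 0"
  shows "cinner (ebasis h m) (ebasis h n) = (if m = n then complex_of_real ((2 * pi / h) ^ CARD('d)) else 0)"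
proof -
  have "cinner (ebasis h m) (ebasis h n) =
      (LINT x|lborel. cnj (indicator (cube (pi / h)) x * wave h m x) * (indicator (cube (pi / h)) x * wave h n x))"
    unfolding ebasis_def by (intro cinner_L2_of square_integrable_cube_wave)
  also have "\<dots> = (LINT x|(lborel :: (real ^ 'd) measure). (\<Prod>i\<in>UNIV. indicator {- (pi / h)..pi / h} (x $ i) *\<^sub>R
      exp (- \<i> * complex_of_real (h * real_of_int ((n - m) $ i) * (x $ i)))))"
  proof (intro Bochner_Integration.integral_cong refl)
    fix x :: "real ^ 'd"
    have "cnj (indicator (cube (pi / h)) x * wave h m x) * (indicator (cube (pi / h)) x * wave h n x) =
        indicator (cube (pi / h)) x * wave h (n + - m) x"
      using wave_add[of h n "- m" x] by (simp add: cnj_wave indicator_def mult.commute)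
    also have "\<dots> = (\<Prod>i\<in>UNIV. indicator {- (pi / h)..pi / h} (x $ i) *\<^sub>R
      exp (- \<i> * complex_of_real (h * real_of_int ((n - m) $ i) * (x $ i))))"
    proof (cases "x \<in> cube (pi / h)")
      case True
      then show ?thesis by (simp add: wave_prod mem_cube)
    next
      case False
      then obtain i where "\<not> (- (pi / h) \<le> x $ i \<and> x $ i \<le> pi / h)" by (auto simp: mem_cube)
      then have "indicator {- (pi / h)..pi / h} (x $ i) = (0 :: real)" by auto
      then have "(\<Prod>i\<in>UNIV. indicator {- (pi / h)..pi / h} (x $ i) *\<^sub>R
        exp (- \<i> * complex_of_real (h * real_of_int ((n - m) $ i) * (x $ i)))) = 0"
        by (intro prod_zero) (auto simp del: indicator_simps intro!: bexI[of _ i])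
      with False show ?thesis by simp
    qed
    finally show "cnj (indicator (cube (pi / h)) x * wave h m x) * (indicator (cube (pi / h)) x * wave h n x) =
      (\<Prod>i\<in>UNIV. indicator {- (pi / h)..pi / h} (x $ i) *\<^sub>R
      exp (- \<i> * complex_of_real (h * real_of_int ((n - m) $ i) * (x $ i))))" .
  qed
  also have "\<dots> = (\<Prod>i\<in>UNIV. if (n - m) $ i = 0 then complex_of_real (2 * pi / h) else 0)"
    using integral_exp_period[OF h]
    by (subst lborel_integral_vec_prod) (auto simp: has_bochner_integral_iff simp del: vector_minus_component intro!:
      prod.cong)
  also have "\<dots> = (if m = n then complex_of_real ((2 * pi / h) ^ CARD('d)) else 0)"
  proof (cases "m = n")
    case False
    then obtain i where "m $ i \<noteq> n $ i" by (auto simp: vec_eq_iff)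
    then have "(\<Prod>i\<in>UNIV. if (n - m) $ i = 0 then complex_of_real (2 * pi / h) else 0) = 0"
      by (intro prod_zero) (auto intro!: bexI[of _ i])
    with False show ?thesis by simp
  qed simp
  finally show ?thesis .
qed

section \<open>Completeness of the waves\<close>

definition wave_orthogonal :: "real \<Rightarrow> (real ^ 'd::finite \<Rightarrow> complex) \<Rightarrow> bool" where
  "wave_orthogonal h w \<longleftrightarrow> integrable lborel w \<and> (\<forall>n. (LINT x|lborel. w x * wave h n x) = 0)"

lemma integrable_mult_bounded:
  fixes w :: "real ^ 'd::finite \<Rightarrow> complex"
  assumes "integrable lborel w" "bounded_measurable a"
  shows "integrable lborel (\<lambda>x. w x * a x)"
proof -
  obtain M where M: "\<And>x. cmod (a x) \<le> M" using assms by (auto simp: bounded_measurable_def)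
  have [measurable]: "w \<in> borel_measurable borel" "a \<in> borel_measurable borel"
    using assms(1) bounded_measurable_borel[OF assms(2)] by auto
  show ?thesis
  proof (rule Bochner_Integration.integrable_bound)
    show "integrable lborel (\<lambda>x. M * norm (w x))" using assms(1) by auto
    show "AE x in lborel. norm (w x * a x) \<le> norm (M * norm (w x))"
    proof (rule AE_I2)
      fix x
      have "cmod (w x) * cmod (a x) \<le> cmod (w x) * M" by (intro mult_left_mono M) simp
      also have "\<dots> \<le> norm (M * norm (w x))" by (simp add: mult.commute)
      finally show "norm (w x * a x) \<le> norm (M * norm (w x))" by (simp add: norm_mult)
    qed
  qed simp
qed

lemma wave_orthogonal_add:
  assumes "wave_orthogonal h v" "wave_orthogonal h w"
  shows "wave_orthogonal h (\<lambda>x. v x + w x)"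
  using assms
  by (auto simp: wave_orthogonal_def distrib_right integrable_mult_bounded Bochner_Integration.integral_add)

lemma wave_orthogonal_cmult: "wave_orthogonal h w \<Longrightarrow> wave_orthogonal h (\<lambda>x. w x * c)"
  by (auto simp: wave_orthogonal_def mult.assoc mult.commute[of c]) (simp add: mult.assoc[symmetric])

lemma wave_orthogonal_wave:
  assumes "wave_orthogonal h w" shows "wave_orthogonal h (\<lambda>x. w x * wave h n x)"
  using assms unfolding wave_orthogonal_def
  by (auto simp: integrable_mult_bounded mult.assoc wave_add[symmetric])

lemma wave_orthogonal_sum:
  assumes "\<And>i. i \<in> I \<Longrightarrow> wave_orthogonal h (w i)"
  shows "wave_orthogonal h (\<lambda>x. \<Sum>i\<in>I. w i x)"
  using assms
proof (induction I rule: infinite_finite_induct)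
  case (insert i I)
  then show ?case by (simp add: wave_orthogonal_add)
qed (simp_all add: wave_orthogonal_def)

text \<open>The waves are monomials in these coordinates and their conjugates, and the image lies in
  a compact torus. Multiplication by a wave preserves \<open>wave_orthogonal\<close>, hence so does
  multiplication by any polynomial in the coordinates.\<close>

definition torus_map :: "real \<Rightarrow> real ^ 'd \<Rightarrow> complex ^ 'd" where
  "torus_map h x = (\<chi> i. cis (h * x $ i))"

lemma wave_axis: "wave h (axis i k) x = cis (- (h * k * x $ i))"
proof -
  have "lattice_point h (axis i k) \<bullet> x = h * k * x $ i"
    by (simp add: lattice_point_def inner_vec_def axis_def if_distrib[of real_of_int] if_distrib[of "\<lambda>t. h * t"]
      if_distrib[of "\<lambda>t. t * _"] cong: if_cong)
  then show ?thesis by (simp add: wave_def cis_conv_exp)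
qed

text \<open>Euler's formula writes each coordinate of the torus map with the two waves of frequency
  \<open>1\<close> and \<open>- 1\<close> along one axis. The induction leaves \<open>w\<close>
  free, so a product is absorbed one factor at a time.\<close>

lemma wave_orthogonal_polynomial:
  fixes p :: "complex ^ 'd::finite \<Rightarrow> real"
  assumes "real_polynomial_function p" "wave_orthogonal h w"
  shows "wave_orthogonal h (\<lambda>x. w x * complex_of_real (p (torus_map h x)))"
  using assms
proof (induction p arbitrary: w rule: real_polynomial_function.induct)
  case (linear l)
  interpret l: bounded_linear l by fact
  have "w x * complex_of_real (l (torus_map h x)) =
      (\<Sum>i\<in>UNIV. w x * wave h (axis i (- 1)) x * ((complex_of_real (l (axis i 1)) - \<i> * complex_of_real (l (axis i \<i>)))
        / 2)
        + w x * wave h (axis i 1) x * ((complex_of_real (l (axis i 1)) + \<i> * complex_of_real (l (axis i \<i>))) /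
          2))" for x
  proof -
    have "torus_map h x = (\<Sum>i\<in>UNIV. cos (h * x $ i) *\<^sub>R axis i 1 + sin (h * x $ i) *\<^sub>R axis i \<i>)"
      by (simp add: vec_eq_iff torus_map_def axis_def sum.distrib if_distrib[of "\<lambda>t. _ *\<^sub>R t"] complex_eq_iff cong:
        if_cong)
    then have "l (torus_map h x) = (\<Sum>i\<in>UNIV. cos (h * x $ i) * l (axis i 1) + sin (h * x $ i) * l (axis i \<i>))"
      by (simp add: l.sum l.add l.scale)
    then have *: "w x * complex_of_real (l (torus_map h x)) =
        (\<Sum>i\<in>UNIV. w x * (complex_of_real (cos (h * x $ i) * l (axis i 1) + sin (h * x $ i) * l (axis i \<i>))))"
      by (simp add: sum_distrib_left)
    have c: "complex_of_real (cos t) * A + complex_of_real (sin t) * B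
      = cis (- (- t)) * ((A - \<i> * B) / 2) + cis (- t) * ((A + \<i> * B) / 2)" for t A B
      by (simp add: cis_conv_exp complex_eq_iff Re_exp Im_exp field_simps)
    have "w x * (complex_of_real (cos (h * x $ i) * l (axis i 1) + sin (h * x $ i) * l (axis i \<i>))) =
       w x * wave h (axis i (- 1)) x * ((complex_of_real (l (axis i 1)) - \<i> * complex_of_real (l (axis i \<i>))) / 2)
        + w x * wave h (axis i 1) x * ((complex_of_real (l (axis i 1)) + \<i> * complex_of_real (l (axis i \<i>))) /
          2)" for i
      using c[of "h * x $ i" "complex_of_real (l (axis i 1))" "complex_of_real (l (axis i \<i>))"]
      by (simp only: wave_axis mult.assoc distrib_left[symmetric] of_real_add of_real_mult of_int_1 of_int_minus
        mult_1_left mult_1_right mult_minus_left mult_minus_right)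
    with * show ?thesis by simp
  qed
  then show ?case
    using linear(2) by (simp only:) (intro wave_orthogonal_sum wave_orthogonal_add wave_orthogonal_cmult
      wave_orthogonal_wave)
next
  case (const c)
  then show ?case by (rule wave_orthogonal_cmult)
next
  case (add f g)
  then show ?case by (simp add: distrib_left wave_orthogonal_add)
next
  case (mult f g)
  from mult.IH(2)[OF mult.IH(1)[OF mult.prems]] show ?case by (simp add: mult.assoc)
qed

lemma borel_measurable_torus_map [measurable]: "torus_map h \<in> borel_measurable borel"
  unfolding torus_map_def cis_conv_exp
  by (intro borel_measurable_continuous_onI continuous_on_vec_lambda continuous_intros)

lemma compact_torus: "compact {z :: complex ^ 'd::finite. \<forall>i. cmod (z $ i) = 1}"
proof -
  have "bounded {z :: complex ^ 'd. \<forall>i. cmod (z $ i) = 1}"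
  proof (rule boundedI)
    fix z :: "complex ^ 'd" assume "z \<in> {z. \<forall>i. cmod (z $ i) = 1}"
    then show "norm z \<le> (\<Sum>i\<in>(UNIV :: 'd set). 1)"
      using L2_set_le_sum[of UNIV "\<lambda>i. cmod (z $ i)"] by (simp add: norm_vec_def)
  qed
  moreover have "closed {z :: complex ^ 'd. \<forall>i. cmod (z $ i) = 1}"
    by (intro closed_Collect_all closed_Collect_eq continuous_intros)
  ultimately show ?thesis by (simp add: compact_eq_bounded_closed)
qed

lemma torus_map_in: "torus_map h x \<in> {z. \<forall>i. cmod (z $ i) = 1}"
  by (simp add: torus_map_def)

text \<open>By Stone-Weierstrass on the compact torus, \<open>g\<close> is uniformly close to a
  polynomial, whose integral against \<open>w\<close> vanishes; the error is at most the uniform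
  distance times the L1 norm of \<open>w\<close>.\<close>

lemma wave_orthogonal_continuous:
  fixes g :: "complex ^ 'd::finite \<Rightarrow> real"
  assumes w: "wave_orthogonal h w" and g: "continuous_on UNIV g"
  shows "(LINT x|lborel. w x * complex_of_real (g (torus_map h x))) = 0"
proof (rule ccontr)
  let ?T = "{z :: complex ^ 'd. \<forall>i. cmod (z $ i) = 1}"
  let ?I = "LINT x|lborel. w x * complex_of_real (g (torus_map h x))"
  let ?W = "LINT x|lborel. norm (w x)"
  assume nz: "?I \<noteq> 0"
  have wint: "integrable lborel w" using w by (simp add: wave_orthogonal_def)
  have W0: "0 \<le> ?W" by simp
  \<comment> \<open>Small enough that the error \<open>?W * e\<close> is at most half the norm of
    the integral; adding 1 covers \<open>?W = 0\<close>.\<close>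
  define e where "e = norm ?I / (2 * (?W + 1))"
  have "0 < ?W + 1" using W0 by (rule add_nonneg_pos) simp
  then have e: "e > 0" using nz unfolding e_def by (intro divide_pos_pos mult_pos_pos) simp_all
  have gT: "continuous_on ?T g" using g continuous_on_subset by blast
  obtain p where p: "real_polynomial_function p" "\<And>z. z \<in> ?T \<Longrightarrow> \<bar>g z - p z\<bar> < e"
    using Stone_Weierstrass_real_polynomial_function[OF compact_torus gT e] by blast
  have [measurable]: "g \<in> borel_measurable borel" by (intro borel_measurable_continuous_onI g)
  have "bounded (g ` ?T)"
    by (intro compact_imp_bounded compact_continuous_image gT compact_torus)
  then obtain B where B: "\<And>z. z \<in> ?T \<Longrightarrow> \<bar>g z\<bar> \<le> B" by (auto simp: bounded_iff)
  have int_g: "integrable lborel (\<lambda>x. w x * complex_of_real (g (torus_map h x)))"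
    by (intro integrable_mult_bounded wint bounded_measurableI[where M = B]) (use B torus_map_in[of h] in auto)
  have wp: "wave_orthogonal h (\<lambda>x. w x * complex_of_real (p (torus_map h x)))"
    by (rule wave_orthogonal_polynomial[OF p(1) w])
  then have int_p: "integrable lborel (\<lambda>x. w x * complex_of_real (p (torus_map h x)))"
    and "(LINT x|lborel. w x * complex_of_real (p (torus_map h x)) * wave h 0 x) = 0"
    unfolding wave_orthogonal_def by blast+
  then have "(LINT x|lborel. w x * complex_of_real (p (torus_map h x))) = 0" by simp
  then have "?I = (LINT x|lborel. w x * complex_of_real (g (torus_map h x)) - w x
    * complex_of_real (p (torus_map h x)))"
    by (simp add: Bochner_Integration.integral_diff[OF int_g int_p])
  also have "norm \<dots> \<le> (LINT x|lborel. norm (w x) * e)"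
  proof (rule order_trans[OF Bochner_Integration.integral_norm_bound], rule Bochner_Integration.integral_mono)
    show "integrable lborel (\<lambda>x. norm (w x * complex_of_real (g (torus_map h x)) - w x
      * complex_of_real (p (torus_map h x))))"
      using int_g int_p by auto
    show "integrable lborel (\<lambda>x. norm (w x) * e)" using wint by auto
    fix x
    have "norm (w x * complex_of_real (g (torus_map h x)) - w x * complex_of_real (p (torus_map h x))) =
        norm (w x) * \<bar>g (torus_map h x) - p (torus_map h x)\<bar>"
      by (simp add: right_diff_distrib[symmetric] norm_mult del: of_real_diff flip: of_real_diff)
    also have "\<dots> \<le> norm (w x) * e"
      using p(2)[OF torus_map_in, of h x] by (intro mult_left_mono) auto
    finally show "norm (w x * complex_of_real (g (torus_map h x)) - w x * complex_of_real (p (torus_map h x)))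
      \<le> norm (w x) * e" .
  qed
  also have "\<dots> = ?W * e" by simp
  also have "\<dots> < norm ?I"
  proof -
    have "?W * e \<le> (?W + 1) * e" using e by simp
    also have "(?W + 1) * e = norm ?I / 2"
    proof -
      have "a * (b / (2 * a)) = b / 2" if "0 < a" for a b :: real using that by simp
      from this[OF \<open>0 < ?W + 1\<close>] show ?thesis unfolding e_def .
    qed
    also have "\<dots> < norm ?I" using nz by simp
    finally show ?thesis .
  qed
  finally show False by simp
qed

text \<open>The indicator of a closed nonempty set is the pointwise limit of the continuous
  functions \<open>max 0 (1 - m * infdist z C)\<close>, all bounded by 1, so dominated convergence
  with majorant |w| passes to the limit.\<close>

lemma wave_orthogonal_closed:
  fixes C :: "(complex ^ 'd::finite) set"
  assumes w: "wave_orthogonal h w" and C: "closed C"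
  shows "(LINT x:torus_map h -` C|lborel. w x) = 0"
proof (cases "C = {}")
  case False
  have wint: "integrable lborel w" using w by (simp add: wave_orthogonal_def)
  have [measurable]: "w \<in> borel_measurable borel" using borel_measurable_integrable[OF wint] by simp
  have [measurable]: "C \<in> sets borel" using C by simp
  define g where "g m z = max 0 (1 - real m * infdist z C)" for m z
  have cont: "continuous_on UNIV (g m)" for m
    unfolding g_def by (intro continuous_intros)
  have [measurable]: "g m \<in> borel_measurable borel" for m by (intro borel_measurable_continuous_onI cont)
  have lim: "(\<lambda>m. g m z) \<longlonglongrightarrow> indicator C z" for z
  proof (cases "z \<in> C")
    case True then show ?thesis by (simp add: g_def)
  next
    case z: False
    then have pos: "infdist z C > 0"
      using C False in_closed_iff_infdist_zero[of C z] infdist_nonneg[of z C] by linarith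
    obtain M :: nat where M: "1 / infdist z C < real M" using reals_Archimedean2 by blast
    have "g m z = 0" if "m \<ge> M" for m
    proof -
      have "1 < real M * infdist z C" using M pos by (simp add: field_simps)
      also have "\<dots> \<le> real m * infdist z C" using that pos by simp
      finally show ?thesis by (simp add: g_def)
    qed
    then have "eventually (\<lambda>m. g m z = 0) sequentially" by (auto intro: eventually_sequentiallyI)
    then show ?thesis using z by (simp add: tendsto_eventually)
  qed
  have "(\<lambda>m. LINT x|lborel. w x * complex_of_real (g m (torus_map h x))) \<longlonglongrightarrow>
      (LINT x|lborel. w x * complex_of_real (indicator C (torus_map h x)))"
  proof (rule integral_dominated_convergence[where w = "\<lambda>x. norm (w x)"])
    show "AE x in lborel. (\<lambda>m. w x * complex_of_real (g m (torus_map h x))) \<longlonglongrightarrow>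
        w x * complex_of_real (indicator C (torus_map h x))"
      by (intro AE_I2 tendsto_intros lim)
    have "\<bar>g m z\<bar> \<le> 1" for m z by (simp add: g_def infdist_nonneg)
    then show "AE x in lborel. norm (w x * complex_of_real (g m (torus_map h x))) \<le> norm (w x)" for m
      by (intro AE_I2) (simp add: norm_mult mult_left_le)
  qed (use wint in auto)
  then have "(LINT x|lborel. w x * complex_of_real (indicator C (torus_map h x))) = 0"
    by (simp add: wave_orthogonal_continuous[OF w cont] LIMSEQ_const_iff)
  moreover have "w x * complex_of_real (indicator C (torus_map h x)) = indicator (torus_map h -` C) x *\<^sub>R w x" for x
    by (simp add: indicator_def)
  ultimately show ?thesis by (simp add: set_lebesgue_integral_def)
qed (simp add: set_lebesgue_integral_def)

text \<open>Closed sets form an intersection-stable generator of the Borel sets. The sets with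
  vanishing integral are closed under complements, because the whole space is one of them, and under
  countable disjoint unions.\<close>

lemma wave_orthogonal_borel:
  fixes B :: "(complex ^ 'd::finite) set"
  assumes w: "wave_orthogonal h w" and B: "B \<in> sets borel"
  shows "(LINT x:torus_map h -` B|lborel. w x) = 0"
proof -
  have wint: "integrable lborel w" using w by (simp add: wave_orthogonal_def)
  have meas: "torus_map h -` A \<in> sets borel" if "A \<in> sets borel" for A :: "(complex ^ 'd) set"
    using measurable_sets_borel[OF borel_measurable_torus_map that] by simp
  have si: "set_integrable lborel (torus_map h -` A) w" if "A \<in> sets borel" for A :: "(complex ^ 'd) set"
    unfolding set_integrable_def by (intro integrable_mult_indicator wint) (use meas[OF that] in auto)
  have eq: "sets (borel :: (complex ^ 'd) measure) = sigma_sets UNIV (Collect closed)"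
    unfolding borel_eq_closed by simp
  have "Int_stable (Collect closed :: (complex ^ 'd) set set)"
    by (auto simp: Int_stable_def)
  moreover have "Collect closed \<subseteq> Pow (UNIV :: (complex ^ 'd) set)" by auto
  moreover have "B \<in> sigma_sets UNIV (Collect closed)" using B eq by simp
  ultimately show ?thesis
  proof (induction rule: sigma_sets_induct_disjoint)
    case (basic A)
    then show ?case using wave_orthogonal_closed[OF w] by simp
  next
    case empty
    then show ?case by (simp add: set_lebesgue_integral_def)
  next
    case (compl A)
    then have A: "A \<in> sets borel" "UNIV - A \<in> sets borel" using eq by auto
    have "(LINT x:torus_map h -` A \<union> torus_map h -` (UNIV - A)|lborel. w x) =
        (LINT x:torus_map h -` A|lborel. w x) + (LINT x:torus_map h -` (UNIV - A)|lborel. w x)"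
      by (rule set_integral_Un) (use A in \<open>auto intro: si\<close>)
    moreover have "torus_map h -` A \<union> torus_map h -` (UNIV - A) = torus_map h -` UNIV" by auto
    ultimately show ?case using compl wave_orthogonal_closed[OF w closed_UNIV] by simp
  next
    case (union A)
    then have A: "A i \<in> sets borel" for i using eq by auto
    then have A2: "(\<Union>i. A i) \<in> sets borel" by blast
    have "(LINT x:(\<Union>i. torus_map h -` A i)|lborel. w x) = (\<Sum>i. (LINT x:torus_map h -` A i|lborel. w x))"
    proof (rule lebesgue_integral_countable_add)
      show "torus_map h -` A i \<in> sets lborel" for i using meas A by simp
      show "torus_map h -` A i \<inter> torus_map h -` A j = {}" if "i \<noteq> j" for i j
        using union(1) that by (auto simp: disjoint_family_on_def)
      show "set_integrable lborel (\<Union>i. torus_map h -` A i) w"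
        using si[OF A2] by (simp add: vimage_UN)
    qed
    then show ?case using union by (simp add: vimage_UN)
  qed
qed

lemma AE_interior_cube:
  "AE x in (lborel :: (real ^ 'd::finite) measure). \<forall>i. x $ i \<noteq> r"
proof -
  have "AE x in (lborel :: (real ^ 'd) measure). x $ i \<noteq> r" for i
    using AE_lborel_inner_neq[of "axis i 1 :: real ^ 'd" r] by (simp add: inner_axis)
  then show ?thesis by (simp add: AE_all_countable)
qed

text \<open>The torus map is injective on the open cube, with a Borel left inverse
  \<open>\<rho>\<close>. Up to the null boundary, every Borel set therefore agrees on the cube with
  the preimage of a Borel set under the torus map, and the integral of \<open>w\<close> over it
  vanishes.\<close>

lemma wave_complete:
  fixes w :: "real ^ 'd::finite \<Rightarrow> complex"
  assumes w: "wave_orthogonal h w" and h: "h > 0" and supp: "\<And>x. x \<notin> cube (pi / h) \<Longrightarrow> w x = 0"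
  shows "AE x in lborel. w x = 0"
proof (rule sigma_finite_measure.density_zero[OF lborel.sigma_finite_measure_axioms])
  show wint: "integrable lborel w" using w by (simp add: wave_orthogonal_def)
  fix A :: "(real ^ 'd) set" assume "A \<in> sets lborel"
  then have A: "A \<in> sets borel" by simp
  \<comment> \<open>The half-angle formula tan (t / 2) = sin t / (1 + cos t) recovers t from the
    point on the circle for |t| < pi. Being built from \<open>arctan\<close>, the inverse is
    measurable without a discussion of branches.\<close>
  define \<rho> where "\<rho> z = (\<chi> i. 2 * arctan (Im (z $ i) / (1 + Re (z $ i))) / h)" for z :: "complex ^ 'd"
  have meas: "\<rho> \<in> borel_measurable borel"
  proof (subst borel_measurable_euclidean_space, rule)
    fix b :: "real ^ 'd" assume "b \<in> Basis"
    then obtain i where b: "b = axis i 1" by (auto simp: Basis_vec_def)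
    have [measurable]: "(\<lambda>z::complex ^ 'd. Re (z $ i)) \<in> borel_measurable borel" "(\<lambda>z::complex ^ 'd. Im (z $ i))
      \<in> borel_measurable borel"
      "arctan \<in> borel_measurable borel"
      by (intro borel_measurable_continuous_onI continuous_intros)+
    show "(\<lambda>z. \<rho> z \<bullet> b) \<in> borel_measurable borel"
      by (simp add: b inner_axis \<rho>_def)
  qed
  have inv: "\<rho> (torus_map h x) = x" if x: "\<forall>i. - (pi / h) < x $ i \<and> x $ i < pi / h" for x
  proof -
    have "2 * arctan (sin (h * x $ i) / (1 + cos (h * x $ i))) / h = x $ i" for i
    proof -
      have "- (pi / 2) < h * x $ i / 2" "h * x $ i / 2 < pi / 2"
        using x[rule_format, of i] h by (auto simp: field_simps)
      then have "arctan (tan (h * x $ i / 2)) = h * x $ i / 2" by (intro arctan_tan) auto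
      moreover have "tan (h * x $ i / 2) = sin (h * x $ i) / (1 + cos (h * x $ i))"
        using tan_half[of "h * x $ i / 2"] by (simp add: add.commute)
      ultimately have "2 * arctan (sin (h * x $ i) / (1 + cos (h * x $ i))) = h * x $ i" by simp
      then show ?thesis using h by (simp only:) simp
    qed
    then show ?thesis by (simp add: \<rho>_def torus_map_def vec_eq_iff)
  qed
  have pre: "\<rho> -` A \<in> sets borel" using measurable_sets_borel[OF meas A] by simp
  have "(LINT x:A|lborel. w x) = (LINT x:torus_map h -` (\<rho> -` A)|lborel. w x)"
    unfolding set_lebesgue_integral_def
  proof (rule integral_cong_AE)
    have [measurable]: "w \<in> borel_measurable borel" using borel_measurable_integrable[OF wint] by simp
    have [measurable]: "A \<in> sets borel" "torus_map h -` (\<rho> -` A) \<in> sets borel"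
      using A measurable_sets_borel[OF borel_measurable_torus_map pre] by auto
    show "(\<lambda>x. indicator A x *\<^sub>R w x) \<in> borel_measurable lborel"
      "(\<lambda>x. indicator (torus_map h -` (\<rho> -` A)) x *\<^sub>R w x) \<in> borel_measurable lborel"
      by simp_all
    show "AE x in lborel. indicator A x *\<^sub>R w x = indicator (torus_map h -` (\<rho> -` A)) x *\<^sub>R w x"
      using AE_interior_cube[of "pi / h"] AE_interior_cube[of "- (pi / h)"]
    proof eventually_elim
      case (elim x)
      show ?case
      proof (cases "x \<in> cube (pi / h)")
        case True
        then have "\<rho> (torus_map h x) = x" using elim by (intro inv) (auto simp: mem_cube order.strict_iff_order)
        then show ?thesis by (simp add: indicator_def)
      qed (simp add: supp)
    qed
  qed
  then show "(LINT x:A|lborel. w x) = 0"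
    using wave_orthogonal_borel[OF w pre] by simp
qed

lemma integrable_cube_mult:
  assumes "square_integrable f"
  shows "integrable lborel (\<lambda>x. indicator (cube r) x * f x)"
proof -
  have "cnj (indicator (cube r) x) = (indicator (cube r) x :: complex)" for x :: "real ^ 'a"
    by (simp add: indicator_def)
  then show ?thesis
    using integrable_cnj_mult[OF square_integrable_indicator[OF bounded_cube, of r] assms] by simp
qed

lemma L2_zero_if_orthogonal_ebasis:
  fixes f :: "('d::finite) L2"
  assumes h: "h > 0" and supp: "wco (indicator (cube (pi / h))) 1 0 f = f"
    and orth: "\<And>n. cinner (ebasis h n) f = 0"
  shows "f = 0"
proof (cases f)
  case (L2_of f0)
  define w where "w x = indicator (cube (pi / h)) x * f0 x" for x
  have sqw: "square_integrable w" unfolding w_def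
    by (intro square_integrable_mult bounded_measurable_indicator L2_of(1)) simp
  have fw: "f = L2_of w"
    using supp L2_of wco_L2_of[of "indicator (cube (pi / h))" 1 f0 0] by (simp add: w_def[abs_def])
  have "wave_orthogonal h w"
    unfolding wave_orthogonal_def
  proof safe
    show "integrable lborel w" unfolding w_def by (rule integrable_cube_mult) fact
    fix n
    \<comment> \<open>The inner product conjugates its left argument, so the wave of index
      \<open>n\<close> is tested with \<open>ebasis h (- n)\<close>.\<close>
    have "cinner (ebasis h (- n)) f = (LINT x|lborel. cnj (indicator (cube (pi / h)) x * wave h (- n) x) * w x)"
      unfolding fw ebasis_def by (intro cinner_L2_of square_integrable_cube_wave sqw)
    also have "\<dots> = (LINT x|lborel. w x * wave h n x)"
      by (intro Bochner_Integration.integral_cong) (auto simp: w_def cnj_wave indicator_def)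
    finally show "(LINT x|lborel. w x * wave h n x) = 0" using orth by simp
  qed
  from wave_complete[OF this h] have "AE x in lborel. w x = 0" by (simp add: w_def)
  then have "L2_of w = L2_of (\<lambda>x. 0)" by (intro L2_of_eqI sqw) auto
  then show ?thesis by (simp add: fw)
qed

section \<open>Orthogonal families and their series\<close>

locale orthogonal_family =
  fixes e :: "'i \<Rightarrow> ('d::finite) L2" and N :: real
  assumes N: "N > 0"
    and orth: "cinner (e m) (e n) = (if m = n then complex_of_real N else 0)"
begin

lemma cinner_sum_e:
  "finite F \<Longrightarrow> n \<in> F \<Longrightarrow> cinner (e n) (\<Sum>m\<in>F. u m *\<^sub>C e m) = complex_of_real N * u n"
  "finite F \<Longrightarrow> n \<notin> F \<Longrightarrow> cinner (e n) (\<Sum>m\<in>F. u m *\<^sub>C e m) = 0"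
  by (simp_all add: cinner_sum_right orth if_distrib[of "\<lambda>x. _ * x"] sum.delta cong: if_cong)

lemma norm_sum_e:
  assumes "finite F"
  shows "(norm (\<Sum>n\<in>F. u n *\<^sub>C e n))\<^sup>2 = N * (\<Sum>n\<in>F. (cmod (u n))\<^sup>2)"
proof -
  have "complex_of_real ((norm (\<Sum>n\<in>F. u n *\<^sub>C e n))\<^sup>2) = (\<Sum>n\<in>F. cnj (u n) * cinner (e n) (\<Sum>m\<in>F. u m *\<^sub>C e m))"
    unfolding cinner_self[symmetric] by (subst cinner_sum_left) simp
  also have "\<dots> = (\<Sum>n\<in>F. complex_of_real (N * (cmod (u n))\<^sup>2))"
    by (intro sum.cong) (simp_all add: cinner_sum_e assms complex_norm_square del: of_real_power)
  also have "\<dots> = complex_of_real (N * (\<Sum>n\<in>F. (cmod (u n))\<^sup>2))"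
    by (simp add: sum_distrib_left del: of_real_power)
  finally show ?thesis by (simp only: of_real_eq_iff)
qed

text \<open>With \<open>P\<close> the combination of the \<open>e n\<close> whose coefficients are
  the inner products, \<open>?S\<close> equals both the inner product of \<open>P\<close> with
  \<open>f\<close> and \<open>(norm P)\<^sup>2 / N\<close>. Cauchy-Schwarz then gives
  \<open>?S\<^sup>2 \<le> N * ?S * (norm f)\<^sup>2\<close>.\<close>

lemma Bessel_finite:
  assumes "finite F"
  shows "(\<Sum>n\<in>F. (cmod (cinner (e n) f))\<^sup>2) \<le> N * (norm f)\<^sup>2"
proof -
  define P where "P = (\<Sum>n\<in>F. cinner (e n) f *\<^sub>C e n)"
  let ?S = "\<Sum>n\<in>F. (cmod (cinner (e n) f))\<^sup>2"
  have P: "(norm P)\<^sup>2 = N * ?S" unfolding P_def by (rule norm_sum_e[OF assms])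
  have "cinner P f = complex_of_real ?S"
    unfolding P_def by (simp add: cinner_sum_left complex_norm_square mult.commute del: of_real_power)
  then have S: "?S \<le> norm P * norm f"
    using cmod_cinner_le[of P f] by (simp add: norm_of_real sum_nonneg del: of_real_power of_real_sum)
  have S0: "0 \<le> ?S" by (simp add: sum_nonneg)
  show ?thesis
  proof (cases "?S = 0")
    case False
    then have "?S > 0" using S0 by simp
    have "?S\<^sup>2 \<le> (norm P * norm f)\<^sup>2" using S S0 by (intro power_mono)
    also have "\<dots> = ?S * (N * (norm f)\<^sup>2)" by (simp add: power_mult_distrib P)
    finally show ?thesis using \<open>?S > 0\<close> by (simp add: power2_eq_square)
  qed (use N in simp)
qed

lemma Bessel_summable: "(\<lambda>n. (cmod (cinner (e n) f))\<^sup>2) summable_on UNIV"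
  by (rule nonneg_bdd_above_summable_on) (auto simp: bdd_above_def intro!: exI[of _ "N * (norm f)\<^sup>2"] Bessel_finite)

text \<open>Orthogonality turns tails of the series of squares into squared norms of differences of
  partial sums. Finite sets that exhaust the series at a geometric rate give a Cauchy sequence, and
  its limit is shown to be the limit along all finite sets.\<close>

lemma has_sum_e:
  assumes u: "(\<lambda>n. (cmod (u n))\<^sup>2) summable_on UNIV"
  obtains S where "((\<lambda>n. u n *\<^sub>C e n) has_sum S) UNIV"
    "(norm S)\<^sup>2 = N * (\<Sum>\<^sub>\<infinity>n. (cmod (u n))\<^sup>2)"
    "\<And>n. cinner (e n) S = complex_of_real N * u n"
proof -
  define T where "T = (\<Sum>\<^sub>\<infinity>n. (cmod (u n))\<^sup>2)"
  have hs: "((\<lambda>n. (cmod (u n))\<^sup>2) has_sum T) UNIV"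
    unfolding T_def using u by (rule has_sum_infsum)
  have le_T: "(\<Sum>n\<in>F. (cmod (u n))\<^sup>2) \<le> T" if "finite F" for F
    unfolding T_def using that u by (intro finite_sum_le_infsum) auto
  have "\<exists>F. finite F \<and> T - \<delta> < (\<Sum>n\<in>F. (cmod (u n))\<^sup>2)" if "\<delta> > 0" for \<delta>
  proof -
    have "eventually (\<lambda>F. T - \<delta> < (\<Sum>n\<in>F. (cmod (u n))\<^sup>2)) (finite_subsets_at_top UNIV)"
      using hs that unfolding has_sum_def by (intro order_tendstoD) auto
    then show ?thesis by (auto simp: eventually_finite_subsets_at_top)
  qed
  \<comment> \<open>The division by \<open>N\<close> cancels the factor in
    \<open>norm_sum_e\<close>, so that partial sums beyond \<open>G k\<close> differ from the one
    over \<open>G k\<close> by at most \<open>(1 / 2) ^ k\<close>.\<close>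
  then have "\<forall>k::nat. \<exists>F. finite F \<and> T - (1 / 4) ^ k / N < (\<Sum>n\<in>F. (cmod (u n))\<^sup>2)"
    using N by simp
  then obtain F where F: "\<And>k::nat. finite (F k)" "\<And>k. T - (1 / 4) ^ k / N < (\<Sum>n\<in>F k. (cmod (u n))\<^sup>2)"
    by metis
  define G where "G k = (\<Union>j\<le>k. F j)" for k
  have G: "finite (G k)" "F k \<subseteq> G k" for k by (auto simp: G_def F)
  have G_mono: "G k \<subseteq> G l" if "k \<le> l" for k l
    unfolding G_def using that by (intro UN_mono) auto
  have close: "norm ((\<Sum>n\<in>H. u n *\<^sub>C e n) - (\<Sum>n\<in>G k. u n *\<^sub>C e n)) \<le> (1 / 2) ^ k"
    if H: "finite H" "G k \<subseteq> H" for H k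
  proof -
    have "(\<Sum>n\<in>H. u n *\<^sub>C e n) - (\<Sum>n\<in>G k. u n *\<^sub>C e n) = (\<Sum>n\<in>H - G k. u n *\<^sub>C e n)"
      using H by (simp add: sum_diff)
    then have "(norm ((\<Sum>n\<in>H. u n *\<^sub>C e n) - (\<Sum>n\<in>G k. u n *\<^sub>C e n)))\<^sup>2 = N * (\<Sum>n\<in>H - G k. (cmod (u n))\<^sup>2)"
      using H by (simp add: norm_sum_e)
    also have "(\<Sum>n\<in>H - G k. (cmod (u n))\<^sup>2) = (\<Sum>n\<in>H. (cmod (u n))\<^sup>2) - (\<Sum>n\<in>G k. (cmod (u n))\<^sup>2)"
      using H G by (simp add: sum_diff)
    also have "\<dots> \<le> T - (\<Sum>n\<in>F k. (cmod (u n))\<^sup>2)"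
      using le_T[OF H(1)] sum_mono2[OF G(1)[of k] G(2)[of k], of "\<lambda>n. (cmod (u n))\<^sup>2"] by fastforce
    also have "\<dots> \<le> (1 / 4) ^ k / N" using F(2)[of k] by simp
    finally have "(norm ((\<Sum>n\<in>H. u n *\<^sub>C e n) - (\<Sum>n\<in>G k. u n *\<^sub>C e n)))\<^sup>2 \<le> N * ((1 / 4) ^ k / N)"
      using N by simp
    also have "\<dots> = ((1 / 2) ^ k)\<^sup>2"
      unfolding power_square_commute using N by (simp add: power2_eq_square)
    finally show ?thesis by (rule power2_le_imp_le) simp
  qed
  define s where "s k = (\<Sum>n\<in>G k. u n *\<^sub>C e n)" for k
  have "Cauchy s"
  proof (rule metric_CauchyI)
    fix \<epsilon> :: real assume "\<epsilon> > 0"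
    then obtain k where k: "(1 / 2 :: real) ^ k < \<epsilon> / 2"
      using real_arch_pow_inv[of "\<epsilon> / 2" "1 / 2"] by auto
    have "dist (s m) (s n) < \<epsilon>" if "k \<le> m" "k \<le> n" for m n
      using close[OF G(1) G_mono[OF that(1)]] close[OF G(1) G_mono[OF that(2)]] k
        dist_triangle2[of "s m" "s n" "s k"] by (simp add: s_def dist_norm)
    then show "\<exists>M. \<forall>m\<ge>M. \<forall>n\<ge>M. dist (s m) (s n) < \<epsilon>" by blast
  qed
  then obtain S where S: "s \<longlonglongrightarrow> S" by (auto simp: Cauchy_convergent_iff convergent_def)
  have near: "norm ((\<Sum>n\<in>H. u n *\<^sub>C e n) - S) \<le> 2 * (1 / 2) ^ k" if H: "finite H" "G k \<subseteq> H" for H k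
  proof -
    have "norm (S - s k) \<le> (1 / 2) ^ k"
    proof (rule tendsto_upperbound)
      show "(\<lambda>l. norm (s l - s k)) \<longlonglongrightarrow> norm (S - s k)" by (intro tendsto_intros S)
      show "\<forall>\<^sub>F l in sequentially. norm (s l - s k) \<le> (1 / 2) ^ k"
        using close[OF G(1) G_mono] by (auto simp: s_def intro!: eventually_sequentiallyI[of k])
    qed simp
    then show ?thesis
      using close[OF H] norm_triangle_ineq4[of "(\<Sum>n\<in>H. u n *\<^sub>C e n) - s k" "S - s k"] by (simp add: s_def)
  qed
  have hasS: "((\<lambda>n. u n *\<^sub>C e n) has_sum S) UNIV"
    unfolding has_sum_def
  proof (rule tendstoI)
    fix \<epsilon> :: real assume "\<epsilon> > 0"
    then obtain k where k: "(1 / 2 :: real) ^ k < \<epsilon> / 2"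
      using real_arch_pow_inv[of "\<epsilon> / 2" "1 / 2"] by auto
    show "\<forall>\<^sub>F H in finite_subsets_at_top UNIV. dist (\<Sum>n\<in>H. u n *\<^sub>C e n) S < \<epsilon>"
      unfolding eventually_finite_subsets_at_top
    proof (intro exI[of _ "G k"] conjI G allI impI, simp)
      fix H assume "finite H \<and> G k \<subseteq> H \<and> H \<subseteq> UNIV"
      then show "dist (\<Sum>n\<in>H. u n *\<^sub>C e n) S < \<epsilon>"
        using near[of H k] k by (simp add: dist_norm)
    qed
  qed
  have cS: "cinner (e n) S = complex_of_real N * u n" for n
  proof -
    have "((\<lambda>m. cinner (e n) (u m *\<^sub>C e m)) has_sum cinner (e n) S) UNIV"
      by (rule has_sum_bounded_linear[OF bounded_linear_cinner_right hasS])
    moreover have "((\<lambda>m. cinner (e n) (u m *\<^sub>C e m)) has_sum (\<Sum>m\<in>{n}. cinner (e n) (u m *\<^sub>C e m))) UNIV"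
      by (rule has_sum_finite_neutralI[where B = "{n}"]) (auto simp: orth)
    ultimately have "cinner (e n) S = (\<Sum>m\<in>{n}. cinner (e n) (u m *\<^sub>C e m))" by (rule has_sum_unique)
    then show ?thesis by (simp add: orth mult.commute)
  qed
  have "(norm S)\<^sup>2 = N * T"
  proof -
    have "((\<lambda>n. cinner (u n *\<^sub>C e n) S) has_sum cinner S S) UNIV"
      by (rule has_sum_bounded_linear[OF bounded_linear_cinner_left hasS])
    moreover have "cinner (u n *\<^sub>C e n) S = complex_of_real (N * (cmod (u n))\<^sup>2)" for n
      by (simp add: cS complex_norm_square mult.left_commute del: of_real_power)
    ultimately have "((\<lambda>n. complex_of_real (N * (cmod (u n))\<^sup>2)) has_sum complex_of_real ((norm S)\<^sup>2)) UNIV"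
      by (simp add: cinner_self del: of_real_power of_real_mult)
    then have "((\<lambda>n. N * (cmod (u n))\<^sup>2) has_sum (norm S)\<^sup>2) UNIV" by (simp only: has_sum_of_real_iff)
    moreover have "((\<lambda>n. N * (cmod (u n))\<^sup>2) has_sum (N * T)) UNIV"
      by (intro has_sum_cmult_right hs)
    ultimately show ?thesis by (rule has_sum_unique)
  qed
  then show ?thesis using that hasS cS unfolding T_def by blast
qed

end

lemma orthogonal_family_ebasis: "h > 0 \<Longrightarrow> orthogonal_family (ebasis h :: int ^ 'd::finite \<Rightarrow> _) ((2
  * pi / h) ^ CARD('d))"
  by standard (auto simp: cinner_ebasis)

lemma wco_indicator_ebasis: "wco (indicator (cube (pi / h))) 1 0 (ebasis h n) = ebasis h n"
  unfolding ebasis_def by (subst wco_L2_of) (auto simp: square_integrable_cube_wave mult.assoc[symmetric]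
    indicator_inter_arith[symmetric])

text \<open>The series with the Fourier coefficients of \<open>f\<close> converges to some
  \<open>S\<close>. The difference \<open>f - S\<close> is supported in the cube and orthogonal to
  all \<open>ebasis h n\<close>, hence zero by completeness; Parseval's identity is the norm formula
  for \<open>S\<close>.\<close>

lemma ebasis_expansion:
  fixes f :: "('d::finite) L2"
  assumes h: "h > 0" and supp: "wco (indicator (cube (pi / h))) 1 0 f = f"
  defines "N \<equiv> (2 * pi / h) ^ CARD('d)"
  shows "((\<lambda>n. (cinner (ebasis h n) f / complex_of_real N) *\<^sub>C ebasis h n) has_sum f) UNIV"
    and "((\<lambda>n. (cmod (cinner (ebasis h n) f))\<^sup>2) has_sum (N * (norm f)\<^sup>2)) UNIV"
proof -
  interpret orthogonal_family "ebasis h :: int ^ 'd \<Rightarrow> _" N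
    unfolding N_def by (rule orthogonal_family_ebasis[OF h])
  define u where "u n = cinner (ebasis h n) f / complex_of_real N" for n
  have u: "(\<lambda>n. (cmod (u n))\<^sup>2) summable_on UNIV"
    using summable_on_cmult_left[OF Bessel_summable[of f], of "inverse (N\<^sup>2)"] N
    by (simp add: u_def norm_divide power_divide divide_inverse power_mult_distrib norm_mult norm_inverse
      power_inverse)
  obtain S where S: "((\<lambda>n. u n *\<^sub>C ebasis h n) has_sum S) UNIV"
    "(norm S)\<^sup>2 = N * (\<Sum>\<^sub>\<infinity>n. (cmod (u n))\<^sup>2)" "\<And>n. cinner (ebasis h n) S = complex_of_real N * u n"
    using has_sum_e[OF u] by blast
  have P: "bounded_clinear (wco (indicator (cube (pi / h))) 1 0 :: 'd L2 \<Rightarrow> _)"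
    by (intro bounded_clinear_wco) auto
  have "((\<lambda>n. wco (indicator (cube (pi / h))) 1 0 (u n *\<^sub>C ebasis h n)) has_sum wco (indicator (cube (pi / h))) 1 0 S)
    UNIV"
    by (rule has_sum_bounded_linear[OF bounded_clinear_imp_linear[OF P] S(1)])
  then have "wco (indicator (cube (pi / h))) 1 0 S = S"
    using S(1) by (simp add: bounded_clinear_scaleC[OF P] wco_indicator_ebasis has_sum_unique)
  then have "f - S = 0"
    using supp S(3) N
    by (intro L2_zero_if_orthogonal_ebasis[OF h]) (simp_all add: bounded_clinear_simps[OF P] cinner_diff_right u_def)
  then have fS: "f = S" by simp
  show "((\<lambda>n. (cinner (ebasis h n) f / complex_of_real N) *\<^sub>C ebasis h n) has_sum f) UNIV"
    using S(1) by (simp add: u_def fS)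
  have "((\<lambda>n. N\<^sup>2 * (cmod (u n))\<^sup>2) has_sum (N\<^sup>2 * (\<Sum>\<^sub>\<infinity>n. (cmod (u n))\<^sup>2))) UNIV"
    by (intro has_sum_cmult_right has_sum_infsum u)
  moreover have "N\<^sup>2 * (cmod (u n))\<^sup>2 = (cmod (cinner (ebasis h n) f))\<^sup>2" for n
    using N by (simp add: u_def norm_divide power_divide)
  ultimately show "((\<lambda>n. (cmod (cinner (ebasis h n) f))\<^sup>2) has_sum (N * (norm f)\<^sup>2)) UNIV"
    using S(2) by (simp add: fS power2_eq_square mult.assoc)
qed

section \<open>The Fourier transform\<close>

lemma has_sum_nn_integral_count_space:
  fixes f :: "'a \<Rightarrow> real"
  assumes "(f has_sum S) UNIV" "\<And>n. 0 \<le> f n"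
  shows "(\<integral>\<^sup>+n. ennreal (f n) \<partial>count_space UNIV) = ennreal S"
proof -
  have "Infinite_Sum.abs_summable_on f UNIV"
    using assms by (auto simp: summable_on_def)
  then have "Infinite_Set_Sum.abs_summable_on f UNIV" by (rule abs_summable_equivalent[THEN iffD1])
  then show ?thesis
    using assms by (simp add: nn_integral_conv_infsetsum infsetsum_infsum infsumI)
qed

text \<open>Half-open, so that the lattice translates tile space without overlap.\<close>

definition half_open_box :: "real \<Rightarrow> (real ^ 'd) set" where
  "half_open_box h = {x. \<forall>i. 0 \<le> x $ i \<and> x $ i < h}"

lemma borel_half_open_box [measurable, simp]: "half_open_box h \<in> sets (borel :: (real ^ 'd::finite) measure)"
proof -
  have "half_open_box h = (\<Inter>i. {x :: real ^ 'd. 0 \<le> x $ i} \<inter> {x. x $ i < h})"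
    by (auto simp: half_open_box_def)
  also have "\<dots> \<in> sets borel"
    by (intro sets.countable_INT' sets.Int) auto
  finally show ?thesis .
qed

lemma lattice_cell:
  fixes x :: "real ^ 'd::finite"
  assumes "h > 0"
  shows "x - lattice_point h n \<in> half_open_box h \<longleftrightarrow> n = (\<chi> i. \<lfloor>x $ i / h\<rfloor>)"
proof -
  have "(0 \<le> x $ i - h * real_of_int (n $ i) \<and> x $ i - h * real_of_int (n $ i) < h) \<longleftrightarrow> n $ i = \<lfloor>x $ i / h\<rfloor>" for i
  proof -
    have "n $ i = \<lfloor>x $ i / h\<rfloor> \<longleftrightarrow> \<lfloor>x $ i / h\<rfloor> = n $ i" by auto
    also have "\<dots> \<longleftrightarrow> real_of_int (n $ i) \<le> x $ i / h \<and> x $ i / h < real_of_int (n $ i) + 1"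
      by (rule floor_eq_iff)
    finally show ?thesis using assms by (simp add: field_simps)
  qed
  then show ?thesis by (simp add: half_open_box_def lattice_point_def vec_eq_iff)
qed

text \<open>The indicators of the lattice cells sum to 1 at every point. Tonelli's theorem exchanges
  sum and integral, and each cell is translated back to the origin.\<close>

lemma nn_integral_tiling:
  fixes g :: "real ^ 'd::finite \<Rightarrow> ennreal"
  assumes [measurable]: "g \<in> borel_measurable borel" and h: "h > 0"
  shows "(\<integral>\<^sup>+x. g x \<partial>lborel) =
    (\<integral>\<^sup>+x. indicator (half_open_box h) x * (\<integral>\<^sup>+n. g (x + lattice_point h n) \<partial>count_space UNIV) \<partial>lborel)"
proof -
  let ?Q = "half_open_box h :: (real ^ 'd) set"
  have count: "countable (UNIV :: (int ^ 'd) set)" by simp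
  have "(\<integral>\<^sup>+x. g x \<partial>lborel) = (\<integral>\<^sup>+x. (\<integral>\<^sup>+n. g x * indicator ?Q (x - lattice_point h n) \<partial>count_space UNIV) \<partial>lborel)"
  proof (intro nn_integral_cong)
    fix x :: "real ^ 'd"
    have "(\<integral>\<^sup>+n. indicator ?Q (x - lattice_point h n) \<partial>count_space UNIV) =
        (\<Sum>n\<in>{\<chi> i. \<lfloor>x $ i / h\<rfloor>}. indicator ?Q (x - lattice_point h n) :: ennreal)"
      by (rule nn_integral_count_space') (auto simp: lattice_cell[OF h])
    also have "\<dots> = 1" using lattice_cell[OF h, of x "\<chi> i. \<lfloor>x $ i / h\<rfloor>"] by simp
    finally show "g x = (\<integral>\<^sup>+n. g x * indicator ?Q (x - lattice_point h n) \<partial>count_space UNIV)"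
      by (simp add: nn_integral_cmult)
  qed
  also have "\<dots> = (\<integral>\<^sup>+n. (\<integral>\<^sup>+x. g x * indicator ?Q (x - lattice_point h n) \<partial>lborel) \<partial>count_space UNIV)"
    by (rule nn_integral_count_space_nn_integral[OF count]) measurable
  also have "\<dots> = (\<integral>\<^sup>+n. (\<integral>\<^sup>+x. g (x + lattice_point h n) * indicator ?Q x \<partial>lborel) \<partial>count_space UNIV)"
  proof (rule nn_integral_cong)
    fix n :: "int ^ 'd"
    show "(\<integral>\<^sup>+x. g x * indicator ?Q (x - lattice_point h n) \<partial>lborel) =
        (\<integral>\<^sup>+x. g (x + lattice_point h n) * indicator ?Q x \<partial>lborel)"
      using nn_integral_lborel_affine[of "\<lambda>x. g x * indicator ?Q (x - lattice_point h n)" 1 "lattice_point h n"]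
      by simp
  qed
  also have "\<dots> = (\<integral>\<^sup>+x. (\<integral>\<^sup>+n. g (x + lattice_point h n) * indicator ?Q x \<partial>count_space UNIV) \<partial>lborel)"
    by (rule nn_integral_count_space_nn_integral[OF count, symmetric]) measurable
  also have "\<dots> = (\<integral>\<^sup>+x. indicator ?Q x * (\<integral>\<^sup>+n. g (x + lattice_point h n) \<partial>count_space UNIV) \<partial>lborel)"
    by (simp add: nn_integral_cmult mult.commute)
  finally show ?thesis .
qed

lemma emeasure_half_open_box:
  assumes "h > 0"
  shows "emeasure lborel (half_open_box h :: (real ^ 'd::finite) set) = ennreal (h ^ CARD('d))"
proof -
  have "emeasure lborel (half_open_box h :: (real ^ 'd) set) = emeasure lborel (cbox 0 (\<chi> i. h) :: (real ^ 'd) set)"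
  proof (rule emeasure_eq_AE)
    show "AE x in lborel. x \<in> half_open_box h \<longleftrightarrow> x \<in> cbox 0 (\<chi> i. h)"
      using AE_interior_cube[of h]
      by eventually_elim (auto simp: half_open_box_def mem_box_cart order.strict_iff_order)
  qed auto
  also have "\<dots> = ennreal (h ^ CARD('d))"
  proof -
    have "(\<Prod>b\<in>(Basis :: (real ^ 'd) set). ((\<chi> i. h) - 0) \<bullet> b) = (\<Prod>b\<in>(Basis :: (real ^ 'd) set). h)"
      by (intro prod.cong) (auto simp: Basis_vec_def inner_axis)
    moreover have "\<And>b. b \<in> (Basis :: (real ^ 'd) set) \<Longrightarrow> 0 \<bullet> b \<le> (\<chi> i. h) \<bullet> b"
      using assms by (auto simp: Basis_vec_def inner_axis)
    ultimately show ?thesis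
      by (subst emeasure_lborel_cbox) simp_all
  qed
  finally show ?thesis .
qed

section \<open>The Fourier integral of compactly supported functions\<close>

definition phase :: "real ^ 'd \<Rightarrow> real ^ 'd \<Rightarrow> complex" where
  "phase s x = exp (- \<i> * complex_of_real (x \<bullet> s))"

lemma cmod_phase [simp]: "cmod (phase s x) = 1"
  by (simp add: phase_def)

lemma borel_measurable_phase2 [measurable]:
  "(\<lambda>p. phase (fst p) (snd p)) \<in> borel_measurable (borel \<Otimes>\<^sub>M (borel :: (real ^ 'd::finite) measure))"
  unfolding borel_prod phase_def
  by (intro borel_measurable_continuous_onI continuous_intros)

lemma borel_measurable_phase [measurable, simp]: "phase s \<in> borel_measurable (borel :: (real ^ 'd::finite) measure)"
  unfolding phase_def by (intro borel_measurable_continuous_onI continuous_intros)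

lemma bounded_measurable_phase [simp]: "bounded_measurable (phase s)"
  by (rule bounded_measurableI[where M = 1]) auto

lemma wave_phase: "wave h n x = phase (lattice_point h n) x"
  by (simp add: wave_def phase_def inner_commute)

lemma phase_add: "phase (s + t) x = phase s x * phase t x"
  by (simp add: phase_def inner_add_right distrib_left exp_add[symmetric])

lemma phase_commute: "phase s x = phase x s"
  by (simp add: phase_def inner_commute)

lemma fourier_integral_phase:
  fixes f :: "real ^ 'd \<Rightarrow> complex"
  shows "fourier_integral f \<xi> = complex_of_real ((2 * pi) powr (- real CARD('d) / 2)) * (LINT x|lborel. phase \<xi> x
    * f x)"
  by (simp add: fourier_integral_def phase_def)

lemma borel_measurable_fourier_integral [measurable]:
  fixes f :: "real ^ 'd::finite \<Rightarrow> complex"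
  assumes [measurable]: "f \<in> borel_measurable borel"
  shows "fourier_integral f \<in> borel_measurable borel"
proof -
  have "(\<lambda>p. phase (fst p) (snd p) * f (snd p)) \<in> borel_measurable (borel \<Otimes>\<^sub>M (lborel :: (real ^ 'd) measure))"
    using borel_measurable_phase2 by (intro borel_measurable_times) (simp_all cong: measurable_cong_sets)
  then have "(\<lambda>\<xi>. LINT x|lborel. phase \<xi> x * f x) \<in> borel_measurable borel"
    by (intro lborel.borel_measurable_lebesgue_integral) (simp add: case_prod_beta')
  then show ?thesis
    unfolding fourier_integral_phase by measurable
qed

lemma integrable_phase_mult:
  assumes "integrable lborel f"
  shows "integrable lborel (\<lambda>x. phase \<xi> x * f x)"
  using integrable_mult_bounded[OF assms bounded_measurable_phase, of \<xi>] by (simp add: mult.commute)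

lemma fourier_integral_add:
  "integrable lborel f \<Longrightarrow> integrable lborel g \<Longrightarrow>
    fourier_integral (\<lambda>x. f x + g x) \<xi> = fourier_integral f \<xi> + fourier_integral g \<xi>"
  by (simp add: fourier_integral_phase distrib_left Bochner_Integration.integral_add integrable_phase_mult)

lemma fourier_integral_cmult:
  "fourier_integral (\<lambda>x. c * f x) \<xi> = c * fourier_integral f \<xi>"
  by (simp add: fourier_integral_phase mult.left_commute[of _ c])

lemma fourier_integral_cong_AE:
  assumes "f \<in> borel_measurable borel" "g \<in> borel_measurable borel" "AE x in lborel. f x = g x"
  shows "fourier_integral f \<xi> = fourier_integral g \<xi>"
proof -
  have [measurable]: "f \<in> borel_measurable borel" "g \<in> borel_measurable borel" by fact+
  show ?thesis
    unfolding fourier_integral_phase by (intro arg_cong2[where f = "(*)"] refl integral_cong_AE) (use assms in auto)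
qed

text \<open>Square integrability together with bounded support gives integrability, so the Fourier
  integral converges; truncation makes these functions dense.\<close>

definition compactly_supported :: "(real ^ 'd::finite \<Rightarrow> complex) \<Rightarrow> bool" where
  "compactly_supported f \<longleftrightarrow> square_integrable f \<and> (\<exists>r. \<forall>x. r < norm x \<longrightarrow> f x = 0)"

lemma compactly_supported_cube:
  assumes "compactly_supported f"
  obtains r where "r > 0" "\<And>x. x \<notin> cube r \<Longrightarrow> f x = 0"
proof -
  obtain r where r: "\<And>x. r < norm x \<Longrightarrow> f x = 0" using assms by (auto simp: compactly_supported_def)
  have "f x = 0" if "x \<notin> cube (max r 1)" for x
  proof -
    have "\<exists>i. \<not> (- max r 1 \<le> x $ i \<and> x $ i \<le> max r 1)" using that by (simp only: mem_cube) blast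
    then obtain i where "\<not> (- max r 1 \<le> x $ i \<and> x $ i \<le> max r 1)" by blast
    then have "max r 1 < \<bar>x $ i\<bar>" by auto
    also have "\<dots> \<le> norm x" by (rule component_le_norm_cart)
    finally show ?thesis using r by simp
  qed
  then show ?thesis using that[of "max r 1"] by simp
qed

lemma compactly_supported_integrable:
  assumes "compactly_supported f"
  shows "integrable lborel f"
proof -
  obtain r where r: "\<And>x. x \<notin> cube r \<Longrightarrow> f x = 0" using compactly_supported_cube[OF assms] by blast
  have "(\<lambda>x. indicator (cube r) x * f x) = f"
  proof
    fix x show "indicator (cube r) x * f x = f x"
      by (cases "x \<in> cube r") (simp_all add: r)
  qed
  then show ?thesis
    using integrable_cube_mult[of f r] assms by (simp add: compactly_supported_def)
qed

text \<open>
  Parseval's identity on a cube containing the support, applied to the modulations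
  \<open>phase s x * f x\<close> and integrated over \<open>s\<close> in a cell of the dual lattice.
\<close>

lemma plancherel_compactly_supported:
  fixes f :: "real ^ 'd::finite \<Rightarrow> complex"
  assumes f: "compactly_supported f"
  shows "(\<integral>\<^sup>+\<xi>. ennreal ((cmod (fourier_integral f \<xi>))\<^sup>2) \<partial>lborel) = ennreal ((norm (L2_of f))\<^sup>2)"
proof -
  obtain r where r: "r > 0" "\<And>x. x \<notin> cube r \<Longrightarrow> f x = 0" using compactly_supported_cube[OF f] by blast
  \<comment> \<open>With this mesh \<open>cube (pi / h)\<close> is exactly the cube
    \<open>cube r\<close> that contains the support.\<close>
  define h where "h = pi / r"
  have h: "h > 0" "pi / h = r" using r by (auto simp: h_def)
  have sq: "square_integrable f" using f by (simp add: compactly_supported_def)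
  then have [measurable]: "f \<in> borel_measurable borel" by (simp add: square_integrable_def)
  define K where "K = (2 * pi) powr (real CARD('d))"
  have K: "K > 0" "K = (2 * pi) ^ CARD('d)" by (auto simp: K_def powr_realpow)
  \<comment> \<open>The value does not depend on \<open>s\<close>, so integrating over the cell only
    multiplies it by the volume \<open>h ^ CARD('d)\<close>.\<close>
  have sum: "(\<integral>\<^sup>+n. ennreal ((cmod (fourier_integral f (s + lattice_point h n)))\<^sup>2) \<partial>count_space UNIV) =
      ennreal (inverse (h ^ CARD('d)) * (norm (L2_of f))\<^sup>2)" for s
  proof -
    define fs where "fs = L2_of (\<lambda>x. phase s x * f x)"
    have sqs: "square_integrable (\<lambda>x. phase s x * f x)"
      by (intro square_integrable_mult bounded_measurable_phase sq)
    have norm_fs: "(norm fs)\<^sup>2 = (norm (L2_of f))\<^sup>2"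
      unfolding fs_def by (simp add: norm_L2_of sqs sq norm_mult)
    have supp: "wco (indicator (cube (pi / h))) 1 0 fs = fs"
    proof -
      have eq: "(\<lambda>x. indicator (cube r) x * (phase s x * f x)) = (\<lambda>x. phase s x * f x)"
      proof
        fix x show "indicator (cube r) x * (phase s x * f x) = phase s x * f x"
          by (cases "x \<in> cube r") (simp_all add: r(2))
      qed
      show ?thesis
        unfolding fs_def by (subst wco_L2_of) (use sqs in \<open>simp_all add: h eq\<close>)
    qed
    have coeff: "cinner (ebasis h (- n)) fs = complex_of_real (sqrt K) * fourier_integral f (s + lattice_point h n)"
      for n
    proof -
      have cf: "cinner (ebasis h (- n)) fs
        = (LINT x|lborel. cnj (indicator (cube (pi / h)) x * wave h (- n) x) * (phase s x * f x))"
        unfolding fs_def ebasis_def by (intro cinner_L2_of square_integrable_cube_wave sqs)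
      have cw: "cnj (wave h (- n) x) = phase (lattice_point h n) x" for x
        by (simp add: cnj_wave wave_phase[symmetric])
      have "(LINT x|lborel. cnj (indicator (cube (pi / h)) x * wave h (- n) x) * (phase s x * f x)) =
          (LINT x|lborel. phase (s + lattice_point h n) x * f x)"
        using r(2) by (intro Bochner_Integration.integral_cong)
          (auto simp: cw phase_add indicator_def h)
      also have "(LINT x|lborel. phase (s + lattice_point h n) x * f x)
        = complex_of_real (sqrt K) * fourier_integral f (s + lattice_point h n)"
      proof -
        have "sqrt K * ((2 * pi) powr (- real CARD('d) / 2)) = 1"
          by (simp add: K_def powr_half_sqrt[symmetric] powr_powr powr_add[symmetric])
        then show ?thesis
          by (simp add: fourier_integral_phase mult.assoc[symmetric] flip: of_real_mult)
      qed
      finally show ?thesis using cf by simp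
    qed
    have "((\<lambda>n. (cmod (cinner (ebasis h n) fs))\<^sup>2) has_sum ((2 * pi / h) ^ CARD('d) * (norm fs)\<^sup>2)) UNIV"
      by (rule ebasis_expansion(2)[OF h(1) supp])
    then have "((\<lambda>n. (cmod (cinner (ebasis h (- n)) fs))\<^sup>2) has_sum ((2 * pi / h) ^ CARD('d) * (norm fs)\<^sup>2)) UNIV"
      using has_sum_reindex_bij_betw[OF bij_uminus, of "\<lambda>n. (cmod (cinner (ebasis h n) fs))\<^sup>2"] by simp
    then have "((\<lambda>n. K * (cmod (fourier_integral f (s + lattice_point h n)))\<^sup>2) has_sum ((2 * pi / h) ^ CARD('d)
      * (norm fs)\<^sup>2)) UNIV"
      using K(1) by (simp add: coeff norm_mult power_mult_distrib)
    then have "((\<lambda>n. inverse K * (K * (cmod (fourier_integral f (s + lattice_point h n)))\<^sup>2)) has_sum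
        inverse K * ((2 * pi / h) ^ CARD('d) * (norm fs)\<^sup>2)) UNIV"
      by (rule has_sum_cmult_right)
    moreover have "inverse K * ((2 * pi / h) ^ CARD('d) * (norm fs)\<^sup>2) = inverse (h ^ CARD('d)) * (norm (L2_of f))\<^sup>2"
      using h K by (simp add: norm_fs power_divide field_simps)
    ultimately have "((\<lambda>n. (cmod (fourier_integral f (s + lattice_point h n)))\<^sup>2) has_sum
        inverse (h ^ CARD('d)) * (norm (L2_of f))\<^sup>2) UNIV"
      using K(1) by (simp add: mult.assoc[symmetric])
    then show ?thesis by (rule has_sum_nn_integral_count_space) simp
  qed
  have "(\<integral>\<^sup>+\<xi>. ennreal ((cmod (fourier_integral f \<xi>))\<^sup>2) \<partial>lborel) =
      (\<integral>\<^sup>+s. indicator (half_open_box h) s * (\<integral>\<^sup>+n. ennreal ((cmod (fourier_integral f (s + lattice_point h n)))\<^sup>2)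
        \<partial>count_space UNIV) \<partial>lborel)"
    by (rule nn_integral_tiling[OF _ h(1)]) measurable
  also have "\<dots> = ennreal (inverse (h ^ CARD('d)) * (norm (L2_of f))\<^sup>2)
    * emeasure lborel (half_open_box h :: (real ^ 'd) set)"
    by (simp add: sum nn_integral_multc mult.commute)
  also have "\<dots> = ennreal ((norm (L2_of f))\<^sup>2)"
    using h by (simp add: emeasure_half_open_box ennreal_mult'[symmetric])
  finally show ?thesis .
qed


lemma square_integrable_fourier_integral:
  "compactly_supported f \<Longrightarrow> square_integrable (fourier_integral f)"
  using plancherel_compactly_supported[of f] borel_measurable_fourier_integral[of f]
  by (simp add: square_integrable_iff_nn compactly_supported_def)

lemma norm_fourier_integral:
  assumes "compactly_supported f"
  shows "norm (L2_of (fourier_integral f)) = norm (L2_of f)"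
proof -
  have "(norm (L2_of (fourier_integral f)))\<^sup>2 = (norm (L2_of f))\<^sup>2"
    using plancherel_compactly_supported[OF assms] nn_integral_norm_L2_of[OF square_integrable_fourier_integral[OF
      assms]]
    by simp
  then show ?thesis by (simp add: power2_eq_iff_nonneg)
qed

lemma compactly_supported_add:
  assumes "compactly_supported f" "compactly_supported g"
  shows "compactly_supported (\<lambda>x. f x + g x)"
proof -
  obtain r s where "\<And>x. r < norm x \<Longrightarrow> f x = 0" "\<And>x. s < norm x \<Longrightarrow> g x = 0"
    using assms by (auto simp: compactly_supported_def)
  then have "\<forall>x. max r s < norm x \<longrightarrow> f x + g x = 0" by simp
  then show ?thesis using assms unfolding compactly_supported_def by (blast intro: square_integrable_add)
qed

lemma compactly_supported_cmult:
  "compactly_supported f \<Longrightarrow> compactly_supported (\<lambda>x. c * f x)"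
  by (auto simp: compactly_supported_def square_integrable_scale)

section \<open>Extension of the transform to all classes\<close>

definition truncate :: "real \<Rightarrow> (real ^ 'd::finite \<Rightarrow> complex) \<Rightarrow> real ^ 'd \<Rightarrow> complex" where
  "truncate r f x = indicator (cball 0 r) x * f x"

lemma borel_measurable_truncate [measurable]:
  "f \<in> borel_measurable borel \<Longrightarrow> truncate r f \<in> borel_measurable borel"
  unfolding truncate_def[abs_def] by (intro borel_measurable_times borel_measurable_indicator) auto

lemma compactly_supported_truncate:
  "square_integrable f \<Longrightarrow> compactly_supported (truncate r f)"
  unfolding compactly_supported_def truncate_def
  by (auto intro!: square_integrable_mult bounded_measurable_indicator exI[of _ r])

lemma truncate_tendsto:
  fixes f :: "real ^ 'd::finite \<Rightarrow> complex"
  assumes f: "square_integrable f"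
  shows "(\<lambda>N. L2_of (truncate (real N) f)) \<longlonglongrightarrow> L2_of f"
proof -
  have [measurable]: "f \<in> borel_measurable borel" using f by (simp add: square_integrable_def)
  have sq: "square_integrable (truncate r f)" for r
    using compactly_supported_truncate[OF f] by (simp add: compactly_supported_def)
  have "(\<lambda>N. LINT x|lborel. (cmod (f x - truncate (real N) f x))\<^sup>2) \<longlonglongrightarrow> (LINT x|(lborel :: (real ^ 'd) measure). 0)"
  proof (rule integral_dominated_convergence[where w = "\<lambda>x. (cmod (f x))\<^sup>2"])
    show "integrable lborel (\<lambda>x. (cmod (f x))\<^sup>2)" using f by (simp add: square_integrable_def)
    show "(\<lambda>x. (cmod (f x - truncate (real N) f x))\<^sup>2) \<in> borel_measurable lborel" for N
      by measurable
    show "AE x in lborel. (\<lambda>N. (cmod (f x - truncate (real N) f x))\<^sup>2) \<longlonglongrightarrow> 0"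
    proof (rule AE_I2)
      fix x :: "real ^ 'd"
      obtain M :: nat where M: "norm x \<le> real M" using real_arch_simple by blast
      have "eventually (\<lambda>N. (cmod (f x - truncate (real N) f x))\<^sup>2 = 0) sequentially"
        using M by (auto simp: truncate_def intro!: eventually_sequentiallyI[of M])
      then show "(\<lambda>N. (cmod (f x - truncate (real N) f x))\<^sup>2) \<longlonglongrightarrow> 0" by (rule tendsto_eventually)
    qed
    show "AE x in lborel. norm ((cmod (f x - truncate (real N) f x))\<^sup>2) \<le> (cmod (f x))\<^sup>2" for N
      by (rule AE_I2) (simp add: truncate_def indicator_def)
  qed simp
  moreover have "(LINT x|lborel. (cmod (f x - truncate (real N) f x))\<^sup>2)
    = (norm (L2_of f - L2_of (truncate (real N) f)))\<^sup>2" for N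
    by (simp add: L2_of_diff f sq norm_L2_of square_integrable_diff)
  ultimately have "(\<lambda>N. (norm (L2_of f - L2_of (truncate (real N) f)))\<^sup>2) \<longlonglongrightarrow> 0" by simp
  then have "(\<lambda>N. sqrt ((norm (L2_of f - L2_of (truncate (real N) f)))\<^sup>2)) \<longlonglongrightarrow> sqrt 0"
    by (rule tendsto_real_sqrt)
  then have "(\<lambda>N. norm (L2_of (truncate (real N) f) - L2_of f)) \<longlonglongrightarrow> 0"
    by (simp add: norm_minus_commute)
  then show ?thesis unfolding dist_norm[symmetric] by (rule tendsto_dist_iff[THEN iffD2])
qed

lemma fourier_truncate_diff:
  assumes "square_integrable f" "square_integrable g"
  shows "L2_of (fourier_integral (truncate r f)) - L2_of (fourier_integral (truncate s g)) =
    L2_of (fourier_integral (\<lambda>x. truncate r f x - truncate s g x))"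
    and "compactly_supported (\<lambda>x. truncate r f x - truncate s g x)"
proof -
  note c = compactly_supported_truncate[OF assms(1), of r] compactly_supported_cmult[OF
    compactly_supported_truncate[OF assms(2), of s], of "- 1"]
  show "compactly_supported (\<lambda>x. truncate r f x - truncate s g x)"
    using compactly_supported_add[OF c] by simp
  have "fourier_integral (\<lambda>x. truncate r f x - truncate s g x) \<xi> =
      fourier_integral (truncate r f) \<xi> - fourier_integral (truncate s g) \<xi>" for \<xi>
    using fourier_integral_add[OF c[THEN compactly_supported_integrable], of \<xi>]
      fourier_integral_cmult[of "- 1" "truncate s g" \<xi>] by simp
  then have "fourier_integral (\<lambda>x. truncate r f x - truncate s g x) =
      (\<lambda>\<xi>. fourier_integral (truncate r f) \<xi> - fourier_integral (truncate s g) \<xi>)" by (rule ext)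
  then show "L2_of (fourier_integral (truncate r f)) - L2_of (fourier_integral (truncate s g)) =
    L2_of (fourier_integral (\<lambda>x. truncate r f x - truncate s g x))"
    using assms by (simp add: L2_of_diff square_integrable_fourier_integral compactly_supported_truncate)
qed

text \<open>By the isometry on compactly supported functions the transforms of the truncations
  inherit the Cauchy property; by completeness the \<open>lim\<close> in the definition of
  \<open>fourier\<close> is therefore a genuine limit.\<close>

lemma fourier_LIMSEQ:
  fixes f :: "real ^ 'd::finite \<Rightarrow> complex"
  assumes f: "square_integrable f"
  shows "(\<lambda>N. L2_of (fourier_integral (truncate (real N) f))) \<longlonglongrightarrow> fourier (L2_of f)"
proof -
  have sq: "square_integrable (truncate r f)" for r
    using compactly_supported_truncate[OF f] by (simp add: compactly_supported_def)
  have "Cauchy (\<lambda>N. L2_of (truncate (real N) f))"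
    using truncate_tendsto[OF f] by (rule LIMSEQ_imp_Cauchy)
  moreover have "dist (L2_of (fourier_integral (truncate r f))) (L2_of (fourier_integral (truncate s f))) =
      dist (L2_of (truncate r f)) (L2_of (truncate s f))" for r s
    by (simp add: dist_norm fourier_truncate_diff f norm_fourier_integral L2_of_diff sq)
  ultimately have "Cauchy (\<lambda>N. L2_of (fourier_integral (truncate (real N) f)))"
    by (simp add: Cauchy_def)
  then have conv: "convergent (\<lambda>N. L2_of (fourier_integral (truncate (real N) f)))"
    by (simp only: Cauchy_convergent_iff)
  \<comment> \<open>The definition truncates an arbitrary representative. Changing it on a null set
    leaves the Fourier integral unchanged at every point.\<close>
  have eq: "fourier_integral (truncate r f) = fourier_integral (\<lambda>x. indicator (cball 0 r) x * rep_L2 (L2_of f) x)"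
    for r
  proof
    fix \<xi>
    have [measurable]: "f \<in> borel_measurable borel" using f by (simp add: square_integrable_def)
    show "fourier_integral (truncate r f) \<xi> = fourier_integral (\<lambda>x. indicator (cball 0 r) x * rep_L2 (L2_of f) x) \<xi>"
    proof (rule fourier_integral_cong_AE)
      show "truncate r f \<in> borel_measurable borel" by measurable
      show "(\<lambda>x. indicator (cball 0 r) x * rep_L2 (L2_of f) x) \<in> borel_measurable borel"
        by (intro borel_measurable_times borel_measurable_indicator) auto
      show "AE x in lborel. truncate r f x = indicator (cball 0 r) x * rep_L2 (L2_of f) x"
        using rep_L2_of[OF f] by eventually_elim (simp add: truncate_def)
    qed
  qed
  show ?thesis
    using conv unfolding fourier_def eq[symmetric] convergent_LIMSEQ_iff .
qed

lemma norm_fourier [simp]: "norm (fourier f) = norm f"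
proof (cases f)
  case (L2_of f0)
  have eq: "norm (L2_of (fourier_integral (truncate r f0))) = norm (L2_of (truncate r f0))" for r
    by (intro norm_fourier_integral compactly_supported_truncate L2_of(1))
  have A: "(\<lambda>N. norm (L2_of (truncate (real N) f0))) \<longlonglongrightarrow> norm (fourier (L2_of f0))"
    using tendsto_norm[OF fourier_LIMSEQ[OF L2_of(1)]] unfolding eq .
  show ?thesis
    unfolding L2_of(2) by (rule LIMSEQ_unique[OF A tendsto_norm[OF truncate_tendsto[OF L2_of(1)]]])
qed

lemma bounded_clinear_fourier: "bounded_clinear (fourier :: ('d::finite) L2 \<Rightarrow> 'd L2)"
proof (rule bounded_clinearI[where M = 1])
  fix f g :: "'d L2" and c :: complex
  obtain f0 g0 where fg: "square_integrable f0" "f = L2_of f0" "square_integrable g0" "g = L2_of g0"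
    by (cases f; cases g) blast
  note cs = compactly_supported_truncate[OF fg(1)] compactly_supported_truncate[OF fg(3)]
  have tadd: "truncate r (\<lambda>x. f0 x + g0 x) = (\<lambda>x. truncate r f0 x + truncate r g0 x)"
    and tsc: "truncate r (\<lambda>x. c * f0 x) = (\<lambda>x. c * truncate r f0 x)" for r
    by (auto simp: truncate_def distrib_left)
  have "L2_of (fourier_integral (truncate r (\<lambda>x. f0 x + g0 x))) =
      L2_of (fourier_integral (truncate r f0)) + L2_of (fourier_integral (truncate r g0))" for r
    unfolding tadd L2_of_add[OF cs[THEN square_integrable_fourier_integral]]
    by (intro arg_cong[where f = L2_of] ext fourier_integral_add cs[THEN compactly_supported_integrable])
  then have "(\<lambda>N. L2_of (fourier_integral (truncate (real N) f0)) + L2_of (fourier_integral (truncate (real N) g0)))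
      \<longlonglongrightarrow> fourier (f + g)"
    using fourier_LIMSEQ[OF square_integrable_add[OF fg(1,3)]] fg by (simp add: L2_of_add)
  moreover have "(\<lambda>N. L2_of (fourier_integral (truncate (real N) f0))
    + L2_of (fourier_integral (truncate (real N) g0)))
      \<longlonglongrightarrow> fourier f + fourier g"
    unfolding fg by (intro tendsto_add fourier_LIMSEQ fg)
  ultimately show "fourier (f + g) = fourier f + fourier g" by (rule LIMSEQ_unique)
  have "L2_of (fourier_integral (truncate r (\<lambda>x. c * f0 x))) = c *\<^sub>C L2_of (fourier_integral (truncate r f0))" for r
    unfolding tsc scaleC_L2_of[OF cs(1)[THEN square_integrable_fourier_integral]]
    by (intro arg_cong[where f = L2_of] ext fourier_integral_cmult)
  then have "(\<lambda>N. c *\<^sub>C L2_of (fourier_integral (truncate (real N) f0))) \<longlonglongrightarrow> fourier (c *\<^sub>C f)"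
    using fourier_LIMSEQ[OF square_integrable_scale[OF fg(1), of c]] fg by (simp add: scaleC_L2_of)
  moreover have "(\<lambda>N. c *\<^sub>C L2_of (fourier_integral (truncate (real N) f0))) \<longlonglongrightarrow> c *\<^sub>C fourier f"
    unfolding fg
    by (intro bounded_linear.tendsto[OF bounded_clinear_imp_linear[OF bounded_clinear_cmult[OF
      bounded_clinear_ident]]] fourier_LIMSEQ fg)
  ultimately show "fourier (c *\<^sub>C f) = c *\<^sub>C fourier f" by (rule LIMSEQ_unique)
qed simp

text \<open>Truncations are compactly supported and converge to the given function, so a closed
  property that holds for them passes to the limit.\<close>

lemma L2_density_induct [consumes 1, case_names compactly_supported]:
  fixes f :: "('d::finite) L2"
  assumes "closed {f. P f}"
    and "\<And>f0. compactly_supported f0 \<Longrightarrow> P (L2_of f0)"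
  shows "P f"
proof (cases f)
  case (L2_of f0)
  have "f \<in> {f. P f}"
    unfolding L2_of(2)
    by (rule closed_sequentially[OF assms(1) _ truncate_tendsto[OF L2_of(1)]])
      (use assms(2) compactly_supported_truncate[OF L2_of(1)] in auto)
  then show ?thesis by simp
qed

lemma fourier_compactly_supported:
  assumes f: "compactly_supported f"
  shows "fourier (L2_of f) = L2_of (fourier_integral f)"
proof -
  obtain r where r: "\<And>x. r < norm x \<Longrightarrow> f x = 0" using f by (auto simp: compactly_supported_def)
  obtain M :: nat where M: "r \<le> real M" using real_arch_simple by blast
  have "truncate (real N) f = f" if "N \<ge> M" for N
  proof
    fix x show "truncate (real N) f x = f x"
      using r[of x] M that by (auto simp: truncate_def indicator_def)
  qed
  then have "eventually (\<lambda>N. L2_of (fourier_integral (truncate (real N) f))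
    = L2_of (fourier_integral f)) sequentially"
    by (auto intro!: eventually_sequentiallyI[of M])
  then have "(\<lambda>N. L2_of (fourier_integral (truncate (real N) f))) \<longlonglongrightarrow> L2_of (fourier_integral f)"
    by (rule tendsto_eventually)
  moreover have "square_integrable f" using f by (simp add: compactly_supported_def)
  ultimately show ?thesis using fourier_LIMSEQ LIMSEQ_unique by blast
qed

section \<open>Multiplication formula and unitarity\<close>

definition cnj_L2 :: "('d::finite) L2 \<Rightarrow> 'd L2" where
  "cnj_L2 f = L2_of (\<lambda>x. cnj (rep_L2 f x))"

lemma borel_measurable_cnj: "f \<in> borel_measurable M \<Longrightarrow> (\<lambda>x. cnj (f x)) \<in> borel_measurable M"
  by (rule borel_measurable_continuous_on[where f = cnj]) (auto intro: continuous_intros)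

lemma square_integrable_cnj: "square_integrable f \<Longrightarrow> square_integrable (\<lambda>x. cnj (f x))"
  by (simp add: square_integrable_def borel_measurable_cnj)

lemma cnj_L2_of: "square_integrable f \<Longrightarrow> cnj_L2 (L2_of f) = L2_of (\<lambda>x. cnj (f x))"
  unfolding cnj_L2_def
proof (rule L2_of_eqI)
  assume f: "square_integrable f"
  show "AE x in lborel. cnj (rep_L2 (L2_of f) x) = cnj (f x)"
    using rep_L2_of[OF f] by eventually_elim simp
qed (simp_all add: square_integrable_cnj)

lemma cnj_L2_cnj_L2 [simp]: "cnj_L2 (cnj_L2 f) = f"
  by (cases f) (simp add: cnj_L2_of square_integrable_cnj)

lemma cnj_L2_add: "cnj_L2 (f + g) = cnj_L2 f + cnj_L2 g"
  by (cases f; cases g) (simp add: cnj_L2_of L2_of_add square_integrable_add square_integrable_cnj)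

lemma cnj_L2_scaleC: "cnj_L2 (c *\<^sub>C f) = cnj c *\<^sub>C cnj_L2 f"
  by (cases f) (simp add: cnj_L2_of scaleC_L2_of square_integrable_scale square_integrable_cnj)

lemma norm_cnj_L2 [simp]: "norm (cnj_L2 f) = norm f"
proof -
  have "(norm (cnj_L2 f))\<^sup>2 = (norm f)\<^sup>2"
    by (cases f) (simp add: cnj_L2_of norm_L2_of square_integrable_cnj)
  then show ?thesis by (simp add: power2_eq_iff_nonneg)
qed

lemma bounded_linear_cnj_L2: "bounded_linear cnj_L2"
  by (rule bounded_linear_intro[where K = 1]) (auto simp: cnj_L2_add scaleR_scaleC cnj_L2_scaleC)

lemma cinner_cnj_L2:
  "square_integrable f \<Longrightarrow> square_integrable g \<Longrightarrow> cinner (cnj_L2 (L2_of f)) (L2_of g) = (LINT x|lborel. f x * g x)"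
  by (simp add: cnj_L2_of cinner_L2_of square_integrable_cnj)

text \<open>Fubini's theorem for the kernel \<open>f x * (phase x y * g y)\<close>, which is
  integrable on the product because \<open>f\<close> and \<open>g\<close> are; \<open>phase\<close>
  is symmetric in its two arguments.\<close>

lemma fourier_multiplication_formula_compact:
  fixes f g :: "real ^ 'd::finite \<Rightarrow> complex"
  assumes f: "compactly_supported f" and g: "compactly_supported g"
  shows "cinner (cnj_L2 (L2_of f)) (fourier (L2_of g)) = cinner (cnj_L2 (fourier (L2_of f))) (L2_of g)"
proof -
  have sq: "square_integrable f" "square_integrable g" using f g by (auto simp: compactly_supported_def)
  then have [measurable]: "f \<in> borel_measurable borel" "g \<in> borel_measurable borel"
    by (auto simp: square_integrable_def)
  have int: "integrable lborel f" "integrable lborel g"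
    using f g by (auto intro: compactly_supported_integrable)
  define C where "C = complex_of_real ((2 * pi) powr (- real CARD('d) / 2))"
  have meas: "(\<lambda>p. f (fst p) * (phase (fst p) (snd p) * g (snd p))) \<in> borel_measurable (lborel \<Otimes>\<^sub>M lborel)"
    using borel_measurable_phase2 by (intro borel_measurable_times) (simp_all cong: measurable_cong_sets)
  have "integrable (lborel \<Otimes>\<^sub>M lborel) (\<lambda>(x, y). f x * (phase x y * g y))"
  proof (rule lborel_pair.Fubini_integrable)
    show "(\<lambda>(x, y). f x * (phase x y * g y)) \<in> borel_measurable (lborel \<Otimes>\<^sub>M lborel)"
      using meas by (simp add: case_prod_beta')
    have "(\<lambda>x. LINT y|lborel. norm (case (x, y) of (x, y) \<Rightarrow> f x * (phase x y * g y))) =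
        (\<lambda>x. norm (f x) * (LINT y|lborel. norm (g y)))"
      by (simp add: norm_mult)
    then show "integrable lborel (\<lambda>x. LINT y|lborel. norm (case (x, y) of (x, y) \<Rightarrow> f x * (phase x y * g y)))"
      using int by simp
    show "AE x in lborel. integrable lborel (\<lambda>y. case (x, y) of (x, y) \<Rightarrow> f x * (phase x y * g y))"
      using integrable_phase_mult[OF int(2)] by simp
  qed
  then have Fub: "(LINT y|lborel. LINT x|lborel. f x * (phase x y * g y))
    = (LINT x|lborel. LINT y|lborel. f x * (phase x y * g y))"
    by (rule lborel_pair.Fubini_integral)
  have "cinner (cnj_L2 (L2_of f)) (fourier (L2_of g)) = (LINT x|lborel. f x * fourier_integral g x)"
    by (simp add: fourier_compactly_supported g cinner_cnj_L2 sq square_integrable_fourier_integral)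
  also have "\<dots> = C * (LINT x|lborel. LINT y|lborel. f x * (phase x y * g y))"
    by (simp add: fourier_integral_phase C_def mult.left_commute[of _ "complex_of_real (_ powr _)"])
  also have "\<dots> = C * (LINT y|lborel. LINT x|lborel. f x * (phase x y * g y))"
    by (simp add: Fub)
  also have "\<dots> = (LINT y|lborel. fourier_integral f y * g y)"
  proof -
    have "(LINT x|lborel. f x * (phase x y * g y)) = (LINT x|lborel. phase y x * f x) * g y" for y
    proof -
      have "(LINT x|lborel. f x * (phase x y * g y)) = (LINT x|lborel. phase y x * f x * g y)"
        by (rule Bochner_Integration.integral_cong) (simp_all add: phase_commute[of y] mult_ac)
      then show ?thesis by simp
    qed
    then show ?thesis by (simp add: fourier_integral_phase C_def mult.assoc)
  qed
  also have "\<dots> = cinner (cnj_L2 (fourier (L2_of f))) (L2_of g)"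
    by (simp add: fourier_compactly_supported f cinner_cnj_L2 sq square_integrable_fourier_integral)
  finally show ?thesis .
qed

lemma bounded_linear_fourier: "bounded_linear fourier"
  by (rule bounded_clinear_imp_linear[OF bounded_clinear_fourier])

text \<open>Density in one variable at a time: both sides are continuous in \<open>f\<close> and in
  \<open>g\<close>.\<close>

lemma fourier_multiplication_formula:
  "cinner (cnj_L2 f) (fourier g) = cinner (cnj_L2 (fourier f)) g"
proof -
  note cont = linear_continuous_on[OF bounded_linear_compose[OF bounded_linear_cinner_left bounded_linear_cnj_L2]]
    linear_continuous_on[OF bounded_linear_compose[OF bounded_linear_cinner_left bounded_linear_compose[OF
      bounded_linear_cnj_L2 bounded_linear_fourier]]]
    linear_continuous_on[OF bounded_linear_compose[OF bounded_linear_cinner_right bounded_linear_fourier]]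
    linear_continuous_on[OF bounded_linear_cinner_right]
  have closed1: "closed {f. cinner (cnj_L2 f) (fourier g) = cinner (cnj_L2 (fourier f)) g}" for g :: "'a L2"
    by (intro closed_Collect_eq cont)
  have closed2: "closed {g. cinner (cnj_L2 f) (fourier g) = cinner (cnj_L2 (fourier f)) g}" for f :: "'a L2"
    by (intro closed_Collect_eq cont)
  show ?thesis
  proof (rule L2_density_induct[where P = "\<lambda>f. cinner (cnj_L2 f) (fourier g)
    = cinner (cnj_L2 (fourier f)) g", OF closed1])
    fix f0 :: "real ^ 'a \<Rightarrow> complex" assume f0: "compactly_supported f0"
    show "cinner (cnj_L2 (L2_of f0)) (fourier g) = cinner (cnj_L2 (fourier (L2_of f0))) g"
      by (rule L2_density_induct[where P = "\<lambda>g. cinner (cnj_L2 (L2_of f0)) (fourier g)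
        = cinner (cnj_L2 (fourier (L2_of f0))) g", OF closed2])
        (rule fourier_multiplication_formula_compact[OF f0])
  qed
qed

text \<open>Polarization recovers the real inner product from the norm; the imaginary part is the
  real inner product of \<open>\<i> *\<^sub>C f\<close> with \<open>g\<close>.\<close>

lemma cinner_eq_if_norm_preserving:
  assumes T: "bounded_clinear T" and n: "\<And>f. norm (T f) = norm f"
  shows "cinner (T f) (T g) = cinner f g"
proof -
  have inn: "inner (T f) (T g) = inner f g" for f g
    by (simp add: dot_norm n flip: bounded_clinear_simps(1)[OF T])
  have Im: "Im (cinner f g) = inner (\<i> *\<^sub>C f) g" for f g :: "'a L2"
    by (simp flip: Re_cinner)
  show ?thesis
    by (rule complex_eqI) (simp_all add: Re_cinner Im inn flip: bounded_clinear_scaleC[OF T])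
qed

text \<open>With two conjugations around \<open>fourier\<close>, the multiplication formula says
  precisely that this operator is the adjoint of \<open>fourier\<close>.\<close>

definition inverse_fourier :: "('d::finite) L2 \<Rightarrow> 'd L2" where
  "inverse_fourier f = cnj_L2 (fourier (cnj_L2 f))"

lemma cinner_inverse_fourier_left: "cinner (inverse_fourier f) g = cinner f (fourier g)"
  using fourier_multiplication_formula[of "cnj_L2 f" g] by (simp add: inverse_fourier_def)

lemma cinner_inverse_fourier_right: "cinner g (inverse_fourier f) = cinner (fourier g) f"
  using cinner_inverse_fourier_left[of f g] cinner_commute by metis

lemma norm_inverse_fourier [simp]: "norm (inverse_fourier f) = norm f"
  by (simp add: inverse_fourier_def)

lemma bounded_clinear_inverse_fourier: "bounded_clinear inverse_fourier"
  by (rule bounded_clinearI[where M = 1])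
    (simp_all add: inverse_fourier_def cnj_L2_add cnj_L2_scaleC bounded_clinear_simps[OF bounded_clinear_fourier]
      bounded_clinear_scaleC[OF bounded_clinear_fourier])

lemma cinner_fourier: "cinner (fourier f) (fourier g) = cinner f g"
  by (rule cinner_eq_if_norm_preserving[OF bounded_clinear_fourier norm_fourier])

lemma inverse_fourier_fourier [simp]: "inverse_fourier (fourier f) = f"
  by (rule cinner_eqI) (simp add: cinner_inverse_fourier_left cinner_fourier)

text \<open>Both \<open>fourier\<close> and its adjoint are isometric, so \<open>fourier\<close> is unitary.\<close>

lemma fourier_inverse_fourier [simp]: "fourier (inverse_fourier f) = f"
  by (rule cinner_eqI')
    (simp add: cinner_eq_if_norm_preserving[OF bounded_clinear_inverse_fourier norm_inverse_fourier]
      flip: cinner_inverse_fourier_left)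

lemma fourier_adj_eq: "fourier_adj = inverse_fourier"
proof
  fix y :: "'a L2"
  show "fourier_adj y = inverse_fourier y"
    unfolding adjoint_op_def
  proof (rule the_equality)
    show "inverse_fourier y \<in> UNIV \<and> (\<forall>x'\<in>UNIV. cinner (inverse_fourier y) x' = cinner y (fourier x'))"
      by (simp add: cinner_inverse_fourier_left)
  next
    fix x assume "x \<in> UNIV \<and> (\<forall>x'\<in>UNIV. cinner x x' = cinner y (fourier x'))"
    then show "x = inverse_fourier y"
      by (intro cinner_eqI) (simp add: cinner_inverse_fourier_left)
  qed
qed

section \<open>Translations and dilations under the Fourier transform\<close>

lemma fourier_affine_compact:
  fixes f :: "real ^ 'd::finite \<Rightarrow> complex"
  assumes f: "compactly_supported f" and h: "h > 0"
  shows "fourier (wco (\<lambda>x. 1) (1 / h) (- (1 / h) *\<^sub>R v) (L2_of f)) =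
    complex_of_real (h ^ CARD('d)) *\<^sub>C wco (phase v) h 0 (fourier (L2_of f))"
proof -
  have sq: "square_integrable f" using f by (auto simp: compactly_supported_def)
  then have [measurable]: "f \<in> borel_measurable borel" by (simp add: square_integrable_def)
  define g where "g x = f ((1 / h) *\<^sub>R x + - (1 / h) *\<^sub>R v)" for x
  have sqg: "square_integrable g"
    unfolding g_def using h by (intro square_integrable_affine sq) auto
  have [measurable]: "g \<in> borel_measurable borel" using sqg by (simp add: square_integrable_def)
  obtain r where r: "\<And>x. r < norm x \<Longrightarrow> f x = 0" using f by (auto simp: compactly_supported_def)
  have "g x = 0" if "h * r + norm v < norm x" for x
  proof -
    have "(1 / h) *\<^sub>R x + - (1 / h) *\<^sub>R v = (1 / h) *\<^sub>R (x - v)" by (simp add: scaleR_diff_right)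
    moreover have "r < norm (x - v) / h"
      using that norm_triangle_ineq2[of x v] h by (simp add: field_simps)
    then have "r < norm ((1 / h) *\<^sub>R (x - v))" unfolding norm_scaleR using h by simp
    ultimately show ?thesis using r by (simp add: g_def)
  qed
  then have csg: "compactly_supported g" using sqg by (auto simp: compactly_supported_def)
  have g_h: "g (h *\<^sub>R x + v) = f x" for x
    using h by (simp add: g_def scaleR_add_right)
  have "fourier_integral g \<xi> = complex_of_real (h ^ CARD('d)) * (phase v \<xi> * fourier_integral f (h *\<^sub>R \<xi>))" for \<xi>
  proof -
    have "(LINT x|lborel. phase \<xi> x * g x)
      = \<bar>h\<bar> ^ CARD('d) *\<^sub>R (LINT x|lborel. phase \<xi> (h *\<^sub>R x + v) * g (h *\<^sub>R x + v))"
      by (rule lborel_integral_affine) (use h in auto)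
    also have "(LINT x|lborel. phase \<xi> (h *\<^sub>R x + v) * g (h *\<^sub>R x + v))
      = (LINT x|lborel. phase v \<xi> * (phase (h *\<^sub>R \<xi>) x * f x))"
    proof -
      have "phase \<xi> (h *\<^sub>R x + v) = phase v \<xi> * phase (h *\<^sub>R \<xi>) x" for x
        unfolding phase_def exp_add[symmetric]
        by (rule arg_cong[where f = exp]) (simp add: inner_add_left inner_commute algebra_simps)
      then show ?thesis unfolding g_h by (simp add: mult.assoc)
    qed
    also have "(LINT x|lborel. phase v \<xi> * (phase (h *\<^sub>R \<xi>) x * f x))
      = phase v \<xi> * (LINT x|lborel. phase (h *\<^sub>R \<xi>) x * f x)"
      by simp
    finally show ?thesis
      using h by (simp add: fourier_integral_phase scaleR_conv_of_real[where 'a = complex] mult.left_commute)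
  qed
  then have eq: "fourier_integral g = (\<lambda>\<xi>. complex_of_real (h ^ CARD('d)) * (phase v \<xi> * fourier_integral f (h *\<^sub>R \<xi>
    + 0)))"
    by auto
  have "wco (\<lambda>x. 1) (1 / h) (- (1 / h) *\<^sub>R v) (L2_of f) = L2_of g"
    using h by (subst wco_L2_of) (simp_all add: sq g_def[abs_def])
  then have "fourier (wco (\<lambda>x. 1) (1 / h) (- (1 / h) *\<^sub>R v) (L2_of f)) = L2_of (fourier_integral g)"
    by (simp add: fourier_compactly_supported csg)
  also have "\<dots> = complex_of_real (h ^ CARD('d)) *\<^sub>C wco (phase v) h 0 (L2_of (fourier_integral f))"
    unfolding eq using h
    by (subst wco_L2_of) (simp_all add: square_integrable_fourier_integral f scaleC_L2_of square_integrable_wco del: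
      add_0_right)
  finally show ?thesis by (simp add: fourier_compactly_supported f)
qed

lemma fourier_affine:
  fixes f :: "('d::finite) L2"
  assumes h: "h > 0"
  shows "fourier (wco (\<lambda>x. 1) (1 / h) (- (1 / h) *\<^sub>R v) f) =
    complex_of_real (h ^ CARD('d)) *\<^sub>C wco (phase v) h 0 (fourier f)"
proof -
  have "bounded_linear (\<lambda>f :: 'd L2. fourier (wco (\<lambda>x. 1) (1 / h) (- (1 / h) *\<^sub>R v) f))"
    using h by (intro bounded_clinear_imp_linear bounded_clinear_compose[OF bounded_clinear_fourier]
      bounded_clinear_wco) auto
  moreover have "bounded_linear (\<lambda>f :: 'd L2. complex_of_real (h ^ CARD('d)) *\<^sub>C wco (phase v) h 0 (fourier f))"
    using h by (intro bounded_clinear_imp_linear bounded_clinear_cmult bounded_clinear_compose[OF bounded_clinear_wco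
      bounded_clinear_fourier]) auto
  ultimately have "closed {f :: 'd L2. fourier (wco (\<lambda>x. 1) (1 / h) (- (1 / h) *\<^sub>R v) f) =
      complex_of_real (h ^ CARD('d)) *\<^sub>C wco (phase v) h 0 (fourier f)}"
    by (intro closed_Collect_eq linear_continuous_on)
  then show ?thesis
    by (rule L2_density_induct) (rule fourier_affine_compact[OF _ h])
qed

lemma shifted_eq_wco:
  assumes "square_integrable \<phi>0" "h > 0"
  shows "shifted \<phi>0 h k = wco (\<lambda>x. 1) (1 / h) (- (1 / h) *\<^sub>R lattice_point h k) (L2_of \<phi>0)"
  using assms by (subst wco_L2_of) (simp_all add: shifted_def scaleR_diff_right)

lemma fourier_shifted:
  fixes \<phi>0 :: "real ^ 'd::finite \<Rightarrow> complex"
  assumes "square_integrable \<phi>0" "h > 0"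
  shows "fourier (shifted \<phi>0 h k) = complex_of_real (h ^ CARD('d)) *\<^sub>C wco (wave h k) h 0 (fourier (L2_of \<phi>0))"
proof -
  have "wave h k = phase (lattice_point h k)" by (rule ext) (rule wave_phase)
  then show ?thesis
    using fourier_affine[OF assms(2), of "lattice_point h k" "L2_of \<phi>0"]
    by (simp only: shifted_eq_wco[OF assms])
qed

section \<open>The discrete Fourier transform\<close>

definition dft_factor :: "'d::finite itself \<Rightarrow> real \<Rightarrow> real" where
  "dft_factor _ h = h ^ CARD('d) / (2 * pi) powr (real CARD('d) / 2)"

lemma dft_factor_sq: "((2 * pi) powr (real n / 2))\<^sup>2 = (2 * pi) ^ n"
  by (simp add: power2_eq_square powr_add[symmetric] powr_realpow)

lemma dfourier_eq:
  "dfourier h u = (\<Sum>\<^sub>\<infinity>n. (complex_of_real (dft_factor TYPE('d) h) * u n) *\<^sub>C (ebasis h n :: ('d::finite) L2))"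
  by (simp add: dfourier_def ebasis_def wave_def dft_factor_def)

abbreviation cube_proj :: "real \<Rightarrow> ('d::finite) L2 \<Rightarrow> 'd L2" where
  "cube_proj h \<equiv> wco (indicator (cube (pi / h))) 1 0"

lemma bounded_clinear_cube_proj: "bounded_clinear (cube_proj h)"
  by (intro bounded_clinear_wco) auto

lemma ell2_cmult: "u \<in> ell2 \<Longrightarrow> (\<lambda>n. (cmod (c * u n))\<^sup>2) summable_on UNIV"
  unfolding ell2_def norm_mult power_mult_distrib by (rule summable_on_cmult_right) simp

lemma dfourier_properties:
  fixes u :: "int ^ 'd::finite \<Rightarrow> complex"
  assumes h: "h > 0" and u: "u \<in> ell2"
  shows dfourier_has_sum:
      "((\<lambda>n. (complex_of_real (dft_factor TYPE('d) h) * u n) *\<^sub>C ebasis h n) has_sum dfourier h u) UNIV"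
    and norm_dfourier: "(norm (dfourier h u))\<^sup>2 = h ^ CARD('d) * (\<Sum>\<^sub>\<infinity>n. (cmod (u n))\<^sup>2)"
    and cinner_ebasis_dfourier: "cinner (ebasis h n) (dfourier h u)
      = complex_of_real ((2 * pi) powr (real CARD('d) / 2)) * u n"
    and cube_proj_dfourier: "cube_proj h (dfourier h u) = dfourier h u"
proof -
  define N where "N = (2 * pi / h) ^ CARD('d)"
  define \<kappa> where "\<kappa> = dft_factor TYPE('d) h"
  interpret orthogonal_family "ebasis h :: int ^ 'd \<Rightarrow> _" N
    unfolding N_def by (rule orthogonal_family_ebasis[OF h])
  obtain S where S: "((\<lambda>n. (complex_of_real \<kappa> * u n) *\<^sub>C ebasis h n) has_sum S) UNIV"
    "(norm S)\<^sup>2 = N * (\<Sum>\<^sub>\<infinity>n. (cmod (complex_of_real \<kappa> * u n))\<^sup>2)"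
    "\<And>n. cinner (ebasis h n) S = complex_of_real N * (complex_of_real \<kappa> * u n)"
    using has_sum_e[OF ell2_cmult[OF u]] by blast
  have DS: "dfourier h u = S"
    using S(1) by (simp add: dfourier_eq \<kappa>_def infsumI)
  show has: "((\<lambda>n. (complex_of_real (dft_factor TYPE('d) h) * u n) *\<^sub>C ebasis h n) has_sum dfourier h u) UNIV"
    using S(1) by (simp add: DS \<kappa>_def)
  have "N * \<kappa> = (2 * pi) powr (real CARD('d) / 2)"
  proof -
    have "N * \<kappa> = (2 * pi) ^ CARD('d) / (2 * pi) powr (real CARD('d) / 2)"
      using h by (simp add: N_def \<kappa>_def dft_factor_def power_divide)
    also have "\<dots> = (2 * pi) powr (real CARD('d) / 2)"
      unfolding dft_factor_sq[symmetric] by (simp add: power2_eq_square)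
    finally show ?thesis .
  qed
  then show "cinner (ebasis h n) (dfourier h u) = complex_of_real ((2 * pi) powr (real CARD('d) / 2)) * u n"
    using S(3)[of n] by (simp add: DS mult.assoc[symmetric] flip: of_real_mult)
  \<comment> \<open>This relation between the normalising constants is the unitarity of the discrete
    transform on the weighted sequence space.\<close>
  have "N * \<kappa>\<^sup>2 = h ^ CARD('d)"
    using h by (simp add: N_def \<kappa>_def dft_factor_def power_divide dft_factor_sq) (simp add: power2_eq_square)
  then show "(norm (dfourier h u))\<^sup>2 = h ^ CARD('d) * (\<Sum>\<^sub>\<infinity>n. (cmod (u n))\<^sup>2)"
    using S(2) by (simp add: DS norm_mult power_mult_distrib infsum_cmult_right' mult.assoc[symmetric])
  have "((\<lambda>n. cube_proj h ((complex_of_real \<kappa> * u n) *\<^sub>C ebasis h n)) has_sum cube_proj h S) UNIV"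
    by (rule has_sum_bounded_linear[OF bounded_clinear_imp_linear[OF bounded_clinear_cube_proj] S(1)])
  then show "cube_proj h (dfourier h u) = dfourier h u"
    using S(1) by (simp add: DS bounded_clinear_scaleC[OF bounded_clinear_cube_proj] wco_indicator_ebasis
      has_sum_unique)
qed

text \<open>Explicit candidate for the adjoint of \<open>dfourier\<close>; on functions supported in
  the cube it is also the inverse.\<close>

definition dcoeff :: "real \<Rightarrow> ('d::finite) L2 \<Rightarrow> int ^ 'd \<Rightarrow> complex" where
  "dcoeff h f k = cinner (ebasis h k) f / complex_of_real ((2 * pi) powr (real CARD('d) / 2))"

lemma dcoeff_ell2:
  assumes "h > 0"
  shows "dcoeff h f \<in> ell2"
proof -
  have "(\<lambda>k. cinner (ebasis h k) f) \<in> ell2"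
    using orthogonal_family.Bessel_summable[OF orthogonal_family_ebasis[OF assms]] by (simp add: ell2_def)
  from ell2_cmult[OF this, of "1 / complex_of_real ((2 * pi) powr (real CARD('a) / 2))"]
  show ?thesis by (simp add: ell2_def dcoeff_def[abs_def])
qed

lemma dcoeff_add: "dcoeff h (f + g) k = dcoeff h f k + dcoeff h g k"
  and dcoeff_diff: "dcoeff h (f - g) k = dcoeff h f k - dcoeff h g k"
  and dcoeff_scaleC: "dcoeff h (c *\<^sub>C f) k = c * dcoeff h f k"
  and dcoeff_zero [simp]: "dcoeff h 0 k = 0"
  by (simp_all add: dcoeff_def cinner_add_right cinner_diff_right add_divide_distrib diff_divide_distrib)

lemma dcoeff_dfourier: "h > 0 \<Longrightarrow> u \<in> ell2 \<Longrightarrow> dcoeff h (dfourier h u) = u"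
  by (rule ext) (simp add: dcoeff_def cinner_ebasis_dfourier)

lemma cinner_ebasis_cube_proj:
  fixes f :: "('d::finite) L2"
  shows "cinner (ebasis h k) (cube_proj h f) = cinner (ebasis h k) f"
proof -
  have "(\<lambda>x. cnj (indicator (cube (pi / h)) x)) = (indicator (cube (pi / h)) :: real ^ 'd \<Rightarrow> complex)"
    by (auto simp: indicator_def)
  then show ?thesis
    using cinner_wco[of "indicator (cube (pi / h))" "ebasis h k" 0 f] by (simp add: wco_indicator_ebasis)
qed

lemma cube_proj_idem [simp]: "cube_proj h (cube_proj h f) = cube_proj h f"
  by (subst wco_wco) (auto simp: indicator_inter_arith[symmetric])

text \<open>The constants of \<open>dfourier\<close> and \<open>dcoeff\<close> multiply to the
  inverse of (2 pi / h)^d, so this is the Fourier series of the projection of \<open>f\<close> to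
  the cube; the functions \<open>ebasis h n\<close> do not see the rest of \<open>f\<close>.\<close>

lemma dfourier_dcoeff:
  fixes f :: "('d::finite) L2"
  assumes h: "h > 0"
  shows "dfourier h (dcoeff h f) = cube_proj h f"
proof -
  have "complex_of_real (dft_factor TYPE('d) h) * dcoeff h f n =
      cinner (ebasis h n) (cube_proj h f) / complex_of_real ((2 * pi / h) ^ CARD('d))" for n
  proof -
    have "dft_factor TYPE('d) h / (2 * pi) powr (real CARD('d) / 2) = inverse ((2 * pi / h) ^ CARD('d))"
      unfolding dft_factor_def power_divide dft_factor_sq[symmetric] by (simp add: power2_eq_square)
    then have "complex_of_real (dft_factor TYPE('d) h) / complex_of_real ((2 * pi) powr (real CARD('d) / 2)) =
        inverse (complex_of_real ((2 * pi / h) ^ CARD('d)))"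
      by (simp only: of_real_divide[symmetric] of_real_inverse[symmetric])
    then have eq: "complex_of_real (dft_factor TYPE('d) h) / complex_of_real ((2 * pi) powr (real CARD('d) / 2)) * c =
        c / complex_of_real ((2 * pi / h) ^ CARD('d))" for c
      by (simp only: divide_inverse mult.commute)
    have "a * (c / s) = a / s * c" for a c s :: complex by simp
    then have "complex_of_real (dft_factor TYPE('d) h) * (c / complex_of_real ((2 * pi) powr (real CARD('d) / 2))) =
        c / complex_of_real ((2 * pi / h) ^ CARD('d))" for c
      using eq by (rule trans)
    then show ?thesis
      unfolding dcoeff_def cinner_ebasis_cube_proj .
  qed
  then show ?thesis
    using ebasis_expansion(1)[OF h cube_proj_idem, of f]
    by (simp add: dfourier_eq infsumI)
qed

lemma ell2_summable_mult:
  assumes "u \<in> ell2" "v \<in> ell2"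
  shows "(\<lambda>n. cnj (u n) * v n) summable_on UNIV"
proof (rule Infinite_Sum.abs_summable_summable, rule summable_on_comparison_test)
  show "(\<lambda>n. (cmod (u n))\<^sup>2 + (cmod (v n))\<^sup>2) summable_on UNIV"
    using assms by (intro summable_on_add) (auto simp: ell2_def)
  show "norm (cnj (u n) * v n) \<le> (cmod (u n))\<^sup>2 + (cmod (v n))\<^sup>2" for n
    using sum_squares_bound[of "cmod (u n)" "cmod (v n)"] mult_nonneg_nonneg[of "cmod (u n)" "cmod (v n)"]
    unfolding norm_mult complex_mod_cnj mult.assoc
    using mult_nonneg_nonneg[OF norm_ge_zero norm_ge_zero, of "u n" "v n"] by linarith
qed auto

lemma cinner_dfourier:
  fixes u :: "int ^ 'd::finite \<Rightarrow> complex"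
  assumes h: "h > 0" and u: "u \<in> ell2"
  shows "ell2_inner h (dcoeff h f) u = cinner f (dfourier h u)"
proof -
  have "((\<lambda>n. cinner f ((complex_of_real (dft_factor TYPE('d) h)
    * u n) *\<^sub>C ebasis h n)) has_sum cinner f (dfourier h u)) UNIV"
    by (rule has_sum_bounded_linear[OF bounded_linear_cinner_right dfourier_has_sum[OF h u]])
  moreover have "cinner f ((complex_of_real (dft_factor TYPE('d) h) * u n) *\<^sub>C ebasis h n) =
      complex_of_real (h ^ CARD('d)) * (cnj (dcoeff h f n) * u n)" for n
    unfolding dcoeff_def complex_cnj_divide cinner_commute[of f "ebasis h n", symmetric]
    by (simp add: dft_factor_def)
  ultimately have "((\<lambda>n. complex_of_real (h ^ CARD('d)) * (cnj (dcoeff h f n)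
    * u n)) has_sum cinner f (dfourier h u)) UNIV"
    by (simp only:)
  moreover have "((\<lambda>n. complex_of_real (h ^ CARD('d)) * (cnj (dcoeff h f n) * u n)) has_sum
      complex_of_real (h ^ CARD('d)) * (\<Sum>\<^sub>\<infinity>n. cnj (dcoeff h f n) * u n)) UNIV"
    by (intro has_sum_cmult_right has_sum_infsum ell2_summable_mult dcoeff_ell2 h u)
  ultimately show ?thesis
    unfolding ell2_inner_def by (rule has_sum_unique[symmetric])
qed

definition delta :: "'a \<Rightarrow> 'a \<Rightarrow> complex" where
  "delta k n = (if n = k then 1 else 0)"

lemma delta_ell2 [simp]: "delta k \<in> ell2"
proof -
  have "(\<lambda>n. (cmod (delta k n))\<^sup>2) summable_on UNIV"
    by (rule has_sum_imp_summable, rule has_sum_finite_neutralI[where B = "{k}"]) (auto simp: delta_def)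
  then show ?thesis by (simp add: ell2_def)
qed

lemma infsum_mult_delta: "(\<Sum>\<^sub>\<infinity>n. f n * delta k n) = f k"
proof -
  have "((\<lambda>n. f n * delta k n) has_sum f k) UNIV"
    by (rule has_sum_finite_neutralI[where B = "{k}"]) (auto simp: delta_def)
  then show ?thesis by (rule infsumI)
qed

lemma dfourier_delta:
  assumes "h > 0"
  shows "dfourier h (delta k) = complex_of_real (dft_factor TYPE('d) h) *\<^sub>C (ebasis h k :: ('d::finite) L2)"
proof -
  have "((\<lambda>n. (complex_of_real (dft_factor TYPE('d) h) * delta k n) *\<^sub>C ebasis h n) has_sum
      (complex_of_real (dft_factor TYPE('d) h) *\<^sub>C (ebasis h k :: ('d::finite) L2))) UNIV"
    by (rule has_sum_finite_neutralI[where B = "{k}"]) (auto simp: delta_def)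
  then show ?thesis using dfourier_has_sum[OF assms delta_ell2] has_sum_unique by blast
qed

text \<open>Uniqueness of the adjoint is checked by testing with the sequences
  \<open>delta k\<close>, which pick out single entries.\<close>

lemma dfourier_adj_eq:
  assumes h: "h > 0"
  shows "dfourier_adj h = dcoeff h"
proof
  fix y :: "'a L2"
  show "dfourier_adj h y = dcoeff h y"
    unfolding adjoint_op_def
  proof (rule the_equality)
    show "dcoeff h y \<in> ell2 \<and> (\<forall>x'\<in>ell2. ell2_inner h (dcoeff h y) x' = cinner y (dfourier h x'))"
      by (auto simp: dcoeff_ell2 h cinner_dfourier)
  next
    fix x assume x: "x \<in> ell2 \<and> (\<forall>x'\<in>ell2. ell2_inner h x x' = cinner y (dfourier h x'))"
    show "x = dcoeff h y"
    proof
      fix k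
      have "ell2_inner h x (delta k) = ell2_inner h (dcoeff h y) (delta k)"
        using x by (simp add: cinner_dfourier h)
      then show "x k = dcoeff h y k"
        using h by (simp add: ell2_inner_def infsum_mult_delta)
    qed
  qed
qed

section \<open>Multiplication of lattice sequences\<close>

definition bounded_seq :: "('a \<Rightarrow> complex) \<Rightarrow> bool" where
  "bounded_seq v \<longleftrightarrow> (\<exists>M. \<forall>k. cmod (v k) \<le> M)"

lemma ell2_mult:
  assumes "\<And>k. cmod (v k) \<le> M" "u \<in> ell2"
  shows "(\<lambda>k. v k * u k) \<in> ell2"
    and "(\<Sum>\<^sub>\<infinity>k. (cmod (v k * u k))\<^sup>2) \<le> M\<^sup>2 * (\<Sum>\<^sub>\<infinity>k. (cmod (u k))\<^sup>2)"
proof -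
  have le: "(cmod (v k * u k))\<^sup>2 \<le> M\<^sup>2 * (cmod (u k))\<^sup>2" for k
    unfolding norm_mult power_mult_distrib by (intro mult_right_mono power_mono assms) auto
  have s: "(\<lambda>k. M\<^sup>2 * (cmod (u k))\<^sup>2) summable_on UNIV"
    using assms(2) by (intro summable_on_cmult_right) (simp add: ell2_def)
  have s': "(\<lambda>k. (cmod (v k * u k))\<^sup>2) summable_on UNIV"
    by (rule summable_on_comparison_test[OF s]) (use le in auto)
  then show "(\<lambda>k. v k * u k) \<in> ell2" by (simp add: ell2_def)
  have "(\<Sum>\<^sub>\<infinity>k. (cmod (v k * u k))\<^sup>2) \<le> (\<Sum>\<^sub>\<infinity>k. M\<^sup>2 * (cmod (u k))\<^sup>2)"
    by (rule infsum_mono[OF s' s le])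
  then show "(\<Sum>\<^sub>\<infinity>k. (cmod (v k * u k))\<^sup>2) \<le> M\<^sup>2 * (\<Sum>\<^sub>\<infinity>k. (cmod (u k))\<^sup>2)"
    by (simp add: infsum_cmult_right')
qed

lemma ell2_add: "u \<in> ell2 \<Longrightarrow> v \<in> ell2 \<Longrightarrow> (\<lambda>k. u k + v k) \<in> ell2"
proof -
  assume uv: "u \<in> ell2" "v \<in> ell2"
  have "(\<lambda>n. 2 * (cmod (u n))\<^sup>2 + 2 * (cmod (v n))\<^sup>2) summable_on UNIV"
    using uv by (intro summable_on_add summable_on_cmult_right) (auto simp: ell2_def)
  then have "(\<lambda>n. (cmod (u n + v n))\<^sup>2) summable_on UNIV"
  proof (rule summable_on_comparison_test)
    fix n
    have "(cmod (u n + v n))\<^sup>2 \<le> (cmod (u n) + cmod (v n))\<^sup>2"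
      by (intro power_mono norm_triangle_ineq) simp
    also have "\<dots> \<le> 2 * (cmod (u n))\<^sup>2 + 2 * (cmod (v n))\<^sup>2"
      using sum_squares_bound[of "cmod (u n)" "cmod (v n)"] by (simp add: power2_sum)
    finally show "(cmod (u n + v n))\<^sup>2 \<le> 2 * (cmod (u n))\<^sup>2 + 2 * (cmod (v n))\<^sup>2" .
  qed auto
  then show ?thesis by (simp add: ell2_def)
qed

lemma ell2_scale: "u \<in> ell2 \<Longrightarrow> (\<lambda>k. c * u k) \<in> ell2"
  using ell2_cmult[of u c] by (simp add: ell2_def)

lemma dfourier_add:
  assumes "h > 0" "u \<in> ell2" "v \<in> ell2"
  shows "dfourier h (\<lambda>k. u k + v k) = dfourier h u + dfourier h v"
proof -
  have "dfourier h (\<lambda>k. u k + v k) = dfourier h (dcoeff h (dfourier h u + dfourier h v))"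
    using assms by (intro arg_cong[where f = "dfourier h"] ext) (simp add: dcoeff_add dcoeff_dfourier)
  also have "\<dots> = dfourier h u + dfourier h v"
    using assms by (simp add: dfourier_dcoeff bounded_clinear_simps[OF bounded_clinear_cube_proj] cube_proj_dfourier)
  finally show ?thesis .
qed

lemma dfourier_scale:
  assumes "h > 0" "u \<in> ell2"
  shows "dfourier h (\<lambda>k. c * u k) = c *\<^sub>C dfourier h u"
proof -
  have "dfourier h (\<lambda>k. c * u k) = dfourier h (dcoeff h (c *\<^sub>C dfourier h u))"
    using assms by (intro arg_cong[where f = "dfourier h"] ext) (simp add: dcoeff_scaleC dcoeff_dfourier)
  also have "\<dots> = c *\<^sub>C dfourier h u"
    using assms by (simp add: dfourier_dcoeff bounded_clinear_scaleC[OF bounded_clinear_cube_proj] cube_proj_dfourier)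
  finally show ?thesis .
qed

text \<open>Multiplication by \<open>v\<close> on the lattice, seen through the discrete Fourier
  transform. It is defined on all of \<open>'d L2\<close> and ignores what lies outside the cube, so
  the discrete Hamiltonian can be handled by the same perturbation argument as the continuous
  one.\<close>

definition lattice_mult :: "real \<Rightarrow> (int ^ 'd \<Rightarrow> complex) \<Rightarrow> ('d::finite) L2 \<Rightarrow> 'd L2" where
  "lattice_mult h v f = dfourier h (\<lambda>k. v k * dcoeff h f k)"

lemma norm_cube_proj_le: "norm (cube_proj h f) \<le> norm f"
  using norm_wco_le[of "indicator (cube (pi / h))" 1 0 f] by (auto simp: indicator_def)

lemma norm_lattice_mult_le:
  assumes h: "h > 0" and v: "\<And>k. cmod (v k) \<le> M"
  shows "norm (lattice_mult h v f) \<le> M * norm f"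
proof -
  have M: "0 \<le> M" using v norm_ge_zero order_trans by blast
  have "(norm (lattice_mult h v f))\<^sup>2 = h ^ CARD('a) * (\<Sum>\<^sub>\<infinity>k. (cmod (v k * dcoeff h f k))\<^sup>2)"
    unfolding lattice_mult_def by (intro norm_dfourier h ell2_mult(1)[where M = M] v dcoeff_ell2)
  also have "\<dots> \<le> h ^ CARD('a) * (M\<^sup>2 * (\<Sum>\<^sub>\<infinity>k. (cmod (dcoeff h f k))\<^sup>2))"
    using h by (intro mult_left_mono ell2_mult(2) v dcoeff_ell2) auto
  also have "\<dots> = M\<^sup>2 * (norm (cube_proj h f))\<^sup>2"
    unfolding dfourier_dcoeff[OF h, symmetric] by (subst norm_dfourier) (auto simp: dcoeff_ell2 h)
  also have "\<dots> \<le> M\<^sup>2 * (norm f)\<^sup>2"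
    by (intro mult_left_mono power_mono norm_cube_proj_le) auto
  finally have "(norm (lattice_mult h v f))\<^sup>2 \<le> (M * norm f)\<^sup>2" by (simp add: power_mult_distrib)
  then show ?thesis by (rule power2_le_imp_le) (simp add: M)
qed

lemma bounded_clinear_lattice_mult:
  assumes h: "h > 0" and v: "bounded_seq v"
  shows "bounded_clinear (lattice_mult h v)"
proof -
  obtain M where M: "\<And>k. cmod (v k) \<le> M" using v by (auto simp: bounded_seq_def)
  show ?thesis
  proof (rule bounded_clinearI)
    show "lattice_mult h v (f + g) = lattice_mult h v f + lattice_mult h v g" for f g
      unfolding lattice_mult_def dcoeff_add distrib_left
      by (intro dfourier_add h ell2_mult(1)[where M = M] M dcoeff_ell2)
    show "lattice_mult h v (c *\<^sub>C f) = c *\<^sub>C lattice_mult h v f" for c f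
      unfolding lattice_mult_def dcoeff_scaleC mult.left_commute[of _ c]
      by (intro dfourier_scale h ell2_mult(1)[where M = M] M dcoeff_ell2)
    show "norm (lattice_mult h v f) \<le> M * norm f" for f
      by (rule norm_lattice_mult_le[OF h M])
  qed
qed

lemma cinner_lattice_mult:
  assumes h: "h > 0" and v: "bounded_seq v" and real: "\<And>k. cnj (v k) = v k"
  shows "cinner f (lattice_mult h v g) = cinner (lattice_mult h v f) g"
proof -
  obtain M where M: "\<And>k. cmod (v k) \<le> M" using v by (auto simp: bounded_seq_def)
  have eq: "cinner f (lattice_mult h v g) = ell2_inner h (dcoeff h f) (\<lambda>k. v k * dcoeff h g k)" for f g :: "'a L2"
    unfolding lattice_mult_def by (intro cinner_dfourier[symmetric] h ell2_mult(1)[where M = M] M dcoeff_ell2)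
  have "cinner (lattice_mult h v f) g = cnj (ell2_inner h (dcoeff h g) (\<lambda>k. v k * dcoeff h f k))"
    using eq[of g f] cinner_commute[of "lattice_mult h v f" g] by simp
  also have "\<dots> = ell2_inner h (dcoeff h f) (\<lambda>k. v k * dcoeff h g k)"
    by (simp add: ell2_inner_def real mult_ac flip: infsum_cnj)
  finally show ?thesis using eq by simp
qed

lemma dcoeff_lattice_mult:
  assumes h: "h > 0" and v: "bounded_seq v"
  shows "dcoeff h (lattice_mult h v f) = (\<lambda>k. v k * dcoeff h f k)"
proof -
  obtain M where M: "\<And>k. cmod (v k) \<le> M" using v by (auto simp: bounded_seq_def)
  show ?thesis
    unfolding lattice_mult_def by (intro dcoeff_dfourier h ell2_mult(1)[where M = M] M dcoeff_ell2)
qed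

section \<open>Embedding and discretization on the Fourier side\<close>

text \<open>The translates by 2 pi j of the cell [-pi, pi)^d that meet the cube of half-side 3 pi /
  2 are exactly those with these indices.\<close>

definition shift_indices :: "(int ^ 'd::finite) set" where
  "shift_indices = {j. \<forall>i. j $ i \<in> {- 1, 0, 1}}"

lemma finite_shift_indices [simp]: "finite (shift_indices :: (int ^ 'd::finite) set)"
proof -
  have "shift_indices = vec_lambda ` (PiE UNIV (\<lambda>_ :: 'd. {- 1, 0, 1 :: int}))"
  proof (intro equalityI subsetI)
    fix j :: "int ^ 'd" assume "j \<in> shift_indices"
    then have "vec_nth j \<in> PiE UNIV (\<lambda>_. {- 1, 0, 1})" by (auto simp: shift_indices_def)
    then show "j \<in> vec_lambda ` (PiE UNIV (\<lambda>_. {- 1, 0, 1}))" by (metis image_eqI vec_nth_inverse)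
  qed (auto simp: shift_indices_def PiE_def Pi_def)
  moreover have "finite (PiE UNIV (\<lambda>_ :: 'd. {- 1, 0, 1 :: int}))" by (rule finite_PiE) auto
  ultimately show ?thesis by (metis finite_imageI)
qed

text \<open>Half-open version of the cube, so that each point has exactly one representative modulo
  the dual lattice.\<close>

definition centered_box :: "real \<Rightarrow> (real ^ 'd) set" where
  "centered_box h = {x. \<forall>i. - (pi / h) \<le> x $ i \<and> x $ i < pi / h}"

lemma centered_box_iff: "x \<in> centered_box h \<longleftrightarrow> x + (\<chi> i. pi / h) \<in> half_open_box (2 * pi / h)"
proof -
  have "- (pi / h) \<le> t \<and> t < pi / h \<longleftrightarrow> 0 \<le> t + pi / h \<and> t + pi / h < 2 * pi / h" for t by auto
  then show ?thesis by (simp add: centered_box_def half_open_box_def)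
qed

lemma borel_centered_box [measurable, simp]: "centered_box h \<in> sets (borel :: (real ^ 'd::finite) measure)"
proof -
  have "(\<lambda>x. x + (\<chi> i. pi / h)) -` half_open_box (2 * pi / h) \<in> sets (borel :: (real ^ 'd) measure)"
    using measurable_sets_borel[OF measurable_affine_borel borel_half_open_box, of 1 "\<chi> i. pi / h" "2 * pi / h"]
      by simp
  moreover have "(\<lambda>x. x + (\<chi> i. pi / h)) -` half_open_box (2 * pi / h) = (centered_box h :: (real ^ 'd) set)"
    by (auto simp: centered_box_iff)
  ultimately show ?thesis by simp
qed

lemma centered_box_subset_cube: "x \<in> centered_box h \<Longrightarrow> x \<in> cube (pi / h)"
  by (auto simp: centered_box_def mem_cube intro: less_imp_le)

lemma centered_box_sum:
  fixes \<xi> :: "real ^ 'd::finite"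
  assumes h: "h > 0" and \<xi>: "h *\<^sub>R \<xi> \<in> cube (3 * pi / 2)"
  shows "(\<Sum>j\<in>shift_indices. indicator (centered_box h) (\<xi> - lattice_point (2 * pi / h) j)) = (1 :: complex)"
proof -
  define j0 :: "int ^ 'd" where "j0 = (\<chi> i. \<lfloor>(\<xi> + (\<chi> i. pi / h)) $ i / (2 * pi / h)\<rfloor>)"
  have h2: "2 * pi / h > 0" using h by simp
  have mem: "\<xi> - lattice_point (2 * pi / h) j \<in> centered_box h \<longleftrightarrow> j = j0" for j
    using lattice_cell[OF h2, of "\<xi> + (\<chi> i. pi / h)" j]
    by (simp add: centered_box_iff j0_def algebra_simps)
  have "j0 $ i \<in> {- 1, 0, 1}" for i
  proof -
    define t where "t = (\<xi> $ i + pi / h) / (2 * pi / h)"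
    define q where "q = (h * \<xi> $ i) / (2 * pi)"
    \<comment> \<open>Counted in periods of length 2 pi / h, the coordinate \<open>q\<close> lies in
      [-3/4, 3/4], so the floor of \<open>q + 1 / 2\<close> can only be -1, 0 or 1.\<close>
    have t: "t = q + 1 / 2" using h by (simp add: t_def q_def field_simps)
    have "- (3 * pi / 2) \<le> h * \<xi> $ i" "h * \<xi> $ i \<le> 3 * pi / 2" using \<xi> by (auto simp: mem_cube)
    then have "- 3 / 4 \<le> q" "q \<le> 3 / 4" by (simp_all add: q_def field_simps)
    then have "- 1 \<le> \<lfloor>t\<rfloor>" "\<lfloor>t\<rfloor> < 2" unfolding t by (simp_all add: le_floor_iff floor_less_iff)
    then have "\<lfloor>t\<rfloor> = - 1 \<or> \<lfloor>t\<rfloor> = 0 \<or> \<lfloor>t\<rfloor> = 1" by linarith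
    then show ?thesis by (auto simp: j0_def t_def)
  qed
  then have j0: "j0 \<in> shift_indices" by (simp add: shift_indices_def)
  have "(\<Sum>j\<in>shift_indices. indicator (centered_box h) (\<xi> - lattice_point (2 * pi / h) j)) =
      (\<Sum>j\<in>shift_indices. if j = j0 then 1 else (0 :: complex))"
    by (intro sum.cong) (auto simp: indicator_def mem)
  then show ?thesis using j0 by simp
qed

lemma wave_periodic:
  assumes "h > 0"
  shows "wave h k (x + lattice_point (2 * pi / h) j) = wave h k x"
proof -
  have "lattice_point h k \<bullet> lattice_point (2 * pi / h) j = 2 * pi * real_of_int (\<Sum>i\<in>UNIV. k $ i * j $ i)"
    using assms by (simp add: inner_vec_def lattice_point_def sum_distrib_left mult_ac)
  then have "- \<i> * complex_of_real (lattice_point h k \<bullet> (x + lattice_point (2 * pi / h) j)) =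
      - \<i> * complex_of_real (lattice_point h k \<bullet> x) + \<i> * (of_int (- (\<Sum>i\<in>UNIV. k $ i * j $ i)) * (of_real pi * 2))"
    by (simp add: inner_add_right algebra_simps)
  moreover have "exp (z + \<i> * (of_int m * (of_real pi * 2))) = exp z" for z m
    by (subst exp_eq) (intro exI[of _ m], simp add: mult_ac)
  ultimately show ?thesis unfolding wave_def by (simp only:)
qed

text \<open>The indicator selects the translate whose argument falls into the fundamental cell, so
  the sum over \<open>j\<close> is a periodic extension. The power of 2 pi compensates the
  normalisation of \<open>dfourier\<close>.\<close>

definition period_coeff :: "(real ^ 'd \<Rightarrow> complex) \<Rightarrow> real \<Rightarrow> int ^ 'd \<Rightarrow> real ^ 'd::finite \<Rightarrow> complex" where
  "period_coeff a h j \<xi> = complex_of_real ((2 * pi) powr (real CARD('d) / 2)) * a (h *\<^sub>R \<xi>) *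
    indicator (centered_box h) (\<xi> - lattice_point (2 * pi / h) j)"

text \<open>
  On the Fourier side the embedding extends a function on the cube \<open>cube (pi / h)\<close> periodically
  and multiplies it by the rescaled symbol; the support condition leaves only the translates
  by \<open>shift_indices\<close>.
\<close>

definition period_op :: "(real ^ 'd \<Rightarrow> complex) \<Rightarrow> real \<Rightarrow> ('d::finite) L2 \<Rightarrow> 'd L2" where
  "period_op a h g = (\<Sum>j\<in>shift_indices. wco (period_coeff a h j) 1 (- lattice_point (2 * pi / h) j) g)"

definition period_adj :: "(real ^ 'd \<Rightarrow> complex) \<Rightarrow> real \<Rightarrow> ('d::finite) L2 \<Rightarrow> 'd L2" where
  "period_adj a h f = (\<Sum>j\<in>shift_indices.
    wco (\<lambda>\<xi>. cnj (period_coeff a h j (\<xi> + lattice_point (2 * pi / h) j))) 1 (lattice_point (2 * pi / h) j) f)"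

lemma cmod_period_coeff_le:
  fixes a :: "real ^ 'd::finite \<Rightarrow> complex"
  assumes "\<And>\<xi>. cmod (a \<xi>) \<le> M"
  shows "cmod (period_coeff a h j \<xi>) \<le> (2 * pi) powr (real CARD('d) / 2) * M"
proof -
  have "cmod (a (h *\<^sub>R \<xi>)) * cmod (indicator (centered_box h) (\<xi> - lattice_point (2 * pi / h) j)) \<le> M"
    using assms[of "h *\<^sub>R \<xi>"] order_trans[OF norm_ge_zero assms[of 0]] by (auto simp: indicator_def)
  then show ?thesis by (simp add: period_coeff_def norm_mult mult.assoc)
qed

lemma borel_measurable_period_coeff [measurable]:
  assumes [measurable]: "a \<in> borel_measurable borel"
  shows "period_coeff a h j \<in> borel_measurable borel"
  unfolding period_coeff_def[abs_def] by measurable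

lemma bounded_measurable_period_coeff [simp]:
  assumes "bounded_measurable a"
  shows "bounded_measurable (period_coeff a h j)"
proof -
  obtain M where "\<And>\<xi>. cmod (a \<xi>) \<le> M" using assms by (auto simp: bounded_measurable_def)
  then show ?thesis
    using cmod_period_coeff_le borel_measurable_period_coeff[OF bounded_measurable_borel[OF assms]]
    by (blast intro: bounded_measurableI)
qed

lemma bounded_measurable_period_coeff_adj [simp]:
  assumes "bounded_measurable a"
  shows "bounded_measurable (\<lambda>\<xi>. cnj (period_coeff a h j (\<xi> + v)))"
  using bounded_measurable_cnj[OF bounded_measurable_affine[OF bounded_measurable_period_coeff[OF assms], of h j 1 v]]
  by simp

lemma bounded_clinear_period_op: "bounded_measurable a \<Longrightarrow> bounded_clinear (period_op a h)"
  unfolding period_op_def[abs_def] by (intro bounded_clinear_sum bounded_clinear_wco) auto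

lemma bounded_clinear_period_adj: "bounded_measurable a \<Longrightarrow> bounded_clinear (period_adj a h)"
  unfolding period_adj_def[abs_def] by (intro bounded_clinear_sum bounded_clinear_wco) auto

lemma norm_period_op_le:
  fixes a :: "real ^ 'd::finite \<Rightarrow> complex"
  assumes a: "a \<in> borel_measurable borel" and M: "\<And>\<xi>. cmod (a \<xi>) \<le> M"
  shows "norm (period_op a h g) \<le> real (card (shift_indices :: (int ^ 'd) set)) * ((2 * pi) powr (real CARD('d) / 2)
    * M) * norm g"
proof -
  have "norm (period_op a h g) \<le> (\<Sum>j\<in>(shift_indices :: (int ^ 'd) set). (2 * pi) powr (real CARD('d) / 2) * M
    * norm g)"
    unfolding period_op_def
    by (intro sum_norm_le norm_wco_le cmod_period_coeff_le M borel_measurable_period_coeff a)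
  then show ?thesis by simp
qed

lemma norm_period_adj_le:
  fixes a :: "real ^ 'd::finite \<Rightarrow> complex"
  assumes a: "a \<in> borel_measurable borel" and M: "\<And>\<xi>. cmod (a \<xi>) \<le> M"
  shows "norm (period_adj a h g) \<le> real (card (shift_indices :: (int ^ 'd) set)) * ((2 * pi) powr (real CARD('d) / 2)
    * M) * norm g"
proof -
  have b: "bounded_measurable a" using a M by (auto simp: bounded_measurable_def)
  have "norm (period_adj a h g) \<le> (\<Sum>j\<in>(shift_indices :: (int ^ 'd) set). (2 * pi) powr (real CARD('d) / 2) * M
    * norm g)"
    unfolding period_adj_def
    by (intro sum_norm_le norm_wco_le bounded_measurable_borel[OF bounded_measurable_period_coeff_adj[OF b]])
      (simp add: cmod_period_coeff_le M)
  then show ?thesis by simp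
qed

lemma cinner_period_op:
  assumes a: "bounded_measurable a"
  shows "cinner (period_op a h g) f = cinner g (period_adj a h f)"
proof -
  have "cinner f (period_op a h g) = cinner (period_adj a h f) g"
    unfolding period_op_def period_adj_def cinner_sum_left cinner_sum_right
    by (intro sum.cong refl) (simp add: cinner_wco a)
  then show ?thesis by (metis cinner_commute)
qed

text \<open>Fixes a representative of the transform whose bound and support conditions hold at every
  point, as the calculus of weights uses them everywhere.\<close>

definition fourier_symbol :: "(real ^ 'd \<Rightarrow> complex) \<Rightarrow> (real ^ 'd::finite \<Rightarrow> complex) \<Rightarrow> bool" where
  "fourier_symbol \<phi> a \<longleftrightarrow> square_integrable \<phi> \<and> bounded_measurable a \<and>
    (\<forall>\<xi>. \<xi> \<notin> cube (3 * pi / 2) \<longrightarrow> a \<xi> = 0) \<and> fourier (L2_of \<phi>) = L2_of a"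

lemma square_integrable_fourier_symbol: "fourier_symbol \<phi> a \<Longrightarrow> square_integrable a"
proof -
  assume a: "fourier_symbol \<phi> a"
  have "(\<lambda>\<xi>. a \<xi> * indicator (cube (3 * pi / 2)) \<xi>) = a"
  proof
    fix \<xi> show "a \<xi> * indicator (cube (3 * pi / 2)) \<xi> = a \<xi>"
      using a by (cases "\<xi> \<in> cube (3 * pi / 2)") (simp_all add: fourier_symbol_def)
  qed
  then show ?thesis
    using square_integrable_mult[OF _ square_integrable_indicator[OF bounded_cube cube_borel], of a "3 * pi / 2"] a
    by (simp add: fourier_symbol_def)
qed

lemma admissible_fourier_symbol:
  assumes "admissible \<phi>0 \<psi>0" "f \<in> {\<phi>0, \<psi>0}"
  shows "\<exists>a. fourier_symbol f a"
proof -
  have sq: "square_integrable f" using assms by (auto simp: admissible_def)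
  obtain M where M: "AE \<xi> in lborel. cmod (rep_L2 (fourier (L2_of f)) \<xi>) \<le> M"
    using assms by (auto simp: admissible_def)
  have supp: "AE \<xi> in lborel. \<xi> \<notin> cube (3 * pi / 2) \<longrightarrow> rep_L2 (fourier (L2_of f)) \<xi> = 0"
    using assms unfolding admissible_def by blast
  define r where "r = rep_L2 (fourier (L2_of f))"
  have [measurable]: "r \<in> borel_measurable borel" by (simp add: r_def)
  \<comment> \<open>Cutting off where the essential bound or the support condition fails changes the
    representative on a null set only.\<close>
  define S where "S = {\<xi>. cmod (r \<xi>) \<le> M} \<inter> cube (3 * pi / 2)"
  have [measurable]: "S \<in> sets borel" unfolding S_def by measurable
  define a where "a \<xi> = indicator S \<xi> * r \<xi>" for \<xi>
  have bm: "bounded_measurable a"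
  proof (rule bounded_measurableI[where M = "max M 0"])
    show "a \<in> borel_measurable borel" unfolding a_def by measurable
    show "cmod (a \<xi>) \<le> max M 0" for \<xi> by (auto simp: a_def S_def indicator_def)
  qed
  have supp_a: "\<xi> \<notin> cube (3 * pi / 2) \<Longrightarrow> a \<xi> = 0" for \<xi> by (auto simp: a_def S_def)
  have AE: "AE \<xi> in lborel. r \<xi> = a \<xi>"
    using M supp unfolding r_def[symmetric]
    by eventually_elim (auto simp: a_def S_def indicator_def)
  have sqa: "square_integrable a"
    using square_integrable_mult[OF bounded_measurable_indicator[OF \<open>S \<in> sets borel\<close>], of r]
    by (simp add: a_def[abs_def] r_def)
  have "L2_of r = L2_of a" by (rule L2_of_eqI) (use AE sqa in \<open>auto simp: r_def\<close>)
  then have "fourier (L2_of f) = L2_of a" by (simp add: r_def)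
  then show ?thesis using sq bm supp_a by (auto simp: fourier_symbol_def)
qed

lemma square_integrable_sum:
  "(\<And>i. i \<in> I \<Longrightarrow> square_integrable (f i)) \<Longrightarrow> square_integrable (\<lambda>x. \<Sum>i\<in>I. f i x)"
  by (induction I rule: infinite_finite_induct) (auto intro: square_integrable_add)

lemma L2_of_sum:
  assumes "\<And>i. i \<in> I \<Longrightarrow> square_integrable (f i)"
  shows "(\<Sum>i\<in>I. L2_of (f i)) = L2_of (\<lambda>x. \<Sum>i\<in>I. f i x)"
  using assms
  by (induction I rule: infinite_finite_induct) (simp_all add: L2_of_add square_integrable_sum)

text \<open>The waves have period 2 pi / h in every coordinate, so each translate carries the same
  wave, and the cell indicators sum to 1 wherever the symbol can be nonzero.\<close>

lemma period_op_ebasis: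
  fixes a :: "real ^ 'd::finite \<Rightarrow> complex"
  assumes a: "fourier_symbol \<phi> a" and h: "h > 0"
  shows "period_op a h (ebasis h k) =
    L2_of (\<lambda>\<xi>. complex_of_real ((2 * pi) powr (real CARD('d) / 2)) * (wave h k \<xi> * a (h *\<^sub>R \<xi>)))"
proof -
  let ?l = "lattice_point (2 * pi / h)"
  have bm: "bounded_measurable a" using a by (simp add: fourier_symbol_def)
  have sqj: "square_integrable (\<lambda>\<xi>. period_coeff a h j \<xi> * (indicator (cube (pi / h)) (\<xi> - ?l j) * wave h k (\<xi>
    - ?l j)))" for j
    using square_integrable_wco[OF bounded_measurable_period_coeff[OF bm, of h j], of 1
      "\<lambda>\<xi>. indicator (cube (pi / h)) \<xi> * wave h k \<xi>" "- ?l j"]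
    by (simp add: square_integrable_cube_wave)
  have "wco (period_coeff a h j) 1 (- ?l j) (ebasis h k) =
      L2_of (\<lambda>\<xi>. period_coeff a h j \<xi> * (indicator (cube (pi / h)) (\<xi> - ?l j) * wave h k (\<xi> - ?l j)))" for j
    unfolding ebasis_def by (subst wco_L2_of) (simp_all add: bm square_integrable_cube_wave)
  then have "period_op a h (ebasis h k) =
      (\<Sum>j\<in>shift_indices. L2_of (\<lambda>\<xi>. period_coeff a h j \<xi> * (indicator (cube (pi / h)) (\<xi> - ?l j) * wave h k (\<xi> - ?l
        j))))"
    by (simp add: period_op_def)
  also have "\<dots> = L2_of (\<lambda>\<xi>. \<Sum>j\<in>shift_indices. period_coeff a h j \<xi> * (indicator (cube (pi / h)) (\<xi> - ?l j)
    * wave h k (\<xi> - ?l j)))"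
    by (intro L2_of_sum sqj)
  also have "\<dots> = L2_of (\<lambda>\<xi>. complex_of_real ((2 * pi) powr (real CARD('d) / 2)) * (wave h k \<xi> * a (h *\<^sub>R \<xi>)))"
  proof (rule arg_cong[where f = L2_of], rule ext)
    fix \<xi> :: "real ^ 'd"
    have w: "wave h k (\<xi> - ?l j) = wave h k \<xi>" for j
      using wave_periodic[OF h, of k "\<xi> - ?l j" j] by simp
    have "(\<Sum>j\<in>shift_indices. period_coeff a h j \<xi> * (indicator (cube (pi / h)) (\<xi> - ?l j) * wave h k (\<xi> - ?l j))) =
        (\<Sum>j\<in>shift_indices. complex_of_real ((2 * pi) powr (real CARD('d) / 2)) * (wave h k \<xi> * a (h *\<^sub>R \<xi>)) *
          indicator (centered_box h) (\<xi> - ?l j))"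
    proof (rule sum.cong[OF refl])
      fix j
      show "period_coeff a h j \<xi> * (indicator (cube (pi / h)) (\<xi> - ?l j) * wave h k (\<xi> - ?l j)) =
          complex_of_real ((2 * pi) powr (real CARD('d) / 2)) * (wave h k \<xi> * a (h *\<^sub>R \<xi>)) *
          indicator (centered_box h) (\<xi> - ?l j)"
        unfolding period_coeff_def w
        by (cases "\<xi> - ?l j \<in> centered_box h") (simp_all add: centered_box_subset_cube)
    qed
    also have "\<dots> = complex_of_real ((2 * pi) powr (real CARD('d) / 2)) * (wave h k \<xi> * a (h *\<^sub>R \<xi>))"
    proof (cases "h *\<^sub>R \<xi> \<in> cube (3 * pi / 2)")
      case True
      then show ?thesis unfolding sum_distrib_left[symmetric] centered_box_sum[OF h True] by simp
    next
      case False
      then have "a (h *\<^sub>R \<xi>) = 0" using a by (simp add: fourier_symbol_def)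
      then show ?thesis by simp
    qed
    finally show "(\<Sum>j\<in>shift_indices. period_coeff a h j \<xi> * (indicator (cube (pi / h)) (\<xi> - ?l j) * wave h k (\<xi>
      - ?l j))) =
        complex_of_real ((2 * pi) powr (real CARD('d) / 2)) * (wave h k \<xi> * a (h *\<^sub>R \<xi>))" .
  qed
  finally show ?thesis .
qed

text \<open>Both sides are \<open>h ^ CARD('d)\<close> times the wave of index \<open>k\<close>
  times the dilated symbol. This identifies \<open>period_op\<close> with the embedding on unit
  sequences; linearity and continuity do the rest.\<close>

lemma fourier_shifted_symbol:
  fixes a :: "real ^ 'd::finite \<Rightarrow> complex"
  assumes a: "fourier_symbol \<phi> a" and h: "h > 0"
  shows "fourier (shifted \<phi> h k) = period_op a h (dfourier h (delta k))"
proof -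
  let ?s = "complex_of_real ((2 * pi) powr (real CARD('d) / 2))"
  have bm: "bounded_measurable a" and sq: "square_integrable \<phi>" and F: "fourier (L2_of \<phi>) = L2_of a"
    using a unfolding fourier_symbol_def by blast+
  have sqa: "square_integrable (\<lambda>\<xi>. wave h k \<xi> * a (h *\<^sub>R \<xi>))"
    using square_integrable_wco[OF bounded_measurable_wave, of h a h k 0] square_integrable_fourier_symbol[OF a] h
      by simp
  have "fourier (shifted \<phi> h k) = complex_of_real (h ^ CARD('d)) *\<^sub>C L2_of (\<lambda>\<xi>. wave h k \<xi> * a (h *\<^sub>R \<xi>))"
    unfolding fourier_shifted[OF sq h] F using h
    by (subst wco_L2_of) (simp_all add: square_integrable_fourier_symbol[OF a])
  moreover have "period_op a h (ebasis h k) = ?s *\<^sub>C L2_of (\<lambda>\<xi>. wave h k \<xi> * a (h *\<^sub>R \<xi>))"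
    by (simp add: period_op_ebasis[OF a h] scaleC_L2_of sqa)
  moreover have "complex_of_real (dft_factor TYPE('d) h) * ?s = complex_of_real (h ^ CARD('d))"
    by (simp add: dft_factor_def)
  moreover have "period_op a h (dfourier h (delta k))
    = complex_of_real (dft_factor TYPE('d) h) *\<^sub>C period_op a h (ebasis h k)"
    by (simp only: dfourier_delta[OF h] bounded_clinear_scaleC[OF bounded_clinear_period_op[OF bm]])
  ultimately show ?thesis by (simp only: scaleC_scaleC)
qed

text \<open>A bounded operator may be applied termwise to the convergent series that defines
  \<open>dfourier h u\<close>.\<close>

lemma shifted_has_sum_embedding:
  fixes a :: "real ^ 'd::finite \<Rightarrow> complex"
  assumes a: "fourier_symbol \<phi> a" and h: "h > 0" and u: "u \<in> ell2"
  shows "((\<lambda>k. u k *\<^sub>C shifted \<phi> h k) has_sum inverse_fourier (period_op a h (dfourier h u))) UNIV"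
proof -
  have bm: "bounded_measurable a" using a unfolding fourier_symbol_def by blast+
  define T where "T f = inverse_fourier (period_op a h f)" for f
  have T: "bounded_clinear T"
    unfolding T_def[abs_def] by (intro bounded_clinear_compose[OF bounded_clinear_inverse_fourier]
      bounded_clinear_period_op bm)
  have "((\<lambda>k. T ((complex_of_real (dft_factor TYPE('d) h) * u k) *\<^sub>C ebasis h k)) has_sum T (dfourier h u)) UNIV"
    by (rule has_sum_bounded_linear[OF bounded_clinear_imp_linear[OF T] dfourier_has_sum[OF h u]])
  moreover have "T ((complex_of_real (dft_factor TYPE('d) h) * u k) *\<^sub>C ebasis h k) = u k *\<^sub>C shifted \<phi> h k" for k
  proof -
    have "(complex_of_real (dft_factor TYPE('d) h) * u k) *\<^sub>C ebasis h k = u k *\<^sub>C dfourier h (delta k)"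
      by (simp add: dfourier_delta[OF h] mult.commute)
    then show ?thesis
      by (simp add: bounded_clinear_scaleC[OF T]) (simp add: T_def flip: fourier_shifted_symbol[OF a h])
  qed
  ultimately show ?thesis by (simp add: T_def)
qed

lemma embedding_eq:
  "fourier_symbol \<phi> a \<Longrightarrow> h > 0 \<Longrightarrow> u \<in> ell2 \<Longrightarrow>
    embedding \<phi> h u = inverse_fourier (period_op a h (dfourier h u))"
  unfolding embedding_def by (intro infsumI shifted_has_sum_embedding)

text \<open>The discretization takes inner products with functions of the kind that the embedding
  sums, hence it is governed by the adjoint of \<open>period_op\<close>.\<close>

lemma discretization_eq:
  fixes b :: "real ^ 'd::finite \<Rightarrow> complex"
  assumes b: "fourier_symbol \<psi> b" and h: "h > 0"
  shows "discretization \<psi> h f = dcoeff h (period_adj b h (fourier f))"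
proof
  fix k
  have bm: "bounded_measurable b" using b unfolding fourier_symbol_def by blast+
  have "cinner (shifted \<psi> h k) f = cinner (fourier (shifted \<psi> h k)) (fourier f)"
    by (simp add: cinner_fourier)
  also have "\<dots> = complex_of_real (dft_factor TYPE('d) h) * cinner (ebasis h k) (period_adj b h (fourier f))"
    by (simp add: fourier_shifted_symbol[OF b h] cinner_period_op[OF bm] dfourier_delta[OF h])
  finally show "discretization \<psi> h f k = dcoeff h (period_adj b h (fourier f)) k"
    using h by (simp add: discretization_def dcoeff_def dft_factor_def)
qed

text \<open>Every weight of \<open>period_adj\<close> contains the indicator of the fundamental cell
  at the point \<open>\<xi>\<close> itself.\<close>

lemma cube_proj_period_adj:
  fixes b :: "real ^ 'd::finite \<Rightarrow> complex"
  assumes bm: "bounded_measurable b"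
  shows "cube_proj h (period_adj b h f) = period_adj b h f"
proof -
  let ?l = "lattice_point (2 * pi / h)"
  have "cube_proj h (wco (\<lambda>\<xi>. cnj (period_coeff b h j (\<xi> + ?l j))) 1 (?l j) f) =
      wco (\<lambda>\<xi>. cnj (period_coeff b h j (\<xi> + ?l j))) 1 (?l j) f" for j
  proof -
    have "(\<lambda>\<xi>. indicator (cube (pi / h)) \<xi> * cnj (period_coeff b h j (\<xi> + ?l j))) =
        (\<lambda>\<xi>. cnj (period_coeff b h j (\<xi> + ?l j)))"
    proof
      fix \<xi>
      show "indicator (cube (pi / h)) \<xi> * cnj (period_coeff b h j (\<xi> + ?l j)) = cnj (period_coeff b h j (\<xi> + ?l j))"
        by (cases "\<xi> \<in> centered_box h") (simp_all add: period_coeff_def centered_box_subset_cube)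
    qed
    then show ?thesis by (subst wco_wco) (simp_all add: bm)
  qed
  then show ?thesis
    by (simp add: period_adj_def linear_sum[OF bounded_linear.linear[OF bounded_clinear_imp_linear[OF
      bounded_clinear_cube_proj]]] o_def)
qed

lemma dfourier_discretization:
  assumes b: "fourier_symbol \<psi> b" and h: "h > 0"
  shows "dfourier h (discretization \<psi> h f) = period_adj b h (fourier f)"
proof -
  have bm: "bounded_measurable b" using b by (simp add: fourier_symbol_def)
  show ?thesis by (simp only: discretization_eq[OF b h] dfourier_dcoeff[OF h] cube_proj_period_adj[OF bm])
qed

section \<open>Biorthogonality on the Fourier side\<close>

lemma cinner_shifted:
  fixes \<phi> \<psi> :: "real ^ 'd::finite \<Rightarrow> complex"
  assumes sq: "square_integrable \<psi>" "square_integrable \<phi>" and h: "h > 0"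
  shows "cinner (shifted \<psi> h k) (shifted \<phi> h n)
    = complex_of_real (h ^ CARD('d)) * cinner (shifted \<psi> 1 k) (shifted \<phi> 1 n)"
proof -
  have [measurable]: "\<psi> \<in> borel_measurable borel" "\<phi> \<in> borel_measurable borel"
    using sq by (auto simp: square_integrable_def)
  have [measurable]: "(\<lambda>x. cnj (\<psi> x)) \<in> borel_measurable borel" by (rule borel_measurable_cnj) measurable
  have sqs: "square_integrable (\<lambda>x. f ((1 / h) *\<^sub>R (x - lattice_point h k)))"
    if "square_integrable f" "h > 0" for f :: "real ^ 'd \<Rightarrow> complex" and h k
    using square_integrable_affine[of "1 / h" f "- (1 / h) *\<^sub>R lattice_point h k"] that
    by (simp add: scaleR_diff_right)
  have lp: "lattice_point h k = h *\<^sub>R lattice_point 1 k" for k :: "int ^ 'd"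
    by (simp add: lattice_point_def vec_eq_iff)
  have "cinner (shifted \<psi> h k) (shifted \<phi> h n) =
      (LINT x|lborel. cnj (\<psi> ((1 / h) *\<^sub>R (x - lattice_point h k))) * \<phi> ((1 / h) *\<^sub>R (x - lattice_point h n)))"
    unfolding shifted_def by (intro cinner_L2_of sqs sq h)
  also have "\<dots> = \<bar>h\<bar> ^ CARD('d) *\<^sub>R
      (LINT x|lborel. cnj (\<psi> ((1 / h) *\<^sub>R (h *\<^sub>R x + 0 - lattice_point h k))) * \<phi> ((1 / h) *\<^sub>R (h *\<^sub>R x + 0 -
        lattice_point h n)))"
    by (rule lborel_integral_affine) (use h in auto)
  also have "(\<lambda>x. cnj (\<psi> ((1 / h) *\<^sub>R (h *\<^sub>R x + 0 - lattice_point h k))) * \<phi> ((1 / h) *\<^sub>R (h *\<^sub>R x + 0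
    - lattice_point h n))) =
      (\<lambda>x. cnj (\<psi> ((1 / 1) *\<^sub>R (x - lattice_point 1 k))) * \<phi> ((1 / 1) *\<^sub>R (x - lattice_point 1 n)))"
    using h by (simp add: lp scaleR_diff_right[symmetric])
  also have "(LINT x|lborel. cnj (\<psi> ((1 / 1) *\<^sub>R (x - lattice_point 1 k))) * \<phi> ((1 / 1) *\<^sub>R (x
    - lattice_point 1 n))) =
      cinner (shifted \<psi> 1 k) (shifted \<phi> 1 n)"
    unfolding shifted_def by (intro cinner_L2_of[symmetric] sqs sq) auto
  finally show ?thesis using h by (simp add: scaleR_conv_of_real)
qed

text \<open>Biorthogonality at mesh 1 gives it at mesh \<open>h\<close> by scaling, with a factor
  \<open>h ^ CARD('d)\<close> that the normalisation of the discretization removes.\<close>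

lemma discretization_embedding:
  fixes \<phi> \<psi> :: "real ^ 'd::finite \<Rightarrow> complex"
  assumes a: "fourier_symbol \<phi> a" and b: "fourier_symbol \<psi> b"
    and bi: "biorthogonal (shifted \<phi> 1) (shifted \<psi> 1)" and h: "h > 0" and u: "u \<in> ell2"
  shows "discretization \<psi> h (embedding \<phi> h u) = u"
proof
  fix k
  have sq: "square_integrable \<psi>" "square_integrable \<phi>" using a b unfolding fourier_symbol_def by blast+
  have "((\<lambda>n. cinner (shifted \<psi> h k) (u n *\<^sub>C shifted \<phi> h n)) has_sum cinner (shifted \<psi> h k) (embedding \<phi> h u)) UNIV"
    unfolding embedding_eq[OF a h u]
    by (rule has_sum_bounded_linear[OF bounded_linear_cinner_right shifted_has_sum_embedding[OF a h u]])
  moreover have "cinner (shifted \<psi> h k) (shifted \<phi> h n) = complex_of_real (h ^ CARD('d)) * delta k n" for n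
  proof -
    have "cinner (shifted \<psi> 1 k) (shifted \<phi> 1 n) = cnj (cinner (shifted \<phi> 1 n) (shifted \<psi> 1 k))"
      by (rule cinner_commute)
    also have "\<dots> = delta k n" using bi by (simp add: biorthogonal_def delta_def)
    finally show ?thesis by (simp add: cinner_shifted[OF sq h])
  qed
  ultimately have "((\<lambda>n. u n * (complex_of_real (h ^ CARD('d))
    * delta k n)) has_sum cinner (shifted \<psi> h k) (embedding \<phi> h u)) UNIV"
    by simp
  moreover have "((\<lambda>n. u n * (complex_of_real (h ^ CARD('d)) * delta k n)) has_sum u k
    * complex_of_real (h ^ CARD('d))) UNIV"
    by (rule has_sum_finite_neutralI[where B = "{k}"]) (auto simp: delta_def)
  ultimately have "cinner (shifted \<psi> h k) (embedding \<phi> h u) = u k * complex_of_real (h ^ CARD('d))"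
    by (rule has_sum_unique)
  then show "discretization \<psi> h (embedding \<phi> h u) k = u k" using h by (simp add: discretization_def)
qed

text \<open>Apply discretization after embedding at mesh 1 to the unit sequence at 0. On the Fourier
  side this says that the products of the two symbols, summed over the translates, equal a constant;
  over the cube of half-side pi / 2 almost every point leaves the support under each nonzero
  translation.\<close>

lemma fourier_symbol_product:
  fixes a b :: "real ^ 'd::finite \<Rightarrow> complex"
  assumes a: "fourier_symbol \<phi> a" and b: "fourier_symbol \<psi> b"
    and bi: "biorthogonal (shifted \<phi> 1) (shifted \<psi> 1)"
  shows "AE \<xi> in lborel. \<xi> \<in> cube (pi / 2) \<longrightarrow> complex_of_real ((2 * pi) ^ CARD('d)) * a \<xi> * cnj (b \<xi>) = 1"
proof -
  let ?l = "lattice_point (2 * pi) :: int ^ 'd \<Rightarrow> _" and ?s = "complex_of_real ((2 * pi) powr (real CARD('d) / 2))"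
  have ss: "?s * ?s = complex_of_real ((2 * pi) ^ CARD('d))"
    unfolding dft_factor_sq[symmetric] by (simp add: power2_eq_square)
  have bma: "bounded_measurable a" and bmb: "bounded_measurable b" using a b unfolding fourier_symbol_def by blast+
  have sqa: "square_integrable (\<lambda>\<xi>. ?s * a \<xi>)"
    by (intro square_integrable_scale square_integrable_fourier_symbol[OF a])
  have "dfourier 1 (discretization \<psi> 1 (embedding \<phi> 1 (delta 0))) = dfourier 1 (delta 0)"
    by (simp add: discretization_embedding[OF a b bi])
  then have eq: "period_adj b 1 (period_op a 1 (dfourier 1 (delta 0))) = dfourier 1 (delta 0)"
    by (simp add: embedding_eq[OF a] dfourier_discretization[OF b])
  have F: "dft_factor TYPE('d) 1 \<noteq> 0" by (simp add: dft_factor_def)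
  have "period_adj b 1 (period_op a 1 (ebasis 1 0)) = ebasis 1 0"
  proof -
    have "complex_of_real (dft_factor TYPE('d) 1) *\<^sub>C (period_adj b 1 (period_op a 1 (ebasis 1 0)) - ebasis 1 0) = 0"
      using eq by (simp add: dfourier_delta scaleC_diff_right bounded_clinear_scaleC[OF bounded_clinear_period_op[OF
        bma]]
        bounded_clinear_scaleC[OF bounded_clinear_period_adj[OF bmb]])
    then have "norm (period_adj b 1 (period_op a 1 (ebasis 1 0)) - ebasis 1 0) = 0"
      using F by (metis mult_eq_0_iff norm_eq_zero norm_scaleC of_real_eq_0_iff)
    then show ?thesis by simp
  qed
  moreover have "period_op a 1 (ebasis 1 0) = L2_of (\<lambda>\<xi>. ?s * a \<xi>)"
    by (simp add: period_op_ebasis[OF a])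
  moreover have "period_adj b 1 (L2_of (\<lambda>\<xi>. ?s * a \<xi>)) =
      L2_of (\<lambda>\<xi>. \<Sum>j\<in>shift_indices. cnj (period_coeff b 1 j (\<xi> + ?l j)) * (?s * a (\<xi> + ?l j)))"
  proof -
    have sqj: "square_integrable (\<lambda>\<xi>. cnj (period_coeff b 1 j (\<xi> + ?l j)) * (?s * a (\<xi> + ?l j)))" for j
      using square_integrable_wco[OF bounded_measurable_period_coeff_adj[OF bmb], of 1 _ 1 j "?l j" "?l j"] sqa
      by (simp add: square_integrable_scale)
    have "wco (\<lambda>\<xi>. cnj (period_coeff b 1 j (\<xi> + ?l j))) 1 (?l j) (L2_of (\<lambda>\<xi>. ?s * a \<xi>)) =
        L2_of (\<lambda>\<xi>. cnj (period_coeff b 1 j (\<xi> + ?l j)) * (?s * a (\<xi> + ?l j)))" for j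
      by (subst wco_L2_of) (simp_all add: sqa bmb)
    then have "period_adj b 1 (L2_of (\<lambda>\<xi>. ?s * a \<xi>)) =
        (\<Sum>j\<in>shift_indices. L2_of (\<lambda>\<xi>. cnj (period_coeff b 1 j (\<xi> + ?l j)) * (?s * a (\<xi> + ?l j))))"
      by (simp add: period_adj_def)
    also have "\<dots> = L2_of (\<lambda>\<xi>. \<Sum>j\<in>shift_indices. cnj (period_coeff b 1 j (\<xi> + ?l j)) * (?s * a (\<xi> + ?l j)))"
      by (intro L2_of_sum sqj)
    finally show ?thesis .
  qed
  ultimately have L2: "L2_of (\<lambda>\<xi>. \<Sum>j\<in>shift_indices. cnj (period_coeff b 1 j (\<xi> + ?l j)) * (?s * a (\<xi> + ?l j)))
    = ebasis 1 0"
    by simp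
  have "square_integrable (\<lambda>\<xi>. \<Sum>j\<in>shift_indices. cnj (period_coeff b 1 j (\<xi> + ?l j)) * (?s * a (\<xi> + ?l j)))"
  proof (rule square_integrable_sum)
    fix j
    show "square_integrable (\<lambda>\<xi>. cnj (period_coeff b 1 j (\<xi> + ?l j)) * (?s * a (\<xi> + ?l j)))"
      using square_integrable_wco[OF bounded_measurable_period_coeff_adj[OF bmb], of 1 _ 1 j "?l j" "?l j"] sqa
      by (simp add: square_integrable_scale)
  qed
  then have "AE \<xi> in lborel. (\<Sum>j\<in>shift_indices. cnj (period_coeff b 1 j (\<xi> + ?l j)) * (?s * a (\<xi> + ?l j))) =
      indicator (cube (pi / 1)) \<xi> * wave 1 0 \<xi>"
    by (rule L2_of_eq_iff[THEN iffD1, OF _ square_integrable_cube_wave L2[unfolded ebasis_def]])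
  then show ?thesis
    \<comment> \<open>The boundary must be excluded: a coordinate equal to -pi / 2 is moved by 2 pi
      onto 3 pi / 2, which still belongs to the support cube.\<close>
    using AE_interior_cube[of "pi / 2"] AE_interior_cube[of "- (pi / 2)"]
  proof eventually_elim
    case (elim \<xi>)
    show ?case
    proof
      assume "\<xi> \<in> cube (pi / 2)"
      then have \<xi>: "- (pi / 2) < \<xi> $ i" "\<xi> $ i < pi / 2" for i
        using elim by (auto simp: mem_cube order.strict_iff_order)
      have "- pi \<le> \<xi> $ i" "\<xi> $ i < pi" for i using \<xi>[of i] pi_gt_zero by linarith+
      then have cb: "\<xi> \<in> centered_box 1" by (simp add: centered_box_def)
      have "a (\<xi> + ?l j) = 0" if j: "j \<noteq> 0" for j
      proof -
        have "\<exists>i. j $ i \<noteq> 0" using j by (simp add: vec_eq_iff)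
        then obtain i where i: "j $ i \<noteq> 0" by blast
        have "(\<xi> + ?l j) $ i = \<xi> $ i + 2 * pi * real_of_int (j $ i)" by (simp add: lattice_point_def)
        moreover have "\<xi> $ i + 2 * pi * real_of_int (j $ i) > 3 * pi / 2 \<or> \<xi> $ i + 2 * pi * real_of_int (j $ i)
          < - (3 * pi / 2)"
        proof (cases "j $ i > 0")
          case True
          then have "2 * pi * 1 \<le> 2 * pi * real_of_int (j $ i)" by (intro mult_left_mono) auto
          then show ?thesis using \<xi>[of i] by linarith
        next
          case False
          with i have "real_of_int (j $ i) \<le> - 1" by linarith
          then have "2 * pi * real_of_int (j $ i) \<le> 2 * pi * (- 1)" by (intro mult_left_mono) auto
          then show ?thesis using \<xi>[of i] by linarith
        qed
        ultimately have "\<xi> + ?l j \<notin> cube (3 * pi / 2)"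
          unfolding mem_cube by (metis linorder_not_less)
        then show ?thesis using a by (simp add: fourier_symbol_def)
      qed
      then have "(\<Sum>j\<in>shift_indices. cnj (period_coeff b 1 j (\<xi> + ?l j)) * (?s * a (\<xi> + ?l j))) =
          (\<Sum>j\<in>{0}. cnj (period_coeff b 1 j (\<xi> + ?l j)) * (?s * a (\<xi> + ?l j)))"
        by (intro sum.mono_neutral_right[OF finite_shift_indices]) (simp add: shift_indices_def, simp)
      also have "\<dots> = ?s * ?s * a \<xi> * cnj (b \<xi>)"
        using cb by (simp add: period_coeff_def)
      finally have "?s * ?s * a \<xi> * cnj (b \<xi>) = indicator (cube (pi / 1)) \<xi> * wave 1 0 \<xi>"
        using elim by simp
      moreover have "\<xi> \<in> cube (pi / 1)" by (rule centered_box_subset_cube[OF cb])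
      ultimately show "complex_of_real ((2 * pi) ^ CARD('d)) * a \<xi> * cnj (b \<xi>) = 1"
        unfolding ss by simp
    qed
  qed
qed

section \<open>Resolvents of bounded symmetric perturbations\<close>

definition res_mult :: "(real ^ 'd \<Rightarrow> real) \<Rightarrow> complex \<Rightarrow> ('d::finite) L2 \<Rightarrow> 'd L2" where
  "res_mult G z = wco (\<lambda>\<xi>. 1 / (complex_of_real (G \<xi>) - z)) 1 0"

definition symmetric_op :: "(('d::finite) L2 \<Rightarrow> 'd L2) \<Rightarrow> real \<Rightarrow> bool" where
  "symmetric_op B M \<longleftrightarrow> bounded_clinear B \<and> (\<forall>f g. cinner f (B g) = cinner (B f) g) \<and>
    0 \<le> M \<and> (\<forall>f. norm (B f) \<le> M * norm f)"

lemma real_minus_nonreal: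
  fixes z :: complex
  assumes "Im z \<noteq> 0"
  shows "complex_of_real x - z \<noteq> 0" "cmod (1 / (complex_of_real x - z)) \<le> 1 / \<bar>Im z\<bar>"
proof -
  have "\<bar>Im z\<bar> \<le> cmod (complex_of_real x - z)"
    using abs_Im_le_cmod[of "complex_of_real x - z"] by simp
  then show "cmod (1 / (complex_of_real x - z)) \<le> 1 / \<bar>Im z\<bar>"
    using assms by (simp add: norm_divide frac_le)
  show "complex_of_real x - z \<noteq> 0" using assms by (auto simp: complex_eq_iff)
qed

context
  fixes G :: "real ^ 'd::finite \<Rightarrow> real" and z :: complex
  assumes G [measurable]: "G \<in> borel_measurable borel" and z: "Im z \<noteq> 0"
begin

lemma bounded_measurable_res: "bounded_measurable (\<lambda>\<xi>. 1 / (complex_of_real (G \<xi>) - z))"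
  by (rule bounded_measurableI[where M = "1 / \<bar>Im z\<bar>"]) (use real_minus_nonreal[OF z] in auto)

lemma bounded_clinear_res_mult: "bounded_clinear (res_mult G z)"
  unfolding res_mult_def by (intro bounded_clinear_wco bounded_measurable_res) simp

lemma norm_res_mult_le: "norm (res_mult G z f) \<le> norm f / \<bar>Im z\<bar>"
  using norm_wco_le[OF bounded_measurable_borel[OF bounded_measurable_res] real_minus_nonreal(2)[OF z], of 0 f]
  by (simp add: res_mult_def)

lemma AE_res_mult: "AE \<xi> in lborel. rep_L2 (res_mult G z k) \<xi> = 1 / (complex_of_real (G \<xi>) - z) * rep_L2 k \<xi>"
  unfolding res_mult_def wco_def
  using rep_L2_of[OF square_integrable_wco[OF bounded_measurable_res, of 1 "rep_L2 k" 0]] by simp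

text \<open>Replaces the equation for the possibly unbounded multiplication operator, with its
  domain, by one for a bounded multiplier, so that existence, uniqueness and bounds can be treated
  without domains.\<close>

lemma res_mult_iff: "w = res_mult G z k \<longleftrightarrow> w \<in> mult_domain G \<and> mult_op G w - z *\<^sub>C w = k"
proof
  assume w: "w = res_mult G z k"
  have b: "bounded_measurable (\<lambda>\<xi>. complex_of_real (G \<xi>) * (1 / (complex_of_real (G \<xi>) - z)))"
  proof -
    \<comment> \<open>Although \<open>G\<close> may be unbounded, \<open>G / (G - z)\<close> equals
      \<open>1 + z / (G - z)\<close> and is bounded, which puts the image of the multiplier into the
      domain.\<close>
    have "complex_of_real (G \<xi>) * (1 / (complex_of_real (G \<xi>) - z)) = 1 + z * (1 / (complex_of_real (G \<xi>) - z))" for \<xi>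
      using real_minus_nonreal(1)[OF z, of "G \<xi>"] by (simp add: field_simps)
    then show ?thesis
      using bounded_measurable_add[OF bounded_measurable_const[of 1] bounded_measurable_mult[OF
        bounded_measurable_const[of z] bounded_measurable_res]]
      by simp
  qed
  have AE: "AE \<xi> in lborel. complex_of_real (G \<xi>) * rep_L2 w \<xi> =
      complex_of_real (G \<xi>) * (1 / (complex_of_real (G \<xi>) - z)) * rep_L2 k \<xi>"
    using AE_res_mult[of k] unfolding w by eventually_elim simp
  have sq: "square_integrable (\<lambda>\<xi>. complex_of_real (G \<xi>) * (1 / (complex_of_real (G \<xi>) - z)) * rep_L2 k \<xi>)"
    by (intro square_integrable_mult b) simp
  have sqw: "square_integrable (\<lambda>\<xi>. complex_of_real (G \<xi>) * rep_L2 w \<xi>)"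
  proof -
    have "(\<integral>\<^sup>+\<xi>. ennreal ((cmod (complex_of_real (G \<xi>) * rep_L2 w \<xi>))\<^sup>2) \<partial>lborel) =
        (\<integral>\<^sup>+\<xi>. ennreal ((cmod (complex_of_real (G \<xi>) * (1 / (complex_of_real (G \<xi>) - z)) * rep_L2 k \<xi>))\<^sup>2) \<partial>lborel)"
      by (rule nn_integral_cong_AE) (use AE in eventually_elim, simp)
    then show ?thesis using sq by (simp add: square_integrable_iff_nn)
  qed
  have "mult_op G w - z *\<^sub>C w = L2_of (\<lambda>\<xi>. complex_of_real (G \<xi>) * rep_L2 w \<xi> - z * rep_L2 w \<xi>)"
    using scaleC_L2_of[of "rep_L2 w" z] L2_of_diff[OF sqw square_integrable_scale[of "rep_L2 w" z]]
    by (simp add: mult_op_def)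
  also have "\<dots> = L2_of (rep_L2 k)"
  proof (rule L2_of_eqI)
    show "square_integrable (\<lambda>\<xi>. complex_of_real (G \<xi>) * rep_L2 w \<xi> - z * rep_L2 w \<xi>)"
      by (intro square_integrable_diff sqw square_integrable_scale) simp
    show "AE \<xi> in lborel. complex_of_real (G \<xi>) * rep_L2 w \<xi> - z * rep_L2 w \<xi> = rep_L2 k \<xi>"
      using AE_res_mult[of k]
    proof eventually_elim
      case (elim \<xi>)
      have "complex_of_real (G \<xi>) * rep_L2 w \<xi> - z * rep_L2 w \<xi> = (complex_of_real (G \<xi>) - z) * rep_L2 w \<xi>"
        by (simp add: left_diff_distrib)
      also have "\<dots> = rep_L2 k \<xi>"
        using elim real_minus_nonreal(1)[OF z, of "G \<xi>"] by (simp add: w)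
      finally show ?case .
    qed
  qed simp
  finally show "w \<in> mult_domain G \<and> mult_op G w - z *\<^sub>C w = k"
    using sqw by (simp add: mult_domain_def)
next
  assume w: "w \<in> mult_domain G \<and> mult_op G w - z *\<^sub>C w = k"
  then have sqw: "square_integrable (\<lambda>\<xi>. complex_of_real (G \<xi>) * rep_L2 w \<xi>)" by (simp add: mult_domain_def)
  have sqd: "square_integrable (\<lambda>\<xi>. complex_of_real (G \<xi>) * rep_L2 w \<xi> - z * rep_L2 w \<xi>)"
    by (intro square_integrable_diff sqw square_integrable_scale) simp
  have k: "k = L2_of (\<lambda>\<xi>. complex_of_real (G \<xi>) * rep_L2 w \<xi> - z * rep_L2 w \<xi>)"
    using w scaleC_L2_of[of "rep_L2 w" z] L2_of_diff[OF sqw square_integrable_scale[of "rep_L2 w" z]]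
    by (simp add: mult_op_def)
  have "1 / (complex_of_real (G \<xi>) - z) * (complex_of_real (G \<xi>) * rep_L2 w \<xi> - z * rep_L2 w \<xi>) = rep_L2 w \<xi>" for \<xi>
  proof -
    have "complex_of_real (G \<xi>) * rep_L2 w \<xi> - z * rep_L2 w \<xi> = (complex_of_real (G \<xi>) - z) * rep_L2 w \<xi>"
      by (simp add: left_diff_distrib)
    then show ?thesis using real_minus_nonreal(1)[OF z, of "G \<xi>"] by simp
  qed
  then have "res_mult G z k = L2_of (rep_L2 w)"
    unfolding k res_mult_def by (subst wco_L2_of) (simp_all add: bounded_measurable_res sqd)
  then show "w = res_mult G z k" by simp
qed

text \<open>Write \<open>k\<close> as \<open>(G - z) w\<close>: multiplication by the real function
  \<open>G\<close> has a real quadratic form, so only \<open>- z\<close> contributes.\<close>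

lemma Im_cinner_res_mult:
  assumes "w = res_mult G z k"
  shows "Im (cinner w k) = - Im z * (norm w)\<^sup>2"
proof -
  have w: "w \<in> mult_domain G" "k = mult_op G w - z *\<^sub>C w"
    using assms unfolding res_mult_iff by auto
  then have sqw: "square_integrable (\<lambda>\<xi>. complex_of_real (G \<xi>) * rep_L2 w \<xi>)" by (simp add: mult_domain_def)
  have "cinner w (mult_op G w) = (LINT \<xi>|lborel. cnj (rep_L2 w \<xi>) * (complex_of_real (G \<xi>) * rep_L2 w \<xi>))"
    using cinner_L2_of[of "rep_L2 w", OF _ sqw] by (simp add: mult_op_def)
  also have "\<dots> = (LINT \<xi>|lborel. complex_of_real (G \<xi> * (cmod (rep_L2 w \<xi>))\<^sup>2))"
    by (intro Bochner_Integration.integral_cong refl) (simp add: complex_norm_square mult_ac del: of_real_power)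
  also have "\<dots> = complex_of_real (LINT \<xi>|lborel. G \<xi> * (cmod (rep_L2 w \<xi>))\<^sup>2)"
    by (rule integral_complex_of_real)
  finally have "Im (cinner w (mult_op G w)) = 0" by simp
  then show ?thesis by (simp add: w(2) cinner_diff_right cinner_self del: of_real_power)
qed

section \<open>Perturbation by a bounded symmetric operator\<close>

context
  fixes B :: "'d L2 \<Rightarrow> 'd L2" and M :: real
  assumes B: "symmetric_op B M"
begin

lemma B_linear: "bounded_clinear B"
  using B by (simp add: symmetric_op_def)

text \<open>The symmetric term has a real quadratic form and drops out of the imaginary part, so the
  bound is independent of both \<open>t\<close> and the size of \<open>B\<close>.\<close>

lemma resolvent_bound:
  assumes "w = res_mult G z (k - complex_of_real t *\<^sub>C B w)"
  shows "norm w \<le> norm k / \<bar>Im z\<bar>"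
proof -
  have "cnj (cinner w (B w)) = cinner w (B w)"
    using B cinner_commute[of "B w" w] by (simp add: symmetric_op_def)
  then have "Im (cinner w (B w)) = 0" by (metis Reals_cnj_iff complex_is_Real_iff)
  then have "Im (cinner w k) = - Im z * (norm w)\<^sup>2"
    using Im_cinner_res_mult[OF assms] by (simp add: cinner_diff_right)
  then have "\<bar>Im z\<bar> * (norm w)\<^sup>2 = \<bar>Im (cinner w k)\<bar>" by (simp add: abs_mult)
  also have "\<dots> \<le> norm w * norm k"
    using abs_Im_le_cmod[of "cinner w k"] cmod_cinner_le[of w k] by linarith
  finally have "norm w * (\<bar>Im z\<bar> * norm w) \<le> norm w * norm k" by (simp add: power2_eq_square mult_ac)
  then have "\<bar>Im z\<bar> * norm w \<le> norm k \<or> norm w = 0"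
    by (metis mult_le_cancel_left_pos norm_ge_zero order_le_less)
  then show ?thesis using z by (auto simp: field_simps)
qed

text \<open>
  The perturbation is switched on in small steps; each step is a contraction because the
  bound by \<open>1 / \<bar>Im z\<bar>\<close> is uniform in \<open>t\<close>.
\<close>

lemma resolvent_exists_step:
  assumes ex: "\<forall>k. \<exists>w. w = res_mult G z (k - complex_of_real t *\<^sub>C B w)"
    and s: "0 \<le> s" "s * M < \<bar>Im z\<bar>"
  shows "\<forall>k. \<exists>w. w = res_mult G z (k - complex_of_real (t + s) *\<^sub>C B w)"
proof
  fix k
  \<comment> \<open>\<open>S\<close> solves the equation at parameter \<open>t\<close>;
    \<open>Sdiff\<close> gives it the Lipschitz constant \<open>1 / |Im z|\<close>, whatever
    \<open>t\<close> is.\<close>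
  obtain S where S: "\<And>k. S k = res_mult G z (k - complex_of_real t *\<^sub>C B (S k))" using ex by metis
  have Sdiff: "norm (S k - S l) \<le> norm (k - l) / \<bar>Im z\<bar>" for k l
  proof (rule resolvent_bound[where t = t])
    have "S k - S l = res_mult G z ((k - complex_of_real t *\<^sub>C B (S k)) - (l - complex_of_real t *\<^sub>C B (S l)))"
      using S[of k] S[of l] by (simp add: bounded_clinear_simps(2)[OF bounded_clinear_res_mult])
    also have "(k - complex_of_real t *\<^sub>C B (S k)) - (l - complex_of_real t *\<^sub>C B (S l)) =
        (k - l) - complex_of_real t *\<^sub>C B (S k - S l)"
      by (simp add: bounded_clinear_simps[OF B_linear] scaleC_diff_right)
    finally show "S k - S l = res_mult G z ((k - l) - complex_of_real t *\<^sub>C B (S k - S l))" .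
  qed
  \<comment> \<open>A fixed point of \<open>T\<close> solves the equation at \<open>t + s\<close>,
    since the extra part of the perturbation is moved to the right-hand side.\<close>
  define T where "T w = S (k - complex_of_real s *\<^sub>C B w)" for w
  have "\<exists>!w. T w = w"
  proof (rule banach_fix_type[where c = "s * M / \<bar>Im z\<bar>"])
    show "0 \<le> s * M / \<bar>Im z\<bar>" using s B by (auto simp: symmetric_op_def)
    show "s * M / \<bar>Im z\<bar> < 1" using s z by (simp add: field_simps)
    show "\<forall>x y. dist (T x) (T y) \<le> s * M / \<bar>Im z\<bar> * dist x y"
    proof (intro allI)
    fix x y :: "'d L2"
    have "dist (T x) (T y) \<le> norm ((k - complex_of_real s *\<^sub>C B x) - (k - complex_of_real s *\<^sub>C B y)) / \<bar>Im z\<bar>"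
      unfolding T_def dist_norm by (rule Sdiff)
    also have "(k - complex_of_real s *\<^sub>C B x) - (k - complex_of_real s *\<^sub>C B y) = complex_of_real s *\<^sub>C B (y - x)"
      by (simp add: bounded_clinear_simps[OF B_linear] scaleC_diff_right)
    also have "norm (complex_of_real s *\<^sub>C B (y - x)) / \<bar>Im z\<bar> \<le> s * (M * norm (y - x)) / \<bar>Im z\<bar>"
      using B s by (intro divide_right_mono) (auto simp: symmetric_op_def intro: mult_left_mono)
    finally show "dist (T x) (T y) \<le> s * M / \<bar>Im z\<bar> * dist x y"
      by (simp add: dist_norm norm_minus_commute mult.assoc)
    qed
  qed
  then obtain w where "T w = w" by blast
  then have "w = S (k - complex_of_real s *\<^sub>C B w)" by (simp add: T_def)
  then have "w = res_mult G z (k - complex_of_real s *\<^sub>C B w - complex_of_real t *\<^sub>C B w)"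
    using S[of "k - complex_of_real s *\<^sub>C B w"] by simp
  moreover have "k - complex_of_real s *\<^sub>C B w - complex_of_real t *\<^sub>C B w = k - complex_of_real (t + s) *\<^sub>C B w"
    by (simp add: scaleC_add_left)
  ultimately show "\<exists>w. w = res_mult G z (k - complex_of_real (t + s) *\<^sub>C B w)" by auto
qed

lemma resolvent_exists: "\<exists>w. w = res_mult G z (k - B w)"
proof -
  \<comment> \<open>Steps of length \<open>1 / N\<close> satisfy the contraction condition
    \<open>s * M < |Im z|\<close> at every stage.\<close>
  obtain N :: nat where N: "M / \<bar>Im z\<bar> < real N" using reals_Archimedean2 by blast
  have M: "0 \<le> M" using B by (simp add: symmetric_op_def)
  then have N0: "0 < real N" using N z by (smt (verit) divide_nonneg_nonneg)
  have step: "\<forall>k. \<exists>w. w = res_mult G z (k - complex_of_real (real n / real N) *\<^sub>C B w)" for n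
  proof (induction n)
    case 0
    then show ?case by simp
  next
    case (Suc n)
    have "1 / real N * M < \<bar>Im z\<bar>" using N N0 z by (simp add: field_simps)
    from resolvent_exists_step[OF Suc _ this]
    show ?case using N0 by (simp add: add_divide_distrib add.commute)
  qed
  from step[of N] show ?thesis using N0 by simp
qed

text \<open>The resolvent at \<open>z\<close> of multiplication by \<open>G\<close> plus
  \<open>B\<close>, given as the solution of a fixed-point equation; existence and uniqueness make
  the choice harmless.\<close>

definition Res :: "'d L2 \<Rightarrow> 'd L2" where
  "Res k = (SOME w. w = res_mult G z (k - B w))"

lemma Res_eq: "Res k = res_mult G z (k - B (Res k))"
  unfolding Res_def by (rule someI_ex[OF resolvent_exists])

lemma Res_unique: "w = res_mult G z (k - B w) \<Longrightarrow> w = Res k"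
proof -
  assume w: "w = res_mult G z (k - B w)"
  have "w - Res k = res_mult G z (k - B w) - res_mult G z (k - B (Res k))"
    using w Res_eq[of k] by (rule arg_cong2[where f = "(-)"])
  also have "\<dots> = res_mult G z ((k - B w) - (k - B (Res k)))"
    by (simp only: bounded_clinear_simps(2)[OF bounded_clinear_res_mult])
  also have "(k - B w) - (k - B (Res k)) = 0 - complex_of_real 1 *\<^sub>C B (w - Res k)"
    by (simp add: bounded_clinear_simps[OF B_linear])
  finally have "norm (w - Res k) \<le> norm (0 :: 'd L2) / \<bar>Im z\<bar>" by (rule resolvent_bound)
  then show ?thesis by simp
qed

lemma norm_Res_le: "norm (Res k) \<le> norm k / \<bar>Im z\<bar>"
  using resolvent_bound[of "Res k" k 1] Res_eq[of k] by simp

lemma bounded_clinear_Res: "bounded_clinear Res"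
proof (rule bounded_clinearI[where M = "1 / \<bar>Im z\<bar>"])
  fix f g :: "'d L2" and c :: complex
  have "Res f + Res g = res_mult G z ((f - B (Res f)) + (g - B (Res g)))"
    using Res_eq[of f] Res_eq[of g] by (simp add: bounded_clinear_simps(1)[OF bounded_clinear_res_mult])
  also have "(f - B (Res f)) + (g - B (Res g)) = (f + g) - B (Res f + Res g)"
    by (simp add: bounded_clinear_simps[OF B_linear])
  finally show "Res (f + g) = Res f + Res g" by (rule Res_unique[symmetric])
  have "c *\<^sub>C Res f = res_mult G z (c *\<^sub>C (f - B (Res f)))"
    using Res_eq[of f] by (simp add: bounded_clinear_scaleC[OF bounded_clinear_res_mult])
  also have "c *\<^sub>C (f - B (Res f)) = c *\<^sub>C f - B (c *\<^sub>C Res f)"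
    by (simp add: bounded_clinear_scaleC[OF B_linear] scaleC_diff_right)
  finally show "Res (c *\<^sub>C f) = c *\<^sub>C Res f" by (rule Res_unique[symmetric])
  show "norm (Res f) \<le> 1 / \<bar>Im z\<bar> * norm f" using norm_Res_le[of f] by simp
qed

end

end

section \<open>Identification with the resolvents of the Hamiltonians\<close>

definition real_mult :: "(real ^ 'd \<Rightarrow> real) \<Rightarrow> ('d::finite) L2 \<Rightarrow> 'd L2" where
  "real_mult V = wco (\<lambda>x. complex_of_real (V x)) 1 0"

lemma mult_op_eq_real_mult: "mult_op V = real_mult V"
  by (rule ext) (simp add: mult_op_def real_mult_def wco_def)

definition bounded_potential :: "(real ^ 'd \<Rightarrow> real) \<Rightarrow> real \<Rightarrow> bool" where
  "bounded_potential V M \<longleftrightarrow> V \<in> borel_measurable (borel :: (real ^ 'd::finite) measure) \<and> (\<forall>x. \<bar>V x\<bar> \<le> M)"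

lemma symmetric_op_real_mult:
  assumes V: "bounded_potential V M"
  shows "symmetric_op (real_mult V) M"
proof -
  have [measurable]: "V \<in> borel_measurable borel" and M: "\<And>x. \<bar>V x\<bar> \<le> M"
    using V by (auto simp: bounded_potential_def)
  have bm: "bounded_measurable (\<lambda>x. complex_of_real (V x))"
    by (rule bounded_measurableI[where M = M]) (auto simp: M)
  have "0 \<le> M" using M[of 0] by linarith
  moreover have "norm (real_mult V f) \<le> M * norm f" for f
    unfolding real_mult_def by (rule norm_wco_le) (auto simp: M)
  moreover have "cinner f (real_mult V g) = cinner (real_mult V f) g" for f g
    unfolding real_mult_def by (subst cinner_wco[OF bm]) simp
  ultimately show ?thesis
    unfolding symmetric_op_def real_mult_def using bounded_clinear_wco[OF bm] by auto
qed

definition fourier_conj :: "(real ^ 'd \<Rightarrow> real) \<Rightarrow> ('d::finite) L2 \<Rightarrow> 'd L2" where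
  "fourier_conj V w = fourier (real_mult V (inverse_fourier w))"

lemma symmetric_op_fourier_conj:
  assumes "bounded_potential V M"
  shows "symmetric_op (fourier_conj V) M"
proof -
  note s = symmetric_op_real_mult[OF assms]
  have "cinner f (fourier_conj V g) = cinner (fourier_conj V f) g" for f g
    using s by (simp add: fourier_conj_def symmetric_op_def cinner_inverse_fourier_right flip:
      cinner_inverse_fourier_left)
  moreover have "norm (fourier_conj V f) \<le> M * norm f" for f
    using s norm_inverse_fourier[of f] by (auto simp: fourier_conj_def symmetric_op_def dest!: spec[of _
      "inverse_fourier f"])
  moreover have "bounded_clinear (fourier_conj V)"
    unfolding fourier_conj_def[abs_def]
    using s by (intro bounded_clinear_compose[OF bounded_clinear_fourier] bounded_clinear_compose[OF _
      bounded_clinear_inverse_fourier])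
      (simp add: symmetric_op_def)
  ultimately show ?thesis using s by (simp add: symmetric_op_def)
qed

text \<open>The Fourier transform carries the equation for \<open>H - z\<close>, including its
  domain condition, into the fixed-point equation. As the latter has exactly one solution, the
  description in \<open>the_inv_into\<close> denotes it.\<close>

lemma resolvent_eq:
  fixes G V :: "real ^ 'd::finite \<Rightarrow> real"
  assumes G: "G \<in> borel_measurable borel" and z: "Im z \<noteq> 0" and V: "bounded_potential V M"
  shows "resolvent G V z f = inverse_fourier (Res G z (fourier_conj V) (fourier f))"
proof -
  note s = symmetric_op_fourier_conj[OF V]
  note Fl = bounded_clinear_simps[OF bounded_clinear_fourier] bounded_clinear_scaleC[OF bounded_clinear_fourier]
  have iff: "x \<in> H0_domain G \<and> H_op G V x - z *\<^sub>C x = f \<longleftrightarrow> x = inverse_fourier (Res G z (fourier_conj V) (fourier f))"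
    for x
  proof -
    have "H_op G V x - z *\<^sub>C x = f \<longleftrightarrow> fourier (H_op G V x - z *\<^sub>C x) = fourier f"
      by (metis inverse_fourier_fourier)
    also have "fourier (H_op G V x - z *\<^sub>C x) = mult_op G (fourier x) - z *\<^sub>C fourier x + fourier_conj V (fourier x)"
      by (simp add: H_op_def H0_def fourier_adj_eq Fl fourier_conj_def mult_op_eq_real_mult)
    also have "\<dots> = fourier f \<longleftrightarrow> mult_op G (fourier x) - z *\<^sub>C fourier x = fourier f - fourier_conj V (fourier x)"
      by (auto simp: algebra_simps)
    finally have "x \<in> H0_domain G \<and> H_op G V x - z *\<^sub>C x = f \<longleftrightarrow>
        fourier x = res_mult G z (fourier f - fourier_conj V (fourier x))"
      by (simp add: res_mult_iff[OF G z] H0_domain_def)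
    also have "\<dots> \<longleftrightarrow> fourier x = Res G z (fourier_conj V) (fourier f)"
      using Res_unique[OF G z s] Res_eq[OF G z s, of "fourier f"] by metis
    also have "\<dots> \<longleftrightarrow> x = inverse_fourier (Res G z (fourier_conj V) (fourier f))"
      by (metis inverse_fourier_fourier fourier_inverse_fourier)
    finally show ?thesis .
  qed
  show ?thesis
    unfolding resolvent_def the_inv_into_def iff by simp
qed

lemma bounded_seq_lattice: "bounded_potential V M \<Longrightarrow> bounded_seq (\<lambda>k. complex_of_real (V (lattice_point h k)))"
  unfolding bounded_potential_def bounded_seq_def by (auto intro!: exI[of _ M])

definition lattice_potential :: "(real ^ 'd \<Rightarrow> real) \<Rightarrow> real \<Rightarrow> ('d::finite) L2 \<Rightarrow> 'd L2" where
  "lattice_potential V h = lattice_mult h (\<lambda>k. complex_of_real (V (lattice_point h k)))"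

lemma symmetric_op_lattice_potential:
  assumes V: "bounded_potential V M" and h: "h > 0"
  shows "symmetric_op (lattice_potential V h) M"
proof -
  have M: "\<And>x. \<bar>V x\<bar> \<le> M" using V by (auto simp: bounded_potential_def)
  have "norm (lattice_mult h (\<lambda>k. complex_of_real (V (lattice_point h k))) f) \<le> M * norm f" for f :: "'a L2"
    by (rule norm_lattice_mult_le[OF h]) (simp add: M)
  moreover have "0 \<le> M" using M[of 0] by linarith
  ultimately show ?thesis
    unfolding symmetric_op_def lattice_potential_def
    using bounded_clinear_lattice_mult[OF h bounded_seq_lattice[OF V]]
      cinner_lattice_mult[OF h bounded_seq_lattice[OF V]]
    by simp
qed

lemma cube_proj_res_mult:
  assumes G: "G \<in> borel_measurable borel" and z: "Im z \<noteq> 0"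
  shows "cube_proj h (res_mult G z f) = res_mult G z (cube_proj h f)"
  unfolding res_mult_def
  by (simp add: wco_wco bounded_measurable_res[OF G z] mult.commute)

lemma cube_proj_lattice_mult:
  assumes "h > 0" "bounded_seq v"
  shows "cube_proj h (lattice_mult h v f) = lattice_mult h v f"
proof -
  obtain M where "\<And>k. cmod (v k) \<le> M" using assms by (auto simp: bounded_seq_def)
  then show ?thesis
    unfolding lattice_mult_def by (intro cube_proj_dfourier assms ell2_mult(1)[where M = M] dcoeff_ell2)
qed

text \<open>Sequences correspond to functions on the cube. The projection \<open>cube_proj h\<close>
  commutes with the multiplier and absorbs the lattice potential, so the solution in the full space
  already lies in its range and comes from a sequence.\<close>

lemma resolvent_discrete_eq:
  fixes G V :: "real ^ 'd::finite \<Rightarrow> real"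
  assumes h: "h > 0" and Gh: "bounded_potential (discrete_symbol G h) N" and z: "Im z \<noteq> 0"
    and V: "bounded_potential V M" and g: "cube_proj h g = g"
  defines "R \<equiv> Res (discrete_symbol G h) z (lattice_potential V h)"
  shows "resolvent_discrete G V h z (dcoeff h g) = dcoeff h (R g)" and "cube_proj h (R g) = R g"
proof -
  let ?G = "discrete_symbol G h" and ?B = "lattice_potential V h"
  have G: "?G \<in> borel_measurable borel" using Gh by (simp add: bounded_potential_def)
  note s = symmetric_op_lattice_potential[OF V h]
  note sG = symmetric_op_real_mult[OF Gh]
  have linG: "bounded_clinear (real_mult ?G)" using sG by (simp add: symmetric_op_def)
  have linB: "bounded_clinear ?B" using s by (simp add: symmetric_op_def)
  note P = bounded_clinear_simps[OF bounded_clinear_cube_proj] bounded_clinear_scaleC[OF bounded_clinear_cube_proj]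
  have PB: "cube_proj h (?B w) = ?B w" for w
    unfolding lattice_potential_def by (rule cube_proj_lattice_mult[OF h bounded_seq_lattice[OF V]])
  show PR: "cube_proj h (R g) = R g"
    unfolding R_def
    by (subst (1 2) Res_eq[OF G z s]) (simp add: cube_proj_res_mult[OF G z] P PB g)
  have PG: "cube_proj h (real_mult ?G w) = real_mult ?G (cube_proj h w)" for w
  proof -
    have "bounded_measurable (\<lambda>x. complex_of_real (?G x))"
      using Gh by (auto simp: bounded_potential_def intro!: bounded_measurableI[where M = N])
    then show ?thesis by (simp add: real_mult_def wco_wco mult.commute)
  qed
  have iff: "u \<in> ell2 \<and> (\<lambda>k. H_discrete G V h u k - z * u k) = dcoeff h g \<longleftrightarrow> u = dcoeff h (R g)" for u
  proof (cases "u \<in> ell2")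
    case u: True
    define w where "w = dfourier h u"
    have w: "cube_proj h w = w" "dcoeff h w = u"
      using u h by (auto simp: w_def cube_proj_dfourier dcoeff_dfourier)
    define y where "y = real_mult ?G w + ?B w - z *\<^sub>C w"
    have "(\<lambda>k. H_discrete G V h u k - z * u k) = dcoeff h y"
    proof
      fix k
      have "dcoeff h (?B w) k = complex_of_real (V (lattice_point h k)) * u k"
        unfolding lattice_potential_def by (simp add: dcoeff_lattice_mult[OF h bounded_seq_lattice[OF V]] w)
      then show "H_discrete G V h u k - z * u k = dcoeff h y k"
        by (simp add: H_discrete_def H0_discrete_def dfourier_adj_eq[OF h] mult_op_eq_real_mult y_def
            dcoeff_add dcoeff_diff dcoeff_scaleC w flip: w_def)
    qed
    moreover have "dcoeff h y = dcoeff h g \<longleftrightarrow> y = g"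
    proof
      assume "dcoeff h y = dcoeff h g"
      then have "cube_proj h y = cube_proj h g" by (simp flip: dfourier_dcoeff[OF h])
      then show "y = g" by (simp add: y_def P PG PB w g)
    qed simp
    moreover have "y = g \<longleftrightarrow> w = res_mult ?G z (g - ?B w)"
    proof -
      have "w \<in> mult_domain ?G"
        unfolding mult_domain_def
        using Gh by (auto simp: bounded_potential_def intro!: square_integrable_mult bounded_measurableI[where M = N])
      then show ?thesis
        unfolding res_mult_iff[OF G z] by (auto simp: y_def mult_op_eq_real_mult algebra_simps)
    qed
    moreover have "w = res_mult ?G z (g - ?B w) \<longleftrightarrow> w = R g"
      unfolding R_def using Res_unique[OF G z s] Res_eq[OF G z s, of g] by metis
    moreover have "w = R g \<longleftrightarrow> u = dcoeff h (R g)"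
      using w PR by (metis dfourier_dcoeff[OF h] w_def)
    ultimately show ?thesis using u by simp
  next
    case False
    then show ?thesis using dcoeff_ell2[OF h] by auto
  qed
  show "resolvent_discrete G V h z (dcoeff h g) = dcoeff h (R g)"
    unfolding resolvent_discrete_def the_inv_into_def iff by simp
qed

section \<open>Commuting the potential with the discretization\<close>

definition weight :: "real \<Rightarrow> real \<Rightarrow> real ^ 'd \<Rightarrow> real" where
  "weight \<tau> r y = (r + norm y) powr (- \<tau>)"

lemma weight_nonneg [simp]: "0 \<le> weight \<tau> r y"
  by (simp add: weight_def)

lemma borel_measurable_weight [measurable]: "weight \<tau> r \<in> borel_measurable (borel :: (real ^ 'd::finite) measure)"
  unfolding weight_def[abs_def] by measurable

lemma nn_integral_powr_real:
  assumes s: "s > 1"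
  shows "(\<integral>\<^sup>+t. ennreal ((1 + \<bar>t\<bar>) powr (- s)) \<partial>lborel) < \<infinity>"
proof -
  define f where "f t = (1 + \<bar>t\<bar>) powr (- s)" for t :: real
  have [measurable]: "f \<in> borel_measurable borel" unfolding f_def by measurable
  have half: "(\<integral>\<^sup>+t. ennreal (f t) * indicator {0..} t \<partial>lborel) = ennreal (0 - (- (1 / (s - 1))))"
  proof -
    define F where "F t = - ((1 + t) powr (1 - s) / (s - 1))" for t :: real
    define g where "g t = indicator {0..} t * (1 + t) powr (- s)" for t :: real
    have [measurable]: "g \<in> borel_measurable borel" unfolding g_def by measurable
    have "(\<integral>\<^sup>+t. ennreal (g t) * indicator {0..} t \<partial>lborel) = 0 - F 0"
    proof (rule nn_integral_FTC_atLeast)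
      show "DERIV F t :> g t" if "0 \<le> t" for t
      proof -
        have "((\<lambda>t. (1 + t) powr (1 - s)) has_real_derivative ((1 - s) * (1 + t) powr (1 - s - 1))) (at t)"
          using that by (auto intro!: derivative_eq_intros)
        then have "((\<lambda>t. - ((1 + t) powr (1 - s) / (s - 1))) has_real_derivative - ((1 - s) * (1 + t) powr (1 - s
          - 1) / (s - 1))) (at t)"
          by (intro DERIV_minus DERIV_cdivide)
        moreover have "- ((1 - s) * (1 + t) powr (1 - s - 1) / (s - 1)) = g t"
          using s that by (simp add: g_def field_simps)
        ultimately show ?thesis by (simp add: F_def[abs_def])
      qed
      have "filterlim (\<lambda>t::real. 1 + t) at_top at_top"
        by (rule filterlim_tendsto_add_at_top[OF tendsto_const filterlim_ident])
      then have "((\<lambda>t::real. (1 + t) powr (1 - s)) \<longlongrightarrow> 0) at_top"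
        using s by (intro tendsto_neg_powr) auto
      then have "(F \<longlongrightarrow> - (0 / (s - 1))) at_top"
        unfolding F_def[abs_def] using s by (intro tendsto_intros) auto
      then show "(F \<longlongrightarrow> 0) at_top" by simp
    qed (auto simp: g_def)
    moreover have "ennreal (g t) * indicator {0..} t = ennreal (f t) * indicator {0..} t" for t
      by (simp add: g_def f_def indicator_def)
    ultimately show ?thesis by (simp add: F_def)
  qed
  have "(\<integral>\<^sup>+t. ennreal (f t) \<partial>lborel) \<le> (\<integral>\<^sup>+t. ennreal (f t) * indicator {0..} t + ennreal (f t)
    * indicator {0..} (- t) \<partial>lborel)"
    by (intro nn_integral_mono) (auto simp: indicator_def)
  also have "\<dots> = (\<integral>\<^sup>+t. ennreal (f t) * indicator {0..} t \<partial>lborel) + (\<integral>\<^sup>+t. ennreal (f t)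
    * indicator {0..} (- t) \<partial>lborel)"
    by (rule nn_integral_add) measurable
  also have "(\<integral>\<^sup>+t. ennreal (f t) * indicator {0..} (- t) \<partial>lborel)
    = (\<integral>\<^sup>+t. ennreal (f t) * indicator {0..} t \<partial>lborel)"
    using nn_integral_real_affine[of "\<lambda>t. ennreal (f t) * indicator {0..} (- t)" "- 1" 0] by (simp add: f_def)
  also have "\<dots> + \<dots> < \<infinity>" unfolding half by simp
  finally show ?thesis by (simp add: f_def)
qed

text \<open>The weight is a product of \<open>CARD('d)\<close> equal factors with exponent
  \<open>s = \<tau> / CARD('d)\<close>. Replacing the norm by one coordinate in each factor only
  enlarges it, and the integral splits into one-dimensional ones that converge because
  \<open>s > 1\<close>.\<close>

lemma nn_integral_weight_finite:
  assumes \<tau>: "\<tau> > real CARD('d::finite)"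
  shows "(\<integral>\<^sup>+y. ennreal (weight \<tau> 1 (y :: real ^ 'd)) \<partial>lborel) < \<infinity>"
proof -
  define s where "s = \<tau> / real CARD('d)"
  have s: "s > 1" using \<tau> by (simp add: s_def field_simps)
  have "(\<integral>\<^sup>+y. ennreal (weight \<tau> 1 (y :: real ^ 'd)) \<partial>lborel) \<le>
      (\<integral>\<^sup>+y. (\<Prod>b\<in>Basis. ennreal ((1 + \<bar>y \<bullet> b\<bar>) powr (- s))) \<partial>(lborel :: (real ^ 'd) measure))"
  proof (rule nn_integral_mono)
    fix y :: "real ^ 'd"
    have "weight \<tau> 1 y = (\<Prod>b\<in>(Basis :: (real ^ 'd) set). (1 + norm y) powr (- s))"
    proof -
      have "((1 + norm y) powr (- s)) ^ CARD('d) = (1 + norm y) powr (- s * real CARD('d))"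
      proof -
        have "0 < (1 + norm y) powr (- s)" using norm_ge_zero[of y] by (simp only: powr_gt_zero)
        then show ?thesis unfolding powr_powr[symmetric] by (rule powr_realpow[symmetric])
      qed
      also have "- s * real CARD('d) = - \<tau>" by (simp add: s_def)
      finally show ?thesis by (simp add: weight_def)
    qed
    also have "\<dots> \<le> (\<Prod>b\<in>(Basis :: (real ^ 'd) set). (1 + \<bar>y \<bullet> b\<bar>) powr (- s))"
      using s by (intro prod_mono conjI powr_mono2') (auto simp: Basis_le_norm)
    finally show "ennreal (weight \<tau> 1 y) \<le> (\<Prod>b\<in>Basis. ennreal ((1 + \<bar>y \<bullet> b\<bar>) powr (- s)))"
      by (simp add: prod_ennreal ennreal_leI)
  qed
  also have "\<dots> = (\<Prod>b\<in>(Basis :: (real ^ 'd) set). \<integral>\<^sup>+t. ennreal ((1 + \<bar>t\<bar>) powr (- s)) \<partial>lborel)"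
    by (rule nn_integral_lborel_prod) auto
  also have "\<dots> < \<infinity>"
    using nn_integral_powr_real[OF s] by (simp add: ennreal_prod_eq_top power_less_top_ennreal)
  finally show ?thesis .
qed

lemma nn_integral_weight_scale:
  assumes r: "r > 0"
  shows "(\<integral>\<^sup>+y. ennreal (weight \<tau> r (y :: real ^ 'd::finite)) \<partial>lborel) =
    ennreal (r powr (real CARD('d) - \<tau>)) * (\<integral>\<^sup>+y. ennreal (weight \<tau> 1 (y :: real ^ 'd)) \<partial>lborel)"
proof -
  have w: "weight \<tau> r (r *\<^sub>R y) = r powr (- \<tau>) * weight \<tau> 1 y" for y :: "real ^ 'd"
  proof -
    have "r + norm (r *\<^sub>R y) = r * (1 + norm y)" using r by (simp add: distrib_left)
    then show ?thesis unfolding weight_def using r by (simp add: powr_mult)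
  qed
  have "(\<integral>\<^sup>+y. ennreal (weight \<tau> r (y :: real ^ 'd)) \<partial>lborel) =
      ennreal (\<bar>r\<bar> ^ CARD('d)) * (\<integral>\<^sup>+y. ennreal (weight \<tau> r (r *\<^sub>R y + 0 :: real ^ 'd)) \<partial>lborel)"
    by (rule nn_integral_lborel_affine) (use r in auto)
  also have "\<dots> = ennreal (r ^ CARD('d)) * (ennreal (r powr (- \<tau>))
    * (\<integral>\<^sup>+y. ennreal (weight \<tau> 1 (y :: real ^ 'd)) \<partial>lborel))"
    using r by (simp add: w ennreal_mult nn_integral_cmult)
  also have "\<dots> = ennreal (r ^ CARD('d) * r powr (- \<tau>)) * (\<integral>\<^sup>+y. ennreal (weight \<tau> 1 (y :: real ^ 'd)) \<partial>lborel)"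
    using r by (simp add: ennreal_mult mult.assoc)
  also have "r ^ CARD('d) * r powr (- \<tau>) = r powr (real CARD('d) - \<tau>)"
    using r by (simp add: powr_diff powr_minus powr_realpow divide_inverse)
  finally show ?thesis .
qed

text \<open>For \<open>r \<ge> 1\<close> the weight varies by at most the factor
  \<open>(1 + CARD('d)) powr \<tau>\<close> over a unit cell, so each term is dominated by this
  factor times an average over a cell, and the sum by an integral.\<close>

lemma lattice_sum_weight_le:
  fixes y :: "real ^ 'd::finite"
  assumes r: "r \<ge> 1" and \<tau>: "\<tau> > 0"
  shows "(\<integral>\<^sup>+n. ennreal (weight \<tau> r (y - lattice_point 1 n)) \<partial>count_space UNIV) \<le>
    ennreal ((1 + real CARD('d)) powr \<tau>) * (\<integral>\<^sup>+y. ennreal (weight \<tau> r (y :: real ^ 'd)) \<partial>lborel)"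
proof -
  let ?D = "1 + real CARD('d)" and ?Q = "half_open_box 1 :: (real ^ 'd) set"
  have near: "weight \<tau> r (y - lattice_point 1 n) \<le> ?D powr \<tau> * weight \<tau> r (y - (s + lattice_point 1 n))"
    if s: "s \<in> ?Q" for s n
  proof -
    have "norm s \<le> (\<Sum>i\<in>UNIV. \<bar>s $ i\<bar>)" by (rule norm_le_l1_cart)
    also have "\<dots> \<le> (\<Sum>i\<in>(UNIV :: 'd set). 1)"
      using s by (intro sum_mono) (auto simp: half_open_box_def abs_le_iff intro: less_imp_le order_trans[of _ 0])
    finally have ns: "norm s \<le> real CARD('d)" by simp
    have "norm (y - (s + lattice_point 1 n)) \<le> norm (y - lattice_point 1 n) + norm s"
      using norm_triangle_ineq4[of "y - lattice_point 1 n" s] by (simp add: algebra_simps)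
    then have "r + norm (y - (s + lattice_point 1 n)) \<le> r + norm (y - lattice_point 1 n) + real CARD('d) * 1"
      using ns by simp
    also have "\<dots> \<le> r + norm (y - lattice_point 1 n) + real CARD('d) * (r + norm (y - lattice_point 1 n))"
      using r norm_ge_zero[of "y - lattice_point 1 n"] by (intro add_left_mono mult_left_mono) linarith+
    finally have le: "r + norm (y - (s + lattice_point 1 n)) \<le> ?D * (r + norm (y - lattice_point 1 n))"
      by (simp add: algebra_simps)
    have pos: "0 < r + norm (y - (s + lattice_point 1 n))" "0 < r + norm (y - lattice_point 1 n)"
      using r by (auto intro: add_pos_nonneg)
    have "(?D * (r + norm (y - lattice_point 1 n))) powr (- \<tau>) \<le> (r + norm (y - (s + lattice_point 1 n))) powr (- \<tau>)"
      using \<tau> pos by (intro powr_mono2' le) auto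
    then have "?D powr (- \<tau>) * weight \<tau> r (y - lattice_point 1 n) \<le> weight \<tau> r (y - (s + lattice_point 1 n))"
      using pos by (simp add: weight_def powr_mult)
    then have "?D powr \<tau> * (?D powr (- \<tau>) * weight \<tau> r (y - lattice_point 1 n))
      \<le> ?D powr \<tau> * weight \<tau> r (y - (s + lattice_point 1 n))"
      by (intro mult_left_mono) auto
    moreover have "?D powr \<tau> * ?D powr (- \<tau>) = 1" by (simp add: powr_add[symmetric])
    ultimately show ?thesis by (simp add: mult.assoc[symmetric])
  qed
  have "(\<integral>\<^sup>+n. ennreal (weight \<tau> r (y - lattice_point 1 n)) \<partial>count_space UNIV) =
      (\<integral>\<^sup>+s. indicator ?Q s * (\<integral>\<^sup>+n. ennreal (weight \<tau> r (y - lattice_point 1 n)) \<partial>count_space UNIV) \<partial>lborel)"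
    by (simp add: nn_integral_multc emeasure_half_open_box)
  also have "\<dots> \<le> (\<integral>\<^sup>+s. indicator ?Q s * (\<integral>\<^sup>+n. ennreal (?D powr \<tau> * weight \<tau> r (y - (s
    + lattice_point 1 n))) \<partial>count_space UNIV) \<partial>lborel)"
    using near by (intro nn_integral_mono) (auto simp: indicator_def intro!: nn_integral_mono ennreal_leI)
  also have "\<dots> = (\<integral>\<^sup>+s. ennreal (?D powr \<tau> * weight \<tau> r (y - s)) \<partial>lborel)"
    by (rule nn_integral_tiling[symmetric]) auto
  also have "\<dots> = ennreal (?D powr \<tau>) * (\<integral>\<^sup>+s. ennreal (weight \<tau> r (y - s)) \<partial>lborel)"
    by (simp add: ennreal_mult nn_integral_cmult)
  also have "(\<integral>\<^sup>+s. ennreal (weight \<tau> r (y - s)) \<partial>lborel) = (\<integral>\<^sup>+s. ennreal (weight \<tau> r (s :: real ^ 'd)) \<partial>lborel)"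
    using nn_integral_lborel_affine[of "\<lambda>s. ennreal (weight \<tau> r (y - s))" "- 1" y] by (simp add: weight_def)
  finally show ?thesis .
qed

text \<open>
  Schur's test for the kernel \<open>cnj (\<psi> (x / h - k)) * (V (h * k) - V x)\<close>. It is split at distance
  \<open>r = h powr (- \<theta>' / (\<tau> - d))\<close> from the diagonal, which balances the Hoelder bound
  \<open>(h * r) powr \<theta>\<close> on the near part against the tail \<open>r powr (d - \<tau>)\<close>.
\<close>

lemma kernel_bound:
  fixes \<psi> :: "real ^ 'd::finite \<Rightarrow> complex" and V :: "real ^ 'd \<Rightarrow> real"
  assumes \<tau>: "\<tau> > real CARD('d)" and \<theta>: "\<theta> > 0" and C': "C' \<ge> 0"
    and \<psi>: "\<And>x. cmod (\<psi> x) \<le> C' * (1 + norm x) powr (- \<tau>)"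
    and M: "\<And>x. \<bar>V x\<bar> \<le> M" and L: "\<And>x y. \<bar>V x - V y\<bar> \<le> L * norm (x - y) powr \<theta>"
    and \<theta>': "1 / \<theta>' = 1 / \<theta> + 1 / (\<tau> - real CARD('d))"
    and h: "0 < h" "h \<le> 1"
  defines "r \<equiv> h powr (- \<theta>' / (\<tau> - real CARD('d)))"
  shows "r \<ge> 1" and "r powr (real CARD('d) - \<tau>) = h powr \<theta>'"
    and "cmod (\<psi> ((1 / h) *\<^sub>R (x - lattice_point h k))) * \<bar>V (lattice_point h k) - V x\<bar> \<le>
      C' * (\<bar>L\<bar> + 2 * M * 2 powr \<tau>) *
        (h powr \<theta>' * weight \<tau> 1 ((1 / h) *\<^sub>R x - lattice_point 1 k) + weight \<tau> r ((1 / h) *\<^sub>R x - lattice_point 1 k))"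
proof -
  define e where "e = \<tau> - real CARD('d)"
  have e: "e > 0" using \<tau> by (simp add: e_def)
  have inv: "1 / \<theta>' = 1 / \<theta> + 1 / e" using \<theta>' by (simp add: e_def)
  then have "1 / \<theta>' > 0" using \<theta> e by (simp add: add_pos_pos)
  then have \<theta>'0: "\<theta>' > 0" by simp
  \<comment> \<open>The defining relation of \<open>\<theta>'\<close>, solved for the exponent of
    \<open>h\<close> in \<open>(h * r) powr \<theta>\<close>: both parts of the split kernel get the
    same rate.\<close>
  have expo: "\<theta> - \<theta> * \<theta>' / e = \<theta>'"
    using inv \<theta> e \<theta>'0 by (simp add: field_simps)
  show r1: "r \<ge> 1"
  proof -
    have "\<theta>' / e \<ge> 0" using \<theta>'0 e by simp
    then have "h powr 0 \<le> h powr (- (\<theta>' / e))" using h by (intro powr_mono') auto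
    then show ?thesis using h by (simp add: r_def e_def)
  qed
  have tail: "r powr (real CARD('d) - \<tau>) = h powr \<theta>'"
  proof -
    have "r powr (- e) = h powr ((- \<theta>' / e) * (- e))" unfolding r_def e_def by (rule powr_powr)
    also have "(- \<theta>' / e) * (- e) = \<theta>'" using e by simp
    finally show ?thesis by (simp add: e_def)
  qed
  show "r powr (real CARD('d) - \<tau>) = h powr \<theta>'" by (rule tail)
  define y where "y = (1 / h) *\<^sub>R x - lattice_point 1 k"
  have lp: "lattice_point h k = h *\<^sub>R lattice_point 1 k"
    by (simp add: lattice_point_def vec_eq_iff)
  have y: "(1 / h) *\<^sub>R (x - lattice_point h k) = y"
    using h by (simp add: y_def lp scaleR_diff_right)
  have xy: "lattice_point h k - x = - (h *\<^sub>R y)"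
    using h by (simp add: y_def lp scaleR_diff_right)
  have M0: "0 \<le> M" using M[of 0] by linarith
  have nn: "0 \<le> h powr \<theta>' * weight \<tau> 1 y" "0 \<le> weight \<tau> r y" by auto
  have Vd: "\<bar>V (lattice_point h k) - V x\<bar> \<le> \<bar>L\<bar> * (h powr \<theta> * norm y powr \<theta>)"
  proof -
    have "\<bar>V (lattice_point h k) - V x\<bar> \<le> L * norm (h *\<^sub>R y) powr \<theta>"
      using L[of "lattice_point h k" x] unfolding xy by simp
    also have "\<dots> \<le> \<bar>L\<bar> * norm (h *\<^sub>R y) powr \<theta>" by (intro mult_right_mono) auto
    also have "norm (h *\<^sub>R y) powr \<theta> = h powr \<theta> * norm y powr \<theta>" using h by (simp add: powr_mult)
    finally show ?thesis .
  qed
  have "cmod (\<psi> y) * \<bar>V (lattice_point h k) - V x\<bar> \<le>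
      C' * (\<bar>L\<bar> * (h powr \<theta>' * weight \<tau> 1 y) + 2 * M * 2 powr \<tau> * weight \<tau> r y)"
  proof (cases "norm y \<le> r")
    case True
    have "h powr \<theta> * norm y powr \<theta> \<le> h powr \<theta> * r powr \<theta>"
      using True \<theta> by (intro mult_left_mono powr_mono2) auto
    also have "\<dots> = h powr \<theta>'"
    proof -
      have "r powr \<theta> = h powr (- \<theta>' / e * \<theta>)" unfolding r_def e_def by (rule powr_powr)
      then have "h powr \<theta> * r powr \<theta> = h powr (\<theta> + - \<theta>' / e * \<theta>)" by (simp only: powr_add)
      also have "\<theta> + - \<theta>' / e * \<theta> = \<theta>'" using expo by (simp add: mult.commute)
      finally show ?thesis .
    qed
    finally have "\<bar>V (lattice_point h k) - V x\<bar> \<le> \<bar>L\<bar> * h powr \<theta>'"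
      using Vd by (meson abs_ge_zero mult_left_mono order_trans)
    then have "cmod (\<psi> y) * \<bar>V (lattice_point h k) - V x\<bar> \<le> (C' * weight \<tau> 1 y) * (\<bar>L\<bar> * h powr \<theta>')"
      using \<psi>[of y] C' by (intro mult_mono) (auto simp: weight_def)
    also have "\<dots> = C' * (\<bar>L\<bar> * (h powr \<theta>' * weight \<tau> 1 y))" by (simp add: mult_ac)
    also have "\<dots> \<le> C' * (\<bar>L\<bar> * (h powr \<theta>' * weight \<tau> 1 y) + 2 * M * 2 powr \<tau> * weight \<tau> r y)"
      using C' M0 nn by (intro mult_left_mono) auto
    finally show ?thesis .
  next
    case False
    have "\<bar>V (lattice_point h k) - V x\<bar> \<le> 2 * M" using M[of "lattice_point h k"] M[of x] by linarith
    \<comment> \<open>Here \<open>norm y > r\<close>, so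
      \<open>(r + norm y) / 2 \<le> norm y\<close>, and the tail is measured with the weight of
      scale \<open>r\<close>.\<close>
    moreover have "weight \<tau> 1 y \<le> 2 powr \<tau> * weight \<tau> r y"
    proof -
      have "((r + norm y) / 2) powr (- \<tau>) \<ge> (1 + norm y) powr (- \<tau>)"
        using False r1 \<tau> by (intro powr_mono2') auto
      moreover have "((r + norm y) / 2) powr (- \<tau>) = 2 powr \<tau> * (r + norm y) powr (- \<tau>)"
        using r1 by (simp add: powr_divide powr_minus_divide)
      ultimately show ?thesis by (simp add: weight_def)
    qed
    ultimately have "cmod (\<psi> y) * \<bar>V (lattice_point h k) - V x\<bar> \<le> (C' * (2 powr \<tau> * weight \<tau> r y)) * (2 * M)"
      using \<psi>[of y] C' by (intro mult_mono) (auto simp: weight_def intro: order_trans[OF _ mult_left_mono])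
    also have "\<dots> = C' * (2 * M * 2 powr \<tau> * weight \<tau> r y)" by (simp add: mult_ac)
    also have "\<dots> \<le> C' * (\<bar>L\<bar> * (h powr \<theta>' * weight \<tau> 1 y) + 2 * M * 2 powr \<tau> * weight \<tau> r y)"
      using C' nn by (intro mult_left_mono) auto
    finally show ?thesis .
  qed
  also have "\<dots> \<le> C' * ((\<bar>L\<bar> + 2 * M * 2 powr \<tau>) * (h powr \<theta>' * weight \<tau> 1 y + weight \<tau> r y))"
    using C' M0 nn by (intro mult_left_mono) (auto simp: algebra_simps)
  finally show "cmod (\<psi> ((1 / h) *\<^sub>R (x - lattice_point h k))) * \<bar>V (lattice_point h k) - V x\<bar> \<le>
      C' * (\<bar>L\<bar> + 2 * M * 2 powr \<tau>) *
        (h powr \<theta>' * weight \<tau> 1 ((1 / h) *\<^sub>R x - lattice_point 1 k) + weight \<tau> r ((1 / h) *\<^sub>R x - lattice_point 1 k))"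
    unfolding y by (simp add: y_def mult.assoc)
qed

text \<open>Schur's test: the kernel bound is written as a product of two square roots,
  Cauchy-Schwarz bounds each coefficient by a row integral, and Tonelli leaves a column sum. The
  factor \<open>h ^ CARD('d)\<close> of the row integral meets \<open>1 / h ^ (2 * CARD('d))\<close>
  from the squared normalisation, which gives the single power in the bound.\<close>

lemma commutator_coefficients_sum:
  fixes \<psi> :: "real ^ 'd::finite \<Rightarrow> complex" and V :: "real ^ 'd \<Rightarrow> real"
  assumes h: "0 < h" and \<psi>: "square_integrable \<psi>" and V: "bounded_potential V M"
    and W: "W \<in> borel_measurable borel" "\<And>y. 0 \<le> W y"
    and kernel: "\<And>x k. cmod (\<psi> ((1 / h) *\<^sub>R (x - lattice_point h k))) * \<bar>V (lattice_point h k) - V x\<bar>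
      \<le> W ((1 / h) *\<^sub>R x - lattice_point 1 k)"
    and A: "(\<integral>\<^sup>+y. ennreal (W y) \<partial>lborel) \<le> ennreal A" "0 \<le> A"
    and A': "\<And>y. (\<integral>\<^sup>+n. ennreal (W (y - lattice_point 1 n)) \<partial>count_space UNIV) \<le> ennreal A'" "0 \<le> A'"
  shows "(\<integral>\<^sup>+k. ennreal ((cmod (complex_of_real (V (lattice_point h k)) * discretization \<psi> h g k
      - discretization \<psi> h (real_mult V g) k))\<^sup>2) \<partial>count_space UNIV) \<le> ennreal (A * A' / h ^ CARD('d) * (norm g)\<^sup>2)"
proof -
  have Vm [measurable]: "V \<in> borel_measurable borel" using V by (simp add: bounded_potential_def)
  note W(1)[measurable]
  have [measurable]: "\<psi> \<in> borel_measurable borel" using \<psi> by (simp add: square_integrable_def)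
  define \<psi>k where "\<psi>k k x = \<psi> ((1 / h) *\<^sub>R (x - lattice_point h k))" for k x
  have sqk: "square_integrable (\<psi>k k)" for k
    unfolding \<psi>k_def using square_integrable_affine[of "1 / h" \<psi> "- (1 / h) *\<^sub>R lattice_point h k"] \<psi> h
    by (simp add: scaleR_diff_right)
  have [measurable]: "\<psi>k k \<in> borel_measurable borel" for k using sqk[of k] by (simp add: square_integrable_def)
  have bmV: "bounded_measurable (\<lambda>x. complex_of_real (V x))"
    using V by (auto simp: bounded_potential_def intro!: bounded_measurableI[where M = M])
  define c where "c k = complex_of_real (V (lattice_point h k)) * discretization \<psi> h g k
    - discretization \<psi> h (real_mult V g) k" for k
  define \<kappa> where "\<kappa> k x = W ((1 / h) *\<^sub>R x - lattice_point 1 k)" for k x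
  have [measurable]: "\<kappa> k \<in> borel_measurable borel" for k unfolding \<kappa>_def by measurable
  have \<kappa>0: "0 \<le> \<kappa> k x" for k x by (simp add: \<kappa>_def W)
  have bound: "ennreal ((cmod (c k))\<^sup>2) \<le> ennreal (A / h ^ CARD('d)) * (\<integral>\<^sup>+x. ennreal (\<kappa> k x
    * (cmod (rep_L2 g x))\<^sup>2) \<partial>lborel)" for k
  proof -
    let ?f = "\<lambda>x. cnj (\<psi>k k x) * (complex_of_real (V (lattice_point h k) - V x) * rep_L2 g x)"
    have sqd: "square_integrable (\<lambda>x. complex_of_real (V (lattice_point h k) - V x) * rep_L2 g x)"
    proof (intro square_integrable_mult bounded_measurableI[where M = "2 * M"])
      fix x show "cmod (complex_of_real (V (lattice_point h k) - V x)) \<le> 2 * M"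
      proof -
        have "\<bar>V (lattice_point h k)\<bar> \<le> M" "\<bar>V x\<bar> \<le> M" using V by (simp_all add: bounded_potential_def)
        then show ?thesis unfolding norm_of_real by linarith
      qed
    qed auto
    have int: "integrable lborel ?f" by (rule integrable_cnj_mult[OF sqk sqd])
    have "h ^ CARD('d) * c k = complex_of_real (V (lattice_point h k)) * cinner (shifted \<psi> h k) g
      - cinner (shifted \<psi> h k) (real_mult V g)"
      using h by (simp add: c_def discretization_def algebra_simps)
    also have "cinner (shifted \<psi> h k) g = (LINT x|lborel. cnj (\<psi>k k x) * rep_L2 g x)"
      using cinner_L2_of[OF sqk, of "rep_L2 g" k] by (simp add: shifted_def \<psi>k_def[abs_def])
    also have "complex_of_real (V (lattice_point h k)) * \<dots>
      = (LINT x|lborel. complex_of_real (V (lattice_point h k)) * (cnj (\<psi>k k x) * rep_L2 g x))"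
      by simp
    also have "cinner (shifted \<psi> h k) (real_mult V g)
      = (LINT x|lborel. cnj (\<psi>k k x) * (complex_of_real (V x) * rep_L2 g x))"
      using cinner_L2_of[OF sqk square_integrable_mult[OF bmV square_integrable_rep_L2], of k g]
      by (simp add: shifted_def \<psi>k_def[abs_def] real_mult_def wco_def)
    also have "(LINT x|lborel. complex_of_real (V (lattice_point h k)) * (cnj (\<psi>k k x) * rep_L2 g x)) - \<dots>
      = (LINT x|lborel. ?f x)"
    proof (subst Bochner_Integration.integral_diff[symmetric])
      show "integrable lborel (\<lambda>x. complex_of_real (V (lattice_point h k)) * (cnj (\<psi>k k x) * rep_L2 g x))"
        using integrable_cnj_mult[OF sqk, of "rep_L2 g" k] by auto
      show "integrable lborel (\<lambda>x. cnj (\<psi>k k x) * (complex_of_real (V x) * rep_L2 g x))"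
        by (rule integrable_cnj_mult[OF sqk square_integrable_mult[OF bmV square_integrable_rep_L2]])
    qed (simp add: algebra_simps)
    finally have ck: "h ^ CARD('d) * c k = (LINT x|lborel. ?f x)" .
    have "ennreal (cmod (LINT x|lborel. ?f x)) \<le> (\<integral>\<^sup>+x. ennreal (cmod (?f x)) \<partial>lborel)"
      by (rule integral_norm_bound_ennreal[OF int])
    also have "\<dots> \<le> (\<integral>\<^sup>+x. ennreal (sqrt (\<kappa> k x)) * ennreal (sqrt (\<kappa> k x) * cmod (rep_L2 g x)) \<partial>lborel)"
    proof (rule nn_integral_mono)
      fix x
      have "cmod (?f x) = (cmod (\<psi>k k x) * \<bar>V (lattice_point h k) - V x\<bar>) * cmod (rep_L2 g x)"
        unfolding norm_mult norm_of_real by simp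
      also have "\<dots> \<le> \<kappa> k x * cmod (rep_L2 g x)"
        unfolding \<psi>k_def \<kappa>_def by (intro mult_right_mono kernel) simp
      also have "\<dots> = sqrt (\<kappa> k x) * (sqrt (\<kappa> k x) * cmod (rep_L2 g x))"
        using \<kappa>0[of k x] by (simp add: mult.assoc[symmetric])
      finally show "ennreal (cmod (?f x)) \<le> ennreal (sqrt (\<kappa> k x)) * ennreal (sqrt (\<kappa> k x) * cmod (rep_L2 g x))"
        using \<kappa>0[of k x] by (simp add: ennreal_mult'[symmetric] ennreal_leI)
    qed
    finally have "(ennreal (cmod (LINT x|lborel. ?f x)))\<^sup>2
      \<le> (\<integral>\<^sup>+x. ennreal (sqrt (\<kappa> k x)) * ennreal (sqrt (\<kappa> k x) * cmod (rep_L2 g x)) \<partial>lborel)\<^sup>2"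
      by (rule power_mono) simp
    also have "\<dots> \<le> (\<integral>\<^sup>+x. (ennreal (sqrt (\<kappa> k x)))\<^sup>2 \<partial>lborel) * (\<integral>\<^sup>+x. (ennreal (sqrt (\<kappa> k x)
      * cmod (rep_L2 g x)))\<^sup>2 \<partial>lborel)"
      by (rule Cauchy_Schwarz_nn_integral) measurable
    also have "\<dots> = (\<integral>\<^sup>+x. ennreal (\<kappa> k x) \<partial>lborel) * (\<integral>\<^sup>+x. ennreal (\<kappa> k x * (cmod (rep_L2 g x))\<^sup>2) \<partial>lborel)"
      using \<kappa>0 by (simp add: ennreal_power power_mult_distrib)
    also have "(\<integral>\<^sup>+x. ennreal (\<kappa> k x) \<partial>lborel) \<le> ennreal (h ^ CARD('d) * A)"
    proof -
      have "(\<integral>\<^sup>+x. ennreal (\<kappa> k x) \<partial>lborel)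
        = ennreal (\<bar>h\<bar> ^ CARD('d)) * (\<integral>\<^sup>+x. ennreal (\<kappa> k (h *\<^sub>R x + h *\<^sub>R lattice_point 1 k)) \<partial>lborel)"
        by (rule nn_integral_lborel_affine) (use h in auto)
      also have "\<dots> \<le> ennreal (h ^ CARD('d)) * ennreal A"
        using A(1) h by (intro mult_mono) (auto simp: \<kappa>_def scaleR_add_right)
      finally show ?thesis using h A by (simp add: ennreal_mult)
    qed
    finally have le: "(ennreal (cmod (LINT x|lborel. ?f x)))\<^sup>2 \<le>
        ennreal (h ^ CARD('d) * A) * (\<integral>\<^sup>+x. ennreal (\<kappa> k x * (cmod (rep_L2 g x))\<^sup>2) \<partial>lborel)"
      by (simp add: mult_right_mono)
    have "ennreal ((cmod (c k))\<^sup>2) = ennreal (1 / (h ^ CARD('d))\<^sup>2) * (ennreal (cmod (LINT x|lborel. ?f x)))\<^sup>2"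
      using h unfolding ck[symmetric] norm_mult norm_of_real
      by (simp add: ennreal_power ennreal_mult'[symmetric] power_mult_distrib del: of_real_power)
    also have "\<dots> \<le> ennreal (1 / (h ^ CARD('d))\<^sup>2) * (ennreal (h ^ CARD('d) * A) * (\<integral>\<^sup>+x. ennreal (\<kappa> k x
      * (cmod (rep_L2 g x))\<^sup>2) \<partial>lborel))"
      by (intro mult_left_mono le) simp
    also have "\<dots> = ennreal (A / h ^ CARD('d)) * (\<integral>\<^sup>+x. ennreal (\<kappa> k x * (cmod (rep_L2 g x))\<^sup>2) \<partial>lborel)"
    proof -
      have "1 / (h ^ CARD('d))\<^sup>2 * (h ^ CARD('d) * A) = A / h ^ CARD('d)"
        using h by (simp add: power2_eq_square)
      then show ?thesis using h A by (simp add: mult.assoc[symmetric] ennreal_mult'[symmetric])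
    qed
    finally show ?thesis .
  qed
  have "(\<integral>\<^sup>+k. ennreal ((cmod (c k))\<^sup>2) \<partial>count_space UNIV) \<le>
      (\<integral>\<^sup>+k. ennreal (A / h ^ CARD('d)) * (\<integral>\<^sup>+x. ennreal (\<kappa> k x * (cmod (rep_L2 g x))\<^sup>2) \<partial>lborel) \<partial>count_space UNIV)"
    by (intro nn_integral_mono bound)
  also have "\<dots> = ennreal (A / h ^ CARD('d)) * (\<integral>\<^sup>+k. (\<integral>\<^sup>+x. ennreal (\<kappa> k x
    * (cmod (rep_L2 g x))\<^sup>2) \<partial>lborel) \<partial>count_space UNIV)"
    by (rule nn_integral_cmult) simp
  also have "(\<integral>\<^sup>+k. (\<integral>\<^sup>+x. ennreal (\<kappa> k x * (cmod (rep_L2 g x))\<^sup>2) \<partial>lborel) \<partial>count_space UNIV) =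
      (\<integral>\<^sup>+x. (\<integral>\<^sup>+k. ennreal (\<kappa> k x * (cmod (rep_L2 g x))\<^sup>2) \<partial>count_space UNIV) \<partial>lborel)"
    by (rule nn_integral_count_space_nn_integral[symmetric]) auto
  also have "\<dots> \<le> (\<integral>\<^sup>+x. ennreal A' * ennreal ((cmod (rep_L2 g x))\<^sup>2) \<partial>lborel)"
  proof (rule nn_integral_mono)
    fix x
    have "(\<integral>\<^sup>+k. ennreal (\<kappa> k x * (cmod (rep_L2 g x))\<^sup>2) \<partial>count_space UNIV) =
        (\<integral>\<^sup>+k. ennreal (\<kappa> k x) \<partial>count_space UNIV) * ennreal ((cmod (rep_L2 g x))\<^sup>2)"
      by (simp add: ennreal_mult' \<kappa>0 nn_integral_multc)
    also have "\<dots> \<le> ennreal A' * ennreal ((cmod (rep_L2 g x))\<^sup>2)"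
      unfolding \<kappa>_def by (intro mult_right_mono A'(1)) simp
    finally show "(\<integral>\<^sup>+k. ennreal (\<kappa> k x * (cmod (rep_L2 g x))\<^sup>2) \<partial>count_space UNIV)
      \<le> ennreal A' * ennreal ((cmod (rep_L2 g x))\<^sup>2)" .
  qed
  also have "\<dots> = ennreal (A' * (norm g)\<^sup>2)"
    using A' by (simp add: nn_integral_cmult nn_integral_norm_rep ennreal_mult)
  finally have "(\<integral>\<^sup>+k. ennreal ((cmod (c k))\<^sup>2) \<partial>count_space UNIV)
    \<le> ennreal (A / h ^ CARD('d)) * ennreal (A' * (norm g)\<^sup>2)"
    by (simp add: mult_left_mono)
  also have "\<dots> = ennreal (A * A' / h ^ CARD('d) * (norm g)\<^sup>2)"
    using A A' h by (simp add: ennreal_mult'[symmetric] mult_ac)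
  finally show ?thesis unfolding c_def .
qed

text \<open>Rows and columns of the kernel are both of order \<open>h powr \<theta>'\<close>: the
  unscaled weight carries this factor explicitly, the scaled one through its integral. The remaining
  power of \<open>h\<close> cancels against the norm of the sequence space.\<close>

lemma commutator_estimate:
  fixes \<psi> :: "real ^ 'd::finite \<Rightarrow> complex" and V :: "real ^ 'd \<Rightarrow> real"
  assumes b: "fourier_symbol \<psi> b"
    and \<tau>: "\<tau> > real CARD('d)" and \<theta>: "\<theta> > 0"
    and decay: "\<exists>C'>0. \<forall>x. cmod (\<psi> x) \<le> C' * (1 + norm x) powr (- \<tau>)"
    and V: "bounded_potential V M" and L: "\<And>x y. \<bar>V x - V y\<bar> \<le> L * norm (x - y) powr \<theta>"
    and \<theta>': "1 / \<theta>' = 1 / \<theta> + 1 / (\<tau> - real CARD('d))"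
  shows "\<exists>C\<ge>0. \<forall>h g. 0 < h \<and> h \<le> 1 \<longrightarrow>
    norm (dfourier h (\<lambda>k. complex_of_real (V (lattice_point h k)) * discretization \<psi> h g k
      - discretization \<psi> h (real_mult V g) k)) \<le> C * h powr \<theta>' * norm g"
proof -
  obtain C' where C': "C' > 0" "\<And>x. cmod (\<psi> x) \<le> C' * (1 + norm x) powr (- \<tau>)" using decay by blast
  have M: "\<And>x. \<bar>V x\<bar> \<le> M" using V by (simp add: bounded_potential_def)
  have M0: "0 \<le> M" using M[of 0] by linarith
  have \<tau>0: "\<tau> > 0" using \<tau> by (meson of_nat_0_le_iff order_le_less_trans)
  have sq\<psi>: "square_integrable \<psi>" using b by (simp add: fourier_symbol_def)
  define K where "K = C' * (\<bar>L\<bar> + 2 * M * 2 powr \<tau>)"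
  have K: "0 \<le> K" using C' M0 by (simp add: K_def)
  obtain I where I: "0 \<le> I" "(\<integral>\<^sup>+y. ennreal (weight \<tau> 1 (y :: real ^ 'd)) \<partial>lborel) = ennreal I"
    using nn_integral_weight_finite[OF \<tau>] by (cases "\<integral>\<^sup>+y. ennreal (weight \<tau> 1 (y :: real ^ 'd)) \<partial>lborel") auto
  define D where "D = (1 + real CARD('d)) powr \<tau>"
  have D: "0 \<le> D" by (simp add: D_def)
  have main: "norm (dfourier h (\<lambda>k. complex_of_real (V (lattice_point h k)) * discretization \<psi> h g k
      - discretization \<psi> h (real_mult V g) k)) \<le> (2 * K * I * sqrt D) * h powr \<theta>' * norm g"
    if h: "0 < h" "h \<le> 1" for h g
  proof -
    define r where "r = h powr (- \<theta>' / (\<tau> - real CARD('d)))"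
    note kb = kernel_bound[OF \<tau> \<theta> less_imp_le[OF C'(1)] C'(2) M L \<theta>' h, folded r_def K_def]
    define W where "W y = K * (h powr \<theta>' * weight \<tau> 1 y + weight \<tau> r y)" for y :: "real ^ 'd"
    have Wm: "W \<in> borel_measurable borel" unfolding W_def by measurable
    have W0: "0 \<le> W y" for y using K by (simp add: W_def)
    \<comment> \<open>The 2 counts the two weights in \<open>W\<close>, each of which contributes
      \<open>K * I * h powr \<theta>'\<close>.\<close>
    define A where "A = 2 * K * I * h powr \<theta>'"
    have A0: "0 \<le> A" using K I by (simp add: A_def)
    have Wr: "(\<integral>\<^sup>+y. ennreal (weight \<tau> r (y :: real ^ 'd)) \<partial>lborel) = ennreal (h powr \<theta>' * I)"
      using kb(1) by (subst nn_integral_weight_scale) (simp_all add: kb(2) I ennreal_mult)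
    have Wsplit: "ennreal (W y) = ennreal K * (ennreal (h powr \<theta>') * ennreal (weight \<tau> 1 y) + ennreal (weight \<tau> r y))"
      for y
      using K by (simp add: W_def ennreal_mult ennreal_plus)
    have "(\<integral>\<^sup>+y. ennreal (W y) \<partial>lborel) = ennreal K * (ennreal (h powr \<theta>') * ennreal I + ennreal (h powr \<theta>' * I))"
      unfolding Wsplit by (simp add: nn_integral_cmult nn_integral_add I Wr)
    also have "\<dots> = ennreal A"
      using K I by (simp add: A_def ennreal_mult[symmetric] ennreal_plus[symmetric] mult_ac del: ennreal_plus)
    finally have A1: "(\<integral>\<^sup>+y. ennreal (W y) \<partial>lborel) \<le> ennreal A" by simp
    have A2: "(\<integral>\<^sup>+n. ennreal (W (y - lattice_point 1 n)) \<partial>count_space UNIV) \<le> ennreal (D * A)" for y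
    proof -
      have "(\<integral>\<^sup>+n. ennreal (W (y - lattice_point 1 n)) \<partial>count_space UNIV) =
          ennreal K * (ennreal (h powr \<theta>') * (\<integral>\<^sup>+n. ennreal (weight \<tau> 1 (y - lattice_point 1 n)) \<partial>count_space UNIV)
            + (\<integral>\<^sup>+n. ennreal (weight \<tau> r (y - lattice_point 1 n)) \<partial>count_space UNIV))"
        unfolding Wsplit by (simp add: nn_integral_cmult nn_integral_add)
      also have "\<dots> \<le> ennreal K * (ennreal (h powr \<theta>') * (ennreal D * ennreal I) + ennreal D * ennreal (h powr \<theta>'
        * I))"
        using lattice_sum_weight_le[OF order_refl \<tau>0, of y] lattice_sum_weight_le[OF kb(1) \<tau>0, of y]
        by (intro mult_left_mono add_mono) (simp_all add: I Wr D_def)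
      also have "\<dots> = ennreal (D * A)"
        using K I D by (simp add: A_def ennreal_mult[symmetric] ennreal_plus[symmetric] mult_ac del: ennreal_plus)
      finally show ?thesis .
    qed
    define c where "c k = complex_of_real (V (lattice_point h k)) * discretization \<psi> h g k
      - discretization \<psi> h (real_mult V g) k" for k
    have c: "(\<integral>\<^sup>+k. ennreal ((cmod (c k))\<^sup>2) \<partial>count_space UNIV) \<le> ennreal (A * (D * A) / h ^ CARD('d) * (norm g)\<^sup>2)"
      unfolding c_def
      by (rule commutator_coefficients_sum[OF h(1) sq\<psi> V Wm W0 _ A1 A0 A2]) (use kb(3) A0 D in \<open>auto simp: W_def\<close>)
    have cell: "c \<in> ell2"
    proof -
      have "(\<lambda>k. complex_of_real (V (lattice_point h k)) * discretization \<psi> h g k) \<in> ell2"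
        by (rule ell2_mult(1)[where M = M]) (simp_all add: M discretization_eq[OF b h(1)] dcoeff_ell2 h)
      moreover have "(\<lambda>k. (- 1) * discretization \<psi> h (real_mult V g) k) \<in> ell2"
        by (rule ell2_scale) (simp add: discretization_eq[OF b h(1)] dcoeff_ell2 h)
      ultimately have "(\<lambda>k. complex_of_real (V (lattice_point h k)) * discretization \<psi> h g k + (- 1)
        * discretization \<psi> h (real_mult V g) k) \<in> ell2"
        by (rule ell2_add)
      then show ?thesis by (simp add: c_def[abs_def])
    qed
    have hs: "((\<lambda>k. (cmod (c k))\<^sup>2) has_sum (\<Sum>\<^sub>\<infinity>k. (cmod (c k))\<^sup>2)) UNIV"
      using cell by (intro has_sum_infsum) (simp add: ell2_def)
    have "ennreal (\<Sum>\<^sub>\<infinity>k. (cmod (c k))\<^sup>2) \<le> ennreal (A * (D * A) / h ^ CARD('d) * (norm g)\<^sup>2)"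
      using c has_sum_nn_integral_count_space[OF hs] by simp
    then have "(\<Sum>\<^sub>\<infinity>k. (cmod (c k))\<^sup>2) \<le> A * (D * A) / h ^ CARD('d) * (norm g)\<^sup>2"
      using A0 D h by (subst (asm) ennreal_le_iff) auto
    then have "(norm (dfourier h c))\<^sup>2 \<le> h ^ CARD('d) * (A * (D * A) / h ^ CARD('d) * (norm g)\<^sup>2)"
      unfolding norm_dfourier[OF h(1) cell] using h by (intro mult_left_mono) auto
    also have "\<dots> = (A * sqrt D * norm g)\<^sup>2"
      using h D by (simp add: power_mult_distrib) (simp add: power2_eq_square)
    finally have "norm (dfourier h c) \<le> A * sqrt D * norm g"
      by (rule power2_le_imp_le) (use A0 D in simp)
    then show ?thesis by (simp add: c_def[abs_def] A_def mult_ac)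
  qed
  show ?thesis
    by (rule exI[of _ "2 * K * I * sqrt D"]) (use main K I D in auto)
qed

section \<open>Discrete and continuous symbols\<close>

text \<open>The derivative of t^3 / 2 - t + sin t is 3 t^2 / 2 - (1 - cos t), nonnegative since 1 -
  cos t is twice the square of sin (t / 2), hence at most t^2 / 2. The lower bound on the sine
  follows because \<open>x \<le> 1\<close>.\<close>

lemma sin_bounds_nonneg:
  fixes x :: real
  assumes x: "0 \<le> x" "x \<le> pi / 4"
  shows "x - sin x \<le> x ^ 3 / 2" "sin x \<le> x" "x / 2 \<le> sin x"
proof -
  show "sin x \<le> x" using x by (simp add: sin_x_le_x)
  have "(\<lambda>t. t ^ 3 / 2 - t + sin t) 0 \<le> (\<lambda>t. t ^ 3 / 2 - t + sin t) x"
  proof (rule DERIV_nonneg_imp_nondecreasing[OF x(1)])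
    fix t :: real assume "0 \<le> t" "t \<le> x"
    have "((\<lambda>t. t ^ 3 / 2 - t + sin t) has_real_derivative (3 * t\<^sup>2 / 2 - 1 + cos t)) (at t)"
      by (auto intro!: derivative_eq_intros)
    moreover have "0 \<le> 3 * t\<^sup>2 / 2 - 1 + cos t"
    proof -
      have "cos t = 1 - 2 * (sin (t / 2))\<^sup>2" using cos_double_sin[of "t / 2"] by simp
      moreover have "\<bar>sin (t / 2)\<bar> \<le> \<bar>t / 2\<bar>" by (rule abs_sin_x_le_abs_x)
      then have "(sin (t / 2))\<^sup>2 \<le> (t / 2)\<^sup>2" by (rule abs_le_square_iff[THEN iffD1])
      moreover have "(t / 2)\<^sup>2 = t\<^sup>2 / 4" by (simp add: power_divide)
      ultimately show ?thesis using zero_le_power2[of t] by linarith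
    qed
    ultimately show "\<exists>y. ((\<lambda>t. t ^ 3 / 2 - t + sin t) has_real_derivative y) (at t) \<and> 0 \<le> y" by blast
  qed
  then show le: "x - sin x \<le> x ^ 3 / 2" by simp
  have "x \<le> 1" using x pi_less_4 by simp
  then have "x ^ 3 \<le> x" using power_decreasing[of 1 3 x] x by simp
  then show "x / 2 \<le> sin x" using le by simp
qed

definition sine_point :: "real \<Rightarrow> real ^ 'd \<Rightarrow> real ^ 'd" where
  "sine_point h \<xi> = (\<chi> i. 2 / h * sin (h / 2 * \<xi> $ i))"

lemma discrete_symbol_sine: "discrete_symbol G h \<xi> = G (sine_point h \<xi>)"
  by (simp add: discrete_symbol_def sine_point_def)

text \<open>On this cube the argument of the sine is at most pi / 4 in modulus. Off zero the factor
  \<open>\<sigma>\<close> is sin t / t, so no coordinate shrinks below one half of itself; the cubic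
  term is the Taylor error.\<close>

lemma sine_point_component:
  assumes h: "h > 0" and \<xi>: "\<xi> \<in> cube (pi / (2 * h))"
  obtains \<sigma> where "sine_point h \<xi> $ i = \<sigma> * \<xi> $ i" "1 / 2 \<le> \<sigma>" "\<sigma> \<le> 1"
    "\<bar>sine_point h \<xi> $ i - \<xi> $ i\<bar> \<le> h\<^sup>2 * \<bar>\<xi> $ i\<bar> ^ 3"
proof (cases "\<xi> $ i = 0")
  case True
  show ?thesis by (rule that[of 1]) (simp_all add: True sine_point_def)
next
  case False
  define x where "x = \<bar>\<xi> $ i\<bar>"
  have x: "0 < x" "x \<le> pi / (2 * h)" using False \<xi> by (auto simp: x_def mem_cube abs_le_iff minus_le_iff)
  define t where "t = h / 2 * x"
  have t: "0 < t" "t \<le> pi / 4" using x h by (auto simp: t_def field_simps)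
  note sb = sin_bounds_nonneg[OF less_imp_le[OF t(1)] t(2)]
  define \<sigma> where "\<sigma> = sin t / t"
  have \<sigma>: "1 / 2 \<le> \<sigma>" "\<sigma> \<le> 1" using sb t by (auto simp: \<sigma>_def field_simps)
  have s: "2 / h * sin t = \<sigma> * x" using h t(1) x by (simp add: \<sigma>_def t_def)
  have comp: "sine_point h \<xi> $ i = \<sigma> * \<xi> $ i"
  proof (cases "\<xi> $ i \<ge> 0")
    case True
    then have "\<xi> $ i = x" by (simp add: x_def)
    then show ?thesis using s by (simp add: sine_point_def t_def)
  next
    case False
    then have "\<xi> $ i = - x" by (simp add: x_def)
    then show ?thesis using s by (simp add: sine_point_def t_def)
  qed
  have "\<bar>sine_point h \<xi> $ i - \<xi> $ i\<bar> = \<bar>\<sigma> - 1\<bar> * x"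
    by (simp add: comp x_def abs_mult[symmetric] left_diff_distrib)
  also have "\<dots> = x - \<sigma> * x" using \<sigma> by (simp add: left_diff_distrib)
  also have "\<dots> = 2 / h * (t - sin t)" using h s by (simp add: right_diff_distrib t_def)
  also have "\<dots> \<le> 2 / h * (t ^ 3 / 2)" using sb h by (intro mult_left_mono) auto
  also have "\<dots> = h\<^sup>2 * x ^ 3 / 8" using h by (simp add: t_def power3_eq_cube power2_eq_square)
  also have "\<dots> \<le> h\<^sup>2 * x ^ 3" using x by simp
  finally show ?thesis using that[OF comp \<sigma>] by (simp add: x_def)
qed

text \<open>Two factors of each cubed coordinate are bounded by the norm and the third is kept, so
  that a componentwise comparison with a multiple of \<open>\<xi>\<close> applies.\<close>

lemma sine_point_diff:
  assumes h: "h > 0" and \<xi>: "\<xi> \<in> cube (pi / (2 * h))"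
  shows "norm (sine_point h \<xi> - \<xi>) \<le> h\<^sup>2 * norm \<xi> ^ 3"
proof -
  have "norm (sine_point h \<xi> - \<xi>) \<le> norm ((h\<^sup>2 * (norm \<xi>)\<^sup>2) *\<^sub>R \<xi>)"
  proof (rule norm_le_componentwise_cart)
    fix i
    obtain \<sigma> where "\<bar>sine_point h \<xi> $ i - \<xi> $ i\<bar> \<le> h\<^sup>2 * \<bar>\<xi> $ i\<bar> ^ 3"
      using sine_point_component[OF h \<xi>, of i] by blast
    also have "\<dots> = h\<^sup>2 * \<bar>\<xi> $ i\<bar>\<^sup>2 * \<bar>\<xi> $ i\<bar>" by (simp add: power3_eq_cube power2_eq_square)
    also have "\<dots> \<le> h\<^sup>2 * (norm \<xi>)\<^sup>2 * \<bar>\<xi> $ i\<bar>"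
      by (intro mult_right_mono mult_left_mono power_mono component_le_norm_cart) auto
    finally show "norm ((sine_point h \<xi> - \<xi>) $ i) \<le> norm (((h\<^sup>2 * (norm \<xi>)\<^sup>2) *\<^sub>R \<xi>) $ i)"
      by (simp add: abs_mult)
  qed
  also have "\<dots> = h\<^sup>2 * norm \<xi> ^ 3" by (simp add: power3_eq_cube power2_eq_square)
  finally show ?thesis .
qed

text \<open>Each coordinate of \<open>\<zeta>\<close> is that of \<open>\<xi>\<close> times a factor
  between 1/2 and 1. The segment therefore stays away from the origin at the scale of
  \<open>\<xi>\<close>, as gradient bounds with a negative exponent require.\<close>

lemma sine_segment:
  assumes h: "h > 0" and \<xi>: "\<xi> \<in> cube (pi / (2 * h))" and \<zeta>: "\<zeta> \<in> closed_segment (sine_point h \<xi>) \<xi>"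
  shows "norm \<zeta> \<le> norm \<xi>" "norm \<xi> / 2 \<le> norm \<zeta>"
proof -
  obtain u where u: "0 \<le> u" "u \<le> 1" "\<zeta> = (1 - u) *\<^sub>R sine_point h \<xi> + u *\<^sub>R \<xi>"
    using \<zeta> by (auto simp: in_segment)
  have comp: "\<bar>\<xi> $ i\<bar> / 2 \<le> \<bar>\<zeta> $ i\<bar> \<and> \<bar>\<zeta> $ i\<bar> \<le> \<bar>\<xi> $ i\<bar>" for i
  proof -
    obtain \<sigma> where \<sigma>: "sine_point h \<xi> $ i = \<sigma> * \<xi> $ i" "1 / 2 \<le> \<sigma>" "\<sigma> \<le> 1"
      using sine_point_component[OF h \<xi>, of i] by blast
    define q where "q = (1 - u) * \<sigma> + u"
    have "(1 - u) * (1 / 2) \<le> (1 - u) * \<sigma>" "(1 - u) * \<sigma> \<le> (1 - u) * 1"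
      using u mult_left_mono[OF \<sigma>(2), of "1 - u"] mult_left_mono[OF \<sigma>(3), of "1 - u"] by simp_all
    then have q: "1 / 2 \<le> q" "q \<le> 1" using u by (auto simp: q_def)
    have "\<zeta> $ i = q * \<xi> $ i" by (simp add: u(3) \<sigma>(1) q_def algebra_simps)
    then have "\<bar>\<zeta> $ i\<bar> = q * \<bar>\<xi> $ i\<bar>" using q by (simp add: abs_mult)
    moreover have "1 / 2 * \<bar>\<xi> $ i\<bar> \<le> q * \<bar>\<xi> $ i\<bar>" "q * \<bar>\<xi> $ i\<bar> \<le> 1 * \<bar>\<xi> $ i\<bar>"
      using mult_right_mono[OF q(1) abs_ge_zero[of "\<xi> $ i"]] mult_right_mono[OF q(2) abs_ge_zero[of "\<xi> $ i"]]
        by simp_all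
    ultimately show ?thesis by simp
  qed
  show "norm \<zeta> \<le> norm \<xi>" by (rule norm_le_componentwise_cart) (use comp in simp)
  have "norm ((1 / 2) *\<^sub>R \<xi>) \<le> norm \<zeta>" by (rule norm_le_componentwise_cart) (use comp in \<open>simp add: abs_mult\<close>)
  then show "norm \<xi> / 2 \<le> norm \<zeta>" by simp
qed

text \<open>The weight of order \<open>2 * \<alpha>\<close> is what the product of two resolvent
  symbols, each decaying with order \<open>\<alpha>\<close>, can absorb.\<close>

definition symbol_diff :: "(real ^ 'd \<Rightarrow> real) \<Rightarrow> real \<Rightarrow> real \<Rightarrow> bool" where
  "symbol_diff G \<alpha> \<gamma> \<longleftrightarrow> (\<exists>C\<ge>0. \<forall>h \<xi>. 0 < h \<and> h \<le> 1 \<and> \<xi> \<in> cube (pi / (2 * h)) \<longrightarrow>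
    \<bar>G (sine_point h \<xi>) - G \<xi>\<bar> \<le> C * h powr \<gamma> * (1 + norm \<xi>) powr (2 * \<alpha>))"

lemma norm_cube_le:
  fixes \<xi> :: "real ^ 'd::finite"
  assumes "\<xi> \<in> cube r"
  shows "norm \<xi> \<le> real CARD('d) * r"
proof -
  have "norm \<xi> \<le> (\<Sum>i\<in>UNIV. \<bar>\<xi> $ i\<bar>)" by (rule norm_le_l1_cart)
  also have "\<dots> \<le> (\<Sum>i\<in>(UNIV :: 'd set). r)"
    using assms by (intro sum_mono) (auto simp: mem_cube abs_le_iff minus_le_iff)
  finally show ?thesis by simp
qed

text \<open>A cubic Taylor error times a gradient of order \<open>b\<close> grows with order
  \<open>3 + b\<close>. The excess over \<open>2 * \<alpha>\<close> is paid with the bound of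
  \<open>1 + norm \<xi>\<close> on the cube by a constant over \<open>h\<close>, which costs as many
  powers of \<open>h\<close>: of the two available, \<open>2 * \<alpha> - b - 1\<close>
  remain.\<close>

lemma symbol_diffI:
  fixes G :: "real ^ 'd::finite \<Rightarrow> real"
  assumes Cb: "Cb \<ge> 0" and b: "3 + b \<ge> 2 * \<alpha>"
    and bound: "\<And>h \<xi>. 0 < h \<Longrightarrow> h \<le> 1 \<Longrightarrow> \<xi> \<in> cube (pi / (2 * h)) \<Longrightarrow> \<xi> \<noteq> 0 \<Longrightarrow>
      \<bar>G (sine_point h \<xi>) - G \<xi>\<bar> \<le> Cb * (h\<^sup>2 * (1 + norm \<xi>) powr (3 + b))"
    and \<gamma>: "\<gamma> \<le> 2 * \<alpha> - b - 1"
  shows "symbol_diff G \<alpha> \<gamma>"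
  unfolding symbol_diff_def
proof (intro exI[of _ "Cb * (1 + real CARD('d) * (pi / 2)) powr (3 + b - 2 * \<alpha>)"] conjI allI impI)
  let ?c = "1 + real CARD('d) * (pi / 2)"
  show "0 \<le> Cb * ?c powr (3 + b - 2 * \<alpha>)" using Cb by simp
  fix h :: real and \<xi> :: "real ^ 'd"
  assume "0 < h \<and> h \<le> 1 \<and> \<xi> \<in> cube (pi / (2 * h))"
  then have h: "0 < h" "h \<le> 1" and \<xi>: "\<xi> \<in> cube (pi / (2 * h))" by auto
  show "\<bar>G (sine_point h \<xi>) - G \<xi>\<bar> \<le> Cb * ?c powr (3 + b - 2 * \<alpha>) * h powr \<gamma> * (1 + norm \<xi>) powr (2 * \<alpha>)"
  proof (cases "\<xi> = 0")
    case True
    then have "sine_point h \<xi> = \<xi>" by (simp add: sine_point_def vec_eq_iff)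
    then show ?thesis using Cb by simp
  next
    case False
    define t where "t = 1 + norm \<xi>"
    have t: "t \<ge> 1" by (simp add: t_def)
    have cpos: "0 < ?c" by (intro add_pos_nonneg) auto
    have "t \<le> 1 + real CARD('d) * (pi / (2 * h))" using norm_cube_le[OF \<xi>] by (simp add: t_def)
    also have "\<dots> \<le> ?c / h" using h by (simp add: field_simps)
    finally have th: "t \<le> ?c / h" .
    have "h\<^sup>2 * t powr (3 + b) = h\<^sup>2 * (t powr (3 + b - 2 * \<alpha>) * t powr (2 * \<alpha>))"
      by (simp add: powr_add[symmetric])
    also have "\<dots> \<le> h\<^sup>2 * ((?c / h) powr (3 + b - 2 * \<alpha>) * t powr (2 * \<alpha>))"
      using th t b by (intro mult_left_mono mult_right_mono powr_mono2) auto
    also have "\<dots> = ?c powr (3 + b - 2 * \<alpha>) * h powr (2 * \<alpha> - b - 1) * t powr (2 * \<alpha>)"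
    proof -
      have "h\<^sup>2 = h powr 2" using h by simp
      moreover have "(?c / h) powr q = ?c powr q * h powr (- q)" for q
        using h cpos by (simp add: powr_divide powr_minus_divide)
      note this[of "3 + b - 2 * \<alpha>"]
      moreover have "h powr 2 * h powr (- (3 + b - 2 * \<alpha>)) = h powr (2 * \<alpha> - b - 1)"
        unfolding powr_add[symmetric] by (rule arg_cong[where f = "(powr) h"]) simp
      ultimately show ?thesis by (simp add: mult_ac)
    qed
    also have "\<dots> \<le> ?c powr (3 + b - 2 * \<alpha>) * h powr \<gamma> * t powr (2 * \<alpha>)"
      using h \<gamma> by (intro mult_right_mono mult_left_mono powr_mono') auto
    finally have "Cb * (h\<^sup>2 * t powr (3 + b)) \<le> Cb * (?c powr (3 + b - 2 * \<alpha>) * h powr \<gamma> * t powr (2 * \<alpha>))"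
      using Cb by (rule mult_left_mono)
    then show ?thesis using bound[OF h \<xi> False] by (simp add: t_def mult.assoc)
  qed
qed

lemma symbol_diff_add:
  fixes G H :: "real ^ 'd::finite \<Rightarrow> real"
  assumes "symbol_diff G \<alpha> \<gamma>" "symbol_diff H \<alpha> \<gamma>"
  shows "symbol_diff (\<lambda>\<xi>. G \<xi> + H \<xi>) \<alpha> \<gamma>"
proof -
  obtain A B where A: "A \<ge> 0" "\<And>h \<xi>. 0 < h \<and> h \<le> 1 \<and> \<xi> \<in> cube (pi / (2 * h)) \<Longrightarrow>
      \<bar>G (sine_point h \<xi>) - G \<xi>\<bar> \<le> A * h powr \<gamma> * (1 + norm \<xi>) powr (2 * \<alpha>)"
    and B: "B \<ge> 0" "\<And>h \<xi>. 0 < h \<and> h \<le> 1 \<and> \<xi> \<in> cube (pi / (2 * h)) \<Longrightarrow>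
      \<bar>H (sine_point h \<xi>) - H \<xi>\<bar> \<le> B * h powr \<gamma> * (1 + norm \<xi>) powr (2 * \<alpha>)"
    using assms unfolding symbol_diff_def by metis
  have "\<bar>(G (sine_point h \<xi>) + H (sine_point h \<xi>)) - (G \<xi> + H \<xi>)\<bar> \<le> (A + B) * h powr \<gamma> * (1 + norm \<xi>) powr (2 * \<alpha>)"
    if "0 < h \<and> h \<le> 1 \<and> \<xi> \<in> cube (pi / (2 * h))" for h \<xi>
    using A(2)[OF that] B(2)[OF that] by (simp add: distrib_right)
  then show ?thesis unfolding symbol_diff_def using A(1) B(1) by (intro exI[of _ "A + B"]) auto
qed

text \<open>The function is not differentiable at the origin, so the mean value theorem is applied
  to the power of one real variable, between the two norms, which are comparable. The resulting
  order is \<open>b = \<alpha> - 1\<close>, whence the rate \<open>\<alpha>\<close>.\<close>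

lemma symbol_diff_norm_powr:
  assumes \<alpha>: "0 < \<alpha>" "\<alpha> \<le> 1" and \<gamma>: "\<gamma> \<le> \<alpha>"
  shows "symbol_diff (\<lambda>\<xi> :: real ^ 'd::finite. norm \<xi> powr \<alpha>) \<alpha> \<gamma>"
proof (rule symbol_diffI[where b = "\<alpha> - 1" and Cb = "\<alpha> * 2 powr (1 - \<alpha>)"])
  fix h and \<xi> :: "real ^ 'd"
  assume h: "0 < h" "h \<le> 1" and \<xi>: "\<xi> \<in> cube (pi / (2 * h))" and nz: "\<xi> \<noteq> 0"
  define s where "s = norm (sine_point h \<xi>)"
  define x where "x = norm \<xi>"
  have x: "x > 0" using nz by (simp add: x_def)
  have s: "s \<le> x" "x / 2 \<le> s" using sine_segment[OF h(1) \<xi>, of "sine_point h \<xi>"] by (auto simp: s_def x_def)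
  have d: "x - s \<le> h\<^sup>2 * x ^ 3"
    using sine_point_diff[OF h(1) \<xi>] norm_triangle_ineq3[of "sine_point h \<xi>" \<xi>] by (simp add: s_def x_def)
  have "\<bar>s powr \<alpha> - x powr \<alpha>\<bar> \<le> \<alpha> * 2 powr (1 - \<alpha>) * (h\<^sup>2 * x powr (\<alpha> + 2))"
  proof (cases "s = x")
    case False
    then have sx: "s < x" using s by simp
    have der: "((\<lambda>t. t powr \<alpha>) has_real_derivative \<alpha> * t powr (\<alpha> - 1)) (at t)" if "s \<le> t" for t
      using that s x by (auto intro!: derivative_eq_intros)
    obtain z where z: "s < z" "z < x" "x powr \<alpha> - s powr \<alpha> = (x - s) * (\<alpha> * z powr (\<alpha> - 1))"
      using MVT2[OF sx, of "\<lambda>t. t powr \<alpha>" "\<lambda>t. \<alpha> * t powr (\<alpha> - 1)"] der by blast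
    have "0 \<le> (x - s) * (\<alpha> * z powr (\<alpha> - 1))" using sx \<alpha> by simp
    then have "\<bar>s powr \<alpha> - x powr \<alpha>\<bar> = (x - s) * (\<alpha> * z powr (\<alpha> - 1))"
      using z(3) by linarith
    also have "\<dots> \<le> (h\<^sup>2 * x ^ 3) * (\<alpha> * (x / 2) powr (\<alpha> - 1))"
      using d z s x sx \<alpha> by (intro mult_mono powr_mono2') auto
    also have "(x / 2) powr (\<alpha> - 1) = 2 powr (1 - \<alpha>) * x powr (\<alpha> - 1)"
      using x by (simp add: powr_divide powr_diff)
    also have "(h\<^sup>2 * x ^ 3) * (\<alpha> * (2 powr (1 - \<alpha>) * x powr (\<alpha> - 1)))
      = \<alpha> * 2 powr (1 - \<alpha>) * (h\<^sup>2 * (x powr 3 * x powr (\<alpha> - 1)))"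
      using x by simp
    also have "x powr 3 * x powr (\<alpha> - 1) = x powr (\<alpha> + 2)"
      unfolding powr_add[symmetric] by (rule arg_cong[where f = "(powr) x"]) simp
    finally show ?thesis .
  qed (use \<alpha> in simp)
  also have "\<dots> \<le> \<alpha> * 2 powr (1 - \<alpha>) * (h\<^sup>2 * (1 + x) powr (\<alpha> + 2))"
    using \<alpha> x by (intro mult_left_mono powr_mono2) auto
  finally show "\<bar>norm (sine_point h \<xi>) powr \<alpha> - norm \<xi> powr \<alpha>\<bar>
    \<le> \<alpha> * 2 powr (1 - \<alpha>) * (h\<^sup>2 * (1 + norm \<xi>) powr (3 + (\<alpha> - 1)))"
    by (simp add: s_def x_def add.commute)
qed (use \<alpha> \<gamma> in auto)

text \<open>Mean value inequality along the segment; \<open>sine_segment\<close> confines the norms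
  at which the gradient has to be bounded.\<close>

lemma gradient_diff:
  fixes G :: "real ^ 'd::finite \<Rightarrow> real"
  assumes D: "\<And>\<xi>. GDERIV G \<xi> :> D \<xi>"
    and h: "0 < h" and \<xi>: "\<xi> \<in> cube (pi / (2 * h))"
    and B: "\<And>\<zeta>. norm \<zeta> \<le> norm \<xi> \<Longrightarrow> norm \<xi> / 2 \<le> norm \<zeta> \<Longrightarrow> norm (D \<zeta>) \<le> B"
  shows "\<bar>G (sine_point h \<xi>) - G \<xi>\<bar> \<le> B * (h\<^sup>2 * norm \<xi> ^ 3)"
proof -
  have "norm (D \<xi>) \<le> B" by (rule B) auto
  then have B0: "0 \<le> B" using norm_ge_zero[of "D \<xi>"] by linarith
  have "norm (G (sine_point h \<xi>) - G \<xi>) \<le> B * norm (sine_point h \<xi> - \<xi>)"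
  proof (rule differentiable_bound[where f' = "\<lambda>\<zeta> v. v \<bullet> D \<zeta>" and S = "closed_segment (sine_point h \<xi>) \<xi>"])
    fix \<zeta> assume \<zeta>: "\<zeta> \<in> closed_segment (sine_point h \<xi>) \<xi>"
    show "(G has_derivative (\<lambda>v. v \<bullet> D \<zeta>)) (at \<zeta> within closed_segment (sine_point h \<xi>) \<xi>)"
      using D[of \<zeta>] by (simp add: gderiv_def has_derivative_at_withinI)
    show "onorm (\<lambda>v. v \<bullet> D \<zeta>) \<le> B"
    proof (rule onorm_bound[OF B0])
      fix v
      have "norm (v \<bullet> D \<zeta>) \<le> norm v * norm (D \<zeta>)" by (simp add: Cauchy_Schwarz_ineq2)
      also have "\<dots> \<le> norm v * B" using sine_segment[OF h \<xi> \<zeta>] by (intro mult_left_mono B) auto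
      finally show "norm (v \<bullet> D \<zeta>) \<le> B * norm v" by (simp add: mult.commute)
    qed
  qed auto
  also have "\<dots> \<le> B * (h\<^sup>2 * norm \<xi> ^ 3)" by (intro mult_left_mono sine_point_diff h \<xi> B0)
  finally show ?thesis by simp
qed

text \<open>Allows a negative exponent: on the segment the norm lies between half and all of that of
  \<open>\<xi>\<close>, which costs at most the factor \<open>2 powr |\<beta>|\<close>.\<close>

lemma symbol_diff_gradient_homogeneous:
  fixes G :: "real ^ 'd::finite \<Rightarrow> real"
  assumes D: "\<And>\<xi>. GDERIV G \<xi> :> D \<xi>" and c: "0 \<le> c"
    and bound: "\<And>\<xi>. \<xi> \<noteq> 0 \<Longrightarrow> norm (D \<xi>) \<le> c * norm \<xi> powr \<beta>"
    and \<beta>: "2 * \<alpha> \<le> 3 + \<beta>" "0 < \<alpha>" and \<gamma>: "\<gamma> \<le> 2 * \<alpha> - \<beta> - 1"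
  shows "symbol_diff G \<alpha> \<gamma>"
proof (rule symbol_diffI[where b = \<beta> and Cb = "c * 2 powr \<bar>\<beta>\<bar>"])
  fix h and \<xi> :: "real ^ 'd"
  assume h: "0 < h" "h \<le> 1" and \<xi>: "\<xi> \<in> cube (pi / (2 * h))" and nz: "\<xi> \<noteq> 0"
  have "\<bar>G (sine_point h \<xi>) - G \<xi>\<bar> \<le> (c * (2 powr \<bar>\<beta>\<bar> * norm \<xi> powr \<beta>)) * (h\<^sup>2 * norm \<xi> ^ 3)"
  proof (rule gradient_diff[OF D h(1) \<xi>])
    fix \<zeta> :: "real ^ 'd" assume \<zeta>: "norm \<zeta> \<le> norm \<xi>" "norm \<xi> / 2 \<le> norm \<zeta>"
    have z0: "0 < norm \<zeta>" using \<zeta> nz by (metis half_gt_zero order_less_le_trans zero_less_norm_iff)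
    have "norm \<zeta> powr \<beta> \<le> 2 powr \<bar>\<beta>\<bar> * norm \<xi> powr \<beta>"
    proof (cases "\<beta> \<ge> 0")
      case True
      have "1 * norm \<zeta> powr \<beta> \<le> 2 powr \<bar>\<beta>\<bar> * norm \<xi> powr \<beta>"
        using \<zeta> True by (intro mult_mono powr_mono2) (auto simp: ge_one_powr_ge_zero)
      then show ?thesis by simp
    next
      case False
      have "norm \<zeta> powr \<beta> \<le> (norm \<xi> / 2) powr \<beta>" using \<zeta> False nz by (intro powr_mono2') auto
      also have "\<dots> = 2 powr \<bar>\<beta>\<bar> * norm \<xi> powr \<beta>" using False by (simp add: powr_divide powr_minus_divide)
      finally show ?thesis .
    qed
    then have "c * norm \<zeta> powr \<beta> \<le> c * (2 powr \<bar>\<beta>\<bar> * norm \<xi> powr \<beta>)" using c by (rule mult_left_mono)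
    then show "norm (D \<zeta>) \<le> c * (2 powr \<bar>\<beta>\<bar> * norm \<xi> powr \<beta>)" using bound[of \<zeta>] z0 by auto
  qed
  also have "\<dots> = c * 2 powr \<bar>\<beta>\<bar> * (h\<^sup>2 * (norm \<xi> powr 3 * norm \<xi> powr \<beta>))" using nz by simp
  also have "norm \<xi> powr 3 * norm \<xi> powr \<beta> = norm \<xi> powr (3 + \<beta>)" by (rule powr_add[symmetric])
  also have "c * 2 powr \<bar>\<beta>\<bar> * (h\<^sup>2 * norm \<xi> powr (3 + \<beta>)) \<le> c * 2 powr \<bar>\<beta>\<bar> * (h\<^sup>2 * (1 + norm \<xi>) powr (3 + \<beta>))"
    using c \<beta> by (intro mult_left_mono powr_mono2) auto
  finally show "\<bar>G (sine_point h \<xi>) - G \<xi>\<bar> \<le> c * 2 powr \<bar>\<beta>\<bar> * (h\<^sup>2 * (1 + norm \<xi>) powr (3 + \<beta>))" .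
qed (use c \<beta> \<gamma> in auto)

text \<open>Variant for gradients that grow at infinity but are merely bounded near the origin, as
  in the second class.\<close>

lemma symbol_diff_gradient:
  fixes G :: "real ^ 'd::finite \<Rightarrow> real"
  assumes D: "\<And>\<xi>. GDERIV G \<xi> :> D \<xi>" and c: "0 \<le> c"
    and bound: "\<And>\<xi>. norm (D \<xi>) \<le> c * (1 + norm \<xi>) powr \<beta>"
    and \<beta>: "2 * \<alpha> \<le> 3 + \<beta>" "0 \<le> \<beta>" and \<gamma>: "\<gamma> \<le> 2 * \<alpha> - \<beta> - 1"
  shows "symbol_diff G \<alpha> \<gamma>"
proof (rule symbol_diffI[where b = \<beta> and Cb = c])
  fix h and \<xi> :: "real ^ 'd"
  assume h: "0 < h" "h \<le> 1" and \<xi>: "\<xi> \<in> cube (pi / (2 * h))" and nz: "\<xi> \<noteq> 0"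
  have "\<bar>G (sine_point h \<xi>) - G \<xi>\<bar> \<le> (c * (1 + norm \<xi>) powr \<beta>) * (h\<^sup>2 * norm \<xi> ^ 3)"
  proof (rule gradient_diff[OF D h(1) \<xi>])
    fix \<zeta> :: "real ^ 'd" assume \<zeta>: "norm \<zeta> \<le> norm \<xi>"
    have "c * (1 + norm \<zeta>) powr \<beta> \<le> c * (1 + norm \<xi>) powr \<beta>"
      using c \<zeta> \<beta> by (intro mult_left_mono powr_mono2) auto
    then show "norm (D \<zeta>) \<le> c * (1 + norm \<xi>) powr \<beta>" using bound[of \<zeta>] by linarith
  qed
  also have "\<dots> \<le> (c * (1 + norm \<xi>) powr \<beta>) * (h\<^sup>2 * (1 + norm \<xi>) ^ 3)"
    using c by (intro mult_left_mono power_mono) auto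
  also have "(1 + norm \<xi>) ^ 3 = (1 + norm \<xi>) powr 3"
    by (rule powr_numeral[symmetric]) (simp add: add_pos_nonneg)
  also have "(c * (1 + norm \<xi>) powr \<beta>) * (h\<^sup>2 * (1 + norm \<xi>) powr 3) = c * (h\<^sup>2 * (1 + norm \<xi>) powr (3 + \<beta>))"
    by (simp add: powr_add mult_ac)
  finally show "\<bar>G (sine_point h \<xi>) - G \<xi>\<bar> \<le> c * (h\<^sup>2 * (1 + norm \<xi>) powr (3 + \<beta>))" .
qed (use c \<beta> \<gamma> in auto)

text \<open>Common interface of the three options. The condition
  \<open>\<gamma> \<le> \<alpha>\<close> makes the high-frequency contributions, of size
  \<open>h powr \<alpha>\<close>, admissible.\<close>

definition good_symbol :: "(real ^ 'd \<Rightarrow> real) \<Rightarrow> real \<Rightarrow> real \<Rightarrow> bool" where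
  "good_symbol G \<alpha> \<gamma> \<longleftrightarrow> continuous_on UNIV G \<and> (\<forall>\<xi>. 0 \<le> G \<xi>) \<and> even_in_coordinates G \<and> 0 < \<alpha> \<and> \<gamma> \<le> \<alpha> \<and>
    (\<exists>c>0. \<exists>c0>0. \<forall>\<xi>. c0 \<le> norm \<xi> \<longrightarrow> c * norm \<xi> powr \<alpha> \<le> G \<xi>) \<and> symbol_diff G \<alpha> \<gamma>"

lemma continuous_on_gderiv: "(\<And>\<xi>. GDERIV G \<xi> :> D \<xi>) \<Longrightarrow> continuous_on UNIV G"
  unfolding gderiv_def by (meson continuous_at_imp_continuous_on has_derivative_continuous)

text \<open>The parameter condition \<open>\<alpha> \<le> 1 + \<beta>\<close> is what gives
  \<open>2 * \<alpha> - \<beta> - 1 \<le> \<alpha>\<close>.\<close>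

lemma good_symbol_class_I:
  assumes "class_I \<alpha> \<beta> G" and \<gamma>: "\<gamma> = min (2 * \<alpha> - 1) (2 * \<alpha> - \<beta> - 1)"
  shows "good_symbol G \<alpha> \<gamma>"
proof -
  obtain D c' where D: "C1_gradient G D" "c' > 0" "\<And>\<xi>. \<xi> \<noteq> 0 \<Longrightarrow> norm (D \<xi>) \<le> c' * norm \<xi> powr \<beta>"
    using assms unfolding class_I_def by blast
  then have g: "\<And>\<xi>. GDERIV G \<xi> :> D \<xi>" by (simp add: C1_gradient_def)
  have "symbol_diff G \<alpha> \<gamma>"
    by (rule symbol_diff_gradient_homogeneous[OF g _ D(3)]) (use assms D in \<open>auto simp: class_I_def\<close>)
  then show ?thesis
    using assms continuous_on_gderiv[OF g] unfolding good_symbol_def class_I_def by auto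
qed

lemma even_norm_powr: "even_in_coordinates (\<lambda>\<xi> :: real ^ 'd::finite. norm \<xi> powr \<alpha>)"
proof -
  have "norm (\<chi> i. \<bar>\<xi> $ i\<bar>) = norm \<xi>" for \<xi> :: "real ^ 'd"
    by (intro antisym norm_le_componentwise_cart) auto
  then show ?thesis by (simp add: even_in_coordinates_def)
qed

lemma continuous_on_norm_powr: "0 < \<alpha> \<Longrightarrow> continuous_on UNIV (\<lambda>\<xi> :: real ^ 'd::finite. norm \<xi> powr \<alpha>)"
  by (intro continuous_on_powr' continuous_intros) auto

lemma good_symbol_class_II:
  assumes cl: "class_II \<alpha> \<beta> G" and \<gamma>: "\<gamma> = 2 * \<alpha> - \<beta> - 1"
  shows "good_symbol G \<alpha> \<gamma>"
proof -
  have ab: "1 / 2 < \<alpha>" "\<alpha> \<le> 1" "0 \<le> \<beta>" "1 + \<beta> < 2 * \<alpha>" using cl by (auto simp: class_II_def)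
  obtain G' where G': "\<And>\<xi>. G \<xi> = norm \<xi> powr \<alpha> + G' \<xi>" "\<And>\<xi>. 0 \<le> G' \<xi>" "even_in_coordinates G'"
    "\<exists>D. C1_gradient G' D \<and> (\<exists>c>0. \<exists>c0>0. \<forall>\<xi>. c0 \<le> norm \<xi> \<longrightarrow> norm (D \<xi>) \<le> c * norm \<xi> powr \<beta>)"
    using cl unfolding class_II_def by blast
  from G'(4) obtain D c c0 where D: "C1_gradient G' D" "c > 0" "c0 > 0" "\<And>\<xi>. c0 \<le> norm \<xi> \<Longrightarrow> norm (D \<xi>)
    \<le> c * norm \<xi> powr \<beta>"
    by blast
  have g: "\<And>\<xi>. GDERIV G' \<xi> :> D \<xi>" and Dc: "continuous_on UNIV D" using D(1) by (auto simp: C1_gradient_def)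
  \<comment> \<open>Continuity bounds the gradient on the ball where the class prescribes
    nothing.\<close>
  have "bounded (D ` cball 0 c0)"
    by (intro compact_imp_bounded compact_continuous_image continuous_on_subset[OF Dc]) auto
  then obtain B where B: "B > 0" "\<And>\<xi>. norm \<xi> \<le> c0 \<Longrightarrow> norm (D \<xi>) \<le> B"
    unfolding bounded_pos by auto
  have bound: "norm (D \<xi>) \<le> (B + c) * (1 + norm \<xi>) powr \<beta>" for \<xi>
  proof (cases "norm \<xi> \<le> c0")
    case True
    have "B * 1 \<le> (B + c) * (1 + norm \<xi>) powr \<beta>"
      using B D ab by (intro mult_mono) (auto intro: ge_one_powr_ge_zero)
    then show ?thesis using B(2)[OF True] by simp
  next
    case False
    have "c * norm \<xi> powr \<beta> \<le> (B + c) * (1 + norm \<xi>) powr \<beta>"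
      using B D ab by (intro mult_mono powr_mono2) auto
    then show ?thesis using D(4)[of \<xi>] False by simp
  qed
  have GG: "G = (\<lambda>\<xi>. norm \<xi> powr \<alpha> + G' \<xi>)" using G'(1) by auto
  have "symbol_diff G' \<alpha> \<gamma>"
    by (rule symbol_diff_gradient[OF g _ bound]) (use B D ab \<gamma> in auto)
  moreover have "symbol_diff (\<lambda>\<xi> :: real ^ 'a. norm \<xi> powr \<alpha>) \<alpha> \<gamma>"
    by (rule symbol_diff_norm_powr) (use ab \<gamma> in auto)
  ultimately have sd: "symbol_diff G \<alpha> \<gamma>" unfolding GG by (rule symbol_diff_add[rotated])
  have ev: "even_in_coordinates G"
    using even_norm_powr[of \<alpha>] G'(3) unfolding even_in_coordinates_def GG by metis
  have cont: "continuous_on UNIV G"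
    unfolding GG using ab by (intro continuous_on_add continuous_on_norm_powr continuous_on_gderiv[OF g]) auto
  have low: "\<forall>\<xi>. 1 \<le> norm \<xi> \<longrightarrow> 1 * norm \<xi> powr \<alpha> \<le> G \<xi>" using G' by auto
  have nn: "\<forall>\<xi>. 0 \<le> G \<xi>" using G' by auto
  show ?thesis
    unfolding good_symbol_def
    using sd ev cont nn ab \<gamma> by (intro conjI exI[of _ 1] low) auto
qed

lemma good_symbol_norm_powr:
  fixes G :: "real ^ 'd::finite \<Rightarrow> real"
  assumes \<alpha>: "0 < \<alpha>" "\<alpha> \<le> 1" and G: "\<And>\<xi>. G \<xi> = norm \<xi> powr \<alpha>"
  shows "good_symbol G \<alpha> \<alpha>"
proof -
  have GG: "G = (\<lambda>\<xi>. norm \<xi> powr \<alpha>)" using G by auto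
  show ?thesis
    unfolding good_symbol_def GG
    using \<alpha> by (intro conjI exI[of _ 1] even_norm_powr continuous_on_norm_powr symbol_diff_norm_powr) auto
qed

section \<open>Bounds for the resolvent symbols\<close>

lemma compact_nonreal_bound:
  assumes K: "compact K" "K \<inter> \<real> = {}"
  obtains \<delta> where "\<delta> > 0" "\<And>z. z \<in> K \<Longrightarrow> \<delta> \<le> \<bar>Im z\<bar>"
proof (cases "K = {}")
  case False
  have "continuous_on K (\<lambda>z. \<bar>Im z\<bar>)" by (intro continuous_intros)
  from continuous_attains_inf[OF K(1) False this] obtain z0 where z0: "z0 \<in> K" "\<And>z. z \<in> K \<Longrightarrow> \<bar>Im z0\<bar> \<le> \<bar>Im z\<bar>"
    by blast
  have "Im z0 \<noteq> 0" using z0(1) K(2) complex_is_Real_iff by blast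
  then show ?thesis using that[of "\<bar>Im z0\<bar>"] z0 by simp
qed (use that[of 1] in auto)

lemma resolvent_lower_bound:
  assumes K: "compact K" "K \<inter> \<real> = {}"
  obtains c where "c > 0" "\<And>z x. z \<in> K \<Longrightarrow> 0 \<le> x \<Longrightarrow> c * (1 + x) \<le> cmod (complex_of_real x - z)"
proof -
  obtain \<delta> where \<delta>: "\<delta> > 0" "\<And>z. z \<in> K \<Longrightarrow> \<delta> \<le> \<bar>Im z\<bar>" using compact_nonreal_bound[OF K] by blast
  obtain R where R: "R > 0" "\<And>z. z \<in> K \<Longrightarrow> cmod z \<le> R"
    using compact_imp_bounded[OF K(1)] unfolding bounded_pos by blast
  \<comment> \<open>Chosen so that the convex combination of the lower bounds
    \<open>\<delta>\<close> and \<open>x - R\<close>, with weights \<open>1 - c\<close> and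
    \<open>c\<close>, equals \<open>c * (1 + x)\<close>.\<close>
  define c where "c = \<delta> / (1 + R + \<delta>)"
  have c: "0 < c" "c \<le> 1" using \<delta> R by (auto simp: c_def)
  have ceq: "(1 - c) * \<delta> = c * (1 + R)" using \<delta> R by (simp add: c_def field_simps)
  have "c * (1 + x) \<le> cmod (complex_of_real x - z)" if z: "z \<in> K" "0 \<le> x" for z x
  proof -
    have 1: "\<delta> \<le> cmod (complex_of_real x - z)"
      using \<delta>(2)[OF z(1)] abs_Im_le_cmod[of "complex_of_real x - z"] by simp
    have 2: "x - R \<le> cmod (complex_of_real x - z)"
      using R(2)[OF z(1)] norm_triangle_ineq2[of "complex_of_real x" z] z(2) by simp
    have "(1 - c) * \<delta> + c * (x - R) \<le> (1 - c) * cmod (complex_of_real x - z) + c * cmod (complex_of_real x - z)"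
      using c 1 2 by (intro add_mono mult_left_mono) auto
    then show ?thesis using ceq by (simp add: algebra_simps)
  qed
  then show ?thesis using that c by blast
qed

text \<open>Small frequencies use the difference of the symbols; elsewhere each resolvent symbol is
  small by itself, because its argument has norm at least \<open>1 / h\<close>. For the discrete
  symbol this still holds up to 3 pi / (2 h), before the sine returns to its zero at 2 pi /
  h.\<close>

lemma good_symbol_resolvent:
  fixes G :: "real ^ 'd::finite \<Rightarrow> real"
  assumes G: "good_symbol G \<alpha> \<gamma>" and K: "compact K" "K \<inter> \<real> = {}"
  obtains C where "C > 0"
    "\<And>z h \<xi>. z \<in> K \<Longrightarrow> 0 < h \<Longrightarrow> h \<le> 1 \<Longrightarrow> \<xi> \<in> cube (pi / (2 * h)) \<Longrightarrow>
      cmod (1 / (complex_of_real (discrete_symbol G h \<xi>) - z) - 1 / (complex_of_real (G \<xi>) - z)) \<le> C * h powr \<gamma>"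
    "\<And>z h \<xi> i. z \<in> K \<Longrightarrow> 0 < h \<Longrightarrow> h \<le> 1 \<Longrightarrow> pi / (2 * h) \<le> \<bar>\<xi> $ i\<bar> \<Longrightarrow>
      cmod (1 / (complex_of_real (G \<xi>) - z)) \<le> C * h powr \<gamma>"
    "\<And>z h \<xi> i. z \<in> K \<Longrightarrow> 0 < h \<Longrightarrow> h \<le> 1 \<Longrightarrow> pi / (2 * h) \<le> \<bar>\<xi> $ i\<bar> \<Longrightarrow> \<bar>\<xi> $ i\<bar> \<le> 3 * pi / (2 * h) \<Longrightarrow>
      cmod (1 / (complex_of_real (discrete_symbol G h \<xi>) - z)) \<le> C * h powr \<gamma>"
proof -
  obtain c where c: "c > 0" "\<And>z x. z \<in> K \<Longrightarrow> 0 \<le> x \<Longrightarrow> c * (1 + x) \<le> cmod (complex_of_real x - z)"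
    using resolvent_lower_bound[OF K] by blast
  have nn: "\<And>\<xi>. 0 \<le> G \<xi>" and \<alpha>: "0 < \<alpha>" "\<gamma> \<le> \<alpha>" using G by (auto simp: good_symbol_def)
  obtain c1 c0 where c1: "c1 > 0" "c0 > 0" "\<And>\<xi>. c0 \<le> norm \<xi> \<Longrightarrow> c1 * norm \<xi> powr \<alpha> \<le> G \<xi>"
    using G unfolding good_symbol_def by blast
  obtain A where A: "A \<ge> 0" "\<And>h \<xi>. 0 < h \<and> h \<le> 1 \<and> \<xi> \<in> cube (pi / (2 * h)) \<Longrightarrow>
      \<bar>G (sine_point h \<xi>) - G \<xi>\<bar> \<le> A * h powr \<gamma> * (1 + norm \<xi>) powr (2 * \<alpha>)"
    using G unfolding good_symbol_def symbol_diff_def by blast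
  define m where "m = max c0 1"
  define c2 where "c2 = min (c1 * 2 powr (- \<alpha>)) ((1 + m) powr (- \<alpha>))"
  have c2: "c2 > 0" using c1 by (simp add: c2_def m_def)
  \<comment> \<open>Growth is only known outside a ball; inside, the nonnegativity of
    \<open>G\<close> and the added 1 suffice.\<close>
  have lower: "c2 * (1 + norm \<xi>) powr \<alpha> \<le> 1 + G \<xi>" for \<xi>
  proof (cases "m \<le> norm \<xi>")
    case True
    have "(1 + norm \<xi>) powr \<alpha> \<le> (2 * norm \<xi>) powr \<alpha>"
      using True \<alpha> by (intro powr_mono2) (auto simp: m_def)
    also have "\<dots> = 2 powr \<alpha> * norm \<xi> powr \<alpha>" by (simp add: powr_mult)
    finally have "c2 * (1 + norm \<xi>) powr \<alpha> \<le> (c1 * 2 powr (- \<alpha>)) * (2 powr \<alpha> * norm \<xi> powr \<alpha>)"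
      using c1 by (intro mult_mono) (auto simp: c2_def)
    also have "\<dots> = c1 * norm \<xi> powr \<alpha>" by (simp add: powr_minus)
    finally show ?thesis using c1(3)[of \<xi>] True by (simp add: m_def)
  next
    case False
    have "c2 * (1 + norm \<xi>) powr \<alpha> \<le> (1 + m) powr (- \<alpha>) * (1 + m) powr \<alpha>"
      using False \<alpha> by (intro mult_mono powr_mono2) (auto simp: c2_def)
    also have "\<dots> = 1" by (simp add: powr_add[symmetric] m_def)
    finally show ?thesis using nn[of \<xi>] by simp
  qed
  define B where "B = 1 / (c * c2)"
  have B: "B > 0" using c c2 by (simp add: B_def)
  have inv: "cmod (1 / (complex_of_real (G \<xi>) - z)) \<le> B * (1 + norm \<xi>) powr (- \<alpha>)" if "z \<in> K" for z \<xi>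
  proof -
    have "c * (c2 * (1 + norm \<xi>) powr \<alpha>) \<le> c * (1 + G \<xi>)" using c lower by (intro mult_left_mono) auto
    also have "\<dots> \<le> cmod (complex_of_real (G \<xi>) - z)" by (rule c(2)[OF that nn])
    finally have le: "c * (c2 * (1 + norm \<xi>) powr \<alpha>) \<le> cmod (complex_of_real (G \<xi>) - z)" .
    have pos: "0 < 1 + norm \<xi>" by (simp add: add_pos_nonneg)
    have "1 / cmod (complex_of_real (G \<xi>) - z) \<le> 1 / (c * (c2 * (1 + norm \<xi>) powr \<alpha>))"
      using c(1) c2 pos by (intro frac_le le) auto
    also have "\<dots> = B * (1 + norm \<xi>) powr (- \<alpha>)" by (simp add: B_def powr_minus_divide)
    finally show ?thesis by (simp add: norm_divide)
  qed
  have far: "cmod (1 / (complex_of_real (G \<xi>) - z)) \<le> B * h powr \<gamma>"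
    if "z \<in> K" "0 < h" "h \<le> 1" "1 / h \<le> norm \<xi>" for z h \<xi>
  proof -
    have "(1 + norm \<xi>) powr (- \<alpha>) \<le> (1 / h) powr (- \<alpha>)" using that \<alpha> by (intro powr_mono2') auto
    also have "\<dots> = h powr \<alpha>" using that by (simp add: powr_divide powr_minus_divide)
    also have "\<dots> \<le> h powr \<gamma>" using that \<alpha> by (intro powr_mono') auto
    finally have "B * (1 + norm \<xi>) powr (- \<alpha>) \<le> B * h powr \<gamma>" using B by (intro mult_left_mono) auto
    then show ?thesis using inv[OF that(1), of \<xi>] by linarith
  qed
  define C where "C = B + A * (B * (2 powr \<alpha> * B))"
  have C: "C > 0" "B \<le> C" "A * (B * (2 powr \<alpha> * B)) \<le> C" using A B by (auto simp: C_def add_pos_nonneg)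
  show ?thesis
  proof (rule that[OF C(1)])
    fix z and h :: real and \<xi> :: "real ^ 'd"
    assume z: "z \<in> K" and h: "0 < h" "h \<le> 1" and \<xi>: "\<xi> \<in> cube (pi / (2 * h))"
    let ?s = "sine_point h \<xi>"
    have ns: "norm \<xi> / 2 \<le> norm ?s" using sine_segment[OF h(1) \<xi>, of ?s] by simp
    have nz: "complex_of_real (G \<zeta>) - z \<noteq> 0" for \<zeta>
      using c(2)[OF z nn[of \<zeta>]] c(1) nn[of \<zeta>] by (auto simp: mult_le_0_iff add_nonneg_nonneg)
    \<comment> \<open>Difference of reciprocals: the two resolvent factors together decay with order
      \<open>2 * \<alpha>\<close> and cancel the weight from \<open>symbol_diff\<close>.\<close>
    have "1 / (complex_of_real (G ?s) - z) - 1 / (complex_of_real (G \<xi>) - z) =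
        complex_of_real (G \<xi> - G ?s) * (1 / (complex_of_real (G ?s) - z) * (1 / (complex_of_real (G \<xi>) - z)))"
      using nz[of ?s] nz[of \<xi>] by (simp add: diff_frac_eq)
    then have "cmod (1 / (complex_of_real (G ?s) - z) - 1 / (complex_of_real (G \<xi>) - z)) =
        \<bar>G ?s - G \<xi>\<bar> * (cmod (1 / (complex_of_real (G ?s) - z)) * cmod (1 / (complex_of_real (G \<xi>) - z)))"
      by (simp only: norm_mult norm_of_real abs_minus_commute)
    also have "\<dots> \<le> (A * h powr \<gamma> * (1 + norm \<xi>) powr (2 * \<alpha>)) * ((B * (2 powr \<alpha> * (1 + norm \<xi>) powr (- \<alpha>))) * (B * (1
      + norm \<xi>) powr (- \<alpha>)))"
    proof (intro mult_mono inv z)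
      show "\<bar>G ?s - G \<xi>\<bar> \<le> A * h powr \<gamma> * (1 + norm \<xi>) powr (2 * \<alpha>)" using A(2) h \<xi> by blast
      have "(1 + norm ?s) powr (- \<alpha>) \<le> ((1 + norm \<xi>) / 2) powr (- \<alpha>)"
        using ns \<alpha> by (intro powr_mono2') (auto simp: add_pos_nonneg)
      also have "\<dots> = 2 powr \<alpha> * (1 + norm \<xi>) powr (- \<alpha>)" by (simp add: powr_divide powr_minus_divide)
      finally have "B * (1 + norm ?s) powr (- \<alpha>) \<le> B * (2 powr \<alpha> * (1 + norm \<xi>) powr (- \<alpha>))"
        using B by (intro mult_left_mono) auto
      then show "cmod (1 / (complex_of_real (G ?s) - z)) \<le> B * (2 powr \<alpha> * (1 + norm \<xi>) powr (- \<alpha>))"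
        using inv[OF z, of ?s] by linarith
    qed (use A B in auto)
    also have "\<dots> = A * (B * (2 powr \<alpha> * B)) * h powr \<gamma> * ((1 + norm \<xi>) powr (2 * \<alpha>) * ((1 + norm \<xi>) powr (- \<alpha>) * (1
      + norm \<xi>) powr (- \<alpha>)))"
      by (simp only: mult_ac)
    also have "(1 + norm \<xi>) powr (2 * \<alpha>) * ((1 + norm \<xi>) powr (- \<alpha>) * (1 + norm \<xi>) powr (- \<alpha>)) = 1"
    proof -
      have "0 < 1 + norm \<xi>" by (simp add: add_pos_nonneg)
      then show ?thesis unfolding powr_add[symmetric] by simp
    qed
    also have "A * (B * (2 powr \<alpha> * B)) * h powr \<gamma> * 1 \<le> C * h powr \<gamma>" using C by (simp add: mult_right_mono)
    finally show "cmod (1 / (complex_of_real (discrete_symbol G h \<xi>) - z) - 1 / (complex_of_real (G \<xi>) - z))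
      \<le> C * h powr \<gamma>"
      by (simp add: discrete_symbol_sine)
  next
    fix z and h :: real and \<xi> :: "real ^ 'd" and i
    assume z: "z \<in> K" and h: "0 < h" "h \<le> 1" and \<xi>: "pi / (2 * h) \<le> \<bar>\<xi> $ i\<bar>"
    have "1 / h \<le> pi / (2 * h)" using h pi_ge_two by (simp add: field_simps)
    then have "1 / h \<le> norm \<xi>" using \<xi> component_le_norm_cart[of \<xi> i] by linarith
    from far[OF z h this] show "cmod (1 / (complex_of_real (G \<xi>) - z)) \<le> C * h powr \<gamma>"
      using C(2) mult_right_mono[OF C(2), of "h powr \<gamma>"] by simp
  next
    fix z and h :: real and \<xi> :: "real ^ 'd" and i
    assume z: "z \<in> K" and h: "0 < h" "h \<le> 1" and \<xi>: "pi / (2 * h) \<le> \<bar>\<xi> $ i\<bar>" "\<bar>\<xi> $ i\<bar> \<le> 3 * pi / (2 * h)"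
    define t where "t = h / 2 * \<bar>\<xi> $ i\<bar>"
    \<comment> \<open>For \<open>t\<close> in this range the sine is at least sin (pi / 6); values
      beyond pi / 2 are reflected.\<close>
    have t: "pi / 4 \<le> t" "t \<le> 3 * pi / 4" using \<xi> h by (auto simp: t_def field_simps)
    have half: "1 / 2 \<le> sin u" if "pi / 4 \<le> u" "u \<le> pi / 2" for u
    proof -
      have "sin (pi / 6) \<le> sin u" using that by (intro sin_monotone_2pi_le) auto
      then show ?thesis by (simp add: sin_30)
    qed
    have "1 / 2 \<le> sin t"
    proof (cases "t \<le> pi / 2")
      case True then show ?thesis using t half by simp
    next
      case False
      then have "1 / 2 \<le> sin (pi - t)" using t by (intro half) auto
      then show ?thesis by simp
    qed
    moreover have "\<bar>sine_point h \<xi> $ i\<bar> = 2 / h * \<bar>sin t\<bar>"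
    proof (cases "\<xi> $ i \<ge> 0")
      case True then show ?thesis using h by (simp add: sine_point_def t_def abs_mult)
    next
      case False then show ?thesis using h by (simp add: sine_point_def t_def abs_mult)
    qed
    ultimately have "2 / h * (1 / 2) \<le> \<bar>sine_point h \<xi> $ i\<bar>"
      using h by (simp only:) (intro mult_left_mono, auto)
    then have "1 / h \<le> norm (sine_point h \<xi>)" using component_le_norm_cart[of "sine_point h \<xi>" i] by simp
    from far[OF z h this] show "cmod (1 / (complex_of_real (discrete_symbol G h \<xi>) - z)) \<le> C * h powr \<gamma>"
      using mult_right_mono[OF C(2), of "h powr \<gamma>"] by (simp add: discrete_symbol_sine)
  qed
qed

section \<open>Convergence of the resolvents\<close>

lemma wco_cong_AE:
  assumes "bounded_measurable a" "bounded_measurable a'" "AE x in lborel. a x = a' x" "c \<noteq> 0"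
  shows "wco a c v f = wco a' c v f"
  unfolding wco_def
proof (rule L2_of_eqI)
  show "AE x in lborel. a x * rep_L2 f (c *\<^sub>R x + v) = a' x * rep_L2 f (c *\<^sub>R x + v)"
    using assms(3) by eventually_elim simp
qed (use assms in \<open>auto intro: square_integrable_wco\<close>)

text \<open>A weight may be replaced by zero on the null set where it exceeds the bound, without
  changing the operator.\<close>

lemma norm_wco_le_AE:
  fixes a :: "real ^ 'd::finite \<Rightarrow> complex" and v :: "real ^ 'd" and f :: "'d L2"
  assumes a: "bounded_measurable a" and M: "AE x in lborel. cmod (a x) \<le> M" "0 \<le> M"
  shows "norm (wco a 1 v f) \<le> M * norm f"
proof -
  note [measurable] = bounded_measurable_borel[OF a]
  define a' where "a' x = (if cmod (a x) \<le> M then a x else 0)" for x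
  have [measurable]: "a' \<in> borel_measurable borel" unfolding a'_def by measurable
  have le: "cmod (a' x) \<le> M" for x using M(2) by (simp add: a'_def)
  have "bounded_measurable a'" by (rule bounded_measurableI[OF _ le]) measurable
  moreover have "AE x in lborel. a x = a' x" using M(1) by eventually_elim (simp add: a'_def)
  ultimately have "wco a 1 v f = wco a' 1 v f" by (intro wco_cong_AE a) auto
  then show ?thesis using norm_wco_le[where a = a' and M = M and v = v and f = f] le by simp
qed

section \<open>Periodicity of the discrete symbol and the sandwiched multiplier\<close>

lemma abs_sin_minus_int_pi: "\<bar>sin (x - pi * real_of_int n)\<bar> = \<bar>sin x\<bar>"
proof -
  have s: "sin (pi * real_of_int n) = 0" unfolding sin_zero_iff_int2 by (auto simp: mult.commute)
  then have "(cos (pi * real_of_int n))\<^sup>2 = 1" using sin_cos_squared_add[of "pi * real_of_int n"] by simp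
  then have "\<bar>cos (pi * real_of_int n)\<bar> = 1" by (simp add: abs_square_eq_1)
  then show ?thesis using s by (simp add: sin_diff abs_mult)
qed

text \<open>A shift by a dual lattice vector changes each sine at most by a sign, and evenness in
  every coordinate removes the signs.\<close>

lemma discrete_symbol_periodic:
  assumes ev: "even_in_coordinates G" and h: "h > 0"
  shows "discrete_symbol G h (\<xi> - lattice_point (2 * pi / h) j) = discrete_symbol G h \<xi>"
proof -
  have "\<bar>sine_point h (\<xi> - lattice_point (2 * pi / h) j) $ i\<bar> = \<bar>sine_point h \<xi> $ i\<bar>" for i
  proof -
    have "h / 2 * (\<xi> - lattice_point (2 * pi / h) j) $ i = h / 2 * \<xi> $ i - pi * real_of_int (j $ i)"
      using h by (simp add: lattice_point_def field_simps)
    then show ?thesis unfolding sine_point_def vec_lambda_beta abs_mult by (simp only: abs_sin_minus_int_pi)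
  qed
  then show ?thesis
    using ev[unfolded even_in_coordinates_def, rule_format, of "sine_point h (\<xi> - lattice_point (2 * pi / h) j)"]
      ev[unfolded even_in_coordinates_def, rule_format, of "sine_point h \<xi>"]
    unfolding discrete_symbol_sine by simp
qed

text \<open>The sine points stay in the cube of half-side \<open>2 / h\<close>, on which the
  continuous function \<open>G\<close> is bounded.\<close>

lemma bounded_discrete_symbol:
  fixes G :: "real ^ 'd::finite \<Rightarrow> real"
  assumes G: "continuous_on UNIV G" and h: "h > 0"
  shows "\<exists>N. bounded_potential (discrete_symbol G h) N"
proof -
  have "bounded (G ` cube (2 / h))"
    by (intro compact_imp_bounded compact_continuous_image continuous_on_subset[OF G]) (auto simp: cube_def)
  then obtain N where N: "\<And>x. x \<in> cube (2 / h) \<Longrightarrow> \<bar>G x\<bar> \<le> N" by (auto simp: bounded_iff)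
  have "sine_point h \<xi> \<in> cube (2 / h)" for \<xi> :: "real ^ 'd"
  proof -
    have "\<bar>sine_point h \<xi> $ i\<bar> \<le> 2 / h" for i
      using mult_left_mono[OF abs_sin_le_one[of "h / 2 * \<xi> $ i"], of "2 / h"] h
      by (simp add: sine_point_def abs_mult)
    then show ?thesis by (simp add: mem_cube abs_le_iff minus_le_iff)
  qed
  moreover have "continuous_on UNIV (discrete_symbol G h)"
    unfolding discrete_symbol_def using h
    by (intro continuous_on_compose2[OF G] continuous_on_vec_lambda continuous_intros) auto
  ultimately show ?thesis
    using N unfolding bounded_potential_def discrete_symbol_sine
    by (auto simp: discrete_symbol_sine intro: borel_measurable_continuous_onI)
qed

text \<open>Because the discrete symbol is periodic, its resolvent passes through the translation by
  \<open>l j\<close> and can be evaluated at \<open>\<xi>\<close>. What remains is one weight and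
  one translation for each pair of indices.\<close>

lemma sandwiched_res_mult:
  fixes a b :: "real ^ 'd::finite \<Rightarrow> complex"
  assumes bma: "bounded_measurable a" and bmb: "bounded_measurable b"
    and ev: "even_in_coordinates G" and h: "h > 0"
    and Gm: "discrete_symbol G h \<in> borel_measurable borel" and z: "Im z \<noteq> 0"
  defines "l \<equiv> lattice_point (2 * pi / h)"
  shows "period_op a h (res_mult (discrete_symbol G h) z (period_adj b h f)) =
    (\<Sum>j\<in>shift_indices. \<Sum>k\<in>shift_indices. wco (\<lambda>\<xi>. period_coeff a h j \<xi> *
      (1 / (complex_of_real (discrete_symbol G h \<xi>) - z)) * cnj (period_coeff b h k (\<xi> - l j + l k))) 1 (l k - l j)
        f)"
proof -
  let ?\<rho> = "\<lambda>\<xi>. 1 / (complex_of_real (discrete_symbol G h \<xi>) - z)"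
  have bm\<rho>: "bounded_measurable ?\<rho>" by (rule bounded_measurable_res[OF Gm z])
  note lin = bounded_linear.linear[OF bounded_clinear_imp_linear]
  have res: "res_mult (discrete_symbol G h) z (wco (\<lambda>\<xi>. cnj (period_coeff b h k (\<xi> + l k))) 1 (l k) f) =
      wco (\<lambda>\<xi>. ?\<rho> \<xi> * cnj (period_coeff b h k (\<xi> + l k))) 1 (l k) f" for k
    unfolding res_mult_def by (subst wco_wco) (simp_all add: bm\<rho> bmb)
  have bmk: "bounded_measurable (\<lambda>\<xi>. ?\<rho> \<xi> * cnj (period_coeff b h k (\<xi> + l k)))" for k
    by (intro bounded_measurable_mult bm\<rho>) (simp add: bmb)
  have inner: "wco (period_coeff a h j) 1 (- l j) (wco (\<lambda>\<xi>. ?\<rho> \<xi> * cnj (period_coeff b h k (\<xi> + l k))) 1 (l k) f) =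
      wco (\<lambda>\<xi>. period_coeff a h j \<xi> * ?\<rho> \<xi> * cnj (period_coeff b h k (\<xi> - l j + l k))) 1 (l k - l j) f" for j k
    by (subst wco_wco[OF bounded_measurable_period_coeff[OF bma] bmk])
      (simp_all add: l_def discrete_symbol_periodic[OF ev h] mult.assoc)
  have lin_res: "bounded_clinear (res_mult (discrete_symbol G h) z)" by (rule bounded_clinear_res_mult[OF Gm z])
  have lin_a: "bounded_clinear (wco (period_coeff a h j) 1 (- l j))" for j
    by (intro bounded_clinear_wco) (simp_all add: bma)
  have "period_op a h (res_mult (discrete_symbol G h) z (period_adj b h f)) =
      (\<Sum>j\<in>shift_indices. wco (period_coeff a h j) 1 (- l j) (\<Sum>k\<in>shift_indices. wco (\<lambda>\<xi>. ?\<rho> \<xi> * cnj (period_coeff b h k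
        (\<xi> + l k))) 1 (l k) f))"
    unfolding period_op_def period_adj_def l_def[symmetric] linear_sum[OF lin[OF lin_res]] o_def res ..
  also have "\<dots> = (\<Sum>j\<in>shift_indices. \<Sum>k\<in>shift_indices.
      wco (\<lambda>\<xi>. period_coeff a h j \<xi> * ?\<rho> \<xi> * cnj (period_coeff b h k (\<xi> - l j + l k))) 1 (l k - l j) f)"
    unfolding linear_sum[OF lin[OF lin_a]] o_def inner ..
  finally show ?thesis .
qed

lemma period_coeff_diagonal:
  fixes a b :: "real ^ 'd::finite \<Rightarrow> complex"
  assumes a: "fourier_symbol \<phi> a" and h: "h > 0"
  shows "(\<Sum>j\<in>shift_indices. period_coeff a h j \<xi> * cnj (period_coeff b h j \<xi>)) =
    complex_of_real ((2 * pi) ^ CARD('d)) * a (h *\<^sub>R \<xi>) * cnj (b (h *\<^sub>R \<xi>))"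
proof -
  let ?s = "complex_of_real ((2 * pi) powr (real CARD('d) / 2))"
  have ss: "?s * ?s = complex_of_real ((2 * pi) ^ CARD('d))"
    unfolding dft_factor_sq[symmetric] by (simp add: power2_eq_square)
  have "(\<Sum>j\<in>shift_indices. period_coeff a h j \<xi> * cnj (period_coeff b h j \<xi>)) =
      (\<Sum>j\<in>shift_indices. (?s * ?s * a (h *\<^sub>R \<xi>) * cnj (b (h *\<^sub>R \<xi>))) * indicator (centered_box h) (\<xi> - lattice_point
        (2 * pi / h) j))"
    by (intro sum.cong refl) (simp add: period_coeff_def indicator_def)
  also have "\<dots> = ?s * ?s * a (h *\<^sub>R \<xi>) * cnj (b (h *\<^sub>R \<xi>))"
  proof (cases "h *\<^sub>R \<xi> \<in> cube (3 * pi / 2)")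
    case True
    then show ?thesis unfolding sum_distrib_left[symmetric] centered_box_sum[OF h True] by simp
  next
    case False
    then have "a (h *\<^sub>R \<xi>) = 0" using a by (simp add: fourier_symbol_def)
    then show ?thesis by simp
  qed
  finally show ?thesis unfolding ss .
qed

text \<open>The diagonal pairs involve no translation and collapse to multiplication by the product
  of the symbols times the discrete resolvent symbol, to be compared with the continuous one. Each
  of the finitely many other pairs is bounded separately by its weight.\<close>

lemma free_resolvent_estimate:
  fixes a b :: "real ^ 'd::finite \<Rightarrow> complex" and G :: "real ^ 'd \<Rightarrow> real"
  assumes a: "fourier_symbol \<phi> a" and b: "fourier_symbol \<psi> b"
    and bi: "biorthogonal (shifted \<phi> 1) (shifted \<psi> 1)"
    and G: "good_symbol G \<alpha> \<gamma>" and K: "compact K" "K \<inter> \<real> = {}"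
  shows "\<exists>C\<ge>0. \<forall>z\<in>K. \<forall>h f. 0 < h \<and> h \<le> 1 \<longrightarrow>
    norm (period_op a h (res_mult (discrete_symbol G h) z (period_adj b h f)) - res_mult G z f) \<le> C * h powr \<gamma> * norm
      f"
proof -
  obtain C where C: "C > 0"
    "\<And>z h \<xi>. z \<in> K \<Longrightarrow> 0 < h \<Longrightarrow> h \<le> 1 \<Longrightarrow> \<xi> \<in> cube (pi / (2 * h)) \<Longrightarrow>
      cmod (1 / (complex_of_real (discrete_symbol G h \<xi>) - z) - 1 / (complex_of_real (G \<xi>) - z)) \<le> C * h powr \<gamma>"
    "\<And>z h \<xi> i. z \<in> K \<Longrightarrow> 0 < h \<Longrightarrow> h \<le> 1 \<Longrightarrow> pi / (2 * h) \<le> \<bar>\<xi> $ i\<bar> \<Longrightarrow>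
      cmod (1 / (complex_of_real (G \<xi>) - z)) \<le> C * h powr \<gamma>"
    "\<And>z h \<xi> i. z \<in> K \<Longrightarrow> 0 < h \<Longrightarrow> h \<le> 1 \<Longrightarrow> pi / (2 * h) \<le> \<bar>\<xi> $ i\<bar> \<Longrightarrow> \<bar>\<xi> $ i\<bar> \<le> 3 * pi / (2 * h) \<Longrightarrow>
      cmod (1 / (complex_of_real (discrete_symbol G h \<xi>) - z)) \<le> C * h powr \<gamma>"
    using good_symbol_resolvent[OF G K] by blast
  have bma: "bounded_measurable a" and bmb: "bounded_measurable b"
    using a b unfolding fourier_symbol_def by blast+
  obtain A where A: "\<And>\<xi>. cmod (a \<xi>) \<le> A" using bma by (auto simp: bounded_measurable_def)
  obtain B where B: "\<And>\<xi>. cmod (b \<xi>) \<le> B" using bmb by (auto simp: bounded_measurable_def)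
  have A0: "0 \<le> A" and B0: "0 \<le> B" using A B norm_ge_zero order_trans by blast+
  have ev: "even_in_coordinates G" and cont: "continuous_on UNIV G" using G by (auto simp: good_symbol_def)
  have Gm: "G \<in> borel_measurable borel" by (rule borel_measurable_continuous_onI[OF cont])
  define s where "s = (2 * pi) powr (real CARD('d) / 2)"
  have s0: "0 \<le> s" by (simp add: s_def)
  define c1 where "c1 = s * A * C * (s * B)"
  define c2 where "c2 = (2 * pi) ^ CARD('d) * A * B * C + C"
  define n where "n = real (card (shift_indices :: (int ^ 'd) set))"
  have c12: "0 \<le> c1" "0 \<le> c2" using A0 B0 C s0 by (auto simp: c1_def c2_def)
  have main: "norm (period_op a h (res_mult (discrete_symbol G h) z (period_adj b h f)) - res_mult G z f) \<le>
      (n * (n * c1) + c2) * h powr \<gamma> * norm f"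
    if z: "z \<in> K" and h: "0 < h" "h \<le> 1" for z h f
  proof -
    let ?l = "lattice_point (2 * pi / h) :: int ^ 'd \<Rightarrow> _"
    define \<rho> where "\<rho> \<xi> = 1 / (complex_of_real (discrete_symbol G h \<xi>) - z)" for \<xi>
    define \<rho>0 where "\<rho>0 \<xi> = 1 / (complex_of_real (G \<xi>) - z)" for \<xi>
    have Imz: "Im z \<noteq> 0" using z K(2) complex_is_Real_iff by blast
    obtain N where N: "bounded_potential (discrete_symbol G h) N" using bounded_discrete_symbol[OF cont h(1)] by blast
    then have Ghm: "discrete_symbol G h \<in> borel_measurable borel" by (simp add: bounded_potential_def)
    have bm\<rho>: "bounded_measurable \<rho>" and bm\<rho>0: "bounded_measurable \<rho>0"
      unfolding \<rho>_def \<rho>0_def by (intro bounded_measurable_res Ghm Gm Imz)+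
    have h\<gamma>: "0 \<le> C * h powr \<gamma>" using C(1) by simp
    have hi: "\<bar>\<xi> $ i\<bar> \<le> 3 * pi / (2 * h)" if "h *\<^sub>R \<xi> \<in> cube (3 * pi / 2)" for \<xi> :: "real ^ 'd" and i
    proof -
      have "\<bar>h * \<xi> $ i\<bar> \<le> 3 * pi / 2" using that
        by (simp only: mem_cube vector_scaleR_component real_scaleR_def abs_le_iff) (meson minus_le_iff)
      then show ?thesis using h by (simp add: abs_mult field_simps)
    qed
    define m where "m j k \<xi> = period_coeff a h j \<xi> * \<rho> \<xi> * cnj (period_coeff b h k (\<xi> - ?l j + ?l k))" for j k \<xi>
    have bmm: "bounded_measurable (m j k)" for j k
      unfolding m_def using bounded_measurable_affine[OF bounded_measurable_period_coeff_adj[OF bmb, of h k "?l k"],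
        of 1 "- ?l j"]
      by (intro bounded_measurable_mult bm\<rho> bounded_measurable_period_coeff[OF bma]) simp
    \<comment> \<open>If both symbols are nonzero, two points that differ by a nonzero multiple of 2
      pi in coordinate \<open>i\<close> both lie in the support cube; this forces |h \<xi>_i| \<ge>
      pi / 2, where the discrete resolvent is small.\<close>
    have off: "norm (wco (m j k) 1 v f) \<le> c1 * h powr \<gamma> * norm f" if jk: "j \<noteq> k" for j k v
    proof (rule norm_wco_le[OF bounded_measurable_borel[OF bmm]])
      fix \<xi>
      show "cmod (m j k \<xi>) \<le> c1 * h powr \<gamma>"
      proof (cases "h *\<^sub>R \<xi> \<in> cube (3 * pi / 2) \<and> h *\<^sub>R (\<xi> - ?l j + ?l k) \<in> cube (3 * pi / 2)")
        case True
        have "\<exists>i. j $ i \<noteq> k $ i" using jk by (simp add: vec_eq_iff)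
        then obtain i where i: "j $ i \<noteq> k $ i" by blast
        have comp: "(h *\<^sub>R (\<xi> - ?l j + ?l k)) $ i = h * \<xi> $ i + 2 * pi * real_of_int (k $ i - j $ i)"
          using h by (simp add: lattice_point_def field_simps)
        have b1: "- (3 * pi / 2) \<le> h * \<xi> $ i + 2 * pi * real_of_int (k $ i - j $ i)"
          "h * \<xi> $ i + 2 * pi * real_of_int (k $ i - j $ i) \<le> 3 * pi / 2"
          using True unfolding mem_cube comp[symmetric] by blast+
        have "pi / 2 \<le> \<bar>h * \<xi> $ i\<bar>"
        proof (cases "k $ i - j $ i > 0")
          case True
          then have "2 * pi * 1 \<le> 2 * pi * real_of_int (k $ i - j $ i)" by (intro mult_left_mono) auto
          then show ?thesis using b1 by linarith
        next
          case False
          with i have "real_of_int (k $ i - j $ i) \<le> - 1" by linarith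
          then have "2 * pi * real_of_int (k $ i - j $ i) \<le> 2 * pi * (- 1)" by (intro mult_left_mono) auto
          then show ?thesis using b1 by linarith
        qed
        then have "pi / (2 * h) \<le> \<bar>\<xi> $ i\<bar>" using h by (simp add: abs_mult field_simps)
        then have "cmod (\<rho> \<xi>) \<le> C * h powr \<gamma>"
          unfolding \<rho>_def by (rule C(4)[OF z h]) (use hi True in blast)
        then have "cmod (period_coeff a h j \<xi>) * cmod (\<rho> \<xi>) * cmod (period_coeff b h k (\<xi> - ?l j + ?l k)) \<le>
            (s * A) * (C * h powr \<gamma>) * (s * B)"
          unfolding s_def using A0 B0 h\<gamma>
          by (intro mult_mono cmod_period_coeff_le A B) auto
        then show ?thesis by (simp add: m_def norm_mult c1_def mult_ac)
      next
        case False
        then have "a (h *\<^sub>R \<xi>) = 0 \<or> b (h *\<^sub>R (\<xi> - ?l j + ?l k)) = 0"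
          using a b unfolding fourier_symbol_def by blast
        then have "m j k \<xi> = 0" unfolding m_def period_coeff_def by auto
        then show ?thesis using c12 by simp
      qed
    qed
    \<comment> \<open>On the cube of half-side pi / (2 h) the product of the symbols is 1 almost
      everywhere, so \<open>\<kappa>\<close> is the difference of the two resolvent symbols;
      outside, both terms are estimated on their own.\<close>
    define \<kappa> where "\<kappa> \<xi> = complex_of_real ((2 * pi) ^ CARD('d)) * a (h *\<^sub>R \<xi>) * cnj (b (h *\<^sub>R \<xi>)) * \<rho> \<xi> + (- 1)
      * \<rho>0 \<xi>" for \<xi>
    have bm\<kappa>: "bounded_measurable \<kappa>"
      unfolding \<kappa>_def
      using bounded_measurable_affine[OF bma, of h 0] bounded_measurable_cnj[OF bounded_measurable_affine[OF bmb, of h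
        0]]
      by (intro bounded_measurable_add bounded_measurable_mult bm\<rho> bm\<rho>0 bounded_measurable_const) simp_all
    have "AE \<xi> in lborel. h *\<^sub>R \<xi> + 0 \<in> cube (pi / 2) \<longrightarrow>
        complex_of_real ((2 * pi) ^ CARD('d)) * a (h *\<^sub>R \<xi> + 0) * cnj (b (h *\<^sub>R \<xi> + 0)) = 1"
      by (rule AE_lborel_affine[OF fourier_symbol_product[OF a b bi]]) (use h in simp)
    then have AE\<kappa>: "AE \<xi> in lborel. cmod (\<kappa> \<xi>) \<le> c2 * h powr \<gamma>"
    proof eventually_elim
      case (elim \<xi>)
      show ?case
      proof (cases "\<xi> \<in> cube (pi / (2 * h))")
        case True
        then have "h *\<^sub>R \<xi> + 0 \<in> cube (pi / 2)" using h by (simp add: mem_cube field_simps)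
        then have "\<kappa> \<xi> = \<rho> \<xi> - \<rho>0 \<xi>" using elim by (simp add: \<kappa>_def)
        then have "cmod (\<kappa> \<xi>) \<le> C * h powr \<gamma>" unfolding \<rho>_def \<rho>0_def using C(2)[OF z h True] by simp
        also have "\<dots> \<le> c2 * h powr \<gamma>" using A0 B0 C by (intro mult_right_mono) (auto simp: c2_def)
        finally show ?thesis .
      next
        case False
        then have "\<exists>i. \<not> (- (pi / (2 * h)) \<le> \<xi> $ i \<and> \<xi> $ i \<le> pi / (2 * h))" by (simp only: mem_cube) blast
        then obtain i where "\<not> (- (pi / (2 * h)) \<le> \<xi> $ i \<and> \<xi> $ i \<le> pi / (2 * h))" by blast
        then have i: "pi / (2 * h) \<le> \<bar>\<xi> $ i\<bar>" by linarith
        have 2: "cmod (\<rho>0 \<xi>) \<le> C * h powr \<gamma>" unfolding \<rho>0_def by (rule C(3)[OF z h i])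
        have 1: "cmod (complex_of_real ((2 * pi) ^ CARD('d)) * a (h *\<^sub>R \<xi>) * cnj (b (h *\<^sub>R \<xi>)) * \<rho> \<xi>) \<le>
            (2 * pi) ^ CARD('d) * A * B * (C * h powr \<gamma>)"
        proof (cases "h *\<^sub>R \<xi> \<in> cube (3 * pi / 2)")
          case True
          have "cmod (\<rho> \<xi>) \<le> C * h powr \<gamma>" unfolding \<rho>_def by (rule C(4)[OF z h i hi[OF True]])
          then have "cmod (complex_of_real ((2 * pi) ^ CARD('d))) * cmod (a (h *\<^sub>R \<xi>)) * cmod (b (h *\<^sub>R \<xi>))
            * cmod (\<rho> \<xi>) \<le>
              (2 * pi) ^ CARD('d) * A * B * (C * h powr \<gamma>)"
            using A0 B0 h\<gamma> by (intro mult_mono A B) (auto simp: norm_mult norm_power)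
          then show ?thesis by (simp only: norm_mult complex_mod_cnj)
        next
          case False
          then have "a (h *\<^sub>R \<xi>) = 0" using a by (simp add: fourier_symbol_def)
          then show ?thesis using A0 B0 h\<gamma> by simp
        qed
        have "cmod (\<kappa> \<xi>) \<le> (2 * pi) ^ CARD('d) * A * B * (C * h powr \<gamma>) + C * h powr \<gamma>"
          unfolding \<kappa>_def by (rule order_trans[OF norm_triangle_ineq]) (use 1 2 in \<open>simp add: norm_mult\<close>)
        also have "\<dots> = c2 * h powr \<gamma>" by (simp add: c2_def algebra_simps)
        finally show ?thesis .
      qed
    qed
    have expand: "period_op a h (res_mult (discrete_symbol G h) z (period_adj b h f)) =
        (\<Sum>j\<in>shift_indices. \<Sum>k\<in>shift_indices. wco (m j k) 1 (?l k - ?l j) f)"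
      unfolding sandwiched_res_mult[OF bma bmb ev h(1) Ghm Imz] m_def \<rho>_def ..
    also have "\<dots> = (\<Sum>j\<in>shift_indices. wco (m j j) 1 0 f + (\<Sum>k\<in>shift_indices - {j}. wco (m j k) 1 (?l k - ?l j) f))"
      by (intro sum.cong refl) (simp add: sum.remove)
    also have "\<dots> = wco (\<lambda>\<xi>. \<Sum>j\<in>shift_indices. m j j \<xi>) 1 0 f + (\<Sum>j\<in>shift_indices. \<Sum>k\<in>shift_indices
      - {j}. wco (m j k) 1 (?l k - ?l j) f)"
      by (simp add: sum.distrib wco_sum bmm)
    also have "(\<lambda>\<xi>. \<Sum>j\<in>shift_indices. m j j \<xi>)
      = (\<lambda>\<xi>. complex_of_real ((2 * pi) ^ CARD('d)) * a (h *\<^sub>R \<xi>) * cnj (b (h *\<^sub>R \<xi>)) * \<rho> \<xi>)"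
    proof
      fix \<xi>
      have "(\<Sum>j\<in>shift_indices. m j j \<xi>) = (\<Sum>j\<in>shift_indices. period_coeff a h j \<xi> * cnj (period_coeff b h j \<xi>)) * \<rho> \<xi>"
        unfolding sum_distrib_right m_def by (intro sum.cong refl) simp
      then show "(\<Sum>j\<in>shift_indices. m j j \<xi>)
        = complex_of_real ((2 * pi) ^ CARD('d)) * a (h *\<^sub>R \<xi>) * cnj (b (h *\<^sub>R \<xi>)) * \<rho> \<xi>"
        unfolding period_coeff_diagonal[OF a h(1)] .
    qed
    finally have E1: "period_op a h (res_mult (discrete_symbol G h) z (period_adj b h f)) =
        wco (\<lambda>\<xi>. complex_of_real ((2 * pi) ^ CARD('d)) * a (h *\<^sub>R \<xi>) * cnj (b (h *\<^sub>R \<xi>)) * \<rho> \<xi>) 1 0 f +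
        (\<Sum>j\<in>shift_indices. \<Sum>k\<in>shift_indices - {j}. wco (m j k) 1 (?l k - ?l j) f)" .
    have E2: "wco (\<lambda>\<xi>. complex_of_real ((2 * pi) ^ CARD('d)) * a (h *\<^sub>R \<xi>) * cnj (b (h *\<^sub>R \<xi>)) * \<rho> \<xi>) 1 0 f
      - res_mult G z f = wco \<kappa> 1 0 f"
    proof -
      have bm1: "bounded_measurable (\<lambda>\<xi>. complex_of_real ((2 * pi) ^ CARD('d)) * a (h *\<^sub>R \<xi>) * cnj (b (h *\<^sub>R \<xi>))
        * \<rho> \<xi>)"
        using bounded_measurable_affine[OF bma, of h 0] bounded_measurable_cnj[OF bounded_measurable_affine[OF bmb, of
          h 0]]
        by (intro bounded_measurable_mult bm\<rho> bounded_measurable_const) simp_all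
      have bm2: "bounded_measurable (\<lambda>\<xi>. (- 1) * \<rho>0 \<xi>)"
        by (intro bounded_measurable_mult bm\<rho>0 bounded_measurable_const)
      have "- res_mult G z f = wco (\<lambda>\<xi>. (- 1) * \<rho>0 \<xi>) 1 0 f"
        unfolding uminus_L2_scaleC res_mult_def \<rho>0_def[symmetric]
        by (cases f) (simp add: wco_L2_of bm\<rho>0 bm2[simplified] scaleC_L2_of square_integrable_mult)
      then show ?thesis
        using wco_add[OF bm1 bm2, of 1 0 f] unfolding \<kappa>_def
          by (simp add: diff_conv_add_uminus del: add_uminus_conv_diff)
    qed
    have E: "period_op a h (res_mult (discrete_symbol G h) z (period_adj b h f)) - res_mult G z f =
        wco \<kappa> 1 0 f + (\<Sum>j\<in>shift_indices. \<Sum>k\<in>shift_indices - {j}. wco (m j k) 1 (?l k - ?l j) f)"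
      unfolding E1 E2[symmetric] by simp
    have "norm (\<Sum>j\<in>shift_indices. \<Sum>k\<in>shift_indices - {j}. wco (m j k) 1 (?l k - ?l j) f) \<le>
        (\<Sum>j\<in>(shift_indices :: (int ^ 'd) set). \<Sum>k\<in>(shift_indices :: (int ^ 'd) set) - {j}. c1 * h powr \<gamma> * norm f)"
      by (intro sum_norm_le off) auto
    also have "\<dots> \<le> (\<Sum>j\<in>(shift_indices :: (int ^ 'd) set). \<Sum>k\<in>(shift_indices :: (int ^ 'd) set). c1 * h powr \<gamma>
      * norm f)"
      using c12 by (intro sum_mono sum_mono2) auto
    also have "\<dots> = n * (n * (c1 * h powr \<gamma> * norm f))" by (simp add: n_def)
    finally have o: "norm (\<Sum>j\<in>shift_indices. \<Sum>k\<in>shift_indices - {j}. wco (m j k) 1 (?l k - ?l j) f)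
      \<le> n * (n * (c1 * h powr \<gamma> * norm f))" .
    have d: "norm (wco \<kappa> 1 0 f) \<le> c2 * h powr \<gamma> * norm f"
      by (rule norm_wco_le_AE[OF bm\<kappa> AE\<kappa>]) (use c12 in simp)
    have "norm (wco \<kappa> 1 0 f + (\<Sum>j\<in>shift_indices. \<Sum>k\<in>shift_indices - {j}. wco (m j k) 1 (?l k - ?l j) f)) \<le>
        c2 * h powr \<gamma> * norm f + n * (n * (c1 * h powr \<gamma> * norm f))"
      using d o norm_triangle_le by (meson add_mono order_trans norm_triangle_ineq)
    also have "\<dots> = (n * (n * c1) + c2) * h powr \<gamma> * norm f" by (simp add: algebra_simps)
    finally show ?thesis unfolding E .
  qed
  show ?thesis
    by (rule exI[of _ "n * (n * c1) + c2"]) (use main c12 in \<open>auto simp: n_def\<close>)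
qed

section \<open>Including the potential\<close>

lemma Hoelder_continuous:
  fixes V :: "real ^ 'd::finite \<Rightarrow> real"
  assumes L: "\<And>x y. \<bar>V x - V y\<bar> \<le> L * norm (x - y) powr \<theta>" and \<theta>: "0 < \<theta>"
  shows "continuous_on UNIV V"
  unfolding continuous_on_eq_continuous_at[OF open_UNIV] isCont_def
proof
  fix x :: "real ^ 'd"
  have "((\<lambda>y. norm (y - x)) \<longlongrightarrow> norm (x - x)) (at x)" by (intro tendsto_intros)
  then have n0: "((\<lambda>y. norm (y - x)) \<longlongrightarrow> 0) (at x)" by simp
  have "((\<lambda>y. norm (y - x) powr \<theta>) \<longlongrightarrow> 0 powr \<theta>) (at x)"
    by (rule tendsto_powr'[OF n0 tendsto_const]) (use \<theta> in auto)
  then have "((\<lambda>y. L * norm (y - x) powr \<theta>) \<longlongrightarrow> L * 0 powr \<theta>) (at x)" by (intro tendsto_mult tendsto_const)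
  then have lim: "((\<lambda>y. L * norm (y - x) powr \<theta>) \<longlongrightarrow> 0) (at x)" by simp
  have "((\<lambda>y. V y - V x) \<longlongrightarrow> 0) (at x)"
    by (rule Lim_null_comparison[OF always_eventually lim]) (simp add: L)
  then show "(V \<longlongrightarrow> V x) (at x)" by (rule LIM_zero_cancel)
qed

text \<open>The sequence \<open>u\<close> behind \<open>q\<close> is recovered from its embedding
  \<open>t\<close>, as biorthogonality makes the discretization a left inverse. Hence the discrete
  potential acts on \<open>q\<close> as the discretized continuous potential plus the commutator
  \<open>\<Delta>\<close>, and the former is moved into the data of the free discrete
  resolvent.\<close>

lemma perturbed_resolvent_identity:
  fixes a b :: "real ^ 'd::finite \<Rightarrow> complex" and G V :: "real ^ 'd \<Rightarrow> real" and g :: "'d L2"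
  assumes a: "fourier_symbol \<phi> a" and b: "fourier_symbol \<psi> b"
    and bi: "biorthogonal (shifted \<phi> 1) (shifted \<psi> 1)" and h: "h > 0"
    and Gh: "bounded_potential (discrete_symbol G h) N" and V: "bounded_potential V M" and z: "Im z \<noteq> 0"
  defines "p \<equiv> period_op a h (Res (discrete_symbol G h) z (lattice_potential V h) (period_adj b h g))"
  defines "\<Delta> \<equiv> dfourier h (\<lambda>k. complex_of_real (V (lattice_point h k)) * discretization \<psi> h (inverse_fourier p) k
      - discretization \<psi> h (real_mult V (inverse_fourier p)) k)"
  shows "p = period_op a h (res_mult (discrete_symbol G h) z (period_adj b h (g - fourier_conj V p)))
    - period_op a h (res_mult (discrete_symbol G h) z \<Delta>)"
proof -
  have bma: "bounded_measurable a" and bmb: "bounded_measurable b"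
    using a b unfolding fourier_symbol_def by blast+
  have Ghm: "discrete_symbol G h \<in> borel_measurable borel" using Gh by (simp add: bounded_potential_def)
  note s = symmetric_op_lattice_potential[OF V h]
  have M: "\<And>x. \<bar>V x\<bar> \<le> M" using V by (simp add: bounded_potential_def)
  define y where "y = period_adj b h g"
  define q where "q = Res (discrete_symbol G h) z (lattice_potential V h) y"
  have Py: "cube_proj h y = y" unfolding y_def by (rule cube_proj_period_adj[OF bmb])
  have Pq: "cube_proj h q = q" unfolding q_def by (rule resolvent_discrete_eq(2)[OF h Gh z V Py])
  define u where "u = dcoeff h q"
  have u: "u \<in> ell2" unfolding u_def by (rule dcoeff_ell2[OF h])
  have Du: "dfourier h u = q" unfolding u_def by (simp add: dfourier_dcoeff[OF h] Pq)
  have pq: "p = period_op a h q" by (simp add: p_def q_def y_def)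
  define t where "t = inverse_fourier p"
  have emb: "embedding \<phi> h u = t" by (simp add: embedding_eq[OF a h u] Du t_def pq)
  have disc: "discretization \<psi> h t = u"
    unfolding emb[symmetric] by (rule discretization_embedding[OF a b bi h u])
  define e where "e k = complex_of_real (V (lattice_point h k)) * discretization \<psi> h t k
    - discretization \<psi> h (real_mult V t) k" for k
  have dd: "discretization \<psi> h f \<in> ell2" for f by (simp add: discretization_eq[OF b h] dcoeff_ell2 h)
  have "(\<lambda>k. complex_of_real (V (lattice_point h k)) * discretization \<psi> h t k) \<in> ell2"
    by (rule ell2_mult(1)[where M = M]) (simp_all add: M dd)
  moreover have "(\<lambda>k. (- 1) * discretization \<psi> h (real_mult V t) k) \<in> ell2" by (rule ell2_scale[OF dd])
  ultimately have "(\<lambda>k. complex_of_real (V (lattice_point h k)) * discretization \<psi> h t k + (- 1)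
    * discretization \<psi> h (real_mult V t) k) \<in> ell2"
    by (rule ell2_add)
  then have e: "e \<in> ell2" by (simp add: e_def[abs_def])
  have "lattice_potential V h q = dfourier h (\<lambda>k. e k + discretization \<psi> h (real_mult V t) k)"
    unfolding lattice_potential_def lattice_mult_def e_def u_def[symmetric] disc by simp
  also have "\<dots> = dfourier h e + dfourier h (discretization \<psi> h (real_mult V t))"
    by (rule dfourier_add[OF h e dd])
  also have "dfourier h e = \<Delta>" unfolding \<Delta>_def e_def[abs_def] t_def ..
  also have "dfourier h (discretization \<psi> h (real_mult V t)) = period_adj b h (fourier_conj V p)"
    unfolding dfourier_discretization[OF b h] fourier_conj_def t_def ..
  finally have Bq: "lattice_potential V h q = \<Delta> + period_adj b h (fourier_conj V p)" .
  have "q = res_mult (discrete_symbol G h) z (y - lattice_potential V h q)"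
    unfolding q_def by (rule Res_eq[OF Ghm z s])
  also have "y - lattice_potential V h q = period_adj b h (g - fourier_conj V p) - \<Delta>"
    unfolding Bq y_def by (simp add: bounded_clinear_simps[OF bounded_clinear_period_adj[OF bmb]])
  finally have "q = res_mult (discrete_symbol G h) z (period_adj b h (g - fourier_conj V p))
    - res_mult (discrete_symbol G h) z \<Delta>"
    by (simp only: bounded_clinear_simps(2)[OF bounded_clinear_res_mult[OF Ghm z]])
  then have "period_op a h q = period_op a h (res_mult (discrete_symbol G h) z (period_adj b h (g
    - fourier_conj V p))) - period_op a h (res_mult (discrete_symbol G h) z \<Delta>)"
    by (simp only: bounded_clinear_simps(2)[OF bounded_clinear_period_op[OF bma], symmetric])
  then show ?thesis unfolding pq[symmetric] .
qed

text \<open>With \<open>w\<close> the error of \<open>p\<close>, the difference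
  \<open>w - \<eta>\<close> is the perturbed resolvent applied to \<open>- B \<eta>\<close>, so its
  norm is at most \<open>M / |Im z|\<close> times that of \<open>\<eta>\<close>.\<close>

lemma resolvent_stability:
  assumes G: "G \<in> borel_measurable borel" and z: "Im z \<noteq> 0" and B: "symmetric_op B M"
    and p: "p = res_mult G z (g - B p) + \<eta>"
  shows "norm (p - Res G z B g) \<le> (1 + M / \<bar>Im z\<bar>) * norm \<eta>"
proof -
  note lin = bounded_clinear_simps[OF bounded_clinear_res_mult[OF G z]] bounded_clinear_simps[OF B_linear[OF G z B]]
  define w where "w = p - Res G z B g"
  have "w - \<eta> = res_mult G z (g - B p) - res_mult G z (g - B (Res G z B g))"
    using p Res_eq[OF G z B, of g] by (simp add: w_def algebra_simps)
  also have "\<dots> = res_mult G z ((g - B p) - (g - B (Res G z B g)))" by (simp only: lin)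
  also have "(g - B p) - (g - B (Res G z B g)) = - B \<eta> - B (w - \<eta>)"
    by (simp add: lin w_def)
  finally have "w - \<eta> = Res G z B (- B \<eta>)" by (rule Res_unique[OF G z B])
  then have "norm (w - \<eta>) \<le> norm (- B \<eta>) / \<bar>Im z\<bar>" using norm_Res_le[OF G z B, of "- B \<eta>"] by (simp only:)
  also have "\<dots> \<le> M * norm \<eta> / \<bar>Im z\<bar>" using B by (intro divide_right_mono) (auto simp: symmetric_op_def)
  finally have "norm w \<le> norm \<eta> + M * norm \<eta> / \<bar>Im z\<bar>"
    using norm_triangle_sub[of w \<eta>] by linarith
  then show ?thesis by (simp add: w_def distrib_right)
qed

text \<open>Boundedness of the difference is asserted along with the estimate, because only then is
  \<open>onorm\<close> the operator norm. The number \<open>\<gamma>0\<close> is the rate for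
  vanishing potential.\<close>

theorem theorem4p4:
  fixes \<phi>0 \<psi>0 :: "real ^ 'd \<Rightarrow> complex"
    and V G0 :: "real ^ 'd \<Rightarrow> real"
    and \<theta> \<theta>' \<tau> \<alpha> \<beta> \<beta>' \<gamma>0 \<gamma> :: real
    and K :: "complex set"
  assumes admissible: "admissible \<phi>0 \<psi>0"
    and V_bounded: "bounded (range V)"
    and \<theta>: "0 < \<theta>" "\<theta> \<le> 1"
    and V_Hoelder: "\<exists>L. \<forall>x y. \<bar>V x - V y\<bar> \<le> L * norm (x - y) powr \<theta>"
    and decay: "V \<noteq> (\<lambda>x. 0) \<Longrightarrow>
      \<tau> > real CARD('d) \<and> (\<exists>C'>0. \<forall>x. cmod (\<psi>0 x) \<le> C' * (1 + norm x) powr (- \<tau>))"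
    and \<theta>': "V \<noteq> (\<lambda>x. 0) \<Longrightarrow> 1 / \<theta>' = 1 / \<theta> + 1 / (\<tau> - real CARD('d))"
    and cases: "(class_I \<alpha> \<beta> G0 \<and> \<gamma>0 = min (2 * \<alpha> - 1) (2 * \<alpha> - \<beta> - 1)) \<or>
      (class_II \<alpha> \<beta>' G0 \<and> \<gamma>0 = 2 * \<alpha> - \<beta>' - 1) \<or>
      (0 < \<alpha> \<and> \<alpha> \<le> 1 \<and> (\<forall>\<xi>. G0 \<xi> = norm \<xi> powr \<alpha>) \<and> \<gamma>0 = \<alpha>)"
    and \<gamma>: "\<gamma> = (if V = (\<lambda>x. 0) then \<gamma>0 else min \<gamma>0 \<theta>')"
    and K: "compact K" "K \<inter> \<real> = {}"
  shows "\<exists>C>0. \<exists>h0>0. \<forall>z\<in>K. \<forall>h. 0 < h \<and> h \<le> h0 \<longrightarrow>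
    bounded_clinear (\<lambda>f. embedding \<phi>0 h (resolvent_discrete G0 V h z (discretization \<psi>0 h f))
      - resolvent G0 V z f) \<and>
    onorm (\<lambda>f. embedding \<phi>0 h (resolvent_discrete G0 V h z (discretization \<psi>0 h f))
      - resolvent G0 V z f) \<le> C * h powr \<gamma>"
proof -
  have G: "good_symbol G0 \<alpha> \<gamma>0"
    using cases good_symbol_class_I good_symbol_class_II good_symbol_norm_powr by blast
  then have cont: "continuous_on UNIV G0" by (simp add: good_symbol_def)
  have Gm: "G0 \<in> borel_measurable borel" by (rule borel_measurable_continuous_onI[OF cont])
  obtain a b where a: "fourier_symbol \<phi>0 a" and b: "fourier_symbol \<psi>0 b"
    using admissible_fourier_symbol[OF admissible] by blast
  have bi: "biorthogonal (shifted \<phi>0 1) (shifted \<psi>0 1)" using admissible by (simp add: admissible_def)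
  have bma: "bounded_measurable a" and bmb: "bounded_measurable b"
    using a b unfolding fourier_symbol_def by blast+
  obtain A where A: "\<And>\<xi>. cmod (a \<xi>) \<le> A" using bma by (auto simp: bounded_measurable_def)
  obtain B where B: "\<And>\<xi>. cmod (b \<xi>) \<le> B" using bmb by (auto simp: bounded_measurable_def)
  have A0: "0 \<le> A" and B0: "0 \<le> B" using A B norm_ge_zero order_trans by blast+
  define nA where "nA = real (card (shift_indices :: (int ^ 'd) set)) * ((2 * pi) powr (real CARD('d) / 2) * A)"
  define nB where "nB = real (card (shift_indices :: (int ^ 'd) set)) * ((2 * pi) powr (real CARD('d) / 2) * B)"
  have nAB: "0 \<le> nA" "0 \<le> nB" using A0 B0 by (auto simp: nA_def nB_def)
  have norm_A: "norm (period_op a h f) \<le> nA * norm f" for h f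
    unfolding nA_def by (rule norm_period_op_le[OF bounded_measurable_borel[OF bma] A])
  have norm_B: "norm (period_adj b h f) \<le> nB * norm f" for h f
    unfolding nB_def by (rule norm_period_adj_le[OF bounded_measurable_borel[OF bmb] B])
  obtain L where L: "\<And>x y. \<bar>V x - V y\<bar> \<le> L * norm (x - y) powr \<theta>" using V_Hoelder by blast
  obtain M where M: "\<And>x. \<bar>V x\<bar> \<le> M" using V_bounded by (auto simp: bounded_iff)
  have V: "bounded_potential V M"
    using M Hoelder_continuous[OF L \<theta>(1)] by (auto simp: bounded_potential_def intro: borel_measurable_continuous_onI)
  have M0: "0 \<le> M" using M[of 0] by linarith
  obtain \<delta> where \<delta>: "\<delta> > 0" "\<And>z. z \<in> K \<Longrightarrow> \<delta> \<le> \<bar>Im z\<bar>" using compact_nonreal_bound[OF K] by blast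
  obtain E where E: "E \<ge> 0" "\<And>z h f. z \<in> K \<Longrightarrow> 0 < h \<and> h \<le> 1 \<Longrightarrow>
      norm (period_op a h (res_mult (discrete_symbol G0 h) z (period_adj b h f)) - res_mult G0 z f) \<le> E * h powr \<gamma>0 *
        norm f"
    using free_resolvent_estimate[OF a b bi G K] by blast
  have \<gamma>le: "\<gamma> \<le> \<gamma>0" using \<gamma> by simp
  \<comment> \<open>For \<open>V = 0\<close> the commutator vanishes and no decay of
    \<open>\<psi>0\<close> is assumed; otherwise the rate \<open>\<theta>'\<close> is weakened to
    \<open>\<gamma>\<close>.\<close>
  have "\<exists>D\<ge>0. \<forall>h g. 0 < h \<and> h \<le> 1 \<longrightarrow>
    norm (dfourier h (\<lambda>k. complex_of_real (V (lattice_point h k)) * discretization \<psi>0 h g k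
      - discretization \<psi>0 h (real_mult V g) k)) \<le> D * h powr \<gamma> * norm g"
  proof (cases "V = (\<lambda>x. 0)")
    case True
    have "real_mult V g = 0" for g by (simp add: True real_mult_def wco_def)
    moreover have "discretization \<psi>0 h 0 k = 0" for h k by (simp add: discretization_def)
    moreover have "norm (dfourier h (\<lambda>k. 0) :: 'd L2) = 0" if "h > 0" for h
      using norm_dfourier[OF that, of "\<lambda>k. 0"] by (simp add: ell2_def)
    ultimately show ?thesis using True by (intro exI[of _ 0]) simp
  next
    case False
    obtain D where D: "D \<ge> 0" "\<And>h g. 0 < h \<and> h \<le> 1 \<Longrightarrow>
      norm (dfourier h (\<lambda>k. complex_of_real (V (lattice_point h k)) * discretization \<psi>0 h g k
        - discretization \<psi>0 h (real_mult V g) k)) \<le> D * h powr \<theta>' * norm g"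
      using commutator_estimate[OF b _ \<theta>(1) _ V L \<theta>'[OF False]] decay[OF False] by blast
    have "D * h powr \<theta>' * norm g \<le> D * h powr \<gamma> * norm g" if "0 < h \<and> h \<le> 1" for h and g :: "'d L2"
      using that D(1) False \<gamma> by (intro mult_right_mono mult_left_mono powr_mono') auto
    then show ?thesis using D order_trans by (intro exI[of _ D]) blast
  qed
  then obtain D where D: "D \<ge> 0" "\<And>h g. 0 < h \<and> h \<le> 1 \<Longrightarrow>
    norm (dfourier h (\<lambda>k. complex_of_real (V (lattice_point h k)) * discretization \<psi>0 h g k
      - discretization \<psi>0 h (real_mult V g) k)) \<le> D * h powr \<gamma> * norm g" by blast
  \<comment> \<open>\<open>P\<close> bounds the sandwiched discrete resolvent. \<open>C\<close> is
    the stability factor times the sum of the free error, on data at most \<open>1 + M * P\<close>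
    times as large as \<open>g\<close>, and of the commutator error after one more discrete
    resolvent and embedding.\<close>
  define P where "P = nA * (nB / \<delta>)"
  define C where "C = (1 + M / \<delta>) * (E * (1 + M * P) + nA * (D * P / \<delta>))"
  have P0: "0 \<le> P" using nAB \<delta> by (simp add: P_def)
  have C0: "0 \<le> C" unfolding C_def using M0 \<delta>(1) E(1) D(1) nAB P0
    by (intro mult_nonneg_nonneg add_nonneg_nonneg divide_nonneg_nonneg) auto
  have main: "bounded_clinear (\<lambda>f. embedding \<phi>0 h (resolvent_discrete G0 V h z (discretization \<psi>0 h f))
    - resolvent G0 V z f) \<and>
      onorm (\<lambda>f. embedding \<phi>0 h (resolvent_discrete G0 V h z (discretization \<psi>0 h f)) - resolvent G0 V z f) \<le> (C + 1)
        * h powr \<gamma>"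
    if z: "z \<in> K" and h: "0 < h" "h \<le> 1" for z h
  proof -
    have Imz: "Im z \<noteq> 0" using z K(2) complex_is_Real_iff by blast
    have z\<delta>: "x / \<bar>Im z\<bar> \<le> x / \<delta>" if "0 \<le> x" for x
      using \<delta>(2)[OF z] \<delta>(1) that by (intro divide_left_mono mult_pos_pos) auto
    obtain N where N: "bounded_potential (discrete_symbol G0 h) N" using bounded_discrete_symbol[OF cont h(1)]
      by blast
    then have Ghm: "discrete_symbol G0 h \<in> borel_measurable borel" by (simp add: bounded_potential_def)
    note sd = symmetric_op_lattice_potential[OF V h(1)] and sc = symmetric_op_fourier_conj[OF V]
    define Rd where "Rd = Res (discrete_symbol G0 h) z (lattice_potential V h)"
    define Rc where "Rc = Res G0 z (fourier_conj V)"
    have linRd: "bounded_clinear Rd" unfolding Rd_def by (rule bounded_clinear_Res[OF Ghm Imz sd])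
    have linRc: "bounded_clinear Rc" unfolding Rc_def by (rule bounded_clinear_Res[OF Gm Imz sc])
    have emb: "embedding \<phi>0 h (resolvent_discrete G0 V h z (discretization \<psi>0 h f)) =
        inverse_fourier (period_op a h (Rd (period_adj b h (fourier f))))" for f
    proof -
      have Py: "cube_proj h (period_adj b h (fourier f)) = period_adj b h (fourier f)"
        by (rule cube_proj_period_adj[OF bmb])
      note R = resolvent_discrete_eq[OF h(1) N Imz V Py, folded Rd_def]
      show ?thesis
        by (simp only: discretization_eq[OF b h(1)] R(1) embedding_eq[OF a h(1) dcoeff_ell2[OF h(1)]]
          dfourier_dcoeff[OF h(1)] R(2))
    qed
    have res: "resolvent G0 V z f = inverse_fourier (Rc (fourier f))" for f
      unfolding Rc_def by (rule resolvent_eq[OF Gm Imz V])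
    have lin: "bounded_clinear (\<lambda>f. embedding \<phi>0 h (resolvent_discrete G0 V h z (discretization \<psi>0 h f))
      - resolvent G0 V z f)"
      unfolding emb res
      by (intro bounded_clinear_diff bounded_clinear_compose[OF bounded_clinear_inverse_fourier]
          bounded_clinear_compose[OF bounded_clinear_period_op[OF bma]] bounded_clinear_compose[OF linRd]
          bounded_clinear_compose[OF bounded_clinear_period_adj[OF bmb]] bounded_clinear_compose[OF linRc]
            bounded_clinear_fourier)
    have bound: "norm (embedding \<phi>0 h (resolvent_discrete G0 V h z (discretization \<psi>0 h f)) - resolvent G0 V z f)
      \<le> C * h powr \<gamma> * norm f" for f
    proof -
      define g where "g = fourier f"
      define p where "p = period_op a h (Rd (period_adj b h g))"
      define \<Delta> where "\<Delta> = dfourier h (\<lambda>k. complex_of_real (V (lattice_point h k))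
        * discretization \<psi>0 h (inverse_fourier p) k
        - discretization \<psi>0 h (real_mult V (inverse_fourier p)) k)"
      define S where "S f = period_op a h (res_mult (discrete_symbol G0 h) z (period_adj b h f))" for f
      define \<eta> where "\<eta> = (S (g - fourier_conj V p) - res_mult G0 z (g - fourier_conj V p))
        - period_op a h (res_mult (discrete_symbol G0 h) z \<Delta>)"
      have p_id: "p = S (g - fourier_conj V p) - period_op a h (res_mult (discrete_symbol G0 h) z \<Delta>)"
        using perturbed_resolvent_identity[OF a b bi h(1) N V Imz, of g] unfolding S_def \<Delta>_def p_def Rd_def .
      then have "p = res_mult G0 z (g - fourier_conj V p) + \<eta>" by (simp add: \<eta>_def)
      then have st: "norm (p - Rc g) \<le> (1 + M / \<bar>Im z\<bar>) * norm \<eta>"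
        unfolding Rc_def by (rule resolvent_stability[OF Gm Imz sc])
      have pn: "norm p \<le> P * norm g"
      proof -
        have "norm (Rd (period_adj b h g)) \<le> norm (period_adj b h g) / \<bar>Im z\<bar>"
          unfolding Rd_def by (rule norm_Res_le[OF Ghm Imz sd])
        also have "\<dots> \<le> norm (period_adj b h g) / \<delta>" by (rule z\<delta>) simp
        also have "\<dots> \<le> nB * norm g / \<delta>" using \<delta>(1) norm_B by (intro divide_right_mono) auto
        finally have "nA * norm (Rd (period_adj b h g)) \<le> nA * (nB * norm g / \<delta>)" using nAB by (intro mult_left_mono)
        then show ?thesis using norm_A[of h "Rd (period_adj b h g)"] by (simp add: p_def P_def)
      qed
      have Vp: "norm (g - fourier_conj V p) \<le> (1 + M * P) * norm g"
      proof -
        have "norm (fourier_conj V p) \<le> M * norm p" using sc by (simp add: symmetric_op_def)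
        also have "\<dots> \<le> M * (P * norm g)" using M0 pn by (intro mult_left_mono)
        finally show ?thesis using norm_triangle_ineq4[of g "fourier_conj V p"] by (simp add: distrib_right)
      qed
      have h\<gamma>: "h powr \<gamma>0 \<le> h powr \<gamma>" using h \<gamma>le by (intro powr_mono') auto
      have 1: "norm (S (g - fourier_conj V p) - res_mult G0 z (g - fourier_conj V p))
        \<le> E * h powr \<gamma> * ((1 + M * P) * norm g)"
      proof -
        have "norm (S (g - fourier_conj V p) - res_mult G0 z (g - fourier_conj V p))
          \<le> E * h powr \<gamma>0 * norm (g - fourier_conj V p)"
          unfolding S_def using E(2)[OF z, of h] h by blast
        also have "\<dots> \<le> E * h powr \<gamma> * ((1 + M * P) * norm g)"
          using E(1) h\<gamma> Vp by (intro mult_mono) auto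
        finally show ?thesis .
      qed
      have 2: "norm (period_op a h (res_mult (discrete_symbol G0 h) z \<Delta>)) \<le> nA * (D * h powr \<gamma> * (P * norm g) / \<delta>)"
      proof -
        have "norm \<Delta> \<le> D * h powr \<gamma> * norm (inverse_fourier p)" unfolding \<Delta>_def using D(2) h by blast
        also have "\<dots> \<le> D * h powr \<gamma> * (P * norm g)" using pn D(1) by (simp add: mult_left_mono)
        finally have \<Delta>: "norm \<Delta> \<le> D * h powr \<gamma> * (P * norm g)" .
        have "norm (res_mult (discrete_symbol G0 h) z \<Delta>) \<le> norm \<Delta> / \<bar>Im z\<bar>" by (rule norm_res_mult_le[OF Ghm Imz])
        also have "\<dots> \<le> norm \<Delta> / \<delta>" by (rule z\<delta>) simp
        also have "\<dots> \<le> D * h powr \<gamma> * (P * norm g) / \<delta>" using \<Delta> \<delta>(1) by (intro divide_right_mono) auto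
        finally have "nA * norm (res_mult (discrete_symbol G0 h) z \<Delta>) \<le> nA * (D * h powr \<gamma> * (P * norm g) / \<delta>)"
          using nAB by (intro mult_left_mono)
        then show ?thesis using norm_A[of h "res_mult (discrete_symbol G0 h) z \<Delta>"] by linarith
      qed
      have "norm \<eta> \<le> E * h powr \<gamma> * ((1 + M * P) * norm g) + nA * (D * h powr \<gamma> * (P * norm g) / \<delta>)"
        unfolding \<eta>_def by (rule order_trans[OF norm_triangle_ineq4 add_mono[OF 1 2]])
      also have "\<dots> = (E * (1 + M * P) + nA * (D * P / \<delta>)) * h powr \<gamma> * norm g"
        by (simp add: algebra_simps)
      finally have \<eta>n: "norm \<eta> \<le> (E * (1 + M * P) + nA * (D * P / \<delta>)) * h powr \<gamma> * norm g" .
      have "norm (p - Rc g) \<le> (1 + M / \<delta>) * ((E * (1 + M * P) + nA * (D * P / \<delta>)) * h powr \<gamma> * norm g)"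
        using st z\<delta>[OF M0] M0 \<delta>(1) \<eta>n
        by (intro order_trans[OF st] mult_mono) (auto intro!: add_nonneg_nonneg)
      also have "\<dots> = C * h powr \<gamma> * norm f" by (simp add: C_def g_def mult.assoc)
      finally have "norm (p - Rc g) \<le> C * h powr \<gamma> * norm f" .
      moreover have "embedding \<phi>0 h (resolvent_discrete G0 V h z (discretization \<psi>0 h f)) - resolvent G0 V z f
        = inverse_fourier (p - Rc g)"
        unfolding emb res by (simp add: p_def g_def bounded_clinear_simps[OF bounded_clinear_inverse_fourier])
      ultimately show ?thesis by simp
    qed
    have "onorm (\<lambda>f. embedding \<phi>0 h (resolvent_discrete G0 V h z (discretization \<psi>0 h f)) - resolvent G0 V z f)
      \<le> C * h powr \<gamma>"
      by (rule onorm_bound) (use C0 bound in auto)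
    \<comment> \<open>\<open>C\<close> may be zero, whereas the constant of the theorem must be
      positive.\<close>
    also have "\<dots> \<le> (C + 1) * h powr \<gamma>" by (simp add: distrib_right)
    finally show ?thesis using lin by blast
  qed
  show ?thesis
    by (rule exI[of _ "C + 1"], rule conjI, use C0 in simp, rule exI[of _ 1]) (use main in auto)
qed

end
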